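(* Let $U\subseteq R_{2,1}$ be a basepoint free four-dimensional subspace. Then the bigraded minimal free resolution of $I_U$ is of exactly one of the six numerical types, Type 1 through Type 6, and each of these six types occurs for some basepoint free $U$. That is, there are exactly six numerical types of bigraded minimal free resolution of $I_U$ for $U$ basepoint free.
   Context: $k$ is an algebraically closed field and $R=k[s,t,u,v]$ is bigraded with $s,t$ of degree $(1,0)$ and $u,v$ of degree $(0,1)$; $R_{m,n}$ is the graded piece of bidegree $(m,n)$. $U=\mathrm{Span}\{p_0,p_1,p_2,p_3\}\subseteq R_{2,1}=H^0(\mathcal{O}_{\mathbb{P}^1\times\mathbb{P}^1}(2,1))$ is a four-dimensional subspace and $I_U=\langle p_0,p_1,p_2,p_3\rangle\subset R$. $U$ is basepoint free if the $p_i$ have no common zero on $\mathbb{P}^1\times\mathbb{P}^1$, i.e. $\sqrt{I_U}=\langle s,t\rangle\cap\langle u,v\rangle$. Numerical types: $I_U$ is of (numerical) Type $n$ if its bigraded minimal free resolution has the form $0\leftarrow I_U\leftarrow F_1\leftarrow F_2\leftarrow F_3\leftarrow F_4\leftarrow 0$ with $F_1=R(-2,-1)^4$ and: Type 1: $F_2=R(-2,-4)\oplus R(-3,-2)^4\oplus R(-4,-1)^2$, $F_3=R(-3,-4)^2\oplus R(-4,-2)^3$, $F_4=R(-4,-4)$. Type 2: $F_2=R(-2,-3)\oplus R(-3,-2)^4\oplus R(-4,-1)^2$, $F_3=R(-3,-3)^2\oplus R(-4,-2)^3$, $F_4=R(-4,-3)$. Type 3: $F_2=R(-2,-4)\oplus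 R(-3,-1)\oplus R(-3,-2)^2\oplus R(-3,-3)\oplus R(-4,-2)\oplus R(-5,-1)$, $F_3=R(-3,-4)^2\oplus R(-4,-3)^2\oplus R(-5,-2)^2$, $F_4=R(-4,-4)\oplus R(-5,-3)$. Type 4: $F_2=R(-2,-3)\oplus R(-3,-1)\oplus R(-3,-2)^2\oplus R(-4,-2)\oplus R(-5,-1)$, $F_3=R(-3,-3)\oplus R(-4,-3)\oplus R(-5,-2)^2$, $F_4=R(-5,-3)$. Type 5: $F_2=R(-2,-2)\oplus R(-3,-2)^2\oplus R(-4,-1)^2$, $F_3=R(-4,-2)^2$, $F_4=0$. Type 6: $F_2=R(-2,-2)^2\oplus R(-4,-1)^2$, $F_3=R(-4,-2)$, $F_4=0$. *)

theory Defs
  imports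
    "HOL-Library.Poly_Mapping"
    "HOL-Library.Product_Plus"
    "HOL-Computational_Algebra.Polynomial"
    "Jordan_Normal_Form.Matrix_Kernel"
begin

section \<open>The bigraded ring R = k[s,t,u,v]\<close>

text \<open>
  The exponent \<open>(a, b, c, d)\<close> stands for the monomial $s^a t^b u^c v^d$; multiplication is that of
  the monoid algebra.
\<close>

type_synonym expo = "nat \<times> nat \<times> nat \<times> nat"
type_synonym 'k bipoly = "expo \<Rightarrow>\<^sub>0 'k"

definition var_s :: "'k::field bipoly" where "var_s = Poly_Mapping.single (1, 0, 0, 0) 1"
definition var_t :: "'k::field bipoly" where "var_t = Poly_Mapping.single (0, 1, 0, 0) 1"
definition var_u :: "'k::field bipoly" where "var_u = Poly_Mapping.single (0, 0, 1, 0) 1"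
definition var_v :: "'k::field bipoly" where "var_v = Poly_Mapping.single (0, 0, 0, 1) 1"

definition const_mult :: "'k::field \<Rightarrow> 'k bipoly \<Rightarrow> 'k bipoly" where
  "const_mult c p = Poly_Mapping.single 0 c * p"

global_interpretation bipoly: vector_space "const_mult :: 'k::field \<Rightarrow> 'k bipoly \<Rightarrow> 'k bipoly"
  by unfold_locales
    (simp_all add: const_mult_def distrib_left distrib_right single_add mult_single flip: mult.assoc)

text \<open>Submodules of \<open>R\<close> over itself are the ideals, so the span below is the generated ideal.\<close>

global_interpretation bideal: Modules.module "(*) :: 'k::field bipoly \<Rightarrow> 'k bipoly \<Rightarrow> 'k bipoly"
  by unfold_locales (simp_all add: algebra_simps)

abbreviation ideal_gen :: "'k::field bipoly set \<Rightarrow> 'k bipoly set" where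
  "ideal_gen \<equiv> bideal.span"

fun bidegree :: "expo \<Rightarrow> int \<times> int" where
  "bidegree (a, b, c, d) = (int a + int b, int c + int d)"

text \<open>The zero polynomial is homogeneous of every bidegree; the piece is zero in negative bidegrees.\<close>

definition graded_piece :: "int \<times> int \<Rightarrow> 'k::field bipoly set" where
  "graded_piece m = {p. \<forall>e \<in> Poly_Mapping.keys p. bidegree e = m}"

fun monom_eval :: "expo \<Rightarrow> 'k::field \<times> 'k \<Rightarrow> 'k \<times> 'k \<Rightarrow> 'k" where
  "monom_eval (a, b, c, d) (x, y) (z, w) = x ^ a * y ^ b * z ^ c * w ^ d"

definition bipoly_eval :: "'k::field bipoly \<Rightarrow> 'k \<times> 'k \<Rightarrow> 'k \<times> 'k \<Rightarrow> 'k" where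
  "bipoly_eval p P Q =
     (\<Sum>e \<in> Poly_Mapping.keys p. Poly_Mapping.lookup p e * monom_eval e P Q)"

text \<open>
  Points of the product of two projective lines are given by pairs of nonzero homogeneous
  coordinate vectors. For \<open>U\<close> spanned by bihomogeneous polynomials, vanishing of all of \<open>U\<close> at such
  a point does not depend on the chosen coordinates and is vanishing of all members of a basis.
\<close>

definition basepoint_free :: "'k::field bipoly set \<Rightarrow> bool" where
  "basepoint_free U \<longleftrightarrow>
     \<not> (\<exists>P Q. P \<noteq> (0, 0) \<and> Q \<noteq> (0, 0) \<and> (\<forall>p \<in> U. bipoly_eval p P Q = 0))"

definition four_dim_subspace :: "'k::field bipoly set \<Rightarrow> bool" where
  "four_dim_subspace U \<longleftrightarrow>
     bipoly.subspace U \<and> U \<subseteq> graded_piece (2, 1) \<and> bipoly.dim U = 4"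

section \<open>Bigraded minimal free resolutions\<close>

text \<open>
  A finitely generated bigraded free module is given by the list of the bidegrees of its basis:
  \<open>[(a\<^sub>0, b\<^sub>0), \<dots>, (a\<^sub>n, b\<^sub>n)]\<close> is $R(-a_0,-b_0) \oplus \dots \oplus R(-a_n,-b_n)$, with underlying
  module \<open>carrier_vec\<close> of the length of the list. A homomorphism of bidegree \<open>(0, 0)\<close> is a matrix
  whose entry in row \<open>i\<close> and column \<open>j\<close> is homogeneous of bidegree \<open>F ! j - G ! i\<close>.
\<close>

type_synonym free_module = "(int \<times> int) list"

definition graded_hom :: "free_module \<Rightarrow> free_module \<Rightarrow> 'k::field bipoly mat set" where
  "graded_hom F G =
     {A \<in> carrier_mat (length G) (length F).
        \<forall>i < length G. \<forall>j < length F. A $$ (i, j) \<in> graded_piece (F ! j - G ! i)}"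

definition mat_image :: "'k::field bipoly mat \<Rightarrow> 'k bipoly vec set" where
  "mat_image A = (\<lambda>x. A *\<^sub>v x) ` carrier_vec (dim_col A)"

text \<open>
  \<open>0 \<leftarrow> I \<leftarrow> F 1 \<leftarrow> F 2 \<leftarrow> \<dots>\<close> is exact, with \<open>d 1\<close> the map from \<open>F 1\<close> to \<open>I\<close>, seen as a map to
  \<open>R = R(0,0)\<close>, and \<open>d (i + 1)\<close> the map from \<open>F (i + 1)\<close> to \<open>F i\<close>. The value \<open>F 0\<close> is not used.
  Minimality: the image of \<open>d (i + 1)\<close> lies in $\langle s,t,u,v\rangle F_i$.
\<close>

definition minimal_free_resolution ::
  "'k::field bipoly set \<Rightarrow> (nat \<Rightarrow> free_module) \<Rightarrow> (nat \<Rightarrow> 'k bipoly mat) \<Rightarrow> bool" where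
  "minimal_free_resolution I F d \<longleftrightarrow>
     d 1 \<in> graded_hom (F 1) [(0, 0)] \<and>
     (\<forall>i \<ge> 1. d (i + 1) \<in> graded_hom (F (i + 1)) (F i)) \<and>
     (\<lambda>x. x $ 0) ` mat_image (d 1) = I \<and>
     (\<forall>i \<ge> 1. mat_kernel (d i) = mat_image (d (i + 1))) \<and>
     (\<forall>i \<ge> 1. \<forall>r < length (F i). \<forall>c < length (F (i + 1)).
        d (i + 1) $$ (r, c) \<in> ideal_gen {var_s, var_t, var_u, var_v})"

section \<open>The six numerical types\<close>

definition free_seq :: "free_module list \<Rightarrow> nat \<Rightarrow> free_module" where
  "free_seq Fs i = (if 1 \<le> i \<and> i \<le> length Fs then Fs ! (i - 1) else [])"

definition type_modules :: "nat \<Rightarrow> free_module list" where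
  "type_modules n = replicate 4 (2, 1) #
    (if n = 1 then
       [[(2, 4)] @ replicate 4 (3, 2) @ replicate 2 (4, 1),
        replicate 2 (3, 4) @ replicate 3 (4, 2),
        [(4, 4)]]
     else if n = 2 then
       [[(2, 3)] @ replicate 4 (3, 2) @ replicate 2 (4, 1),
        replicate 2 (3, 3) @ replicate 3 (4, 2),
        [(4, 3)]]
     else if n = 3 then
       [[(2, 4), (3, 1)] @ replicate 2 (3, 2) @ [(3, 3), (4, 2), (5, 1)],
        replicate 2 (3, 4) @ replicate 2 (4, 3) @ replicate 2 (5, 2),
        [(4, 4), (5, 3)]]
     else if n = 4 then
       [[(2, 3), (3, 1)] @ replicate 2 (3, 2) @ [(4, 2), (5, 1)],
        [(3, 3), (4, 3)] @ replicate 2 (5, 2),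
        [(5, 3)]]
     else if n = 5 then
       [[(2, 2)] @ replicate 2 (3, 2) @ replicate 2 (4, 1),
        replicate 2 (4, 2),
        []]
     else
       [replicate 2 (2, 2) @ replicate 2 (4, 1),
        [(4, 2)],
        []])"

text \<open>
  A minimal free resolution is unique up to isomorphism of bigraded complexes, so that it has the
  given form means that there is one of that form; reordering basis elements is an isomorphism, so
  the order of the summands is immaterial.
\<close>

definition of_numerical_type :: "nat \<Rightarrow> 'k::field bipoly set \<Rightarrow> bool" where
  "of_numerical_type n I \<longleftrightarrow>
     n \<in> {1..6} \<and> (\<exists>d. minimal_free_resolution I (free_seq (type_modules n)) d)"

end

(*
  Let S = k[s,t] and let U, of codimension two in <u,v> (x) S_2, be the common kernel of two functionals
  f, g. The four functionals f(u q), g(u q), f(v q), g(v q) on the three-dimensional space S_2 satisfy a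
  linear relation. According to its rank, U has one of the bases
    u q0, v q0 + u q1, v q1 + u q2, v q2    or    u q0, v q0 + u q1, v q1, u q2
  with q0, q1, q2 a basis of S_2, unless U contains u q0 and v q0 for some quadric q0. In this last case
  the syzygies are found by elimination, and the type is 5 or 6. In the other two cases a syzygy of U
  induces one of q0, q1, q2, which by Hilbert-Burch is a combination of two linear syzygies. So the
  syzygies of U are the solutions of two linear equations, up to a kernel R(-3,-2)^2 that cancels two
  generators of degree (3,2). The coefficients in s, t of these equations form a 2 x 4 pencil that, by
  basepoint freeness, has no degenerate point; over an algebraically closed field there are two such
  pencils up to equivalence, which leaves four linear systems to be resolved, one for each of the
  types 1 to 4.

  The types are told apart by the existence of syzygies of the bidegrees (0,1), (0,2) and (1,0), which
  can be read off from the piece of bidegree (2,1) of the ideal.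
*)
theory Submission
  imports Defs "HOL-Library.Product_Lexorder"
begin

text \<open>The seven unknowns arise as follows. In the syzygy of \<open>q0, q1, q2\<close> induced
  by a syzygy of \<open>U\<close>, both Hilbert-Burch coefficients lie in the ideal of
  \<open>u, v\<close>. Each splits as \<open>u * a0 + v * a1\<close>, which gives four unknowns of
  degree (3,1); comparing the parts at \<open>u\<close> and at \<open>v\<close> leaves one Koszul
  term in each of the three entries, which gives three unknowns of degree (2,2). Quotients of R are
  replaced by retractions of R onto the subring generated by the remaining coordinates, so that
  every reduction is an equation in R. Minimality is read off from degrees: no bidegree occurs in
  two consecutive modules, so no matrix entry is a nonzero constant. Two resolutions of one ideal
  can be compared only through data of the ideal, hence the syzygies that separate the types are
  rewritten as relations between elements of its piece of bidegree (2,1).\<close>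

instance prod :: ("{ordered_cancel_comm_monoid_add, linorder}", "{ordered_cancel_comm_monoid_add, linorder}")
    ordered_cancel_comm_monoid_add
  \<comment> \<open>Through this instance for lexicographically ordered exponents R becomes an
    integral domain; all cancellations of nonzero factors rest on it.\<close>
  by standard (auto simp: less_eq_prod_def intro: add_left_mono add_strict_left_mono)

text \<open>As a simplification rule for the ring acting on itself this one loops with associativity.\<close>

declare bideal.scale_scale [simp del]

section \<open>Constants, monomials and substitution\<close>

definition cst :: "'k::field \<Rightarrow> 'k bipoly" where
  "cst c = Poly_Mapping.single 0 c"

lemma cst_0 [simp]: "cst 0 = 0" and cst_1 [simp]: "cst 1 = 1"
  by (simp_all add: cst_def)

lemma cst_add: "cst (a + b) = cst a + cst b"
  by (simp add: cst_def single_add)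

lemma cst_mult: "cst (a * b) = cst a * cst b"
  by (simp add: cst_def mult_single)

lemma cst_minus: "cst (- a) = - cst a"
  by (simp add: cst_def single_uminus)

lemma cst_diff: "cst (a - b) = cst a - cst b"
  by (simp add: cst_def single_diff)

lemmas cst_hom = cst_add cst_mult cst_minus cst_diff

lemma cst_eq_iff [simp]: "cst a = cst b \<longleftrightarrow> a = b"
  by (metis cst_def lookup_single_eq)

lemma cst_eq_0_iff [simp]: "cst a = 0 \<longleftrightarrow> a = 0"
  by (metis cst_0 cst_eq_iff)

lemma const_mult_eq: "const_mult c p = cst c * p"
  by (simp add: const_mult_def cst_def)

lemma bipoly_add_induct [case_names zero single add]:
  assumes "P 0" "\<And>e c. P (Poly_Mapping.single e c)" "\<And>p q. P p \<Longrightarrow> P q \<Longrightarrow> P (p + q)"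
  shows "P (p :: 'k::field bipoly)"
proof (induction p rule: update_induct)
  case const
  then show ?case by (rule assms(1))
next
  case (update f a b)
  have "Poly_Mapping.update a b f = f + Poly_Mapping.single a b"
    using update(1) by (intro poly_mapping_eqI) (auto simp: lookup_update lookup_add lookup_single in_keys_iff
      when_def)
  then show ?case using update assms by simp
qed

lemma single_monomial:
  "Poly_Mapping.single (a, b, c, d) x = cst x * var_s ^ a * var_t ^ b * var_u ^ c *
    (var_v :: 'k::field bipoly) ^ d"
proof -
  have pw: "Poly_Mapping.single e (1::'k) ^ n = Poly_Mapping.single (((+) e ^^ n) 0) 1" for e :: expo and n
    by (induction n) (simp_all add: mult_single)
  have "((+) (1::nat,0::nat,0::nat,0::nat) ^^ n) 0 = (n,0,0,0)"
    "((+) (0::nat,1::nat,0::nat,0::nat) ^^ n) 0 = (0,n,0,0)"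
    "((+) (0::nat,0::nat,1::nat,0::nat) ^^ n) 0 = (0,0,n,0)"
    "((+) (0::nat,0::nat,0::nat,1::nat) ^^ n) 0 = (0,0,0,n)" for n
    by (induction n) (auto simp: zero_prod_def)
  then show ?thesis
    by (simp add: cst_def var_s_def var_t_def var_u_def var_v_def pw mult_single)
qed

text \<open>R is generated by its variables as an algebra: properties of ring homomorphisms and
  memberships in ideals need to be checked on generators only.\<close>

lemma bipoly_induct [case_names cst s t u v add mult]:
  assumes "\<And>c. P (cst c)" "P var_s" "P var_t" "P var_u" "P var_v"
    "\<And>p q. P p \<Longrightarrow> P q \<Longrightarrow> P (p + q)" "\<And>p q. P p \<Longrightarrow> P q \<Longrightarrow> P (p * q)"
  shows "P (p :: 'k::field bipoly)"
proof (induction p rule: bipoly_add_induct)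
  case zero
  then show ?case using assms(1)[of 0] by simp
next
  case (single e c)
  have pw: "P x \<Longrightarrow> P (x ^ n)" for x n
    using assms(1)[of 1] by (induction n) (auto intro: assms)
  obtain a b i j where "e = (a, b, i, j)" by (cases e)
  then show ?case by (simp add: single_monomial) (intro assms pw)
next
  case (add p q)
  then show ?case by (rule assms)
qed

text \<open>Meaningful only for ring homomorphisms \<open>h\<close>.\<close>

definition ev :: "('k::field \<Rightarrow> 'r::comm_ring_1) \<Rightarrow> 'r \<Rightarrow> 'r \<Rightarrow> 'r \<Rightarrow> 'r \<Rightarrow> 'k bipoly \<Rightarrow> 'r" where
  "ev h x y z w p = (\<Sum>(a, b, c, d) \<in> Poly_Mapping.keys p.
     h (Poly_Mapping.lookup p (a, b, c, d)) * (x ^ a * y ^ b * z ^ c * w ^ d))"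

definition is_hom :: "('a::comm_ring_1 \<Rightarrow> 'r::comm_ring_1) \<Rightarrow> bool" where
  "is_hom h \<longleftrightarrow> h 0 = 0 \<and> h 1 = 1 \<and> (\<forall>a b. h (a + b) = h a + h b) \<and> (\<forall>a b. h (a * b) = h a * h b)"

lemma is_homD:
  assumes "is_hom h"
  shows "h 0 = 0" "h 1 = 1" "h (a + b) = h a + h b" "h (a * b) = h a * h b" "h (- a) = - h a"
    "h (a - b) = h a - h b"
proof -
  show "h 0 = 0" "h 1 = 1" "h (a + b) = h a + h b" "h (a * b) = h a * h b"
    using assms by (simp_all add: is_hom_def)
  have m: "h (- a) = - h a" for a
  proof -
    have "h (a + - a) = h a + h (- a)" using assms unfolding is_hom_def by blast
    then have "h a + h (- a) = 0" using assms by (simp add: is_hom_def)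
    then show ?thesis by (simp add: eq_neg_iff_add_eq_0 add.commute)
  qed
  show "h (- a) = - h a" by (rule m)
  show "h (a - b) = h a - h b"
  proof -
    have "h (a + - b) = h a + h (- b)" using assms unfolding is_hom_def by blast
    then show ?thesis by (simp add: m)
  qed
qed

lemma is_hom_cst: "is_hom cst"
  by (simp add: is_hom_def cst_hom)

lemma is_hom_id: "is_hom (\<lambda>x. x)"
  by (simp add: is_hom_def)

lemma ev_superset:
  assumes "is_hom h" "finite K" "Poly_Mapping.keys p \<subseteq> K"
  shows "ev h x y z w p = (\<Sum>(a, b, c, d) \<in> K.
     h (Poly_Mapping.lookup p (a, b, c, d)) * (x ^ a * y ^ b * z ^ c * w ^ d))"
  unfolding ev_def
  by (rule sum.mono_neutral_left) (use assms in \<open>auto simp: in_keys_iff is_homD(1)\<close>)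

lemma ev_add:
  assumes "is_hom h"
  shows "ev h x y z w (p + q) = ev h x y z w p + ev h x y z w q"
proof -
  let ?K = "Poly_Mapping.keys p \<union> Poly_Mapping.keys q"
  have k: "Poly_Mapping.keys (p + q) \<subseteq> ?K" by (rule keys_add)
  have f: "finite ?K" by simp
  have kp: "Poly_Mapping.keys p \<subseteq> ?K" and kq: "Poly_Mapping.keys q \<subseteq> ?K" by auto
  show ?thesis
    unfolding ev_superset[OF assms f k] ev_superset[OF assms f kp] ev_superset[OF assms f kq]
      sum.distrib[symmetric]
    by (rule sum.cong) (auto simp: lookup_add is_homD(3)[OF assms] distrib_right)
qed

lemma ev_0 [simp]: "ev h x y z w 0 = 0"
  by (simp add: ev_def)

lemma ev_single:
  assumes "is_hom h"
  shows "ev h x y z w (Poly_Mapping.single (a, b, c, d) e) = h e * (x ^ a * y ^ b * z ^ c * w ^ d)"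
  by (cases "e = 0") (simp_all add: ev_def is_homD[OF assms])

lemma ev_mult:
  assumes "is_hom h"
  shows "ev h x y z w (p * q) = ev h x y z w p * ev h x y z w q"
proof (induction p rule: bipoly_add_induct)
  case (single e c)
  show ?case
  proof (induction q rule: bipoly_add_induct)
    case (single e' c')
    obtain a b i j a' b' i' j' where "e = (a, b, i, j)" "e' = (a', b', i', j')"
      by (cases e, cases e') auto
    then show ?case
      by (simp add: mult_single ev_single[OF assms] is_homD[OF assms] power_add algebra_simps)
  qed (simp_all add: distrib_left ev_add[OF assms])
qed (simp_all add: distrib_right ev_add[OF assms])

lemma ev_cst: "is_hom h \<Longrightarrow> ev h x y z w (cst c) = h c"
  using ev_single[of h x y z w 0 0 0 0 c] by (simp add: cst_def zero_prod_def)

lemma ev_vars [simp]: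
  assumes "is_hom h"
  shows "ev h x y z w var_s = x" "ev h x y z w var_t = y" "ev h x y z w var_u = z" "ev h x y z w var_v = w"
  by (simp_all add: var_s_def var_t_def var_u_def var_v_def ev_single[OF assms] is_homD[OF assms])

lemma is_hom_ev:
  assumes "is_hom h"
  shows "is_hom (ev h x y z w)"
  unfolding is_hom_def[of "ev h x y z w"]
  using ev_cst[OF assms, of x y z w 1] by (simp add: ev_add[OF assms] ev_mult[OF assms] is_homD(2)[OF assms])

lemma bipoly_eval_eq: "bipoly_eval p (x, y) (z, w) = ev (\<lambda>x. x) x y z w p"
  unfolding bipoly_eval_def ev_def by (rule sum.cong) (auto simp: mult.assoc)

abbreviation subst :: "'k::field bipoly \<Rightarrow> 'k bipoly \<Rightarrow> 'k bipoly \<Rightarrow> 'k bipoly \<Rightarrow> 'k bipoly \<Rightarrow> 'k bipoly" where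
  "subst \<equiv> ev cst"

section \<open>The bigrading\<close>

lemma bidegree_add: "bidegree (e + e') = bidegree e + bidegree e'"
  by (cases e; cases e') simp

lemma bidegree_0 [simp]: "bidegree 0 = 0"
  by (simp add: zero_prod_def)

lemma gp_0 [simp]: "0 \<in> graded_piece m"
  by (simp add: graded_piece_def)

lemma gp_add [intro]: "p \<in> graded_piece m \<Longrightarrow> q \<in> graded_piece m \<Longrightarrow> p + q \<in> graded_piece m"
  using keys_add[of p q] by (auto simp: graded_piece_def)

lemma gp_uminus [intro]: "p \<in> graded_piece m \<Longrightarrow> - p \<in> graded_piece m"
  by (auto simp: graded_piece_def in_keys_iff)

lemma gp_diff [intro]: "p \<in> graded_piece m \<Longrightarrow> q \<in> graded_piece m \<Longrightarrow> p - q \<in> graded_piece m"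
  using gp_add[of p m "- q"] gp_uminus[of q m] by simp

lemma gp_sum [intro]: "(\<And>i. i \<in> A \<Longrightarrow> f i \<in> graded_piece m) \<Longrightarrow> sum f A \<in> graded_piece m"
  by (induction A rule: infinite_finite_induct) auto

lemma gp_single: "bidegree e = m \<Longrightarrow> Poly_Mapping.single e c \<in> graded_piece m"
  by (auto simp: graded_piece_def)

lemma gp_cst [simp]: "cst c \<in> graded_piece (0, 0)"
  unfolding cst_def by (rule gp_single) (simp add: zero_prod_def)

lemma gp_vars [simp]:
  "var_s \<in> graded_piece (1, 0)" "var_t \<in> graded_piece (1, 0)"
  "var_u \<in> graded_piece (0, 1)" "var_v \<in> graded_piece (0, 1)"
  by (simp_all add: var_s_def var_t_def var_u_def var_v_def gp_single)

lemma gp_mult: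
  assumes "p \<in> graded_piece m" "q \<in> graded_piece n" "m + n = l"
  shows "p * q \<in> graded_piece l"
  unfolding graded_piece_def
proof (intro CollectI ballI)
  fix e assume "e \<in> Poly_Mapping.keys (p * q)"
  then obtain a b where "e = a + b" "a \<in> Poly_Mapping.keys p" "b \<in> Poly_Mapping.keys q"
    using keys_mult[of p q] by blast
  then show "bidegree e = l" using assms by (auto simp: graded_piece_def bidegree_add)
qed

lemma gp_cst_mult: "p \<in> graded_piece m \<Longrightarrow> cst c * p \<in> graded_piece m"
  by (rule gp_mult[OF gp_cst]) (auto simp: zero_prod_def[symmetric])

lemma gp_neg: "fst m < 0 \<or> snd m < 0 \<Longrightarrow> p \<in> graded_piece m \<Longrightarrow> p = 0"
  using keys_eq_empty[of p] by (fastforce simp: graded_piece_def)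

section \<open>Homogeneous components\<close>

definition hc :: "int \<times> int \<Rightarrow> 'k::field bipoly \<Rightarrow> 'k bipoly" where
  "hc m p = Poly_Mapping.mapp (\<lambda>e c. c when bidegree e = m) p"

lemma lookup_hc: "Poly_Mapping.lookup (hc m p) e = (if bidegree e = m then Poly_Mapping.lookup p e else 0)"
  by (auto simp: hc_def lookup_mapp in_keys_iff when_def)

lemma hc_in [simp]: "hc m p \<in> graded_piece m"
  by (auto simp: graded_piece_def in_keys_iff lookup_hc split: if_splits)

lemma hc_add: "hc m (p + q) = hc m p + hc m q"
  by (rule poly_mapping_eqI) (simp add: lookup_hc lookup_add)

lemma hc_0 [simp]: "hc m 0 = 0"
  by (rule poly_mapping_eqI) (simp add: lookup_hc)

lemma hc_sum: "hc m (sum f A) = (\<Sum>i\<in>A. hc m (f i))"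
  by (induction A rule: infinite_finite_induct) (simp_all add: hc_add)

lemma hc_gp: "p \<in> graded_piece m \<Longrightarrow> hc m p = p"
  by (rule poly_mapping_eqI) (auto simp: lookup_hc graded_piece_def in_keys_iff)

lemma hc_gp_other: "p \<in> graded_piece n \<Longrightarrow> n \<noteq> m \<Longrightarrow> hc m p = 0"
  by (rule poly_mapping_eqI) (auto simp: lookup_hc graded_piece_def in_keys_iff)

text \<open>Multiplication by a homogeneous element shifts components. Thus in a relation with
  homogeneous coefficients the unknowns may be replaced by their components of the fitting
  bidegree.\<close>

lemma hc_mult:
  assumes "q \<in> graded_piece d"
  shows "hc m (q * p) = q * hc (m - d) p"
proof (induction p rule: bipoly_add_induct)
  case (single e c)
  have g: "Poly_Mapping.single e c \<in> graded_piece (bidegree e)" by (rule gp_single) simp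
  have h: "q * Poly_Mapping.single e c \<in> graded_piece (d + bidegree e)"
    by (rule gp_mult[OF assms g]) simp
  show ?case
  proof (cases "d + bidegree e = m")
    case True
    then show ?thesis using hc_gp[OF h] hc_gp[OF g] by (auto simp: algebra_simps)
  next
    case False
    then have "bidegree e \<noteq> m - d" by auto
    then show ?thesis using hc_gp_other[OF h False] hc_gp_other[OF g] by simp
  qed
qed (simp_all add: distrib_left hc_add)

section \<open>Explicit bases of the graded pieces of low bidegree\<close>

lemma nat_sum_eqs:
  "int a + int b = 0 \<longleftrightarrow> a = 0 \<and> b = 0"
  "int a + int b = 1 \<longleftrightarrow> a = 1 \<and> b = 0 \<or> a = 0 \<and> b = 1"
  "int a + int b = 2 \<longleftrightarrow> a = 2 \<and> b = 0 \<or> a = 1 \<and> b = 1 \<or> a = 0 \<and> b = 2"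
  by arith+

lemma expo_bidegree_cases:
  "bidegree e = (0, 0) \<Longrightarrow> e = 0"
  "bidegree e = (1, 0) \<Longrightarrow> e \<in> {(1,0,0,0), (0,1,0,0)}"
  "bidegree e = (0, 1) \<Longrightarrow> e \<in> {(0,0,1,0), (0,0,0,1)}"
  "bidegree e = (2, 0) \<Longrightarrow> e \<in> {(2,0,0,0), (1,1,0,0), (0,2,0,0)}"
  "bidegree e = (1, 1) \<Longrightarrow> e \<in> {(1,0,1,0), (0,1,1,0), (1,0,0,1), (0,1,0,1)}"
  "bidegree e = (2, 1) \<Longrightarrow> e \<in> {(2,0,1,0), (1,1,1,0), (0,2,1,0), (2,0,0,1), (1,1,0,1), (0,2,0,1)}"
  by (cases e; auto simp: zero_prod_def nat_sum_eqs)+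

lemma bipoly_sum_single:
  assumes "finite K" "Poly_Mapping.keys p \<subseteq> K"
  shows "p = (\<Sum>e\<in>K. Poly_Mapping.single e (Poly_Mapping.lookup p e))"
  by (rule poly_mapping_eqI)
    (use assms in \<open>auto simp: lookup_sum lookup_single when_def in_keys_iff\<close>)

lemma gp_eq_sum:
  assumes "p \<in> graded_piece m" "finite K" "\<And>e. bidegree e = m \<Longrightarrow> e \<in> K"
  shows "p = (\<Sum>e\<in>K. Poly_Mapping.single e (Poly_Mapping.lookup p e))"
  using assms by (intro bipoly_sum_single) (auto simp: graded_piece_def)

lemma gp00: "p \<in> graded_piece (0, 0) \<Longrightarrow> \<exists>c. p = cst c"
  using gp_eq_sum[of p "(0,0)" "{0}"] expo_bidegree_cases(1) by (auto simp: cst_def)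

lemma gp10: "p \<in> graded_piece (1, 0) \<Longrightarrow> \<exists>a b. p = cst a * var_s + cst b * var_t"
  using gp_eq_sum[of p "(1,0)" "{(1,0,0,0), (0,1,0,0)}"] expo_bidegree_cases(2)
  by (fastforce simp: single_monomial)

lemma gp01: "p \<in> graded_piece (0, 1) \<Longrightarrow> \<exists>a b. p = cst a * var_u + cst b * var_v"
  using gp_eq_sum[of p "(0,1)" "{(0,0,1,0), (0,0,0,1)}"] expo_bidegree_cases(3)
  by (fastforce simp: single_monomial)

lemma gp20:
  assumes "p \<in> graded_piece (2, 0)"
  shows "\<exists>a b c. p = cst a * var_s\<^sup>2 + cst b * (var_s * var_t) + cst c * var_t\<^sup>2"
proof -
  define f where "f = Poly_Mapping.lookup p"
  have "p = (\<Sum>e\<in>{(2,0,0,0), (1,1,0,0), (0,2,0,0)}. Poly_Mapping.single e (f e))"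
    using expo_bidegree_cases(4) by (unfold f_def, intro gp_eq_sum[OF assms]) auto
  also have "\<dots> = cst (f (2,0,0,0)) * var_s\<^sup>2 + cst (f (1,1,0,0)) * (var_s * var_t) + cst (f (0,2,0,0)) *
    var_t\<^sup>2"
    by (simp add: single_monomial mult.assoc)
  finally show ?thesis by (intro exI)
qed

lemma gp21:
  assumes "p \<in> graded_piece (2, 1)"
  shows "\<exists>a \<in> graded_piece (2, 0). \<exists>b \<in> graded_piece (2, 0). p = var_u * a + var_v * b"
proof -
  define f where "f = Poly_Mapping.lookup p"
  have "p = (\<Sum>e\<in>{(2,0,1,0), (1,1,1,0), (0,2,1,0), (2,0,0,1), (1,1,0,1), (0,2,0,1)}.
      Poly_Mapping.single e (f e))"
    using expo_bidegree_cases(6) by (unfold f_def, intro gp_eq_sum[OF assms]) auto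
  also have "\<dots> = var_u * (cst (f (2,0,1,0)) * (var_s * var_s) + cst (f (1,1,1,0)) * (var_s * var_t)
        + cst (f (0,2,1,0)) * (var_t * var_t))
      + var_v * (cst (f (2,0,0,1)) * (var_s * var_s) + cst (f (1,1,0,1)) * (var_s * var_t)
        + cst (f (0,2,0,1)) * (var_t * var_t))"
    by (simp add: single_monomial distrib_left power2_eq_square mult_ac add_ac)
  finally have *: "p = \<dots>" .
  have m: "x * y \<in> graded_piece (2, 0)" if "x \<in> graded_piece (1,0)"
    "y \<in> graded_piece (1,0)" for x y :: "'a bipoly"
    using that by (rule gp_mult) simp
  show ?thesis
    by (intro bexI, rule *) (rule gp_add gp_cst_mult gp_vars m)+
qed

section \<open>Linear coordinates and regular sequences\<close>

text \<open>By \<open>p * q - f p * f q = q * (p - f p) + f p * (q - f q)\<close> the elements with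
  \<open>p - f p\<close> in an ideal \<open>J\<close> are closed under products, so the variables
  decide.\<close>

lemma hom_defect:
  assumes "is_hom f" "\<And>c. f (cst c) = cst c"
    and J: "\<And>x y. x \<in> J \<Longrightarrow> y \<in> J \<Longrightarrow> x + y \<in> J" "\<And>x y. x \<in> J \<Longrightarrow> y * x \<in> J" "0 \<in> J"
    and "var_s - f var_s \<in> J" "var_t - f var_t \<in> J" "var_u - f var_u \<in> J" "var_v - f var_v \<in> J"
  shows "(p :: 'k::field bipoly) - f p \<in> J"
proof (induction p rule: bipoly_induct)
  case (add p q)
  have "p + q - f (p + q) = (p - f p) + (q - f q)"
    by (simp add: is_homD[OF assms(1)] algebra_simps)
  then show ?case using add J(1) by metis
next
  case (mult p q)
  have "p * q - f (p * q) = q * (p - f p) + f p * (q - f q)"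
    by (simp add: is_homD[OF assms(1)] algebra_simps)
  then show ?case using mult J(1,2) by metis
qed (use assms in simp_all)

definition is_basis2 :: "'k::field bipoly \<Rightarrow> 'k bipoly \<Rightarrow> 'k bipoly \<Rightarrow> 'k bipoly \<Rightarrow> bool" where
  "is_basis2 x y p q \<longleftrightarrow> (\<exists>a b c d. a * d - b * c \<noteq> 0 \<and>
     p = cst a * x + cst b * y \<and> q = cst c * x + cst d * y)"

lemma is_basis2_inv:
  assumes "is_basis2 x y p q"
  shows "is_basis2 p q x y"
proof -
  obtain a b c d where D: "a * d - b * c \<noteq> 0" "p = cst a * x + cst b * y" "q = cst c * x + cst d * y"
    using assms unfolding is_basis2_def by blast
  define e where "e = inverse (a * d - b * c)"
  have e: "e * (a * d - b * c) = 1" using D(1) by (simp add: e_def)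
  have ce: "cst e * (cst a * cst d - cst b * cst c) = 1"
    by (metis cst_1 cst_diff cst_mult e)
  have x: "x = cst (e * d) * p + cst (- e * b) * q"
  proof -
    have "cst (e * d) * p + cst (- e * b) * q = cst e * (cst a * cst d - cst b * cst c) * x"
      by (simp add: D cst_hom algebra_simps)
    then show ?thesis by (simp add: ce)
  qed
  have y: "y = cst (- e * c) * p + cst (e * a) * q"
  proof -
    have "cst (- e * c) * p + cst (e * a) * q = cst e * (cst a * cst d - cst b * cst c) * y"
      by (simp add: D cst_hom algebra_simps)
    then show ?thesis by (simp add: ce)
  qed
  have "(e * d) * (e * a) - (- e * b) * (- e * c) = e * (e * (a * d - b * c))"
    by (simp add: algebra_simps)
  then have "(e * d) * (e * a) - (- e * b) * (- e * c) \<noteq> 0"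
    using e by auto
  then show ?thesis unfolding is_basis2_def using x y by blast
qed

lemma is_basis2_trans:
  assumes "is_basis2 x y p q" "is_basis2 p q z w"
  shows "is_basis2 x y z w"
proof -
  obtain a b c d where D: "a * d - b * c \<noteq> 0" "p = cst a * x + cst b * y" "q = cst c * x + cst d * y"
    using assms(1) unfolding is_basis2_def by blast
  obtain a' b' c' d' where D': "a' * d' - b' * c' \<noteq> 0" "z = cst a' * p + cst b' * q"
    "w = cst c' * p + cst d' * q"
    using assms(2) unfolding is_basis2_def by blast
  have "z = cst (a' * a + b' * c) * x + cst (a' * b + b' * d) * y"
    "w = cst (c' * a + d' * c) * x + cst (c' * b + d' * d) * y"
    by (simp_all add: D D' cst_hom algebra_simps)
  moreover have "(a' * a + b' * c) * (c' * b + d' * d) - (a' * b + b' * d) * (c' * a + d' * c)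
    = (a * d - b * c) * (a' * d' - b' * c')"
    by (simp add: algebra_simps)
  ultimately show ?thesis unfolding is_basis2_def using D(1) D'(1) by (metis mult_eq_0_iff)
qed

lemma is_basis2_refl: "is_basis2 x y x y"
  unfolding is_basis2_def by (rule exI[of _ 1], rule exI[of _ 0], rule exI[of _ 0], rule exI[of _ 1]) simp

lemma is_basis2_gp:
  assumes "is_basis2 x y p q" "x \<in> graded_piece m" "y \<in> graded_piece m"
  shows "p \<in> graded_piece m" "q \<in> graded_piece m"
  using assms unfolding is_basis2_def by (auto intro!: gp_add gp_cst_mult)

text \<open>Linear coordinates on both factors. The normal forms of \<open>U\<close> change
  \<open>u, v\<close> and the normal form of the pencil changes \<open>s, t\<close>, so everything
  below is relative to such a choice.\<close>

locale coords =
  fixes s t u v :: "'k::field bipoly"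
  assumes st: "is_basis2 var_s var_t s t" and uv: "is_basis2 var_u var_v u v"
begin

lemma gp_coords: "s \<in> graded_piece (1, 0)" "t \<in> graded_piece (1, 0)" "u \<in> graded_piece (0, 1)"
  "v \<in> graded_piece (0, 1)"
  using is_basis2_gp[OF st] is_basis2_gp[OF uv] by auto

text \<open>A linear change of coordinates extends to an automorphism \<open>f\<close> of R, with
  inverse \<open>g\<close> given by the inverse matrices. Statements about the variables travel
  along this pair.\<close>

lemma automorphism:
  obtains f g where "is_hom f" "is_hom g" "\<And>c. f (cst c) = cst c" "\<And>c. g (cst c) = cst c"
    "f var_s = s" "f var_t = t" "f var_u = u" "f var_v = v" "\<And>p. f (g p) = p" "\<And>p. g (f p) = p"
    "g s = var_s" "g t = var_t" "g u = var_u" "g v = var_v"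
proof -
  \<comment> \<open>One pair of coordinates at a time: a matrix and its inverse, with all composites
    spelled out so that they can rewrite \<open>f (g _)\<close> and \<open>g (f _)\<close> on the
    variables.\<close>
  have basis: "\<exists>a b c d a' b' c' d'. p = cst a * x + cst b * y \<and> q = cst c * x + cst d * y
      \<and> (\<forall>p q :: 'k bipoly. cst a * (cst a' * p + cst b' * q) + cst b * (cst c' * p + cst d' * q) = p
         \<and> cst c * (cst a' * p + cst b' * q) + cst d * (cst c' * p + cst d' * q) = q
         \<and> cst a' * (cst a * p + cst b * q) + cst b' * (cst c * p + cst d * q) = p
         \<and> cst c' * (cst a * p + cst b * q) + cst d' * (cst c * p + cst d * q) = q)"
    if B: "is_basis2 x y p q" for x y p q :: "'k bipoly"
  proof -
    obtain a b c d where D: "a * d - b * c \<noteq> 0" "p = cst a * x + cst b * y" "q = cst c * x + cst d * y"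
      using B unfolding is_basis2_def by blast
    define e where "e = inverse (a * d - b * c)"
    have e: "e * (a * d - b * c) = 1" using D(1) by (simp add: e_def)
    have ce: "cst e * (cst a * cst d - cst b * cst c) = (1 :: 'k bipoly)"
      by (metis cst_1 cst_diff cst_mult e)
    have id: "cst a * (cst (e * d) * p + cst (- e * b) * q) + cst b * (cst (- e * c) * p + cst (e * a) * q) = p
         \<and> cst c * (cst (e * d) * p + cst (- e * b) * q) + cst d * (cst (- e * c) * p + cst (e * a) * q) = q
         \<and> cst (e * d) * (cst a * p + cst b * q) + cst (- e * b) * (cst c * p + cst d * q) = p
         \<and> cst (- e * c) * (cst a * p + cst b * q) + cst (e * a) * (cst c * p + cst d * q) = q" for p
           q :: "'k bipoly"
    proof -
      have "cst a * (cst (e * d) * p + cst (- e * b) * q) + cst b * (cst (- e * c) * p + cst (e * a) * q)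
          = cst e * (cst a * cst d - cst b * cst c) * p"
        "cst c * (cst (e * d) * p + cst (- e * b) * q) + cst d * (cst (- e * c) * p + cst (e * a) * q)
          = cst e * (cst a * cst d - cst b * cst c) * q"
        "cst (e * d) * (cst a * p + cst b * q) + cst (- e * b) * (cst c * p + cst d * q)
          = cst e * (cst a * cst d - cst b * cst c) * p"
        "cst (- e * c) * (cst a * p + cst b * q) + cst (e * a) * (cst c * p + cst d * q)
          = cst e * (cst a * cst d - cst b * cst c) * q"
        by (simp_all add: cst_hom algebra_simps)
      then show ?thesis by (simp add: ce)
    qed
    show ?thesis using D(2,3) id by blast
  qed
  obtain a b c d a' b' c' d' where D: "s = cst a * var_s + cst b * var_t" "t = cst c * var_s + cst d * var_t"
    and D': "\<And>p q :: 'k bipoly. cst a * (cst a' * p + cst b' * q) + cst b * (cst c' * p + cst d' * q) = p"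
       "\<And>p q :: 'k bipoly. cst c * (cst a' * p + cst b' * q) + cst d * (cst c' * p + cst d' * q) = q"
       "\<And>p q :: 'k bipoly. cst a' * (cst a * p + cst b * q) + cst b' * (cst c * p + cst d * q) = p"
       "\<And>p q :: 'k bipoly. cst c' * (cst a * p + cst b * q) + cst d' * (cst c * p + cst d * q) = q"
    using basis[OF st] by blast
  obtain i j k l i' j' k' l' where E: "u = cst i * var_u + cst j * var_v" "v = cst k * var_u + cst l * var_v"
    and E': "\<And>p q :: 'k bipoly. cst i * (cst i' * p + cst j' * q) + cst j * (cst k' * p + cst l' * q) = p"
       "\<And>p q :: 'k bipoly. cst k * (cst i' * p + cst j' * q) + cst l * (cst k' * p + cst l' * q) = q"
       "\<And>p q :: 'k bipoly. cst i' * (cst i * p + cst j * q) + cst j' * (cst k * p + cst l * q) = p"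
       "\<And>p q :: 'k bipoly. cst k' * (cst i * p + cst j * q) + cst l' * (cst k * p + cst l * q) = q"
    using basis[OF uv] by blast
  define f where "f = subst s t u v"
  define g where "g = subst (cst a' * var_s + cst b' * var_t) (cst c' * var_s + cst d' * var_t)
    (cst i' * var_u + cst j' * var_v) (cst k' * var_u + cst l' * var_v)"
  have hf: "is_hom f" and hg: "is_hom g"
    by (simp_all add: f_def g_def is_hom_ev is_hom_cst)
  have cf: "f (cst c) = cst c" and cg: "g (cst c) = cst c" for c
    by (simp_all add: f_def g_def ev_cst is_hom_cst)
  have vf: "f var_s = s" "f var_t = t" "f var_u = u" "f var_v = v"
    by (simp_all add: f_def is_hom_cst)
  have vg: "g var_s = cst a' * var_s + cst b' * var_t" "g var_t = cst c' * var_s + cst d' * var_t"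
    "g var_u = cst i' * var_u + cst j' * var_v" "g var_v = cst k' * var_u + cst l' * var_v"
    by (simp_all add: g_def is_hom_cst)
  have fg_var: "f (g var_s) = var_s" "f (g var_t) = var_t" "f (g var_u) = var_u" "f (g var_v) = var_v"
    by (simp_all only: vg is_homD[OF hf] cf vf D E D' E')
  have gf_var: "g s = var_s" "g t = var_t" "g u = var_u" "g v = var_v"
    by (simp_all only: D E is_homD[OF hg] cg vg D' E')
  have fg: "f (g p) = p" for p
    by (induction p rule: bipoly_induct) (simp_all add: fg_var is_homD[OF hf] is_homD[OF hg] cf cg)
  have gf: "g (f p) = p" for p
    by (induction p rule: bipoly_induct) (simp_all add: gf_var vf is_homD[OF hf] is_homD[OF hg] cf cg)
  show thesis by (rule that[OF hf hg cf cg vf fg gf gf_var])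
qed

end

text \<open>The three ways in which a variable meets the hypotheses of
  \<open>retraction_aux\<close>: it is killed as the first generator of the ideal, killed as the
  second one, or kept.\<close>

lemma triv_dec:
  fixes x y z :: "'a::comm_ring_1"
  shows "\<exists>a b. x = 0 + (x * a + y * b)" "\<exists>a b. x = 0 + (y * a + x * b)" "\<exists>a b. x = x + (y * a + z * b)"
  by (rule exI[of _ 1], rule exI[of _ 0], simp, rule exI[of _ 0], rule exI[of _ 1], simp,
      rule exI[of _ 0], rule exI[of _ 0], simp)

text \<open>A substitution of the standard variables that changes each of them by an element of the
  ideal of \<open>e, e'\<close> changes every element only by this ideal
  (\<open>hom_defect\<close>); conjugation with the automorphism carries this to the chosen
  coordinates.\<close>

lemma (in coords) retraction_aux:
  fixes x y z w e e' :: "'k bipoly"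
  assumes "\<exists>a b. var_s = x + (e * a + e' * b)" "\<exists>a b. var_t = y + (e * a + e' * b)"
    "\<exists>a b. var_u = z + (e * a + e' * b)" "\<exists>a b. var_v = w + (e * a + e' * b)"
  shows "\<exists>r f. is_hom r \<and> (\<forall>c. r (cst c) = cst c) \<and> is_hom f \<and>
    f var_s = s \<and> f var_t = t \<and> f var_u = u \<and> f var_v = v \<and>
    r s = f x \<and> r t = f y \<and> r u = f z \<and> r v = f w \<and>
    (\<forall>p. \<exists>a b. p = r p + (f e * a + f e' * b))"
proof -
  obtain f g where F: "is_hom f" "is_hom g" "\<And>c. f (cst c) = cst c" "\<And>c. g (cst c) = cst c"
    "f var_s = s" "f var_t = t" "f var_u = u" "f var_v = v" "\<And>p. f (g p) = p" "\<And>p. g (f p) = p"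
    "g s = var_s" "g t = var_t" "g u = var_u" "g v = var_v"
    using automorphism by metis
  define r where "r = (\<lambda>p. f (subst x y z w (g p)))"
  note hs = is_hom_ev[OF is_hom_cst, of x y z w]
  have hr: "is_hom r"
    unfolding is_hom_def r_def by (simp add: is_homD[OF F(1)] is_homD[OF F(2)] is_homD[OF hs])
  let ?J = "{q. \<exists>a b. q = e * a + e' * b}"
  have J: "p - subst x y z w p \<in> ?J" for p
  proof (rule hom_defect[OF hs])
    have *: "\<exists>a b. p = q + (e * a + e' * b) \<Longrightarrow> p - q \<in> ?J" for p q
    proof -
      assume "\<exists>a b. p = q + (e * a + e' * b)"
      then obtain a b where "p = q + (e * a + e' * b)" by blast
      then have "p - q = e * a + e' * b" by simp
      then show "p - q \<in> ?J" by blast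
    qed
    show "var_s - subst x y z w var_s \<in> ?J" "var_t - subst x y z w var_t \<in> ?J"
      "var_u - subst x y z w var_u \<in> ?J" "var_v - subst x y z w var_v \<in> ?J"
      by (simp_all only: ev_vars[OF is_hom_cst] *[OF assms(1)] *[OF assms(2)] *[OF assms(3)] *[OF assms(4)])
    show "0 \<in> ?J" by (auto intro!: exI[of _ "0 :: 'k bipoly"])
  next
    fix p q assume "p \<in> ?J" "q \<in> ?J"
    then obtain a b a' b' where "p = e * a + e' * b" "q = e * a' + e' * b'" by blast
    then have "p + q = e * (a + a') + e' * (b + b')" by (simp add: algebra_simps)
    then show "p + q \<in> ?J" by blast
  next
    fix p q assume "p \<in> ?J"
    then obtain a b where "p = e * a + e' * b" by blast
    then have "q * p = e * (q * a) + e' * (q * b)" by (simp add: algebra_simps)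
    then show "q * p \<in> ?J" by blast
  qed (simp add: ev_cst is_hom_cst)
  have dec: "\<exists>a b. p = r p + (f e * a + f e' * b)" for p
  proof -
    obtain a b where "g p - subst x y z w (g p) = e * a + e' * b" using J by blast
    then have "g p = subst x y z w (g p) + (e * a + e' * b)" by (simp add: diff_eq_eq add.commute)
    then have "f (g p) = f (subst x y z w (g p) + (e * a + e' * b))" by (rule arg_cong)
    then have "p = r p + (f e * f a + f e' * f b)"
      by (simp add: is_homD[OF F(1)] F r_def)
    then show ?thesis by blast
  qed
  have cr: "r (cst c) = cst c" for c by (simp add: r_def F ev_cst is_hom_cst)
  have rv: "r s = f x" "r t = f y" "r u = f z" "r v = f w"
    by (simp_all add: r_def F is_hom_cst)
  show ?thesis using hr cr F(1) F(5-8) rv dec by blast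
qed

context coords
begin

text \<open>\<open>r\<close> plays the part of the quotient map modulo \<open>s, t\<close>: its
  image is the subring generated by \<open>u, v\<close>, and what it kills lies in the ideal of
  \<open>s, t\<close>.\<close>

lemma retraction_st:
  obtains r where "is_hom r" "\<And>c. r (cst c) = cst c" "r s = 0" "r t = 0" "r u = u" "r v = v"
    "\<And>p. \<exists>a b. p = r p + s * a + t * b"
proof -
  obtain r f :: "'k bipoly \<Rightarrow> 'k bipoly" where R: "is_hom r" "\<And>c. r (cst c) = cst c" "is_hom f"
    "f var_s = s" "f var_t = t" "f var_u = u" "f var_v = v"
    "r s = f 0" "r t = f 0" "r u = f var_u" "r v = f var_v"
    "\<And>p. \<exists>a b. p = r p + (f var_s * a + f var_t * b)"
    using retraction_aux[OF triv_dec(1)[of var_s var_t] triv_dec(2)[of var_t var_s] triv_dec(3)[of var_u var_s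
      var_t] triv_dec(3)[of var_v var_s var_t]] by blast
  show thesis
    by (rule that[of r]) (use R in \<open>simp_all add: is_homD add.assoc\<close>)
qed

lemma retraction_s:
  obtains r where "is_hom r" "\<And>c. r (cst c) = cst c" "r s = 0" "r t = t" "r u = u" "r v = v"
    "\<And>p. \<exists>a. p = r p + s * a"
proof -
  obtain r f :: "'k bipoly \<Rightarrow> 'k bipoly" where R: "is_hom r" "\<And>c. r (cst c) = cst c" "is_hom f"
    "f var_s = s" "f var_t = t" "f var_u = u" "f var_v = v"
    "r s = f 0" "r t = f var_t" "r u = f var_u" "r v = f var_v"
    "\<And>p. \<exists>a b. p = r p + (f var_s * a + f 0 * b)"
    using retraction_aux[OF triv_dec(1)[of var_s 0] triv_dec(3)[of var_t var_s 0] triv_dec(3)[of var_u var_s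
      0] triv_dec(3)[of var_v var_s 0]] by blast
  show thesis
    by (rule that[of r]) (use R in \<open>simp_all add: is_homD\<close>)
qed

lemma retraction_u:
  obtains r where "is_hom r" "\<And>c. r (cst c) = cst c" "r s = s" "r t = t" "r u = 0" "r v = v"
    "\<And>p. \<exists>a. p = r p + u * a"
proof -
  obtain r f :: "'k bipoly \<Rightarrow> 'k bipoly" where R: "is_hom r" "\<And>c. r (cst c) = cst c" "is_hom f"
    "f var_s = s" "f var_t = t" "f var_u = u" "f var_v = v"
    "r s = f var_s" "r t = f var_t" "r u = f 0" "r v = f var_v"
    "\<And>p. \<exists>a b. p = r p + (f var_u * a + f 0 * b)"
    using retraction_aux[OF triv_dec(3)[of var_s var_u 0] triv_dec(3)[of var_t var_u 0] triv_dec(1)[of var_u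
      0] triv_dec(3)[of var_v var_u 0]] by blast
  show thesis
    by (rule that[of r]) (use R in \<open>simp_all add: is_homD\<close>)
qed

end

lemma var_neq_0 [simp]: "(var_s :: 'k::field bipoly) \<noteq> 0" "(var_t :: 'k bipoly) \<noteq> 0"
  "(var_u :: 'k bipoly) \<noteq> 0" "(var_v :: 'k bipoly) \<noteq> 0"
  by (metis lookup_single_eq lookup_zero one_neq_zero var_s_def,
      metis lookup_single_eq lookup_zero one_neq_zero var_t_def,
      metis lookup_single_eq lookup_zero one_neq_zero var_u_def,
      metis lookup_single_eq lookup_zero one_neq_zero var_v_def)

lemma is_basis2_swap: "is_basis2 x y p q \<Longrightarrow> is_basis2 x y q p"
proof -
  assume "is_basis2 x y p q"
  then obtain a b c d where "a * d - b * c \<noteq> 0" "p = cst a * x + cst b * y" "q = cst c * x + cst d * y"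
    unfolding is_basis2_def by blast
  then show ?thesis unfolding is_basis2_def
    by (intro exI[of _ c] exI[of _ d] exI[of _ a] exI[of _ b]) (auto simp: algebra_simps)
qed

section \<open>Koszul relations\<close>

context coords
begin

lemma coords_swap_uv: "coords s t v u"
  using st uv is_basis2_swap by (auto simp: coords_def)

lemma coords_neq_0: "s \<noteq> 0" "t \<noteq> 0" "u \<noteq> 0" "v \<noteq> 0"
  by (rule automorphism; metis is_homD(1) var_neq_0)+

text \<open>Killing \<open>s\<close> leaves \<open>t * r b = 0\<close>, so \<open>b\<close> is a
  multiple of \<open>s\<close>, and then \<open>s\<close> cancels.\<close>

lemma koszul_st:
  assumes "s * a = t * b"
  shows "\<exists>c. a = t * c \<and> b = s * c"
proof -
  obtain r where r: "is_hom r" "r s = 0" "r t = t" "\<And>p. \<exists>a. p = r p + s * a"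
    using retraction_s by metis
  have "r (s * a) = r (t * b)" using assms by simp
  then have "r b = 0" using coords_neq_0 by (simp add: is_homD[OF r(1)] r)
  then obtain c where c: "b = s * c" using r(4)[of b] by auto
  then have "s * a = s * (t * c)" using assms by (simp add: mult_ac)
  then show ?thesis using c coords_neq_0 by (metis mult_left_cancel)
qed

lemma koszul_uv:
  assumes "u * a = v * b"
  shows "\<exists>c. a = v * c \<and> b = u * c"
proof -
  obtain r where r: "is_hom r" "r u = 0" "r v = v" "\<And>p. \<exists>a. p = r p + u * a"
    using retraction_u by metis
  have "r (u * a) = r (v * b)" using assms by simp
  then have "r b = 0" using coords_neq_0 by (simp add: is_homD[OF r(1)] r)
  then obtain c where c: "b = u * c" using r(4)[of b] by auto
  then have "u * a = u * (v * c)" using assms by (simp add: mult_ac)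
  then show ?thesis using c coords_neq_0 by (metis mult_left_cancel)
qed

text \<open>The retraction that kills \<open>s, t\<close> fixes \<open>u, v\<close>, so the Koszul
  relation holds for the images and lifts with an error in the ideal of \<open>s, t\<close>.\<close>

lemma koszul_mod_st:
  assumes "u * x + v * y = s * a + t * b"
  shows "\<exists>c x1 x2 y1 y2. x = v * c + s * x1 + t * x2 \<and> y = - (u * c) + s * y1 + t * y2"
proof -
  obtain r where r: "is_hom r" "r s = 0" "r t = 0" "r u = u" "r v = v"
      "\<And>p. \<exists>a b. p = r p + s * a + t * b"
    using retraction_st by metis
  have "r (u * x + v * y) = r (s * a + t * b)" using assms by simp
  then have "u * r x = v * (- r y)" by (simp add: is_homD[OF r(1)] r eq_neg_iff_add_eq_0)
  then obtain c where "r x = v * c" "- r y = u * c" using koszul_uv by blast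
  then have "r x = v * c" "r y = - (u * c)" by (simp, metis minus_minus)
  then show ?thesis using r(6)[of x] r(6)[of y] by metis
qed

text \<open>Since the retraction fixes \<open>u\<close>, this element remains a nonzerodivisor
  modulo \<open>s, t\<close>.\<close>

lemma coprime_st_u:
  assumes "u * x = s * a + t * b"
  shows "\<exists>x1 x2. x = s * x1 + t * x2"
proof -
  obtain r where r: "is_hom r" "r s = 0" "r t = 0" "r u = u"
      "\<And>p. \<exists>a b. p = r p + s * a + t * b"
    using retraction_st by metis
  have "r (u * x) = r (s * a + t * b)" using assms by simp
  then have "r x = 0" using coords_neq_0 by (simp add: is_homD[OF r(1)] r)
  then show ?thesis using r(5)[of x] by auto
qed

end

section \<open>Resolutions of the kernels of four linear systems\<close>

text \<open>Exactness of $R^k \to R^n \to R^m$ with maps \<open>E\<close> and \<open>D\<close>; entries outside these ranges are junk.\<close>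

definition exf :: "nat \<Rightarrow> nat \<Rightarrow> nat \<Rightarrow> (nat \<Rightarrow> nat \<Rightarrow> 'r::comm_ring_1) \<Rightarrow> (nat \<Rightarrow> nat \<Rightarrow> 'r) \<Rightarrow> bool" where
  "exf m n k D E \<longleftrightarrow> (\<forall>x. (\<forall>i<m. (\<Sum>j<n. D i j * x j) = 0) \<longleftrightarrow> (\<exists>y. \<forall>j<n. x j = (\<Sum>l<k. E j l * y l)))"

definition mt :: "'r list list \<Rightarrow> nat \<Rightarrow> nat \<Rightarrow> 'r" where
  "mt M i j = M ! i ! j"

text \<open>By linearity the inclusion of the image in the kernel is a matrix identity; only the
  other inclusion needs an argument.\<close>

lemma exfI:
  assumes "\<And>x. (\<And>i. i < m \<Longrightarrow> (\<Sum>j<n. D i j * x j) = 0) \<Longrightarrow> \<exists>y. \<forall>j<n. x j = (\<Sum>l<k. E j l * y l)"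
    and "\<And>i l. i < m \<Longrightarrow> l < k \<Longrightarrow> (\<Sum>j<n. D i j * E j l) = 0"
  shows "exf m n k D E"
  unfolding exf_def
proof (intro allI iffI impI)
  fix x i assume "\<exists>y. \<forall>j<n. x j = (\<Sum>l<k. E j l * y l)" and i: "i < m"
  then obtain y where y: "\<forall>j<n. x j = (\<Sum>l<k. E j l * y l)" by blast
  then have "(\<Sum>j<n. D i j * x j) = (\<Sum>j<n. \<Sum>l<k. D i j * E j l * y l)"
    by (intro sum.cong) (auto simp: sum_distrib_left mult.assoc)
  also have "\<dots> = (\<Sum>l<k. (\<Sum>j<n. D i j * E j l) * y l)"
    by (subst sum.swap) (simp add: sum_distrib_right)
  finally show "(\<Sum>j<n. D i j * x j) = 0" using assms(2) i by simp
qed (use assms(1) in blast)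

lemmas expand = mt_def eval_nat_numeral sum.lessThan_Suc All_less_Suc less_Suc_eq

context coords
begin

lemma koszul_st0:
  assumes "s * a + t * b = 0"
  shows "\<exists>c. a = t * c \<and> b = - (s * c)"
proof -
  have "s * a = t * (- b)" using assms by (simp add: eq_neg_iff_add_eq_0)
  then obtain c where "a = t * c" "- b = s * c" using koszul_st by blast
  then show ?thesis by (metis minus_minus)
qed

text \<open>The Koszul relation of the regular sequence \<open>s, t * t\<close>, by two steps with
  \<open>s, t\<close>. It serves type 4, where \<open>t * t\<close> appears among the matrix
  entries.\<close>

lemma koszul_st20:
  assumes "s * a + t * (t * b) = 0"
  shows "\<exists>c. a = t * (t * c) \<and> b = - (s * c)"
proof -
  obtain c where c: "a = t * c" "t * b = - (s * c)" using koszul_st0[OF assms] by blast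
  then have "s * c + t * b = 0" by simp
  then obtain d where "c = t * d" "b = - (s * d)" using koszul_st0 by blast
  then show ?thesis using c by blast
qed

lemma coprime_st_v: "v * x = s * a + t * b \<Longrightarrow> \<exists>x1 x2. x = s * x1 + t * x2"
  using coords.coprime_st_u[OF coords_swap_uv] .

lemma coprime_st_u0:
  assumes "u * x + s * a + t * b = 0"
  shows "\<exists>x1 x2. x = s * x1 + t * x2"
proof -
  have "u * x = s * (- a) + t * (- b)" using assms by (simp add: eq_neg_iff_add_eq_0 algebra_simps)
  then show ?thesis by (rule coprime_st_u)
qed

lemma coprime_st_v0:
  assumes "v * x + s * a + t * b = 0"
  shows "\<exists>x1 x2. x = s * x1 + t * x2"
proof -
  have "v * x = s * (- a) + t * (- b)" using assms by (simp add: eq_neg_iff_add_eq_0 algebra_simps)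
  then show ?thesis by (rule coprime_st_v)
qed

lemma cancel_t: "t * x = 0 \<Longrightarrow> x = 0" and cancel_s: "s * x = 0 \<Longrightarrow> x = 0"
  using coords_neq_0 by simp_all

text \<open>
  The rows of \<open>rho\<close> are the equations of types 1 to 4 in the unknowns \<open>a0, \<dots>, a3\<close> of degree \<open>(3, 1)\<close> and
  \<open>y0, y1, y2\<close> of degree \<open>(2, 2)\<close>; in types 3 and 4 the unknown \<open>a3\<close> is free. The columns of \<open>gamma\<close>,
  \<open>delta\<close> and \<open>epsilon\<close> are the parameters of the general solution, found by reducing modulo \<open>s, t\<close> first.
\<close>

definition "rho1 =
  [[s, t, 0, 0, -u, -v, 0],
   [0, 0, s, t, 0, -u, -v]]"

definition "gamma1 =
  [[0, u, v, 0, 0, 0, 0, t, 0],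
   [0, 0, 0, 0, u, v, 0, -s, 0],
   [0, 0, u, v, 0, 0, 0, 0, t],
   [0, 0, 0, 0, 0, u, v, 0, -s],
   [v*v, s, 0, 0, t, 0, 0, 0, 0],
   [-(u*v), 0, s, 0, 0, t, 0, 0, 0],
   [u*u, 0, 0, s, 0, 0, t, 0, 0]]"

definition "delta1 =
  [[s, t, 0, 0, 0],
   [-(v*v), 0, t, 0, 0],
   [u*v, 0, 0, t, 0],
   [-(u*u), 0, 0, 0, t],
   [0, -(v*v), -s, 0, 0],
   [0, u*v, 0, -s, 0],
   [0, -(u*u), 0, 0, -s],
   [0, 0, -u, -v, 0],
   [0, 0, 0, -u, -v]]"

definition "epsilon1 =
  [[t],
   [-s],
   [v*v],
   [-(u*v)],
   [u*u]]"

definition "rho2 =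
  [[s, t, 0, 0, -u, -v, 0],
   [0, 0, s, t, 0, 0, -u]]"

definition "gamma2 =
  [[0, u, v, 0, 0, 0, 0, t, 0],
   [0, 0, 0, 0, u, v, 0, -s, 0],
   [0, 0, 0, u, 0, 0, 0, 0, t],
   [0, 0, 0, 0, 0, 0, u, 0, -s],
   [v, s, 0, 0, t, 0, 0, 0, 0],
   [-u, 0, s, 0, 0, t, 0, 0, 0],
   [0, 0, 0, s, 0, 0, t, 0, 0]]"

definition "delta2 =
  [[s, t, 0, 0, 0],
   [-v, 0, t, 0, 0],
   [u, 0, 0, t, 0],
   [0, 0, 0, 0, t],
   [0, -v, -s, 0, 0],
   [0, u, 0, -s, 0],
   [0, 0, 0, 0, -s],
   [0, 0, -u, -v, 0],
   [0, 0, 0, 0, -u]]"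

definition "epsilon2 =
  [[t],
   [-s],
   [v],
   [-u],
   [0]]"

definition "rho3 =
  [[s, t, 0, 0, -u, -v, 0],
   [0, s, t, 0, 0, -u, -v]]"

definition "gamma3 =
  [[0, 0, u, v, 0, 0, 0, -(t*v), t*t],
   [0, 0, 0, u, v, 0, 0, 0, -(s*t)],
   [0, 0, 0, 0, u, v, -(u*u), -(s*u), s*s],
   [0, 1, 0, 0, 0, 0, 0, 0, 0],
   [v*v, 0, s, t, 0, 0, t*v, 0, 0],
   [-(u*v), 0, 0, s, t, 0, -(t*u), -(s*t), 0],
   [u*u, 0, 0, 0, s, t, 0, 0, 0]]"

definition "delta3 =
  [[s, t, 0, 0, 0, 0],
   [0, 0, 0, 0, 0, 0],
   [-(v*v), 0, -(t*v), 0, 0, t*t],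
   [u*v, 0, 0, -(t*v), 0, -(s*t)],
   [-(u*u), 0, 0, t*u, s*t, 0],
   [0, -(u*u), 0, -(s*u), -(s*s), 0],
   [-u, -v, s, t, 0, 0],
   [0, 0, -u, -v, t, -s],
   [0, 0, 0, 0, v, -u]]"

definition "epsilon3 =
  [[t, 0],
   [-s, 0],
   [-v, t],
   [u, -s],
   [0, u],
   [0, v]]"

definition "rho4 =
  [[s, t, 0, 0, -u, -v, 0],
   [0, s, t, 0, 0, 0, -u]]"

definition "gamma4 =
  [[0, 0, u, v, 0, 0, 0, t*t],
   [0, 0, 0, 0, u, 0, t*v, -(s*t)],
   [0, 0, 0, 0, 0, u, -(s*v), s*s],
   [0, 1, 0, 0, 0, 0, 0, 0],
   [v, 0, s, 0, t, 0, 0, 0],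
   [-u, 0, 0, s, 0, 0, t*t, 0],
   [0, 0, 0, 0, s, t, 0, 0]]"

definition "delta4 =
  [[s, t*t, 0, 0],
   [0, 0, 0, 0],
   [-v, 0, t*t, 0],
   [u, 0, 0, t*t],
   [0, -(t*v), -(s*t), 0],
   [0, s*v, s*s, 0],
   [0, u, 0, -s],
   [0, 0, -u, -v]]"

definition "epsilon4 =
  [[t*t],
   [-s],
   [v],
   [-u]]"

text \<open>Modulo \<open>s, t\<close> the vector \<open>(y0, y1, y2)\<close> is killed by the
  matrix with rows \<open>(u, v, 0)\<close> and \<open>(0, u, v)\<close>, whose kernel is generated
  by its minors \<open>(v * v, - (u * v), u * u)\<close>. The \<open>f\<close> and \<open>g\<close>
  describe the lift.\<close>

lemma solve_y:
  assumes "u * y0 + v * y1 = s * a0 + t * a1" "u * y1 + v * y2 = s * a2 + t * a3"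
  shows "\<exists>c f0 f1 f2 g0 g1 g2. y0 = v * v * c + s * f0 + t * g0 \<and> y1 = - (u * v * c) + s * f1 + t * g1
    \<and> y2 = u * u * c + s * f2 + t * g2"
proof -
  obtain b0 p0 q0 p1 q1 where 1: "y0 = v * b0 + s * p0 + t * q0" "y1 = - (u * b0) + s * p1 + t * q1"
    using koszul_mod_st[OF assms(1)] by blast
  obtain b1 p2 q2 p3 q3 where 2: "y1 = v * b1 + s * p2 + t * q2" "y2 = - (u * b1) + s * p3 + t * q3"
    using koszul_mod_st[OF assms(2)] by blast
  \<comment> \<open>The rows give two expressions for \<open>y1\<close>; equating them is again a
    relation of \<open>u, v\<close> modulo \<open>s, t\<close>.\<close>
  have "u * b0 + v * b1 = s * (p1 - p2) + t * (q1 - q2)"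
    using 1(2) 2(1) by (simp add: algebra_simps)
  then obtain c x1 x2 x3 x4 where 3: "b0 = v * c + s * x1 + t * x2" "b1 = - (u * c) + s * x3 + t * x4"
    using koszul_mod_st by blast
  have "y0 = v * v * c + s * (v * x1 + p0) + t * (v * x2 + q0)"
    "y1 = - (u * v * c) + s * (p1 - u * x1) + t * (q1 - u * x2)"
    "y2 = u * u * c + s * (p3 - u * x3) + t * (q3 - u * x4)"
    unfolding 1(1,2) 2(2) 3 by (simp_all add: algebra_simps)
  then show ?thesis by blast
qed

text \<open>With \<open>y\<close> inserted, each row reads \<open>s * _ + t * _ = 0\<close>. The
  rows share none of the \<open>a\<close>, so the two Koszul multipliers \<open>d1, d2\<close> are
  independent of each other.\<close>

lemma solve1:
  assumes "s * a0 + t * a1 - u * y0 - v * y1 = 0" "s * a2 + t * a3 - u * y1 - v * y2 = 0"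
  shows "\<exists>c f0 f1 f2 g0 g1 g2 d1 d2. a0 = u * f0 + v * f1 + t * d1 \<and> a1 = u * g0 + v * g1 - s * d1 \<and>
    a2 = u * f1 + v * f2 + t * d2 \<and> a3 = u * g1 + v * g2 - s * d2 \<and> y0 = (v * v) * c + s * f0 + t * g0 \<and>
    y1 = - ((u * v) * c) + s * f1 + t * g1 \<and> y2 = (u * u) * c + s * f2 + t * g2"
proof -
  have 1: "u * y0 + v * y1 = s * a0 + t * a1" "u * y1 + v * y2 = s * a2 + t * a3"
    using assms by (simp_all add: algebra_simps)
  obtain c f0 f1 f2 g0 g1 g2 where y: "y0 = v * v * c + s * f0 + t * g0" "y1 = - (u * v * c) + s * f1 + t * g1"
    "y2 = u * u * c + s * f2 + t * g2"
    using solve_y[OF 1] by blast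
  have "s * (a0 - (u * f0 + v * f1)) + t * (a1 - (u * g0 + v * g1)) = 0"
    using assms(1) unfolding y by (simp add: algebra_simps)
  then obtain d1 where d1: "a0 - (u * f0 + v * f1) = t * d1" "a1 - (u * g0 + v * g1) = - (s * d1)"
    using koszul_st0 by blast
  have "s * (a2 - (u * f1 + v * f2)) + t * (a3 - (u * g1 + v * g2)) = 0"
    using assms(2) unfolding y by (simp add: algebra_simps)
  then obtain d2 where d2: "a2 - (u * f1 + v * f2) = t * d2" "a3 - (u * g1 + v * g2) = - (s * d2)"
    using koszul_st0 by blast
  have "a0 = u * f0 + v * f1 + t * d1" "a1 = u * g0 + v * g1 - s * d1"
    "a2 = u * f1 + v * f2 + t * d2" "a3 = u * g1 + v * g2 - s * d2"
    using d1 d2 by (simp_all add: algebra_simps)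
  then show ?thesis using y by blast
qed

text \<open>\<open>u * u * c\<close> lies in the ideal of \<open>s, t\<close>, hence so does
  \<open>c\<close>. Removing its contribution leaves a Koszul relation for each pair
  \<open>f, g\<close>; cancelling \<open>t\<close> then gives \<open>d1\<close> and
  \<open>d2\<close>.\<close>

lemma solve1_delta:
  assumes "u * f0 + v * f1 + t * d1 = 0" "u * g0 + v * g1 - s * d1 = 0" "u * f1 + v * f2 + t * d2 = 0"
    "u * g1 + v * g2 - s * d2 = 0" "(v * v) * c + s * f0 + t * g0 = 0" "- ((u * v) * c) + s * f1 + t * g1 = 0"
    "(u * u) * c + s * f2 + t * g2 = 0"
  shows "\<exists>c1 c2 h0 h1 h2. c = s * c1 + t * c2 \<and> f0 = - ((v * v) * c1) + t * h0 \<and> f1 = (u * v) * c1 + t * h1 \<and>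
    f2 = - ((u * u) * c1) + t * h2 \<and> g0 = - ((v * v) * c2) - s * h0 \<and> g1 = (u * v) * c2 - s * h1 \<and>
    g2 = - ((u * u) * c2) - s * h2 \<and> d1 = - (u * h0) - v * h1 \<and> d2 = - (u * h1) - v * h2"
proof -
  have "u * (u * c) + s * f2 + t * g2 = 0" using assms(7) by (simp add: mult.assoc)
  then obtain c1 c2 where c: "c = s * c1 + t * c2"
    by (metis coprime_st_u0 coprime_st_u)
  have "s * (v * v * c1 + f0) + t * (v * v * c2 + g0) = 0"
    using assms(5) unfolding c by (simp add: algebra_simps)
  then obtain h0 where h0: "v * v * c1 + f0 = t * h0" "v * v * c2 + g0 = - (s * h0)" using koszul_st0 by blast
  have "s * (f1 - u * v * c1) + t * (g1 - u * v * c2) = 0"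
    using assms(6) unfolding c by (simp add: algebra_simps)
  then obtain h1 where h1: "f1 - u * v * c1 = t * h1" "g1 - u * v * c2 = - (s * h1)" using koszul_st0 by blast
  have "s * (u * u * c1 + f2) + t * (u * u * c2 + g2) = 0"
    using assms(7) unfolding c by (simp add: algebra_simps)
  then obtain h2 where h2: "u * u * c1 + f2 = t * h2" "u * u * c2 + g2 = - (s * h2)" using koszul_st0 by blast
  have F: "f0 = - ((v * v) * c1) + t * h0" "f1 = (u * v) * c1 + t * h1" "f2 = - ((u * u) * c1) + t * h2"
    "g0 = - ((v * v) * c2) - s * h0" "g1 = (u * v) * c2 - s * h1" "g2 = - ((u * u) * c2) - s * h2"
    using h0 h1 h2 by (simp_all add: algebra_simps eq_neg_iff_add_eq_0)
  have "t * (u * h0 + v * h1 + d1) = 0" using assms(1) unfolding F by (simp add: algebra_simps)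
  then have "u * h0 + v * h1 + d1 = 0" by (rule cancel_t)
  then have d1: "d1 = - (u * h0) - v * h1" by (simp add: algebra_simps eq_neg_iff_add_eq_0)
  have "t * (u * h1 + v * h2 + d2) = 0" using assms(3) unfolding F by (simp add: algebra_simps)
  then have "u * h1 + v * h2 + d2 = 0" by (rule cancel_t)
  then have d2: "d2 = - (u * h1) - v * h2" by (simp add: algebra_simps eq_neg_iff_add_eq_0)
  show ?thesis using c F d1 d2 by blast
qed

lemma solve1_epsilon:
  assumes "s * c1 + t * c2 = 0" "- ((v * v) * c1) + t * h0 = 0" "(u * v) * c1 + t * h1 = 0"
    "- ((u * u) * c1) + t * h2 = 0" "- ((v * v) * c2) - s * h0 = 0" "(u * v) * c2 - s * h1 = 0"
    "- ((u * u) * c2) - s * h2 = 0" "- (u * h0) - v * h1 = 0" "- (u * h1) - v * h2 = 0"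
  shows "\<exists>e. c1 = t * e \<and> c2 = - (s * e) \<and> h0 = (v * v) * e \<and> h1 = - ((u * v) * e) \<and> h2 = (u * u) * e"
proof -
  obtain e where c: "c1 = t * e" "c2 = - (s * e)" using koszul_st0[OF assms(1)] by blast
  have "t * (h0 - (v * v) * e) = 0" "t * (h1 + (u * v) * e) = 0" "t * (h2 - (u * u) * e) = 0"
    using assms(2,3,4) unfolding c by (simp_all add: algebra_simps)
  then have "h0 - (v * v) * e = 0" "h1 + (u * v) * e = 0" "h2 - (u * u) * e = 0"
    using cancel_t by blast+
  then have "h0 = (v * v) * e" "h1 = - ((u * v) * e)" "h2 = (u * u) * e"
    by (simp_all add: eq_neg_iff_add_eq_0)
  then show ?thesis using c by blast
qed

text \<open>The second row contains only \<open>y2\<close>, which therefore lies in the ideal of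
  \<open>s, t\<close>, and the kernel modulo \<open>s, t\<close> is generated by
  \<open>(v, -u, 0)\<close>. This lowers the degree of the parameter \<open>c\<close> from (2,4) to
  (2,3).\<close>

lemma solve2:
  assumes "s * a0 + t * a1 - u * y0 - v * y1 = 0" "s * a2 + t * a3 - u * y2 = 0"
  shows "\<exists>c f0 f1 f2 g0 g1 g2 d1 d2. a0 = u * f0 + v * f1 + t * d1 \<and> a1 = u * g0 + v * g1 - s * d1 \<and>
    a2 = u * f2 + t * d2 \<and> a3 = u * g2 - s * d2 \<and> y0 = v * c + s * f0 + t * g0 \<and>
    y1 = - (u * c) + s * f1 + t * g1 \<and> y2 = s * f2 + t * g2"
proof -
  have 1: "u * y0 + v * y1 = s * a0 + t * a1" "u * y2 = s * a2 + t * a3"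
    using assms by (simp_all add: algebra_simps)
  obtain c f0 f1 g0 g1 where y: "y0 = v * c + s * f0 + t * g0" "y1 = - (u * c) + s * f1 + t * g1"
    using koszul_mod_st[OF 1(1)] by blast
  obtain f2 g2 where y2: "y2 = s * f2 + t * g2" using coprime_st_u[OF 1(2)] by blast
  have "s * (a0 - (u * f0 + v * f1)) + t * (a1 - (u * g0 + v * g1)) = 0"
    using assms(1) unfolding y by (simp add: algebra_simps)
  then obtain d1 where d1: "a0 - (u * f0 + v * f1) = t * d1" "a1 - (u * g0 + v * g1) = - (s * d1)"
    using koszul_st0 by blast
  have "s * (a2 - u * f2) + t * (a3 - u * g2) = 0"
    using assms(2) unfolding y2 by (simp add: algebra_simps)
  then obtain d2 where d2: "a2 - u * f2 = t * d2" "a3 - u * g2 = - (s * d2)"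
    using koszul_st0 by blast
  have "a0 = u * f0 + v * f1 + t * d1" "a1 = u * g0 + v * g1 - s * d1"
    "a2 = u * f2 + t * d2" "a3 = u * g2 - s * d2"
    using d1 d2 by (simp_all add: algebra_simps)
  then show ?thesis using y y2 by blast
qed

lemma solve2_delta:
  assumes "u * f0 + v * f1 + t * d1 = 0" "u * g0 + v * g1 - s * d1 = 0" "u * f2 + t * d2 = 0"
    "u * g2 - s * d2 = 0" "v * c + s * f0 + t * g0 = 0" "- (u * c) + s * f1 + t * g1 = 0" "s * f2 + t * g2 = 0"
  shows "\<exists>c1 c2 h0 h1 h2. c = s * c1 + t * c2 \<and> f0 = - (v * c1) + t * h0 \<and> f1 = u * c1 + t * h1 \<and>
    f2 = t * h2 \<and> g0 = - (v * c2) - s * h0 \<and> g1 = u * c2 - s * h1 \<and> g2 = - (s * h2) \<and>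
    d1 = - (u * h0) - v * h1 \<and> d2 = - (u * h2)"
proof -
  have "u * c = s * f1 + t * g1" using assms(6) by (simp add: algebra_simps)
  then obtain c1 c2 where c: "c = s * c1 + t * c2" using coprime_st_u by blast
  have "s * (v * c1 + f0) + t * (v * c2 + g0) = 0"
    using assms(5) unfolding c by (simp add: algebra_simps)
  then obtain h0 where h0: "v * c1 + f0 = t * h0" "v * c2 + g0 = - (s * h0)" using koszul_st0 by blast
  have "s * (f1 - u * c1) + t * (g1 - u * c2) = 0"
    using assms(6) unfolding c by (simp add: algebra_simps)
  then obtain h1 where h1: "f1 - u * c1 = t * h1" "g1 - u * c2 = - (s * h1)" using koszul_st0 by blast
  obtain h2 where h2: "f2 = t * h2" "g2 = - (s * h2)" using koszul_st0[OF assms(7)] by blast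
  have F: "f0 = - (v * c1) + t * h0" "f1 = u * c1 + t * h1"
    "g0 = - (v * c2) - s * h0" "g1 = u * c2 - s * h1"
    using h0 h1 by (simp_all add: algebra_simps eq_neg_iff_add_eq_0)
  have "t * (u * h0 + v * h1 + d1) = 0" using assms(1) unfolding F by (simp add: algebra_simps)
  then have "u * h0 + v * h1 + d1 = 0" by (rule cancel_t)
  then have d1: "d1 = - (u * h0) - v * h1" by (simp add: algebra_simps eq_neg_iff_add_eq_0)
  have "t * (u * h2 + d2) = 0" using assms(3) unfolding h2 by (simp add: algebra_simps)
  then have "u * h2 + d2 = 0" by (rule cancel_t)
  then have d2: "d2 = - (u * h2)" by (simp add: eq_neg_iff_add_eq_0 add.commute)
  show ?thesis using c F h2 d1 d2 by blast
qed

lemma solve2_epsilon: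
  assumes "s * c1 + t * c2 = 0" "- (v * c1) + t * h0 = 0" "u * c1 + t * h1 = 0" "t * h2 = 0"
    "- (v * c2) - s * h0 = 0" "u * c2 - s * h1 = 0" "- (s * h2) = 0" "- (u * h0) - v * h1 = 0" "- (u * h2) = 0"
  shows "\<exists>e. c1 = t * e \<and> c2 = - (s * e) \<and> h0 = v * e \<and> h1 = - (u * e) \<and> h2 = 0"
proof -
  obtain e where c: "c1 = t * e" "c2 = - (s * e)" using koszul_st0[OF assms(1)] by blast
  have "t * (h0 - v * e) = 0" "t * (h1 + u * e) = 0"
    using assms(2,3) unfolding c by (simp_all add: algebra_simps)
  then have "h0 - v * e = 0" "h1 + u * e = 0" "h2 = 0"
    using cancel_t assms(4) by blast+
  then have "h0 = v * e" "h1 = - (u * e)" "h2 = 0"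
    by (simp_all add: eq_neg_iff_add_eq_0)
  then show ?thesis using c by blast
qed

text \<open>The rows share \<open>a1\<close>, and the two values found for it must agree. This is a
  relation of \<open>u, v\<close> modulo \<open>s, t\<close>; it produces the parameters
  \<open>T\<close>, \<open>R\<close>, \<open>P\<close> of degrees (3,3), (4,2), (5,1).\<close>

lemma solve3:
  assumes "s * a0 + t * a1 - u * y0 - v * y1 = 0" "s * a1 + t * a2 - u * y1 - v * y2 = 0"
  shows "\<exists>c z f0 f1 f2 f3 T R P. a0 = u * f0 + v * f1 - (t * v) * R + (t * t) * P \<and>
    a1 = u * f1 + v * f2 - (s * t) * P \<and> a2 = u * f2 + v * f3 - (u * u) * T - (s * u) * R + (s * s) * P \<and>
    a3 = z \<and> y0 = (v * v) * c + s * f0 + t * f1 + (t * v) * T \<and>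
    y1 = - ((u * v) * c) + s * f1 + t * f2 - (t * u) * T - (s * t) * R \<and> y2 = (u * u) * c + s * f2 + t * f3"
proof -
  have 1: "u * y0 + v * y1 = s * a0 + t * a1" "u * y1 + v * y2 = s * a1 + t * a2"
    using assms by (simp_all add: algebra_simps)
  obtain c p0 p1 p2 q0 q1 q2 where y: "y0 = v * v * c + s * p0 + t * q0" "y1 = - (u * v * c) + s * p1 + t * q1"
    "y2 = u * u * c + s * p2 + t * q2"
    using solve_y[OF 1] by blast
  have "s * (a0 - (u * p0 + v * p1)) + t * (a1 - (u * q0 + v * q1)) = 0"
    using assms(1) unfolding y by (simp add: algebra_simps)
  then obtain X where X: "a0 - (u * p0 + v * p1) = t * X" "a1 - (u * q0 + v * q1) = - (s * X)"
    using koszul_st0 by blast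
  have "s * (a1 - (u * p1 + v * p2)) + t * (a2 - (u * q1 + v * q2)) = 0"
    using assms(2) unfolding y by (simp add: algebra_simps)
  then obtain Y where Y: "a1 - (u * p1 + v * p2) = t * Y" "a2 - (u * q1 + v * q2) = - (s * Y)"
    using koszul_st0 by blast
  have "u * (q0 - p1) + v * (q1 - p2) = s * X + t * Y"
    using X(2) Y(1) by (simp add: algebra_simps)
  then obtain T x1 x2 x3 x4 where T: "q0 - p1 = v * T + s * x1 + t * x2" "q1 - p2 = - (u * T) + s * x3 + t * x4"
    using koszul_mod_st by blast
  have q: "q0 = p1 + (v * T + s * x1 + t * x2)" "q1 = p2 + (- (u * T) + s * x3 + t * x4)"
    using T by (simp_all add: algebra_simps)
  have "s * (X - u * x1 - v * x3) + t * (Y - u * x2 - v * x4) = 0"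
    using X(2) Y(1) unfolding q by (simp add: algebra_simps)
  then obtain P where P: "X - u * x1 - v * x3 = t * P" "Y - u * x2 - v * x4 = - (s * P)"
    using koszul_st0 by blast
  have XY: "X = u * x1 + v * x3 + t * P" "Y = u * x2 + v * x4 - s * P"
    using P by (simp_all add: algebra_simps)
  have a: "a0 = u * p0 + v * p1 + t * X" "a1 = u * p1 + v * p2 + t * Y" "a2 = u * q1 + v * q2 - s * Y"
    using X Y by (simp_all add: algebra_simps)
  \<comment> \<open>The terms with \<open>x1, x2, x4\<close> are absorbed into the parameters
    \<open>f\<close>. In \<open>y1\<close> only the difference \<open>x2 - x3\<close> survives, and
    it becomes \<open>R\<close>.\<close>
  show ?thesis
    by (rule exI[of _ c], rule exI[of _ a3], rule exI[of _ "p0 + t * x1"], rule exI[of _ "p1 + t * x2"],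
        rule exI[of _ "p2 + t * x4"], rule exI[of _ "q2 - s * x4"], rule exI[of _ T],
        rule exI[of _ "x2 - x3"], rule exI[of _ P])
      (simp add: y a XY q algebra_simps)
qed

text \<open>As for type 1, \<open>c\<close> lies in the ideal of \<open>s, t\<close>. The outer
  equations leave one Koszul multiplier each, \<open>h\<close> and \<open>k\<close>, and the
  equation of \<open>y1\<close> couples them: modulo \<open>s, t\<close> it determines
  \<open>T\<close>, with error \<open>n1, n2\<close>. Two further Koszul steps with multipliers
  \<open>i, j\<close> do the rest.\<close>

lemma solve3_delta:
  assumes "u * f0 + v * f1 - (t * v) * R + (t * t) * P = 0" "u * f1 + v * f2 - (s * t) * P = 0"
    "u * f2 + v * f3 - (u * u) * T - (s * u) * R + (s * s) * P = 0" "z = 0"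
    "(v * v) * c + s * f0 + t * f1 + (t * v) * T = 0" "- ((u * v) * c) + s * f1 + t * f2 - (t * u) * T - (s *
    t) * R = 0" "(u * u) * c + s * f2 + t * f3 = 0"
  shows "\<exists>c1 c2 n1 n2 i j. c = s * c1 + t * c2 \<and> z = 0 \<and> f0 = - ((v * v) * c1) - (t * v) * n1 + (t * t) * j \<and>
    f1 = (u * v) * c1 - (t * v) * n2 - (s * t) * j \<and> f2 = - ((u * u) * c1) + (t * u) * n2 + (s * t) * i \<and>
    f3 = - ((u * u) * c2) - (s * u) * n2 - (s * s) * i \<and> T = - (u * c1) - v * c2 + s * n1 + t * n2 \<and>
    R = - (u * n1) - v * n2 + t * i - s * j \<and> P = v * i - u * j"
proof -
  have "u * (u * c) + s * f2 + t * f3 = 0" using assms(7) by (simp add: mult.assoc)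
  then obtain c1 c2 where c: "c = s * c1 + t * c2"
    by (metis coprime_st_u0 coprime_st_u)
  have "s * (u * u * c1 + f2) + t * (u * u * c2 + f3) = 0"
    using assms(7) unfolding c by (simp add: algebra_simps)
  then obtain h where h: "u * u * c1 + f2 = t * h" "u * u * c2 + f3 = - (s * h)" using koszul_st0 by blast
  have "s * (v * v * c1 + f0) + t * (v * v * c2 + f1 + v * T) = 0"
    using assms(5) unfolding c by (simp add: algebra_simps)
  then obtain k where k: "v * v * c1 + f0 = t * k" "v * v * c2 + f1 + v * T = - (s * k)" using koszul_st0
    by blast
  have f: "f0 = t * k - v * v * c1" "f1 = - (s * k) - v * v * c2 - v * T" "f2 = t * h - u * u * c1"
    "f3 = - (s * h) - u * u * c2"
    using h k by (simp_all add: algebra_simps eq_neg_iff_add_eq_0)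
  have "s * (- (u * v * c1) - v * v * c2 - v * T - s * k) + t * (- (u * v * c2) - u * u * c1 + t * h - u * T -
    s * R) = 0"
    using assms(6) unfolding c f by (simp add: algebra_simps)
  then obtain m where m: "- (u * v * c1) - v * v * c2 - v * T - s * k = t * m"
    "- (u * v * c2) - u * u * c1 + t * h - u * T - s * R = - (s * m)" using koszul_st0 by blast
  have "v * (u * c1 + v * c2 + T) + s * k + t * m = 0"
    unfolding m(1)[symmetric] by (simp add: algebra_simps)
  then obtain n1 n2 where n: "u * c1 + v * c2 + T = s * n1 + t * n2" using coprime_st_v0 by blast
  have T: "T = - (u * c1) - v * c2 + s * n1 + t * n2"
    using n by (simp add: algebra_simps eq_neg_iff_add_eq_0)
  have "s * (v * n1 + k) + t * (v * n2 + m) = v * (s * n1 + t * n2) + s * k + t * m"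
    by (simp add: algebra_simps)
  also have "\<dots> = 0" unfolding n[symmetric] m(1)[symmetric] by (simp add: algebra_simps)
  finally obtain j where j: "v * n1 + k = t * j" "v * n2 + m = - (s * j)" using koszul_st0 by blast
  have "s * (u * n1 + R - m) + t * (u * n2 - h) = u * (s * n1 + t * n2) - (t * h - s * R) + - (s * m)"
    by (simp add: algebra_simps)
  also have "\<dots> = 0" unfolding n[symmetric] m(2)[symmetric] by (simp add: algebra_simps)
  finally obtain i where i: "u * n1 + R - m = t * i" "u * n2 - h = - (s * i)" using koszul_st0 by blast
  have kh: "k = t * j - v * n1" "h = u * n2 + s * i" "m = - (s * j) - v * n2"
    using i j by (simp_all add: algebra_simps eq_neg_iff_add_eq_0)
  have R: "R = - (u * n1) - v * n2 + t * i - s * j"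
    using i(1) unfolding kh(3) by (simp add: algebra_simps eq_neg_iff_add_eq_0)
  have F: "f0 = - ((v * v) * c1) - (t * v) * n1 + (t * t) * j" "f1 = (u * v) * c1 - (t * v) * n2 - (s * t) * j"
    "f2 = - ((u * u) * c1) + (t * u) * n2 + (s * t) * i" "f3 = - ((u * u) * c2) - (s * u) * n2 - (s * s) * i"
    by (simp_all add: f kh T algebra_simps)
  have "t * (t * (P - v * i + u * j)) = 0"
    using assms(1) unfolding F R by (simp add: algebra_simps)
  then have "P - v * i + u * j = 0" using cancel_t by blast
  then have P: "P = v * i - u * j" by (simp add: algebra_simps)
  show ?thesis using c assms(4) F T R P by blast
qed

lemma solve3_epsilon:
  assumes "s * c1 + t * c2 = 0" "- ((v * v) * c1) - (t * v) * n1 + (t * t) * j = 0"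
    "(u * v) * c1 - (t * v) * n2 - (s * t) * j = 0" "- ((u * u) * c1) + (t * u) * n2 + (s * t) * i = 0"
    "- ((u * u) * c2) - (s * u) * n2 - (s * s) * i = 0" "- (u * c1) - v * c2 + s * n1 + t * n2 = 0"
    "- (u * n1) - v * n2 + t * i - s * j = 0" "v * i - u * j = 0"
  shows "\<exists>e w. c1 = t * e \<and> c2 = - (s * e) \<and> n1 = - (v * e) + t * w \<and> n2 = u * e - s * w \<and> i = u * w \<and>
    j = v * w"
proof -
  obtain e where c: "c1 = t * e" "c2 = - (s * e)" using koszul_st0[OF assms(1)] by blast
  have "s * (n1 + v * e) + t * (n2 - u * e) = 0" using assms(6) unfolding c by (simp add: algebra_simps)
  then obtain w where "n1 + v * e = t * w" "n2 - u * e = - (s * w)" using koszul_st0 by blast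
  then have n: "n1 = - (v * e) + t * w" "n2 = u * e - s * w" by (simp_all add: algebra_simps)
  have "s * (v * w - j) + t * (i - u * w) = 0" using assms(7) unfolding n by (simp add: algebra_simps)
  then obtain x where "v * w - j = t * x" "i - u * w = - (s * x)" using koszul_st0 by blast
  then have ij: "j = v * w - t * x" "i = u * w - s * x" by (simp_all add: algebra_simps)
  have "t * (s * (s * x)) = 0" using assms(4) unfolding c n ij by (simp add: algebra_simps)
  then have "x = 0" using cancel_s cancel_t by blast
  then show ?thesis using c n ij by auto
qed

text \<open>A mixture of the preceding cases: \<open>a1\<close> is shared, but the second row
  contains only \<open>y2\<close>. The multiplier \<open>T\<close> of the compatibility relation is
  absorbed into \<open>c\<close>, so that only \<open>R\<close> and \<open>P\<close> are
  new.\<close>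

lemma solve4:
  assumes "s * a0 + t * a1 - u * y0 - v * y1 = 0" "s * a1 + t * a2 - u * y2 = 0"
  shows "\<exists>c z f0 f1 f2 f3 R P. a0 = u * f0 + v * f1 + (t * t) * P \<and> a1 = u * f2 + (t * v) * R - (s * t) * P \<and>
    a2 = u * f3 - (s * v) * R + (s * s) * P \<and> a3 = z \<and> y0 = v * c + s * f0 + t * f2 \<and>
    y1 = - (u * c) + s * f1 + (t * t) * R \<and> y2 = s * f2 + t * f3"
proof -
  have 1: "u * y0 + v * y1 = s * a0 + t * a1" "u * y2 = s * a1 + t * a2"
    using assms by (simp_all add: algebra_simps)
  obtain c p0 q0 p1 q1 where y: "y0 = v * c + s * p0 + t * q0" "y1 = - (u * c) + s * p1 + t * q1"
    using koszul_mod_st[OF 1(1)] by blast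
  obtain p2 q2 where y2: "y2 = s * p2 + t * q2" using coprime_st_u[OF 1(2)] by blast
  have "s * (a0 - (u * p0 + v * p1)) + t * (a1 - (u * q0 + v * q1)) = 0"
    using assms(1) unfolding y by (simp add: algebra_simps)
  then obtain X where X: "a0 - (u * p0 + v * p1) = t * X" "a1 - (u * q0 + v * q1) = - (s * X)"
    using koszul_st0 by blast
  have "s * (a1 - u * p2) + t * (a2 - u * q2) = 0"
    using assms(2) unfolding y2 by (simp add: algebra_simps)
  then obtain Y where Y: "a1 - u * p2 = t * Y" "a2 - u * q2 = - (s * Y)"
    using koszul_st0 by blast
  have "u * (q0 - p2) + v * q1 = s * X + t * Y"
    using X(2) Y(1) by (simp add: algebra_simps)
  then obtain T x1 x2 x3 x4 where T: "q0 - p2 = v * T + s * x1 + t * x2" "q1 = - (u * T) + s * x3 + t * x4"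
    using koszul_mod_st by blast
  have q: "q0 = p2 + (v * T + s * x1 + t * x2)" using T by (simp add: algebra_simps)
  have "s * (X - u * x1 - v * x3) + t * (Y - u * x2 - v * x4) = 0"
    using X(2) Y(1) unfolding q T(2) by (simp add: algebra_simps)
  then obtain P where P: "X - u * x1 - v * x3 = t * P" "Y - u * x2 - v * x4 = - (s * P)"
    using koszul_st0 by blast
  have XY: "X = u * x1 + v * x3 + t * P" "Y = u * x2 + v * x4 - s * P"
    using P by (simp_all add: algebra_simps)
  have a: "a0 = u * p0 + v * p1 + t * X" "a1 = u * p2 + t * Y" "a2 = u * q2 - s * Y"
    using X Y by (simp_all add: algebra_simps)
  show ?thesis
    by (rule exI[of _ "c + t * T"], rule exI[of _ a3], rule exI[of _ "p0 + t * x1"],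
        rule exI[of _ "p1 + t * x3"], rule exI[of _ "p2 + t * x2"], rule exI[of _ "q2 - s * x2"],
        rule exI[of _ x4], rule exI[of _ P])
      (simp add: y y2 a XY q T(2) algebra_simps)
qed

text \<open>Here \<open>c\<close> lies in the ideal of \<open>s, t * t\<close>: its coefficient at
  \<open>t\<close> is once more in the ideal of \<open>s, t\<close>, and the part
  \<open>s * m\<close> of it moves to the coefficient of \<open>s\<close>.\<close>

lemma solve4_delta:
  assumes "u * f0 + v * f1 + (t * t) * P = 0" "u * f2 + (t * v) * R - (s * t) * P = 0"
    "u * f3 - (s * v) * R + (s * s) * P = 0" "z = 0" "v * c + s * f0 + t * f2 = 0"
    "- (u * c) + s * f1 + (t * t) * R = 0" "s * f2 + t * f3 = 0"
  shows "\<exists>c1 n k m'. c = s * c1 + (t * t) * n \<and> z = 0 \<and> f0 = - (v * c1) + (t * t) * k \<and>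
    f1 = u * c1 + (t * t) * m' \<and> f2 = - ((t * v) * n) - (s * t) * k \<and> f3 = (s * v) * n + (s * s) * k \<and>
    R = u * n - s * m' \<and> P = - (u * k) - v * m'"
proof -
  obtain h where h: "f2 = t * h" "f3 = - (s * h)" using koszul_st0[OF assms(7)] by blast
  obtain c' c2 where c0: "c = s * c' + t * c2" using coprime_st_v0[OF assms(5)] by blast
  have "s * (v * c' + f0) + t * (v * c2 + t * h) = 0"
    using assms(5) unfolding c0 h by (simp add: algebra_simps)
  then obtain k0 where k0: "v * c' + f0 = t * k0" "v * c2 + t * h = - (s * k0)" using koszul_st0 by blast
  have "v * c2 + s * k0 + t * h = 0" using k0(2) by (simp add: algebra_simps eq_neg_iff_add_eq_0)
  then obtain m n where c2: "c2 = s * m + t * n" using coprime_st_v0 by blast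
  have "s * (v * m + k0) + t * (v * n + h) = 0"
    using \<open>v * c2 + s * k0 + t * h = 0\<close> unfolding c2 by (simp add: algebra_simps)
  then obtain k where k: "v * m + k0 = t * k" "v * n + h = - (s * k)" using koszul_st0 by blast
  have hk: "h = - (v * n) - s * k" "k0 = t * k - v * m"
    using k by (simp_all add: algebra_simps eq_neg_iff_add_eq_0)
  define c1 where "c1 = c' + t * m"
  have c: "c = s * c1 + (t * t) * n" by (simp add: c0 c2 c1_def algebra_simps)
  have f0: "f0 = - (v * c1) + (t * t) * k" using k0(1) by (simp add: hk c1_def algebra_simps)
  have "s * (f1 - u * c1) + t * (t * (R - u * n)) = 0"
    using assms(6) unfolding c by (simp add: algebra_simps)
  then obtain m' where "f1 - u * c1 = t * (t * m')" "R - u * n = - (s * m')" using koszul_st20 by blast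
  then have l: "f1 = u * c1 + (t * t) * m'" "R = u * n - s * m'" by (simp_all add: algebra_simps)
  have "t * (t * (u * k + v * m' + P)) = 0"
    using assms(1) unfolding f0 l by (simp add: algebra_simps)
  then have "u * k + v * m' + P = 0" using cancel_t by blast
  then have P: "P = - (u * k) - v * m'" by (simp add: algebra_simps eq_neg_iff_add_eq_0)
  have "f2 = - ((t * v) * n) - (s * t) * k" "f3 = (s * v) * n + (s * s) * k"
    by (simp_all add: h hk algebra_simps)
  then show ?thesis using c assms(4) f0 l P by blast
qed

lemma solve4_epsilon:
  assumes "s * c1 + (t * t) * n = 0" "- (v * c1) + (t * t) * k = 0" "u * c1 + (t * t) * m' = 0"
    "- ((t * v) * n) - (s * t) * k = 0" "(s * v) * n + (s * s) * k = 0" "u * n - s * m' = 0"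
    "- (u * k) - v * m' = 0"
  shows "\<exists>e. c1 = (t * t) * e \<and> n = - (s * e) \<and> k = v * e \<and> m' = - (u * e)"
proof -
  have "s * c1 + t * (t * n) = 0" using assms(1) by (simp add: mult.assoc)
  then obtain e where c: "c1 = t * (t * e)" "n = - (s * e)" using koszul_st20 by blast
  have "t * (t * (k - v * e)) = 0" "t * (t * (m' + u * e)) = 0"
    using assms(2,3) unfolding c by (simp_all add: algebra_simps)
  then have "k - v * e = 0" "m' + u * e = 0" using cancel_t by blast+
  then have "k = v * e" "m' = - (u * e)" "c1 = (t * t) * e"
    by (simp_all add: c eq_neg_iff_add_eq_0 mult.assoc)
  then show ?thesis using c by blast
qed

section \<open>Exactness of the complexes for types 1 to 4\<close>

lemma exact1_gamma: "exf 2 7 9 (mt rho1) (mt gamma1)"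
proof (rule exfI)
  fix x :: "nat \<Rightarrow> 'k bipoly" assume H: "\<And>i. i < 2 \<Longrightarrow> (\<Sum>j<7. mt rho1 i j * x j) = 0"
  have E: "s * x 0 + t * x 1 - u * x 4 - v * x 5 = 0"
    "s * x 2 + t * x 3 - u * x 5 - v * x 6 = 0"
    using H[of 0] H[of 1] by (simp_all add: expand rho1_def algebra_simps neg_eq_iff_add_eq_0)
  obtain c f0 f1 f2 g0 g1 g2 d1 d2 where "x 0 = u * f0 + v * f1 + t * d1" "x 1 = u * g0 + v * g1 - s * d1"
    "x 2 = u * f1 + v * f2 + t * d2" "x 3 = u * g1 + v * g2 - s * d2" "x 4 = (v * v) * c + s * f0 + t * g0"
    "x 5 = - ((u * v) * c) + s * f1 + t * g1" "x 6 = (u * u) * c + s * f2 + t * g2"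
      using solve1[OF E] by blast
  then show "\<exists>y. \<forall>j<7. x j = (\<Sum>l<9. mt gamma1 j l * y l)"
      by (intro exI[of _ "\<lambda>l. [c, f0, f1, f2, g0, g1, g2, d1,
        d2] ! l"]) (simp add: expand gamma1_def algebra_simps eq_neg_iff_add_eq_0)
next
  fix i l :: nat assume "i < 2" "l < 9"
  then show "(\<Sum>j<7. mt rho1 i j * mt gamma1 j l) = 0"
    by (auto simp: expand rho1_def gamma1_def algebra_simps)
qed

lemma exact1_delta: "exf 7 9 5 (mt gamma1) (mt delta1)"
proof (rule exfI)
  fix x :: "nat \<Rightarrow> 'k bipoly" assume H: "\<And>i. i < 7 \<Longrightarrow> (\<Sum>j<9. mt gamma1 i j * x j) = 0"
  have E: "u * x 1 + v * x 2 + t * x 7 = 0"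
    "u * x 4 + v * x 5 - s * x 7 = 0"
    "u * x 2 + v * x 3 + t * x 8 = 0"
    "u * x 5 + v * x 6 - s * x 8 = 0"
    "(v * v) * x 0 + s * x 1 + t * x 4 = 0"
    "- ((u * v) * x 0) + s * x 2 + t * x 5 = 0"
    "(u * u) * x 0 + s * x 3 + t * x 6 = 0"
    using H[of 0] H[of 1] H[of 2] H[of 3] H[of 4] H[of 5] H[of 6]
      by (simp_all add: expand gamma1_def algebra_simps neg_eq_iff_add_eq_0)
  obtain c1 c2 h0 h1 h2 where "x 0 = s * c1 + t * c2" "x 1 = - ((v * v) * c1) + t * h0"
    "x 2 = (u * v) * c1 + t * h1" "x 3 = - ((u * u) * c1) + t * h2" "x 4 = - ((v * v) * c2) - s * h0"
    "x 5 = (u * v) * c2 - s * h1" "x 6 = - ((u * u) * c2) - s * h2" "x 7 = - (u * h0) - v * h1"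
    "x 8 = - (u * h1) - v * h2"
      using solve1_delta[OF E] by blast
  then show "\<exists>y. \<forall>j<9. x j = (\<Sum>l<5. mt delta1 j l * y l)"
      by (intro exI[of _ "\<lambda>l. [c1, c2, h0, h1, h2] ! l"]) (simp add: expand delta1_def algebra_simps
        eq_neg_iff_add_eq_0)
next
  fix i l :: nat assume "i < 7" "l < 5"
  then show "(\<Sum>j<9. mt gamma1 i j * mt delta1 j l) = 0"
    by (auto simp: expand gamma1_def delta1_def algebra_simps)
qed

lemma exact1_epsilon: "exf 9 5 1 (mt delta1) (mt epsilon1)"
proof (rule exfI)
  fix x :: "nat \<Rightarrow> 'k bipoly" assume H: "\<And>i. i < 9 \<Longrightarrow> (\<Sum>j<5. mt delta1 i j * x j) = 0"
  have E: "s * x 0 + t * x 1 = 0"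
    "- ((v * v) * x 0) + t * x 2 = 0"
    "(u * v) * x 0 + t * x 3 = 0"
    "- ((u * u) * x 0) + t * x 4 = 0"
    "- ((v * v) * x 1) - s * x 2 = 0"
    "(u * v) * x 1 - s * x 3 = 0"
    "- ((u * u) * x 1) - s * x 4 = 0"
    "- (u * x 2) - v * x 3 = 0"
    "- (u * x 3) - v * x 4 = 0"
    using H[of 0] H[of 1] H[of 2] H[of 3] H[of 4] H[of 5] H[of 6] H[of 7] H[of 8]
      by (simp_all add: expand delta1_def algebra_simps neg_eq_iff_add_eq_0)
  obtain e where "x 0 = t * e" "x 1 = - (s * e)" "x 2 = (v * v) * e" "x 3 = - ((u * v) * e)" "x 4 = (u * u) * e"
      using solve1_epsilon[OF E] by blast
  then show "\<exists>y. \<forall>j<5. x j = (\<Sum>l<1. mt epsilon1 j l * y l)"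
      by (intro exI[of _ "\<lambda>l. [e] ! l"]) (simp add: expand epsilon1_def algebra_simps eq_neg_iff_add_eq_0)
next
  fix i l :: nat assume "i < 9" "l < 1"
  then show "(\<Sum>j<5. mt delta1 i j * mt epsilon1 j l) = 0"
    by (auto simp: expand delta1_def epsilon1_def algebra_simps)
qed

text \<open>With no columns on the right exactness means injectivity, for whatever
  \<open>E\<close>.\<close>

lemma exact1_inj: "exf 5 1 0 (mt epsilon1) E"
proof (rule exfI)
  fix x :: "nat \<Rightarrow> 'k bipoly" assume H: "\<And>i. i < 5 \<Longrightarrow> (\<Sum>j<1. mt epsilon1 i j * x j) = 0"
  have H0: "t * x 0 = 0" using H[of 0] by (simp add: expand epsilon1_def algebra_simps)
  have H2: "(v * v) * x 0 = 0" using H[of 2] by (simp add: expand epsilon1_def algebra_simps)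
  have "x 0 = 0" using cancel_t[of "x 0"] H0 by auto
  then show "\<exists>y. \<forall>j<1. x j = (\<Sum>l<0. E j l * y l)" by (simp add: expand)
qed simp

lemma exact2_gamma: "exf 2 7 9 (mt rho2) (mt gamma2)"
proof (rule exfI)
  fix x :: "nat \<Rightarrow> 'k bipoly" assume H: "\<And>i. i < 2 \<Longrightarrow> (\<Sum>j<7. mt rho2 i j * x j) = 0"
  have E: "s * x 0 + t * x 1 - u * x 4 - v * x 5 = 0"
    "s * x 2 + t * x 3 - u * x 6 = 0"
    using H[of 0] H[of 1] by (simp_all add: expand rho2_def algebra_simps neg_eq_iff_add_eq_0)
  obtain c f0 f1 f2 g0 g1 g2 d1 d2 where "x 0 = u * f0 + v * f1 + t * d1" "x 1 = u * g0 + v * g1 - s * d1"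
    "x 2 = u * f2 + t * d2" "x 3 = u * g2 - s * d2" "x 4 = v * c + s * f0 + t * g0"
    "x 5 = - (u * c) + s * f1 + t * g1" "x 6 = s * f2 + t * g2"
      using solve2[OF E] by blast
  then show "\<exists>y. \<forall>j<7. x j = (\<Sum>l<9. mt gamma2 j l * y l)"
      by (intro exI[of _ "\<lambda>l. [c, f0, f1, f2, g0, g1, g2, d1,
        d2] ! l"]) (simp add: expand gamma2_def algebra_simps eq_neg_iff_add_eq_0)
next
  fix i l :: nat assume "i < 2" "l < 9"
  then show "(\<Sum>j<7. mt rho2 i j * mt gamma2 j l) = 0"
    by (auto simp: expand rho2_def gamma2_def algebra_simps)
qed

lemma exact2_delta: "exf 7 9 5 (mt gamma2) (mt delta2)"
proof (rule exfI)
  fix x :: "nat \<Rightarrow> 'k bipoly" assume H: "\<And>i. i < 7 \<Longrightarrow> (\<Sum>j<9. mt gamma2 i j * x j) = 0"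
  have E: "u * x 1 + v * x 2 + t * x 7 = 0"
    "u * x 4 + v * x 5 - s * x 7 = 0"
    "u * x 3 + t * x 8 = 0"
    "u * x 6 - s * x 8 = 0"
    "v * x 0 + s * x 1 + t * x 4 = 0"
    "- (u * x 0) + s * x 2 + t * x 5 = 0"
    "s * x 3 + t * x 6 = 0"
    using H[of 0] H[of 1] H[of 2] H[of 3] H[of 4] H[of 5] H[of 6]
      by (simp_all add: expand gamma2_def algebra_simps neg_eq_iff_add_eq_0)
  obtain c1 c2 h0 h1 h2 where "x 0 = s * c1 + t * c2" "x 1 = - (v * c1) + t * h0" "x 2 = u * c1 + t * h1"
    "x 3 = t * h2" "x 4 = - (v * c2) - s * h0" "x 5 = u * c2 - s * h1" "x 6 = - (s * h2)"
    "x 7 = - (u * h0) - v * h1" "x 8 = - (u * h2)"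
      using solve2_delta[OF E] by blast
  then show "\<exists>y. \<forall>j<9. x j = (\<Sum>l<5. mt delta2 j l * y l)"
      by (intro exI[of _ "\<lambda>l. [c1, c2, h0, h1, h2] ! l"]) (simp add: expand delta2_def algebra_simps
        eq_neg_iff_add_eq_0)
next
  fix i l :: nat assume "i < 7" "l < 5"
  then show "(\<Sum>j<9. mt gamma2 i j * mt delta2 j l) = 0"
    by (auto simp: expand gamma2_def delta2_def algebra_simps)
qed

lemma exact2_epsilon: "exf 9 5 1 (mt delta2) (mt epsilon2)"
proof (rule exfI)
  fix x :: "nat \<Rightarrow> 'k bipoly" assume H: "\<And>i. i < 9 \<Longrightarrow> (\<Sum>j<5. mt delta2 i j * x j) = 0"
  have E: "s * x 0 + t * x 1 = 0"
    "- (v * x 0) + t * x 2 = 0"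
    "u * x 0 + t * x 3 = 0"
    "t * x 4 = 0"
    "- (v * x 1) - s * x 2 = 0"
    "u * x 1 - s * x 3 = 0"
    "- (s * x 4) = 0"
    "- (u * x 2) - v * x 3 = 0"
    "- (u * x 4) = 0"
    using H[of 0] H[of 1] H[of 2] H[of 3] H[of 4] H[of 5] H[of 6] H[of 7] H[of 8]
      by (simp_all add: expand delta2_def algebra_simps neg_eq_iff_add_eq_0)
  obtain e where "x 0 = t * e" "x 1 = - (s * e)" "x 2 = v * e" "x 3 = - (u * e)" "x 4 = 0"
      using solve2_epsilon[OF E] by blast
  then show "\<exists>y. \<forall>j<5. x j = (\<Sum>l<1. mt epsilon2 j l * y l)"
      by (intro exI[of _ "\<lambda>l. [e] ! l"]) (simp add: expand epsilon2_def algebra_simps eq_neg_iff_add_eq_0)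
next
  fix i l :: nat assume "i < 9" "l < 1"
  then show "(\<Sum>j<5. mt delta2 i j * mt epsilon2 j l) = 0"
    by (auto simp: expand delta2_def epsilon2_def algebra_simps)
qed

lemma exact2_inj: "exf 5 1 0 (mt epsilon2) E"
proof (rule exfI)
  fix x :: "nat \<Rightarrow> 'k bipoly" assume H: "\<And>i. i < 5 \<Longrightarrow> (\<Sum>j<1. mt epsilon2 i j * x j) = 0"
  have H0: "t * x 0 = 0" using H[of 0] by (simp add: expand epsilon2_def algebra_simps)
  have H2: "v * x 0 = 0" using H[of 2] by (simp add: expand epsilon2_def algebra_simps)
  have "x 0 = 0" using cancel_t[of "x 0"] H0 by auto
  then show "\<exists>y. \<forall>j<1. x j = (\<Sum>l<0. E j l * y l)" by (simp add: expand)
qed simp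

lemma exact3_gamma: "exf 2 7 9 (mt rho3) (mt gamma3)"
proof (rule exfI)
  fix x :: "nat \<Rightarrow> 'k bipoly" assume H: "\<And>i. i < 2 \<Longrightarrow> (\<Sum>j<7. mt rho3 i j * x j) = 0"
  have E: "s * x 0 + t * x 1 - u * x 4 - v * x 5 = 0"
    "s * x 1 + t * x 2 - u * x 5 - v * x 6 = 0"
    using H[of 0] H[of 1] by (simp_all add: expand rho3_def algebra_simps neg_eq_iff_add_eq_0)
  obtain c z f0 f1 f2 f3 T R P where "x 0 = u * f0 + v * f1 - (t * v) * R + (t * t) * P"
    "x 1 = u * f1 + v * f2 - (s * t) * P" "x 2 = u * f2 + v * f3 - (u * u) * T - (s * u) * R + (s * s) * P"
    "x 3 = z" "x 4 = (v * v) * c + s * f0 + t * f1 + (t * v) * T"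
    "x 5 = - ((u * v) * c) + s * f1 + t * f2 - (t * u) * T - (s * t) * R" "x 6 = (u * u) * c + s * f2 + t * f3"
      using solve3[OF E, of "x 3"] by blast
  then show "\<exists>y. \<forall>j<7. x j = (\<Sum>l<9. mt gamma3 j l * y l)"
      by (intro exI[of _ "\<lambda>l. [c, z, f0, f1, f2, f3, T, R, P] ! l"]) (simp add: expand gamma3_def
        algebra_simps eq_neg_iff_add_eq_0)
next
  fix i l :: nat assume "i < 2" "l < 9"
  then show "(\<Sum>j<7. mt rho3 i j * mt gamma3 j l) = 0"
    by (auto simp: expand rho3_def gamma3_def algebra_simps)
qed

lemma exact3_delta: "exf 7 9 6 (mt gamma3) (mt delta3)"
proof (rule exfI)
  fix x :: "nat \<Rightarrow> 'k bipoly" assume H: "\<And>i. i < 7 \<Longrightarrow> (\<Sum>j<9. mt gamma3 i j * x j) = 0"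
  have E: "u * x 2 + v * x 3 - (t * v) * x 7 + (t * t) * x 8 = 0"
    "u * x 3 + v * x 4 - (s * t) * x 8 = 0"
    "u * x 4 + v * x 5 - (u * u) * x 6 - (s * u) * x 7 + (s * s) * x 8 = 0"
    "x 1 = 0"
    "(v * v) * x 0 + s * x 2 + t * x 3 + (t * v) * x 6 = 0"
    "- ((u * v) * x 0) + s * x 3 + t * x 4 - (t * u) * x 6 - (s * t) * x 7 = 0"
    "(u * u) * x 0 + s * x 4 + t * x 5 = 0"
    using H[of 0] H[of 1] H[of 2] H[of 3] H[of 4] H[of 5] H[of 6]
      by (simp_all add: expand gamma3_def algebra_simps neg_eq_iff_add_eq_0)
  obtain c1 c2 n1 n2 i j where "x 0 = s * c1 + t * c2" "x 1 = 0"
    "x 2 = - ((v * v) * c1) - (t * v) * n1 + (t * t) * j" "x 3 = (u * v) * c1 - (t * v) * n2 - (s * t) * j"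
    "x 4 = - ((u * u) * c1) + (t * u) * n2 + (s * t) * i" "x 5 = - ((u * u) * c2) - (s * u) * n2 - (s * s) *
    i" "x 6 = - (u * c1) - v * c2 + s * n1 + t * n2" "x 7 = - (u * n1) - v * n2 + t * i - s * j"
    "x 8 = v * i - u * j"
      using solve3_delta[OF E] by blast
  then show "\<exists>y. \<forall>j<9. x j = (\<Sum>l<6. mt delta3 j l * y l)"
      by (intro exI[of _ "\<lambda>l. [c1, c2, n1, n2, i, j] ! l"]) (simp add: expand delta3_def algebra_simps
        eq_neg_iff_add_eq_0)
next
  fix i l :: nat assume "i < 7" "l < 6"
  then show "(\<Sum>j<9. mt gamma3 i j * mt delta3 j l) = 0"
    by (auto simp: expand gamma3_def delta3_def algebra_simps)
qed

lemma exact3_epsilon: "exf 9 6 2 (mt delta3) (mt epsilon3)"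
proof (rule exfI)
  fix x :: "nat \<Rightarrow> 'k bipoly" assume H: "\<And>i. i < 9 \<Longrightarrow> (\<Sum>j<6. mt delta3 i j * x j) = 0"
  have E: "s * x 0 + t * x 1 = 0"
    "- ((v * v) * x 0) - (t * v) * x 2 + (t * t) * x 5 = 0"
    "(u * v) * x 0 - (t * v) * x 3 - (s * t) * x 5 = 0"
    "- ((u * u) * x 0) + (t * u) * x 3 + (s * t) * x 4 = 0"
    "- ((u * u) * x 1) - (s * u) * x 3 - (s * s) * x 4 = 0"
    "- (u * x 0) - v * x 1 + s * x 2 + t * x 3 = 0"
    "- (u * x 2) - v * x 3 + t * x 4 - s * x 5 = 0"
    "v * x 4 - u * x 5 = 0"
    using H[of 0] H[of 2] H[of 3] H[of 4] H[of 5] H[of 6] H[of 7] H[of 8]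
      by (simp_all add: expand delta3_def algebra_simps neg_eq_iff_add_eq_0)
  obtain e w where "x 0 = t * e" "x 1 = - (s * e)" "x 2 = - (v * e) + t * w" "x 3 = u * e - s * w"
    "x 4 = u * w" "x 5 = v * w"
      using solve3_epsilon[OF E] by blast
  then show "\<exists>y. \<forall>j<6. x j = (\<Sum>l<2. mt epsilon3 j l * y l)"
      by (intro exI[of _ "\<lambda>l. [e, w] ! l"]) (simp add: expand epsilon3_def algebra_simps eq_neg_iff_add_eq_0)
next
  fix i l :: nat assume "i < 9" "l < 2"
  then show "(\<Sum>j<6. mt delta3 i j * mt epsilon3 j l) = 0"
    by (auto simp: expand delta3_def epsilon3_def algebra_simps)
qed

lemma exact3_inj: "exf 6 2 0 (mt epsilon3) E"
proof (rule exfI)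
  fix x :: "nat \<Rightarrow> 'k bipoly" assume H: "\<And>i. i < 6 \<Longrightarrow> (\<Sum>j<2. mt epsilon3 i j * x j) = 0"
  have H0: "t * x 0 = 0" using H[of 0] by (simp add: expand epsilon3_def algebra_simps)
  have H2: "- (v * x 0) + t * x 1 = 0" using H[of 2] by (simp add: expand epsilon3_def algebra_simps)
  have "x 0 = 0" "x 1 = 0" using cancel_t[of "x 0"] cancel_t[of "x 1"] H0 H2 by auto
  then show "\<exists>y. \<forall>j<2. x j = (\<Sum>l<0. E j l * y l)" by (simp add: expand)
qed simp

lemma exact4_gamma: "exf 2 7 8 (mt rho4) (mt gamma4)"
proof (rule exfI)
  fix x :: "nat \<Rightarrow> 'k bipoly" assume H: "\<And>i. i < 2 \<Longrightarrow> (\<Sum>j<7. mt rho4 i j * x j) = 0"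
  have E: "s * x 0 + t * x 1 - u * x 4 - v * x 5 = 0"
    "s * x 1 + t * x 2 - u * x 6 = 0"
    using H[of 0] H[of 1] by (simp_all add: expand rho4_def algebra_simps neg_eq_iff_add_eq_0)
  obtain c z f0 f1 f2 f3 R P where "x 0 = u * f0 + v * f1 + (t * t) * P"
    "x 1 = u * f2 + (t * v) * R - (s * t) * P" "x 2 = u * f3 - (s * v) * R + (s * s) * P" "x 3 = z"
    "x 4 = v * c + s * f0 + t * f2" "x 5 = - (u * c) + s * f1 + (t * t) * R" "x 6 = s * f2 + t * f3"
      using solve4[OF E, of "x 3"] by blast
  then show "\<exists>y. \<forall>j<7. x j = (\<Sum>l<8. mt gamma4 j l * y l)"
      by (intro exI[of _ "\<lambda>l. [c, z, f0, f1, f2, f3, R, P] ! l"]) (simp add: expand gamma4_def algebra_simps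
        eq_neg_iff_add_eq_0)
next
  fix i l :: nat assume "i < 2" "l < 8"
  then show "(\<Sum>j<7. mt rho4 i j * mt gamma4 j l) = 0"
    by (auto simp: expand rho4_def gamma4_def algebra_simps)
qed

lemma exact4_delta: "exf 7 8 4 (mt gamma4) (mt delta4)"
proof (rule exfI)
  fix x :: "nat \<Rightarrow> 'k bipoly" assume H: "\<And>i. i < 7 \<Longrightarrow> (\<Sum>j<8. mt gamma4 i j * x j) = 0"
  have E: "u * x 2 + v * x 3 + (t * t) * x 7 = 0"
    "u * x 4 + (t * v) * x 6 - (s * t) * x 7 = 0"
    "u * x 5 - (s * v) * x 6 + (s * s) * x 7 = 0"
    "x 1 = 0"
    "v * x 0 + s * x 2 + t * x 4 = 0"
    "- (u * x 0) + s * x 3 + (t * t) * x 6 = 0"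
    "s * x 4 + t * x 5 = 0"
    using H[of 0] H[of 1] H[of 2] H[of 3] H[of 4] H[of 5] H[of 6]
      by (simp_all add: expand gamma4_def algebra_simps neg_eq_iff_add_eq_0)
  obtain c1 n k m' where "x 0 = s * c1 + (t * t) * n" "x 1 = 0" "x 2 = - (v * c1) + (t * t) * k"
    "x 3 = u * c1 + (t * t) * m'" "x 4 = - ((t * v) * n) - (s * t) * k" "x 5 = (s * v) * n + (s * s) * k"
    "x 6 = u * n - s * m'" "x 7 = - (u * k) - v * m'"
      using solve4_delta[OF E] by blast
  then show "\<exists>y. \<forall>j<8. x j = (\<Sum>l<4. mt delta4 j l * y l)"
      by (intro exI[of _ "\<lambda>l. [c1, n, k, m'] ! l"]) (simp add: expand delta4_def algebra_simps
        eq_neg_iff_add_eq_0)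
next
  fix i l :: nat assume "i < 7" "l < 4"
  then show "(\<Sum>j<8. mt gamma4 i j * mt delta4 j l) = 0"
    by (auto simp: expand gamma4_def delta4_def algebra_simps)
qed

lemma exact4_epsilon: "exf 8 4 1 (mt delta4) (mt epsilon4)"
proof (rule exfI)
  fix x :: "nat \<Rightarrow> 'k bipoly" assume H: "\<And>i. i < 8 \<Longrightarrow> (\<Sum>j<4. mt delta4 i j * x j) = 0"
  have E: "s * x 0 + (t * t) * x 1 = 0"
    "- (v * x 0) + (t * t) * x 2 = 0"
    "u * x 0 + (t * t) * x 3 = 0"
    "- ((t * v) * x 1) - (s * t) * x 2 = 0"
    "(s * v) * x 1 + (s * s) * x 2 = 0"
    "u * x 1 - s * x 3 = 0"
    "- (u * x 2) - v * x 3 = 0"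
    using H[of 0] H[of 2] H[of 3] H[of 4] H[of 5] H[of 6] H[of 7]
      by (simp_all add: expand delta4_def algebra_simps neg_eq_iff_add_eq_0)
  obtain e where "x 0 = (t * t) * e" "x 1 = - (s * e)" "x 2 = v * e" "x 3 = - (u * e)"
      using solve4_epsilon[OF E] by blast
  then show "\<exists>y. \<forall>j<4. x j = (\<Sum>l<1. mt epsilon4 j l * y l)"
      by (intro exI[of _ "\<lambda>l. [e] ! l"]) (simp add: expand epsilon4_def algebra_simps eq_neg_iff_add_eq_0)
next
  fix i l :: nat assume "i < 8" "l < 1"
  then show "(\<Sum>j<4. mt delta4 i j * mt epsilon4 j l) = 0"
    by (auto simp: expand delta4_def epsilon4_def algebra_simps)
qed

lemma exact4_inj: "exf 4 1 0 (mt epsilon4) E"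
proof (rule exfI)
  fix x :: "nat \<Rightarrow> 'k bipoly" assume H: "\<And>i. i < 4 \<Longrightarrow> (\<Sum>j<1. mt epsilon4 i j * x j) = 0"
  have H0: "(t * t) * x 0 = 0" using H[of 0] by (simp add: expand epsilon4_def algebra_simps)
  have H2: "v * x 0 = 0" using H[of 2] by (simp add: expand epsilon4_def algebra_simps)
  have "x 0 = 0" using cancel_t[of "x 0"] cancel_t[of "t * x 0"] H0 by (auto simp: mult.assoc)
  then show "\<exists>y. \<forall>j<1. x j = (\<Sum>l<0. E j l * y l)" by (simp add: expand)
qed simp

end

section \<open>From exactness of functions to resolutions\<close>

lemma mat_kernel_eq_image:
  fixes D :: "nat \<Rightarrow> nat \<Rightarrow> 'k::field bipoly"
  assumes "exf m n k D E"
  shows "mat_kernel (mat m n (\<lambda>(i, j). D i j)) = mat_image (mat n k (\<lambda>(i, j). E i j))"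
proof -
  have mv: "(mat m n (\<lambda>(i, j). D i j) *\<^sub>v x) $ i = (\<Sum>j<n. D i j * x $ j)"
    if "x \<in> carrier_vec n" "i < m" for x i m n and D :: "nat \<Rightarrow> nat \<Rightarrow> 'k bipoly"
    using that by (simp add: scalar_prod_def lessThan_atLeast0)
  have ker: "x \<in> mat_kernel (mat m n (\<lambda>(i, j). D i j)) \<longleftrightarrow>
      x \<in> carrier_vec n \<and> (\<forall>i<m. (\<Sum>j<n. D i j * x $ j) = 0)" for x
  proof -
    let ?A = "mat m n (\<lambda>(i, j). D i j)"
    have "?A *\<^sub>v x = 0\<^sub>v m \<longleftrightarrow> (\<forall>i<m. (\<Sum>j<n. D i j * x $ j) = 0)" if x: "x \<in> carrier_vec n"
    proof
      assume H: "?A *\<^sub>v x = 0\<^sub>v m"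
      show "\<forall>i<m. (\<Sum>j<n. D i j * x $ j) = 0"
      proof (intro allI impI)
        fix i assume i: "i < m"
        show "(\<Sum>j<n. D i j * x $ j) = 0"
          using arg_cong[OF H, of "\<lambda>w. w $ i"] unfolding mv[OF x i] index_zero_vec(1)[OF i] .
      qed
    next
      assume H: "\<forall>i<m. (\<Sum>j<n. D i j * x $ j) = 0"
      have "(?A *\<^sub>v x) $ i = 0\<^sub>v m $ i" if "i < m" for i
        unfolding mv[OF x that] index_zero_vec(1)[OF that] using H that by blast
      then show "?A *\<^sub>v x = 0\<^sub>v m" by (intro eq_vecI) (simp_all only: index_zero_vec dim_mult_mat_vec
        dim_row_mat)
    qed
    then show ?thesis unfolding mat_kernel_def dim_row_mat dim_col_mat by blast
  qed
  have im: "x \<in> mat_image (mat n k (\<lambda>(i, j). E i j)) \<longleftrightarrow>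
      x \<in> carrier_vec n \<and> (\<exists>y. \<forall>j<n. x $ j = (\<Sum>l<k. E j l * y l))" for x
  proof
    assume "x \<in> mat_image (mat n k (\<lambda>(i, j). E i j))"
    then obtain y where y: "y \<in> carrier_vec k" "x = mat n k (\<lambda>(i, j). E i j) *\<^sub>v y"
      unfolding mat_image_def dim_col_mat by blast
    have "\<forall>j<n. x $ j = (\<Sum>l<k. E j l * y $ l)" unfolding y(2) using mv[OF y(1), of _ n E] by blast
    moreover have "x \<in> carrier_vec n" unfolding y(2) by (rule carrier_vecI) simp
    ultimately show "x \<in> carrier_vec n \<and> (\<exists>y. \<forall>j<n. x $ j = (\<Sum>l<k. E j l * y l))" by blast
  next
    assume "x \<in> carrier_vec n \<and> (\<exists>y. \<forall>j<n. x $ j = (\<Sum>l<k. E j l * y l))"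
    then obtain y where x: "x \<in> carrier_vec n" and y: "\<forall>j<n. x $ j = (\<Sum>l<k. E j l * y l)" by blast
    have "x $ j = (mat n k (\<lambda>(i, j). E i j) *\<^sub>v vec k y) $ j" if "j < n" for j
      unfolding mv[OF vec_carrier that] using y that by (auto intro!: sum.cong)
    then have "x = mat n k (\<lambda>(i, j). E i j) *\<^sub>v vec k y"
      using x by (intro eq_vecI) (simp_all only: dim_mult_mat_vec dim_row_mat carrier_vecD)
    then show "x \<in> mat_image (mat n k (\<lambda>(i, j). E i j))"
      unfolding mat_image_def dim_col_mat by (metis image_eqI vec_carrier)
  qed
  have "(\<forall>i<m. (\<Sum>j<n. D i j * x $ j) = 0) \<longleftrightarrow> (\<exists>y. \<forall>j<n. x $ j = (\<Sum>l<k. E j l * y l))" for x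
    using assms[unfolded exf_def] by (rule spec)
  then show ?thesis unfolding set_eq_iff ker im by simp
qed

text \<open>A monomial of nonzero bidegree is divisible by some variable. So minimality of a graded
  matrix is a matter of the degrees of its entries.\<close>

lemma gp_in_irrelevant:
  assumes "p \<in> graded_piece m" "m \<noteq> (0, 0)"
  shows "p \<in> ideal_gen {var_s, var_t, var_u, var_v}"
proof -
  let ?I = "ideal_gen {var_s, var_t, var_u, var_v :: 'a bipoly}"
  have single: "Poly_Mapping.single e c \<in> ?I" if "bidegree e = m" for e and c :: 'a
  proof -
    obtain a b i j where e: "e = (a, b, i, j)" by (cases e)
    have mul: "x \<in> ?I \<Longrightarrow> y * x \<in> ?I" for x y by (rule bideal.span_scale)
    have base: "var_s \<in> ?I" "var_t \<in> ?I" "var_u \<in> ?I" "var_v \<in> ?I"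
      by (auto intro: bideal.span_base)
    have pow: "x ^ n \<in> ?I" if "x \<in> ?I" "n > 0" for x n
      using that mul by (cases n) (auto simp: mult.commute)
    from that assms(2) e consider "a > 0" | "b > 0" | "i > 0" | "j > 0" by fastforce
    then show ?thesis unfolding e single_monomial
    proof cases
      case 1
      show "cst c * var_s ^ a * var_t ^ b * var_u ^ i * var_v ^ j \<in> ?I"
        using mul[OF pow[OF base(1) 1], of "cst c * var_t ^ b * var_u ^ i * var_v ^ j"]
        by (simp add: mult_ac)
    next
      case 2
      show "cst c * var_s ^ a * var_t ^ b * var_u ^ i * var_v ^ j \<in> ?I"
        using mul[OF pow[OF base(2) 2], of "cst c * var_s ^ a * var_u ^ i * var_v ^ j"]
        by (simp add: mult_ac)
    next
      case 3
      show "cst c * var_s ^ a * var_t ^ b * var_u ^ i * var_v ^ j \<in> ?I"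
        using mul[OF pow[OF base(3) 3], of "cst c * var_s ^ a * var_t ^ b * var_v ^ j"]
        by (simp add: mult_ac)
    next
      case 4
      show "cst c * var_s ^ a * var_t ^ b * var_u ^ i * var_v ^ j \<in> ?I"
        using mul[OF pow[OF base(4) 4], of "cst c * var_s ^ a * var_t ^ b * var_u ^ i"]
        by (simp add: mult_ac)
    qed
  qed
  have "p = (\<Sum>e\<in>Poly_Mapping.keys p. Poly_Mapping.single e (Poly_Mapping.lookup p e))"
    by (rule bipoly_sum_single) auto
  also have "\<dots> \<in> ?I"
    using assms(1) by (intro bideal.span_sum single) (auto simp: graded_piece_def)
  finally show ?thesis .
qed

lemma ideal_gen_image:
  "ideal_gen (p ` {..<n::nat}) = {q :: 'k::field bipoly. \<exists>x. q = (\<Sum>i<n. p i * x i)}"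
proof (induction n)
  case 0
  then show ?case by (auto simp: bideal.span_empty)
next
  case (Suc n)
  have "p ` {..<Suc n} = insert (p n) (p ` {..<n})" by (auto simp: lessThan_Suc)
  then have "ideal_gen (p ` {..<Suc n}) = {x. \<exists>k. x - k * p n \<in> ideal_gen (p ` {..<n})}"
    using bideal.span_insert[of "p n" "p ` {..<n}"] by simp
  also have "\<dots> = {q. \<exists>x. q = (\<Sum>i<Suc n. p i * x i)}"
  proof (intro equalityI subsetI)
    fix q assume "q \<in> {x. \<exists>k. x - k * p n \<in> ideal_gen (p ` {..<n})}"
    then obtain k x where "q - k * p n = (\<Sum>i<n. p i * x i)" using Suc by auto
    then have "q = (\<Sum>i<n. p i * x i) + p n * k" by (simp add: diff_eq_eq mult.commute)
    also have "\<dots> = (\<Sum>i<Suc n. p i * (x(n := k)) i)" by simp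
    finally show "q \<in> {q. \<exists>x. q = (\<Sum>i<Suc n. p i * x i)}" by blast
  next
    fix q assume "q \<in> {q. \<exists>x. q = (\<Sum>i<Suc n. p i * x i)}"
    then obtain x where "q = (\<Sum>i<n. p i * x i) + p n * x n" by auto
    then have "q - x n * p n = (\<Sum>i<n. p i * x i)" by (simp add: mult.commute)
    then show "q \<in> {x. \<exists>k. x - k * p n \<in> ideal_gen (p ` {..<n})}" using Suc by blast
  qed
  finally show ?case .
qed

text \<open>Since consecutive modules have no bidegree in common, all entries of the maps between
  them have nonzero bidegree; this is the whole of minimality.\<close>

lemma resolution_from_exact:
  fixes p :: "nat \<Rightarrow> 'k::field bipoly"
  assumes p: "\<And>i. i < 4 \<Longrightarrow> p i \<in> graded_piece (2, 1)"
    and D2: "\<And>i j. i < 4 \<Longrightarrow> j < length L2 \<Longrightarrow> D2 i j \<in> graded_piece (L2 ! j - (2, 1))"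
    and D3: "\<And>i j. i < length L2 \<Longrightarrow> j < length L3 \<Longrightarrow> D3 i j \<in> graded_piece (L3 ! j - L2 ! i)"
    and D4: "\<And>i j. i < length L3 \<Longrightarrow> j < length L4 \<Longrightarrow> D4 i j \<in> graded_piece (L4 ! j - L3 ! i)"
    and ex: "exf 1 4 (length L2) (\<lambda>_. p) D2" "exf 4 (length L2) (length L3) D2 D3"
      "exf (length L2) (length L3) (length L4) D3 D4" "exf (length L3) (length L4) 0 D4 D4"
    and disj: "(2, 1) \<notin> set L2" "set L2 \<inter> set L3 = {}" "set L3 \<inter> set L4 = {}"
  shows "\<exists>d. minimal_free_resolution (ideal_gen (p ` {..<4})) (free_seq [replicate 4 (2, 1), L2, L3, L4]) d"
proof -
  define Fs where "Fs = [replicate 4 (2, 1), L2, L3, L4 :: free_module]"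
  define F where "F = free_seq Fs"
  \<comment> \<open>From the fifth step on \<open>D4\<close> is only a filler between modules of
    rank 0.\<close>
  define D where "D i = (if i = 1 then (\<lambda>_. p) else if i = 2 then D2 else if i = 3 then D3 else D4)" for
    i :: nat
  define m where "m i = (if i = 1 then 1 else length (F (i - 1)))" for i :: nat
  define d where "d i = mat (m i) (length (F i)) (\<lambda>(a, b). D i a b)" for i
  have F: "F 1 = replicate 4 (2, 1)" "F (Suc 0) = replicate 4 (2, 1)" "F 2 = L2" "F (Suc (Suc 0)) = L2"
    "F 3 = L3" "F 4 = L4"
    "\<And>i. i > 4 \<Longrightarrow> F i = []"
    by (simp_all add: F_def Fs_def free_seq_def numeral_eq_Suc)
  have cases_i: "i = 1 \<or> i = 2 \<or> i = 3 \<or> i = 4 \<or> i > 4" if "i \<ge> 1" for i :: nat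
    using that by auto
  have exf0: "exf a 0 0 A B" for a and A B :: "nat \<Rightarrow> nat \<Rightarrow> 'k bipoly" by (simp add: exf_def)
  have exf: "exf (m i) (length (F i)) (length (F (i + 1))) (D i) (D (i + 1))" if "i \<ge> 1" for i
    using cases_i[OF that] ex exf0 F by (elim disjE) (simp_all add: m_def D_def)
  have kernel: "mat_kernel (d i) = mat_image (d (i + 1))" if "i \<ge> 1" for i
    using mat_kernel_eq_image[OF exf[OF that]] that by (simp add: d_def m_def)
  have hom1: "d 1 \<in> graded_hom (F 1) [(0, 0)]"
    unfolding graded_hom_def d_def using p by (auto simp: m_def F D_def zero_prod_def[symmetric])
  have entry: "D (i + 1) r c \<in> graded_piece (F (i + 1) ! c - F i ! r) \<and> F (i + 1) ! c \<noteq> F i ! r"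
    if "i \<ge> 1" "r < length (F i)" "c < length (F (i + 1))" for i r c
    using cases_i[OF that(1)]
  proof (elim disjE)
    assume "i = 1" then show ?thesis using that D2 disj by (auto simp: F D_def) (metis nth_mem)
  next
    assume "i = 2" then show ?thesis using that D3 disj by (auto simp: F D_def) (metis disjoint_iff nth_mem)
  next
    assume "i = 3" then show ?thesis using that D4 disj by (auto simp: F D_def) (metis disjoint_iff nth_mem)
  qed (use that F in auto)
  have hom: "d (i + 1) \<in> graded_hom (F (i + 1)) (F i)" if "i \<ge> 1" for i
    unfolding graded_hom_def d_def using entry[OF that] that by (auto simp: m_def)
  have minimal: "d (i + 1) $$ (r, c) \<in> ideal_gen {var_s, var_t, var_u, var_v}"
    if "i \<ge> 1" "r < length (F i)" "c < length (F (i + 1))" for i r c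
  proof -
    have "F (i + 1) ! c - F i ! r \<noteq> (0, 0)" using entry[OF that] by (simp add: zero_prod_def[symmetric])
    then have "D (i + 1) r c \<in> ideal_gen {var_s, var_t, var_u, var_v}"
      using entry[OF that] gp_in_irrelevant by blast
    then show ?thesis using that by (simp add: d_def m_def)
  qed
  have image: "(\<lambda>x. x $ 0) ` mat_image (d 1) = ideal_gen (p ` {..<4})"
  proof -
    have d1: "(d 1 *\<^sub>v x) $ 0 = (\<Sum>i<4. p i * x $ i)" if "x \<in> carrier_vec 4" for x
      using that by (simp add: d_def m_def F D_def scalar_prod_def lessThan_atLeast0)
    have "dim_col (d 1) = 4" by (simp add: d_def F)
    then have "(\<lambda>x. x $ 0) ` mat_image (d 1) = {q. \<exists>x\<in>carrier_vec 4. q = (\<Sum>i<4. p i * x $ i)}"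
      using d1 by (auto simp: mat_image_def image_iff)
    also have "\<dots> = {q. \<exists>x. q = (\<Sum>i<4. p i * x i)}"
    proof (intro equalityI subsetI)
      fix q assume "q \<in> {q. \<exists>x. q = (\<Sum>i<4. p i * x i)}"
      then obtain x where "q = (\<Sum>i<4. p i * x i)" by blast
      also have "\<dots> = (\<Sum>i<4. p i * vec 4 x $ i)" by (intro sum.cong) auto
      finally show "q \<in> {q. \<exists>x\<in>carrier_vec 4. q = (\<Sum>i<4. p i * x $ i)}" using vec_carrier by blast
    qed blast
    finally show ?thesis by (simp add: ideal_gen_image)
  qed
  have "minimal_free_resolution (ideal_gen (p ` {..<4})) F d"
    unfolding minimal_free_resolution_def using hom1 hom kernel image minimal by blast
  then show ?thesis unfolding F_def Fs_def by blast
qed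

section \<open>Removing a redundant pair of generators\<close>

text \<open>Renumbering: \<open>f\<close> enumerates the surviving indices \<open>J\<close>, and
  exactness may be tested over \<open>J\<close>.\<close>

lemma exf_reindex_middle:
  fixes D E :: "nat \<Rightarrow> nat \<Rightarrow> 'a::comm_ring_1"
  assumes b: "bij_betw f {..<n'} J"
    and ex: "\<And>x. (\<forall>i<m. (\<Sum>j\<in>J. D i j * x j) = 0) \<longleftrightarrow> (\<exists>y. \<forall>j\<in>J. x j = (\<Sum>l<k. E j l * y l))"
  shows "exf m n' k (\<lambda>i j. D i (f j)) (\<lambda>j l. E (f j) l)"
  unfolding exf_def
proof
  fix x :: "nat \<Rightarrow> 'a"
  define g where "g = the_inv_into {..<n'} f"
  have gf: "g (f j) = j" if "j < n'" for j
    using b that unfolding g_def by (simp add: bij_betw_def the_inv_into_f_f)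
  have sum: "(\<Sum>j\<in>J. D i j * x (g j)) = (\<Sum>j<n'. D i (f j) * x j)" for i
    unfolding sum.reindex_bij_betw[OF b, symmetric] by (intro sum.cong) (auto simp: gf)
  have J: "(\<forall>j\<in>J. P j) \<longleftrightarrow> (\<forall>j<n'. P (f j))" for P
    unfolding bij_betw_imp_surj_on[OF b, symmetric] by blast
  show "(\<forall>i<m. (\<Sum>j<n'. D i (f j) * x j) = 0) \<longleftrightarrow> (\<exists>y. \<forall>j<n'. x j = (\<Sum>l<k. E (f j) l * y l))"
    using ex[of "\<lambda>j. x (g j)"] unfolding sum J by (simp add: gf)
qed

lemma prune_sum:
  assumes "r1 < n" "r2 < n" "r1 \<noteq> r2" "w r1 = 0" "w r2 = (0 :: 'a::comm_ring_1)"
  shows "(\<Sum>j\<in>{..<n::nat} - {r1, r2}. f j * w j) = (\<Sum>j<n. f j * w j)"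
  by (rule sum.mono_neutral_left) (use assms in auto)

text \<open>
  The kernel of \<open>Th\<close> is the image of \<open>D\<close> plus a free part on \<open>y1, y2\<close>, which have unit entries in the
  rows \<open>r1, r2\<close>: these rows can be cleared from \<open>D\<close> and dropped.
\<close>

lemma prune:
  fixes p :: "nat \<Rightarrow> 'a::comm_ring_1"
  assumes A: "\<And>A. (\<Sum>i<m. p i * A i) = 0 \<longleftrightarrow> (\<exists>w. \<forall>i<m. A i = (\<Sum>j<n. Th i j * w j))"
    and B: "\<And>w. (\<forall>i<m. (\<Sum>j<n. Th i j * w j) = 0) \<longleftrightarrow>
       (\<exists>y z1 z2. \<forall>j<n. w j = (\<Sum>l<k. D j l * y l) + z1 * y1 j + z2 * y2 j)"
    and C: "\<And>y z1 z2. (\<forall>j<n. (\<Sum>l<k. D j l * y l) + z1 * y1 j + z2 * y2 j = 0) \<Longrightarrow> z1 = 0 \<and> z2 = 0"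
    and ex: "exf n k q D E"
    and r: "r1 < n" "r2 < n" "r1 \<noteq> r2" "y1 r1 = 1" "y1 r2 = 0" "y2 r1 = 0" "y2 r2 = 1"
    and b: "bij_betw f {..<n'} ({..<n} - {r1, r2})"
  defines "D' \<equiv> \<lambda>j l. D j l - y1 j * D r1 l - y2 j * D r2 l"
  shows "exf 1 m n' (\<lambda>_. p) (\<lambda>i j. Th i (f j))"
    and "exf m n' k (\<lambda>i j. Th i (f j)) (\<lambda>j l. D' (f j) l)"
    and "exf n' k q (\<lambda>j l. D' (f j) l) E"
proof -
  let ?J = "{..<n} - {r1, r2}"
  have J: "(\<forall>j\<in>?J. P j) \<longleftrightarrow> (\<forall>j<n'. P (f j))" for P
    unfolding bij_betw_imp_surj_on[OF b, symmetric] by blast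
  have D': "(\<Sum>l<k. D' j l * y l) = (\<Sum>l<k. D j l * y l) - y1 j * (\<Sum>l<k. D r1 l * y l) - y2 j * (\<Sum>l<k. D r2 l *
    y l)" for j y
    unfolding D'_def by (simp add: algebra_simps sum_subtractf sum.distrib sum_distrib_left)
  \<comment> \<open>\<open>y1\<close> and \<open>y2\<close> lie in the kernel of \<open>Th\<close>:
    choose the part from \<open>D\<close> to be zero in \<open>B\<close>.\<close>
  have Thy: "(\<Sum>j<n. Th i j * y1 j) = 0" "(\<Sum>j<n. Th i j * y2 j) = 0" if "i < m" for i
  proof -
    have "\<exists>y z1 z2. \<forall>j<n. y1 j = (\<Sum>l<k. D j l * y l) + z1 * y1 j + z2 * y2 j"
      by (intro exI[of _ "\<lambda>_. 0"] exI[of _ 1] exI[of _ 0]) simp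
    then show "(\<Sum>j<n. Th i j * y1 j) = 0" using B[of y1] that by blast
    have "\<exists>y z1 z2. \<forall>j<n. y2 j = (\<Sum>l<k. D j l * y l) + z1 * y1 j + z2 * y2 j"
      by (rule exI[of _ "\<lambda>_. 0"], rule exI[of _ 0], rule exI[of _ 1]) simp
    then show "(\<Sum>j<n. Th i j * y2 j) = 0" using B[of y2] that by blast
  qed
  \<comment> \<open>Subtracting multiples of \<open>y1, y2\<close> clears the entries
    \<open>r1, r2\<close> of \<open>w\<close> without changing its image, so the columns
    \<open>r1, r2\<close> of \<open>Th\<close> are redundant.\<close>
  have red: "(\<Sum>j<n. Th i j * w j) = (\<Sum>j\<in>?J. Th i j * (w j - w r1 * y1 j - w r2 * y2 j))" if "i < m" for i w
  proof -
    have "(\<Sum>j<n. Th i j * (w j - w r1 * y1 j - w r2 * y2 j))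
       = (\<Sum>j<n. Th i j * w j) - w r1 * (\<Sum>j<n. Th i j * y1 j) - w r2 * (\<Sum>j<n. Th i j * y2 j)"
      by (simp add: algebra_simps sum_subtractf sum.distrib sum_distrib_left)
    then show ?thesis
      by (subst prune_sum[OF r(1-3)]) (simp_all add: r Thy[OF that])
  qed
  show "exf 1 m n' (\<lambda>_. p) (\<lambda>i j. Th i (f j))"
    unfolding exf_def
  proof
    fix x :: "nat \<Rightarrow> 'a"
    have "(\<exists>w. \<forall>i<m. x i = (\<Sum>j<n. Th i j * w j)) \<longleftrightarrow> (\<exists>y. \<forall>i<m. x i = (\<Sum>l<n'. Th i (f l) * y l))"
    proof
      assume "\<exists>w. \<forall>i<m. x i = (\<Sum>j<n. Th i j * w j)"
      then obtain w where "\<forall>i<m. x i = (\<Sum>j<n. Th i j * w j)" by blast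
      then have "\<forall>i<m. x i = (\<Sum>j\<in>?J. Th i j * (w j - w r1 * y1 j - w r2 * y2 j))" using red by simp
      then have "\<forall>i<m. x i = (\<Sum>l<n'. Th i (f l) * (w (f l) - w r1 * y1 (f l) - w r2 * y2 (f l)))"
        unfolding sum.reindex_bij_betw[OF b, symmetric] .
      then show "\<exists>y. \<forall>i<m. x i = (\<Sum>l<n'. Th i (f l) * y l)"
        by (intro exI[of _ "\<lambda>l. w (f l) - w r1 * y1 (f l) - w r2 * y2 (f l)"])
    next
      assume "\<exists>y. \<forall>i<m. x i = (\<Sum>l<n'. Th i (f l) * y l)"
      then obtain y where y: "\<forall>i<m. x i = (\<Sum>l<n'. Th i (f l) * y l)" by blast
      define g where "g = the_inv_into {..<n'} f"
      have gf: "g (f j) = j" if "j < n'" for j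
        using b that unfolding g_def by (simp add: bij_betw_def the_inv_into_f_f)
      define w where "w j = (if j \<in> ?J then y (g j) else 0)" for j
      have fJ: "f l \<in> ?J" if "l < n'" for l using b that by (auto simp: bij_betw_def)
      have "(\<Sum>j<n. Th i j * w j) = (\<Sum>l<n'. Th i (f l) * y l)" for i
      proof -
        have "(\<Sum>j<n. Th i j * w j) = (\<Sum>j\<in>?J. Th i j * w j)"
          by (rule prune_sum[OF r(1-3), symmetric]) (simp_all add: w_def)
        also have "\<dots> = (\<Sum>l<n'. Th i (f l) * w (f l))"
          unfolding sum.reindex_bij_betw[OF b, symmetric] ..
        also have "\<dots> = (\<Sum>l<n'. Th i (f l) * y l)"
          using fJ by (intro sum.cong) (auto simp: w_def gf)
        finally show ?thesis .
      qed
      then show "\<exists>w. \<forall>i<m. x i = (\<Sum>j<n. Th i j * w j)" using y by (intro exI[of _ w]) simp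
    qed
    then show "(\<forall>i<1::nat. (\<Sum>j<m. p j * x j) = 0) \<longleftrightarrow> (\<exists>y. \<forall>j<m. x j = (\<Sum>l<n'. Th j (f l) * y l))"
      using A[of x] by (simp add: less_one)
  qed
  show "exf m n' k (\<lambda>i j. Th i (f j)) (\<lambda>j l. D' (f j) l)"
  proof (rule exf_reindex_middle[OF b])
    fix x :: "nat \<Rightarrow> 'a"
    define w where "w j = (if j \<in> ?J then x j else 0)" for j
    have w0: "w r1 = 0" "w r2 = 0" by (simp_all add: w_def)
    have eq: "(\<Sum>j\<in>?J. Th i j * x j) = (\<Sum>j<n. Th i j * w j)" for i
      unfolding prune_sum[OF r(1-3) w0, symmetric] by (intro sum.cong) (auto simp: w_def)
    have "(\<exists>y z1 z2. \<forall>j<n. w j = (\<Sum>l<k. D j l * y l) + z1 * y1 j + z2 * y2 j)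
       \<longleftrightarrow> (\<exists>y. \<forall>j\<in>?J. x j = (\<Sum>l<k. D' j l * y l))"
    proof
      assume "\<exists>y z1 z2. \<forall>j<n. w j = (\<Sum>l<k. D j l * y l) + z1 * y1 j + z2 * y2 j"
      then obtain y z1 z2 where w: "\<forall>j<n. w j = (\<Sum>l<k. D j l * y l) + z1 * y1 j + z2 * y2 j" by blast
      \<comment> \<open>The unit entries in the rows \<open>r1, r2\<close> determine
        \<open>z1\<close> and \<open>z2\<close>; inserting them turns \<open>D\<close> into
        \<open>D'\<close>.\<close>
      have "0 = (\<Sum>l<k. D r1 l * y l) + z1" "0 = (\<Sum>l<k. D r2 l * y l) + z2"
        using w[rule_format, OF r(1)] w[rule_format, OF r(2)] by (simp_all add: w0 r)
      then have z: "z1 = - (\<Sum>l<k. D r1 l * y l)" "z2 = - (\<Sum>l<k. D r2 l * y l)"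
        by (simp_all add: eq_neg_iff_add_eq_0 add.commute)
      have "x j = (\<Sum>l<k. D' j l * y l)" if "j \<in> ?J" for j
      proof -
        have "x j = w j" using that by (simp add: w_def)
        also have "\<dots> = (\<Sum>l<k. D' j l * y l)" using w that unfolding D' z by (simp add: mult.commute)
        finally show ?thesis .
      qed
      then show "\<exists>y. \<forall>j\<in>?J. x j = (\<Sum>l<k. D' j l * y l)" by blast
    next
      assume "\<exists>y. \<forall>j\<in>?J. x j = (\<Sum>l<k. D' j l * y l)"
      then obtain y where y: "\<forall>j\<in>?J. x j = (\<Sum>l<k. D' j l * y l)" by blast
      have "w j = (\<Sum>l<k. D j l * y l) + - (\<Sum>l<k. D r1 l * y l) * y1 j + - (\<Sum>l<k. D r2 l * y l) * y2 j"
        if "j < n" for j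
      proof (cases "j \<in> ?J")
        case True
        then have "w j = (\<Sum>l<k. D' j l * y l)" using y by (simp add: w_def)
        then show ?thesis unfolding D' by (simp add: mult.commute)
      next
        case False
        then have "j = r1 \<or> j = r2" using that by auto
        then show ?thesis by (auto simp: w_def r)
      qed
      then show "\<exists>y z1 z2. \<forall>j<n. w j = (\<Sum>l<k. D j l * y l) + z1 * y1 j + z2 * y2 j" by blast
    qed
    then show "(\<forall>i<m. (\<Sum>j\<in>?J. Th i j * x j) = 0) \<longleftrightarrow> (\<exists>y. \<forall>j\<in>?J. x j = (\<Sum>l<k. D' j l * y l))"
      unfolding eq using B[of w] by blast
  qed
  show "exf n' k q (\<lambda>j l. D' (f j) l) E"
    unfolding exf_def
  proof
    fix y :: "nat \<Rightarrow> 'a"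
    have "(\<forall>j\<in>?J. (\<Sum>l<k. D' j l * y l) = 0) \<longleftrightarrow> (\<forall>j<n. (\<Sum>l<k. D j l * y l) = 0)"
    proof
      assume *: "\<forall>j\<in>?J. (\<Sum>l<k. D' j l * y l) = 0"
      \<comment> \<open>In the rows \<open>r1, r2\<close> this holds identically, in the other rows
        it is the row of \<open>D'\<close>. By \<open>C\<close> the two correction terms are then
        zero.\<close>
      have **: "(\<Sum>l<k. D j l * y l) + - (\<Sum>l<k. D r1 l * y l) * y1 j + - (\<Sum>l<k. D r2 l * y l) * y2 j = 0"
        if "j < n" for j
      proof (cases "j \<in> ?J")
        case True
        then have "(\<Sum>l<k. D' j l * y l) = 0" using * by blast
        then show ?thesis unfolding D' by (simp add: mult.commute)
      next
        case False
        then have "j = r1 \<or> j = r2" using that by auto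
        then show ?thesis by (auto simp: r)
      qed
      then have "- (\<Sum>l<k. D r1 l * y l) = 0" "- (\<Sum>l<k. D r2 l * y l) = 0" using C by blast+
      then show "\<forall>j<n. (\<Sum>l<k. D j l * y l) = 0" using ** by simp
    next
      assume "\<forall>j<n. (\<Sum>l<k. D j l * y l) = 0"
      then show "\<forall>j\<in>?J. (\<Sum>l<k. D' j l * y l) = 0" using r by (simp add: D')
    qed
    then show "(\<forall>j<n'. (\<Sum>l<k. D' (f j) l * y l) = 0) \<longleftrightarrow> (\<exists>z. \<forall>l<k. y l = (\<Sum>i<q. E l i * z i))"
      unfolding J[of "\<lambda>j. (\<Sum>l<k. D' j l * y l) = 0", symmetric] using ex[unfolded exf_def] by blast
  qed
qed

lemma sum_linear:
  "(\<Sum>j\<in>A. g j * (a * x j + b * y j)) = a * (\<Sum>j\<in>A. g j * x j) + b * (\<Sum>j\<in>A. g j * (y j :: 'a::comm_ring_1))"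
  by (simp only: distrib_left sum.distrib sum_distrib_left mult_ac)

text \<open>The degrees of the unknowns \<open>a0, a1, a2, a3, y0, y1, y2\<close>.\<close>

definition hdeg :: "nat \<Rightarrow> int \<times> int" where
  "hdeg k = (if k < 4 then (3, 1) else (2, 2))"

text \<open>The entries of \<open>gam\<close> are homogeneous, so taking components of the
  complementary bidegrees does not disturb the equation.\<close>

lemma homogeneous_lift:
  fixes h :: "nat \<Rightarrow> 'k::field bipoly"
  assumes gam: "\<And>k j. k < 7 \<Longrightarrow> j < n \<Longrightarrow> gam k j \<in> graded_piece (L ! j - hdeg k)"
    and h: "\<And>k. k < 7 \<Longrightarrow> h k \<in> graded_piece (e - hdeg k)"
    and x: "\<forall>k<7. h k = (\<Sum>j<n. gam k j * x j)"
  shows "\<exists>x. (\<forall>k<7. h k = (\<Sum>j<n. gam k j * x j)) \<and> (\<forall>j<n. x j \<in> graded_piece (e - L ! j))"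
proof (intro exI[of _ "\<lambda>j. hc (e - L ! j) (x j)"] conjI allI impI)
  fix k :: nat assume k: "k < 7"
  have "h k = hc (e - hdeg k) (\<Sum>j<n. gam k j * x j)" using hc_gp[OF h[OF k]] x k by simp
  also have "\<dots> = (\<Sum>j<n. gam k j * hc (e - L ! j) (x j))"
    unfolding hc_sum by (intro sum.cong refl) (simp add: hc_mult[OF gam[OF k]])
  finally show "h k = (\<Sum>j<n. gam k j * hc (e - L ! j) (x j))" .
qed simp

text \<open>
  In degree \<open>(3, 2)\<close> only the generators of that degree contribute to the last three entries, where \<open>h1\<close>
  and \<open>h2\<close> are independent; so lifting \<open>h1, h2\<close> along \<open>gam\<close> produces the unit entries to be pruned.
\<close>

lemma assemble:
  fixes p :: "nat \<Rightarrow> 'k::field bipoly"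
  assumes p: "\<And>i. i < 4 \<Longrightarrow> p i \<in> graded_piece (2, 1)"
    and eta: "\<And>i k. i < 4 \<Longrightarrow> k < 7 \<Longrightarrow> eta i k \<in> graded_piece (hdeg k - (2, 1))"
    and gam: "\<And>k j. k < 7 \<Longrightarrow> j < length L2 \<Longrightarrow> gam k j \<in> graded_piece (L2 ! j - hdeg k)"
    and D3: "\<And>i j. i < length L2 \<Longrightarrow> j < length L3 \<Longrightarrow> D3 i j \<in> graded_piece (L3 ! j - L2 ! i)"
    and D4: "\<And>i j. i < length L3 \<Longrightarrow> j < length L4 \<Longrightarrow> D4 i j \<in> graded_piece (L4 ! j - L3 ! i)"
    and syz: "\<And>A. (\<Sum>i<4. p i * A i) = 0 \<longleftrightarrow>
      (\<exists>x. (\<forall>i<2. (\<Sum>k<7. rho i k * x k) = 0) \<and> (\<forall>i<4. A i = (\<Sum>k<7. eta i k * x k)))"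
    and ex: "exf 2 7 (length L2) rho gam" "exf 7 (length L2) (length L3) gam D3"
      "exf (length L2) (length L3) (length L4) D3 D4" "exf (length L3) (length L4) 0 D4 D4"
    and h: "\<And>k. k < 7 \<Longrightarrow> h1 k \<in> graded_piece ((3, 2) - hdeg k)" "\<And>k. k < 7 \<Longrightarrow> h2 k \<in> graded_piece ((3,
      2) - hdeg k)"
      "\<forall>i<2. (\<Sum>k<7. rho i k * h1 k) = 0" "\<forall>i<2. (\<Sum>k<7. rho i k * h2 k) = 0"
      "\<forall>i<4. (\<Sum>k<7. eta i k * h1 k) = 0" "\<forall>i<4. (\<Sum>k<7. eta i k * h2 k) = 0"
    and ker: "\<And>x. (\<forall>i<2. (\<Sum>k<7. rho i k * x k) = 0) \<Longrightarrow> (\<forall>i<4. (\<Sum>k<7. eta i k * x k) = 0) \<Longrightarrow>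
      \<exists>z1 z2. \<forall>k<7. x k = z1 * h1 k + z2 * h2 k"
    and indep: "\<And>z1 z2. (\<forall>k. 4 \<le> k \<and> k < 7 \<longrightarrow> z1 * h1 k + z2 * h2 k = 0) \<Longrightarrow> z1 = 0 \<and> z2 = 0"
    and col: "\<And>j. j < length L2 \<Longrightarrow> L2 ! j \<noteq> (3, 2) \<Longrightarrow> (\<forall>k. 4 \<le> k \<and> k < 7 \<longrightarrow> gam k j = 0) \<or>
        fst ((3, 2) - L2 ! j) < 0 \<or> snd ((3, 2) - L2 ! j) < 0"
    and disj: "(2, 1) \<notin> set L2" "set L2 \<inter> set L3 = {}" "set L3 \<inter> set L4 = {}"
  shows "\<exists>r1 r2 d. r1 < length L2 \<and> r2 < length L2 \<and> r1 \<noteq> r2 \<and> L2 ! r1 = (3, 2) \<and> L2 ! r2 = (3, 2) \<and>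
    minimal_free_resolution (ideal_gen (p ` {..<4}))
      (free_seq [replicate 4 (2, 1), map ((!) L2) (filter (\<lambda>j. j \<noteq> r1 \<and> j \<noteq> r2) [0..<length L2]), L3, L4]) d"
proof -
  let ?n = "length L2"
  let ?k = "length L3"
  \<comment> \<open>The syzygy matrix before pruning: parametrise the solutions of the system by
    \<open>gam\<close>, then apply \<open>eta\<close>.\<close>
  define Th where "Th i j = (\<Sum>k<7. eta i k * gam k j)" for i j
  have Th: "(\<Sum>j<?n. Th i j * w j) = (\<Sum>k<7. eta i k * (\<Sum>j<?n. gam k j * w j))" for i w
    unfolding Th_def sum_distrib_left sum_distrib_right by (subst sum.swap) (simp add: mult.assoc)
  note exg = ex(1)[unfolded exf_def, rule_format]
  obtain x1 where x1: "\<forall>k<7. h1 k = (\<Sum>j<?n. gam k j * x1 j)" "\<forall>j<?n. x1 j \<in> graded_piece ((3, 2) - L2 ! j)"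
    using exg[of h1] h(3) homogeneous_lift[OF gam h(1)] by blast
  obtain x2 where x2: "\<forall>k<7. h2 k = (\<Sum>j<?n. gam k j * x2 j)" "\<forall>j<?n. x2 j \<in> graded_piece ((3, 2) - L2 ! j)"
    using exg[of h2] h(4) homogeneous_lift[OF gam h(2)] by blast
  \<comment> \<open>If the combination vanished at all generators of degree (3,2), then by
    \<open>col\<close> nothing would contribute to the last three entries, and \<open>h1, h2\<close>
    would be dependent there.\<close>
  have unit: "\<exists>j<?n. L2 ! j = (3, 2) \<and> cst a * x1 j + cst b * x2 j \<noteq> 0" if ab: "a \<noteq> 0 \<or> b \<noteq> 0" for a b
  proof (rule ccontr)
    assume neg: "\<not> ?thesis"
    have "cst a * h1 k + cst b * h2 k = 0" if k: "4 \<le> k" "k < 7" for k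
    proof -
      have "cst a * h1 k + cst b * h2 k = (\<Sum>j<?n. gam k j * (cst a * x1 j + cst b * x2 j))"
        unfolding sum_linear using x1(1) x2(1) k by simp
      also have "\<dots> = 0"
      proof (intro sum.neutral ballI)
        fix j assume "j \<in> {..<?n}"
        then have j: "j < ?n" by simp
        have g: "cst a * x1 j + cst b * x2 j \<in> graded_piece ((3, 2) - L2 ! j)"
          using x1(2) x2(2) j by (intro gp_add gp_cst_mult) auto
        show "gam k j * (cst a * x1 j + cst b * x2 j) = 0"
        proof (cases "L2 ! j = (3, 2)")
          case True then show ?thesis using neg j by auto
        next
          case False
          then show ?thesis using col[OF j False] gp_neg[OF _ g] k by auto
        qed
      qed
      finally show ?thesis .
    qed
    then have "cst a = 0 \<and> cst b = (0 :: 'k bipoly)" by (intro indep) blast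
    then show False using ab by simp
  qed
  have cst1: "\<exists>c. x1 j = cst c" and cst2: "\<exists>c. x2 j = cst c" if "j < ?n" "L2 ! j = (3, 2)" for j
  proof -
    have "x1 j \<in> graded_piece (0, 0)" "x2 j \<in> graded_piece (0, 0)"
      using x1(2) x2(2) that by (metis diff_self zero_prod_def)+
    then show "\<exists>c. x1 j = cst c" "\<exists>c. x2 j = cst c" using gp00 by blast+
  qed
  obtain r1 where r1: "r1 < ?n" "L2 ! r1 = (3, 2)" "x1 r1 \<noteq> 0" using unit[of 1 0] by auto
  obtain a b where ab: "x1 r1 = cst a" "x2 r1 = cst b" using cst1 cst2 r1 by blast
  have a: "a \<noteq> 0" using ab r1 by auto
  \<comment> \<open>This combination vanishes at \<open>r1\<close>, so its unit entry sits at a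
    different generator and the 2 x 2 matrix of constants is invertible.\<close>
  obtain r2 where r2: "r2 < ?n" "L2 ! r2 = (3, 2)" "cst (- b) * x1 r2 + cst a * x2 r2 \<noteq> 0"
    using unit[of "- b" a] a by blast
  obtain c d where cd: "x1 r2 = cst c" "x2 r2 = cst d" using cst1 cst2 r2 by blast
  define e where "e = inverse (a * d - b * c)"
  have "cst (a * d - b * c) \<noteq> (0 :: 'k bipoly)" using r2(3) unfolding cd by (simp add: cst_hom algebra_simps)
  then have det: "e * (a * d - b * c) = 1" by (simp add: e_def)
  have ne: "r1 \<noteq> r2" using r2(3) ab cd by (auto simp: cst_hom mult_ac)
  \<comment> \<open>The inverse of the matrix with rows \<open>(a, b)\<close> and
    \<open>(c, d)\<close> makes the entries at \<open>r1, r2\<close> those of the identity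
    matrix.\<close>
  define y1 where "y1 j = cst e * (cst d * x1 j - cst c * x2 j)" for j
  define y2 where "y2 j = cst e * (cst a * x2 j - cst b * x1 j)" for j
  have ce: "cst e * (cst a * cst d - cst b * cst c) = (1 :: 'k bipoly)"
    by (metis cst_1 cst_diff cst_mult det)
  have delta: "y1 r1 = 1" "y1 r2 = 0" "y2 r1 = 0" "y2 r2 = 1"
    using ce by (simp_all add: y1_def y2_def ab cd algebra_simps)
  have x_y: "z1 * x1 j + z2 * x2 j = (z1 * cst a + z2 * cst b) * y1 j + (z1 * cst c + z2 * cst d) * y2 j" for
    z1 z2 j
  proof -
    have "(z1 * cst a + z2 * cst b) * y1 j + (z1 * cst c + z2 * cst d) * y2 j
      = cst e * (cst a * cst d - cst b * cst c) * (z1 * x1 j + z2 * x2 j)"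
      unfolding y1_def y2_def by (simp add: algebra_simps)
    then show ?thesis by (simp add: ce)
  qed
  have y_x: "z1 * y1 j + z2 * y2 j = (cst e * (z1 * cst d - z2 * cst b)) * x1 j + (cst e * (z2 * cst a - z1 *
    cst c)) * x2 j" for z1 z2 j
    unfolding y1_def y2_def by (simp add: algebra_simps)
  have gx: "(\<Sum>j<?n. gam k j * ((\<Sum>l<?k. D3 j l * y l) + z1 * y1 j + z2 * y2 j))
      = (\<Sum>j<?n. gam k j * (\<Sum>l<?k. D3 j l * y l)) + (cst e * (z1 * cst d - z2 * cst b)) * h1 k
        + (cst e * (z2 * cst a - z1 * cst c)) * h2 k" if "k < 7" for k y z1 z2
  proof -
    have "(\<Sum>j<?n. gam k j * ((\<Sum>l<?k. D3 j l * y l) + z1 * y1 j + z2 * y2 j))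
      = (\<Sum>j<?n. gam k j * (\<Sum>l<?k. D3 j l * y l)) + (\<Sum>j<?n. gam k j * (z1 * y1 j + z2 * y2 j))"
      by (simp add: distrib_left sum.distrib add.assoc)
    also have "(\<Sum>j<?n. gam k j * (z1 * y1 j + z2 * y2 j)) =
      (cst e * (z1 * cst d - z2 * cst b)) * h1 k + (cst e * (z2 * cst a - z1 * cst c)) * h2 k"
      unfolding y_x sum_linear x1(1)[rule_format, OF that] x2(1)[rule_format, OF that] ..
    finally show ?thesis by (simp add: add.assoc)
  qed
  have gD: "(\<Sum>j<?n. gam k j * (\<Sum>l<?k. D3 j l * y l)) = 0" if "k < 7" for k y
    using ex(2)[unfolded exf_def, rule_format, of "\<lambda>j. \<Sum>l<?k. D3 j l * y l"] that by blast
  have A: "(\<Sum>i<4. p i * A i) = 0 \<longleftrightarrow> (\<exists>w. \<forall>i<4. A i = (\<Sum>j<?n. Th i j * w j))" for A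
  proof
    assume "(\<Sum>i<4. p i * A i) = 0"
    then obtain x where x: "\<forall>i<2. (\<Sum>k<7. rho i k * x k) = 0" "\<forall>i<4. A i = (\<Sum>k<7. eta i k * x k)"
      using syz by blast
    then obtain w where "\<forall>k<7. x k = (\<Sum>j<?n. gam k j * w j)" using exg by blast
    then have "\<forall>i<4. A i = (\<Sum>j<?n. Th i j * w j)" using x(2) by (simp add: Th)
    then show "\<exists>w. \<forall>i<4. A i = (\<Sum>j<?n. Th i j * w j)" by blast
  next
    assume "\<exists>w. \<forall>i<4. A i = (\<Sum>j<?n. Th i j * w j)"
    then obtain w where w: "\<forall>i<4. A i = (\<Sum>j<?n. Th i j * w j)" by blast
    define x where "x k = (\<Sum>j<?n. gam k j * w j)" for k
    have "\<forall>i<2. (\<Sum>k<7. rho i k * x k) = 0" using exg[of x] x_def by blast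
    moreover have "\<forall>i<4. A i = (\<Sum>k<7. eta i k * x k)" using w by (simp add: Th x_def)
    ultimately show "(\<Sum>i<4. p i * A i) = 0" using syz by blast
  qed
  have B: "(\<forall>i<4. (\<Sum>j<?n. Th i j * w j) = 0) \<longleftrightarrow>
       (\<exists>y z1 z2. \<forall>j<?n. w j = (\<Sum>l<?k. D3 j l * y l) + z1 * y1 j + z2 * y2 j)" for w
  proof
    assume *: "\<forall>i<4. (\<Sum>j<?n. Th i j * w j) = 0"
    define x where "x k = (\<Sum>j<?n. gam k j * w j)" for k
    have "\<forall>i<2. (\<Sum>k<7. rho i k * x k) = 0" using exg[of x] x_def by blast
    moreover have "\<forall>i<4. (\<Sum>k<7. eta i k * x k) = 0" using * by (simp add: Th x_def)
    ultimately obtain z1 z2 where z: "\<forall>k<7. x k = z1 * h1 k + z2 * h2 k" using ker by blast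
    have "(\<Sum>j<?n. gam k j * (w j - (z1 * x1 j + z2 * x2 j))) = 0" if "k < 7" for k
    proof -
      have "(\<Sum>j<?n. gam k j * (w j - (z1 * x1 j + z2 * x2 j)))
        = x k - (z1 * (\<Sum>j<?n. gam k j * x1 j) + z2 * (\<Sum>j<?n. gam k j * x2 j))"
        unfolding x_def by (simp add: algebra_simps sum_subtractf sum.distrib sum_distrib_left)
      then show ?thesis using z x1(1) x2(1) that by simp
    qed
    then obtain y where "\<forall>j<?n. w j - (z1 * x1 j + z2 * x2 j) = (\<Sum>l<?k. D3 j l * y l)"
      using ex(2)[unfolded exf_def, rule_format, of "\<lambda>j. w j - (z1 * x1 j + z2 * x2 j)"] by blast
    then have "\<forall>j<?n. w j = (\<Sum>l<?k. D3 j l * y l) + (z1 * cst a + z2 * cst b) * y1 j + (z1 * cst c + z2 * cst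
      d) * y2 j"
      unfolding x_y by (simp add: algebra_simps)
    then show "\<exists>y z1 z2. \<forall>j<?n. w j = (\<Sum>l<?k. D3 j l * y l) + z1 * y1 j + z2 * y2 j" by blast
  next
    assume "\<exists>y z1 z2. \<forall>j<?n. w j = (\<Sum>l<?k. D3 j l * y l) + z1 * y1 j + z2 * y2 j"
    then obtain y z1 z2 where w: "\<forall>j<?n. w j = (\<Sum>l<?k. D3 j l * y l) + z1 * y1 j + z2 * y2 j" by blast
    define f1 where "f1 = cst e * (z1 * cst d - z2 * cst b)"
    define f2 where "f2 = cst e * (z2 * cst a - z1 * cst c)"
    have gw: "(\<Sum>j<?n. gam k j * w j) = f1 * h1 k + f2 * h2 k" if "k < 7" for k
    proof -
      have "(\<Sum>j<?n. gam k j * w j) = (\<Sum>j<?n. gam k j * ((\<Sum>l<?k. D3 j l * y l) + z1 * y1 j + z2 * y2 j))"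
        using w by (intro sum.cong) auto
      then show ?thesis unfolding gx[OF that] gD[OF that] f1_def f2_def by simp
    qed
    show "\<forall>i<4. (\<Sum>j<?n. Th i j * w j) = 0"
    proof (intro allI impI)
      fix i :: nat assume i: "i < 4"
      have "(\<Sum>j<?n. Th i j * w j) = (\<Sum>k<7. eta i k * (f1 * h1 k + f2 * h2 k))"
        unfolding Th using gw by (intro sum.cong) auto
      also have "\<dots> = f1 * (\<Sum>k<7. eta i k * h1 k) + f2 * (\<Sum>k<7. eta i k * h2 k)"
        by (rule sum_linear)
      finally show "(\<Sum>j<?n. Th i j * w j) = 0" using h(5,6) i by simp
    qed
  qed
  have C: "z1 = 0 \<and> z2 = 0" if "\<forall>j<?n. (\<Sum>l<?k. D3 j l * y l) + z1 * y1 j + z2 * y2 j = 0" for y z1 z2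
  proof -
    have z: "cst e * (z1 * cst d - z2 * cst b) = 0 \<and> cst e * (z2 * cst a - z1 * cst c) = 0"
    proof (rule indep, intro allI impI)
      fix k assume "4 \<le> k \<and> k < (7::nat)"
      then have k: "k < 7" by simp
      have "(\<Sum>j<?n. gam k j * ((\<Sum>l<?k. D3 j l * y l) + z1 * y1 j + z2 * y2 j)) = 0"
        using that by (intro sum.neutral) auto
      then show "(cst e * (z1 * cst d - z2 * cst b)) * h1 k + (cst e * (z2 * cst a - z1 * cst c)) * h2 k = 0"
        unfolding gx[OF k] gD[OF k] by simp
    qed
    have E: "z1 * (cst e * (cst a * cst d - cst b * cst c))
        = cst a * (cst e * (z1 * cst d - z2 * cst b)) + cst b * (cst e * (z2 * cst a - z1 * cst c))"
      "z2 * (cst e * (cst a * cst d - cst b * cst c))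
        = cst c * (cst e * (z1 * cst d - z2 * cst b)) + cst d * (cst e * (z2 * cst a - z1 * cst c))"
      by (simp_all add: algebra_simps)
    show ?thesis using E[unfolded ce conjunct1[OF z] conjunct2[OF z]] by simp
  qed
  define ns where "ns = filter (\<lambda>j. j \<noteq> r1 \<and> j \<noteq> r2) [0..<?n]"
  have ns: "distinct ns" "set ns = {..<?n} - {r1, r2}" by (auto simp: ns_def)
  have bij: "bij_betw ((!) ns) {..<length ns} ({..<?n} - {r1, r2})"
    using bij_betw_nth[OF ns(1) refl ns(2)[symmetric]] .
  define L2' where "L2' = map ((!) L2) ns"
  have ns_lt: "ns ! j < ?n" "ns ! j \<noteq> r1" "ns ! j \<noteq> r2" if "j < length ns" for j
    using nth_mem[OF that] ns(2) by auto
  have Thg: "Th i j \<in> graded_piece (L2 ! j - (2, 1))" if "i < 4" "j < ?n" for i j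
    unfolding Th_def by (intro gp_sum gp_mult[OF eta[OF that(1)] gam[OF _ that(2)]]) auto
  have y1g: "y1 j \<in> graded_piece ((3, 2) - L2 ! j)" and y2g: "y2 j \<in> graded_piece ((3,
    2) - L2 ! j)" if "j < ?n" for j
    unfolding y1_def y2_def using x1(2) x2(2) that by (auto intro!: gp_cst_mult gp_diff)
  have D3g: "D3 j l - y1 j * D3 r1 l - y2 j * D3 r2 l \<in> graded_piece (L3 ! l - L2 ! j)" if "j < ?n"
    "l < ?k" for j l
    using D3[OF that] gp_mult[OF y1g[OF that(1)] D3[OF r1(1) that(2)]] gp_mult[OF y2g[OF that(1)] D3[OF r2(1)
      that(2)]]
    by (intro gp_diff) (auto simp: r1 r2)
  note pr = prune[where m = 4 and p = p and n = ?n and Th = Th and k = ?k and D = D3 and ?y1.0 = y1 and ?y2.0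
    = y2
      and q = "length L4" and E = D4 and ?r1.0 = r1 and ?r2.0 = r2 and f = "(!) ns" and n' = "length ns",
    OF A B C ex(3) r1(1) r2(1) ne delta bij]
  define D2n where "D2n = (\<lambda>i j. Th i (ns ! j))"
  define D3n where "D3n = (\<lambda>j l. D3 (ns ! j) l - y1 (ns ! j) * D3 r1 l - y2 (ns ! j) * D3 r2 l)"
  have len: "length L2' = length ns" by (simp add: L2'_def)
  have g2: "D2n i j \<in> graded_piece (L2' ! j - (2, 1))" if "i < 4" "j < length L2'" for i j
    using Thg[OF that(1) ns_lt(1)] that(2) by (simp add: L2'_def D2n_def)
  have g3: "D3n j l \<in> graded_piece (L3 ! l - L2' ! j)" if "j < length L2'" "l < ?k" for j l
    using D3g[OF ns_lt(1) that(2)] that(1) by (simp add: L2'_def D3n_def)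
  have sub: "set L2' \<subseteq> set L2"
  proof
    fix e assume "e \<in> set L2'"
    then obtain j where "j \<in> set ns" "e = L2 ! j" unfolding L2'_def set_map by (rule imageE)
    then show "e \<in> set L2" using ns(2) by simp
  qed
  then have disj': "(2, 1) \<notin> set L2'" "set L2' \<inter> set L3 = {}" using disj by blast+
  note pr' = pr[folded D2n_def D3n_def len]
  have "\<exists>d. minimal_free_resolution (ideal_gen (p ` {..<4})) (free_seq [replicate 4 (2, 1), L2', L3, L4]) d"
    by (rule resolution_from_exact[where p = p and ?D2.0 = D2n and ?D3.0 = D3n and ?D4.0 = D4,
          OF p g2 g3 D4 pr' ex(4) disj' disj(3)])
  then show ?thesis using r1 r2 ne unfolding L2'_def ns_def by blast
qed

section \<open>Linear algebra over an algebraically closed field\<close>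

definition inverse4 :: "(nat \<Rightarrow> nat \<Rightarrow> 'k::field) \<Rightarrow> (nat \<Rightarrow> nat \<Rightarrow> 'k) \<Rightarrow> bool" where
  "inverse4 G H \<longleftrightarrow> (\<forall>i<4. \<forall>j<4. (\<Sum>l<4. G i l * H l j) = (if i = j then 1 else 0)) \<and>
              (\<forall>i<4. \<forall>j<4. (\<Sum>l<4. H i l * G l j) = (if i = j then 1 else 0))"

text \<open>The determinant decides. The relation is one among rows, hence a kernel vector of the
  transpose.\<close>

lemma left_kernel:
  fixes G :: "nat \<Rightarrow> nat \<Rightarrow> 'k::field"
  assumes "\<nexists>H. inverse4 G H"
  shows "\<exists>f. (\<exists>i<4. f i \<noteq> 0) \<and> (\<forall>j<4. (\<Sum>i<4. f i * G i j) = 0)"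
proof -
  define n :: nat where "n = 4"
  define A where "A = mat n n (\<lambda>(i, j). G i j)"
  have A: "A \<in> carrier_mat n n" by (simp add: A_def)
  have "det A = 0"
  proof (rule ccontr)
    assume d: "det A \<noteq> 0"
    have "A \<in> Units (ring_mat TYPE('k) n ())" by (rule det_non_zero_imp_unit[OF A d])
    then obtain B where B: "B \<in> carrier_mat n n" "B * A = 1\<^sub>m n" "A * B = 1\<^sub>m n"
      unfolding Units_def ring_mat_simps by auto
    have "(\<Sum>l<n. G i l * B $$ (l, j)) = (if i = j then 1 else 0)" if "i < n" "j < n" for i j
      using arg_cong[OF B(3), of "\<lambda>M. M $$ (i, j)"] that B(1)
      by (simp add: A_def scalar_prod_def lessThan_atLeast0)
    moreover have "(\<Sum>l<n. B $$ (i, l) * G l j) = (if i = j then 1 else 0)" if "i < n" "j < n" for i j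
      using arg_cong[OF B(2), of "\<lambda>M. M $$ (i, j)"] that B(1)
      by (simp add: A_def scalar_prod_def lessThan_atLeast0)
    ultimately have "inverse4 G (\<lambda>i j. B $$ (i, j))" by (simp add: inverse4_def n_def)
    then show False using assms by blast
  qed
  then have "det (transpose_mat A) = 0" using det_transpose[OF A] by simp
  then obtain v where v: "v \<in> carrier_vec n" "v \<noteq> 0\<^sub>v n" "transpose_mat A *\<^sub>v v = 0\<^sub>v n"
    using det_0_iff_vec_prod_zero_field[of "transpose_mat A" n] A by auto
  have "\<exists>i<n. v $ i \<noteq> 0"
  proof (rule ccontr)
    assume "\<not> ?thesis"
    then have "v = 0\<^sub>v n" using v(1) by (intro eq_vecI) auto
    then show False using v(2) by simp
  qed
  moreover have "(\<Sum>i<n. v $ i * G i j) = 0" if "j < n" for j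
    using arg_cong[OF v(3), of "\<lambda>w. w $ j"] that v(1)
    by (simp add: A_def scalar_prod_def lessThan_atLeast0 mult.commute)
  ultimately show ?thesis unfolding n_def by (intro exI[of _ "\<lambda>i. v $ i"]) simp
qed

text \<open>The only place where algebraic closedness enters: roots of quadratic
  polynomials.\<close>

lemma quadratic_root: "\<exists>x :: 'k::alg_closed_field. x * x - b * x + c = 0"
proof -
  have "\<exists>x. (\<Sum>k\<le>2. (\<lambda>k. if k = 0 then c else if k = 1 then - b else 1) k * x ^ k) = 0"
    by (rule alg_closed) auto
  then obtain x where "(\<Sum>k\<le>2. (if k = 0 then c else if k = 1 then - b else 1) * x ^ k) = 0" by blast
  then have "x * x - b * x + c = 0" by (simp add: numeral_2_eq_2 atMost_Suc algebra_simps)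
  then show ?thesis by blast
qed

text \<open>A nonzero singular 2 x 2 matrix is a column times a row. In this form decomposable
  tensors are recognised.\<close>

lemma rank_one:
  fixes p :: "'k::field"
  assumes "p * w = q * r" "p \<noteq> 0 \<or> q \<noteq> 0 \<or> r \<noteq> 0 \<or> w \<noteq> 0"
  obtains e f x y where "e \<noteq> 0 \<or> f \<noteq> 0" "x \<noteq> 0 \<or> y \<noteq> 0" "p = e * x" "q = e * y" "r = f * x" "w = f * y"
proof (cases "p = 0 \<and> q = 0")
  case True
  then show thesis using assms by (intro that[of 0 1 r w]) auto
next
  case False
  define f where "f = (if p \<noteq> 0 then r / p else w / q)"
  have "r = f * p" "w = f * q" using False assms(1) by (auto simp: f_def field_simps)
  then show thesis using False by (intro that[of 1 f p q]) auto
qed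

lemma sum4: "(\<Sum>i<4. f i) = f 0 + f 1 + f 2 + f (3::nat)"
  by (simp add: eval_nat_numeral)

text \<open>If no row completed the three given ones, every unit vector would be a combination of
  them, and the identity matrix of size 4 would factor through a space of dimension 3.\<close>

lemma extend_to_invertible:
  fixes G :: "nat \<Rightarrow> nat \<Rightarrow> 'k::field"
  assumes "\<And>f0 f1 f2. (\<forall>j<4. f0 * G 0 j + f1 * G 1 j + f2 * G 2 j = 0) \<Longrightarrow> f0 = 0 \<and> f1 = 0 \<and> f2 = 0"
  shows "\<exists>r H. inverse4 (\<lambda>i j. if i = 3 then r j else G i j) H"
proof (rule ccontr)
  assume no: "\<not> ?thesis"
  have "\<exists>x0 x1 x2. \<forall>j<4. x0 * G 0 j + x1 * G 1 j + x2 * G 2 j = (if j = c then 1 else 0)" for c :: nat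
  proof -
    \<comment> \<open>The three rows and a unit vector; by independence of the three, a relation
      must involve the unit vector.\<close>
    define M where "M = (\<lambda>i j :: nat. if i = (3::nat) then (if j = c then 1 else 0) else G i j)"
    have "\<forall>r. \<not> (\<exists>H. inverse4 (\<lambda>i j. if i = 3 then r j else G i j) H)" using no by blast
    then have "\<not> (\<exists>H. inverse4 M H)" unfolding M_def by (rule spec)
    then obtain f where f: "\<exists>i<4. f i \<noteq> 0" "\<forall>j<4. (\<Sum>i<4. f i * M i j) = 0"
      using left_kernel by blast
    have eq: "f 0 * G 0 j + f 1 * G 1 j + f 2 * G 2 j + f 3 * (if j = c then 1 else 0) = 0" if "j < 4" for j
      using f(2)[rule_format, OF that] by (simp add: sum4 M_def)
    have f3: "f 3 \<noteq> 0"
    proof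
      assume "f 3 = 0"
      then have "f 0 = 0 \<and> f 1 = 0 \<and> f 2 = 0" using eq by (intro assms) simp
      then show False using f(1) \<open>f 3 = 0\<close> by (auto simp: eval_nat_numeral less_Suc_eq)
    qed
    have "- f 0 / f 3 * G 0 j + - f 1 / f 3 * G 1 j + - f 2 / f 3 * G 2 j = (if j = c then 1 else 0)" if "j <
      4" for j
    proof -
      have e: "f 0 * G 0 j + f 1 * G 1 j + f 2 * G 2 j = - (f 3 * (if j = c then 1 else 0))"
        using eq[OF that] by (simp only: eq_neg_iff_add_eq_0)
      have "- f 0 / f 3 * G 0 j + - f 1 / f 3 * G 1 j + - f 2 / f 3 * G 2 j
        = - (f 0 * G 0 j + f 1 * G 1 j + f 2 * G 2 j) / f 3"
        using f3 by (simp add: field_simps)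
      then show ?thesis unfolding e using f3 by simp
    qed
    then show ?thesis
      by (intro exI[of _ "- f 0 / f 3"] exI[of _ "- f 1 / f 3"] exI[of _ "- f 2 / f 3"]) simp
  qed
  then obtain x0 x1 x2 where x: "\<And>c j. j < 4 \<Longrightarrow> x0 c * G 0 j + x1 c * G 1 j + x2 c * G 2 j = (if j = c then 1
    else 0)"
    by metis
  \<comment> \<open>The coefficients of these combinations, padded by a zero column. The matrix is
    singular, and a left kernel vector of it would be a relation among the unit vectors.\<close>
  define X where "X = (\<lambda>(c::nat) (i::nat). if i = 0 then x0 c else if i = 1 then x1 c else if i = 2 then x2 c
    else (0 :: 'k))"
  have "\<nexists>H. inverse4 X H"
  proof
    assume "\<exists>H. inverse4 X H"
    then obtain H where "\<forall>i<4. \<forall>j<4. (\<Sum>l<4. H i l * X l j) = (if i = j then 1 else 0)"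
      unfolding inverse4_def by blast
    then have "(\<Sum>l<4. H 3 l * X l 3) = 1" by simp
    then show False by (simp add: X_def)
  qed
  then obtain f where f: "\<exists>i<4. f i \<noteq> 0" "\<forall>j<4. (\<Sum>i<4. f i * X i j) = 0"
    using left_kernel by blast
  have z: "(\<Sum>i<4. f i * x0 i) = 0" "(\<Sum>i<4. f i * x1 i) = 0" "(\<Sum>i<4. f i * x2 i) = 0"
    using f(2)[rule_format, of 0] f(2)[rule_format, of 1] f(2)[rule_format, of 2] by (simp_all add: X_def)
  have "f j = 0" if "j < 4" for j
  proof -
    have "f j = (\<Sum>c<4. f c * (if j = c then 1 else 0))" using that
      by (simp add: sum4) (auto simp: eval_nat_numeral less_Suc_eq)
    also have "\<dots> = (\<Sum>c<4. f c * (x0 c * G 0 j + x1 c * G 1 j + x2 c * G 2 j))"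
      using x[OF that] by simp
    also have "\<dots> = (\<Sum>i<4. f i * x0 i) * G 0 j + (\<Sum>i<4. f i * x1 i) * G 1 j + (\<Sum>i<4. f i * x2 i) * G 2 j"
      by (simp add: sum4 algebra_simps)
    finally show ?thesis using z by simp
  qed
  then show False using f(1) by blast
qed

text \<open>
  A \<open>2 \<times> 4\<close> matrix of linear forms in \<open>s, t\<close> that has no zero row at any point after any change of
  rows is, up to column operations, \<open>[s t 0 0; 0 0 s t]\<close>, or it is \<open>[s t 0 0; 0 s t 0]\<close> in suitable
  coordinates: a functional that kills its columns is a nondegenerate pairing.
\<close>

lemma pencil_cases:
  fixes m :: "nat \<Rightarrow> nat \<Rightarrow> 'k::alg_closed_field"
  assumes nondeg: "\<forall>e f x y. (e \<noteq> 0 \<or> f \<noteq> 0) \<and> (x \<noteq> 0 \<or> y \<noteq> 0) \<longrightarrow>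
     (\<exists>j<4. e * (m 0 j * x + m 1 j * y) + f * (m 2 j * x + m 3 j * y) \<noteq> 0)"
  shows "(\<exists>H. inverse4 m H) \<or>
    (\<exists>s t G H. is_basis2 var_s var_t s (t :: 'k bipoly) \<and> inverse4 G H \<and>
      (\<forall>j<4. cst (m 0 j) * var_s + cst (m 1 j) * var_t = cst (G 0 j) * s + cst (G 1 j) * t \<and>
             cst (m 2 j) * var_s + cst (m 3 j) * var_t = cst (G 1 j) * s + cst (G 2 j) * t))"
  supply One_nat_def [simp del]
proof (cases "\<exists>H. inverse4 m H")
  case False
  then obtain f where f: "\<exists>i<4. f i \<noteq> 0" "\<forall>j<4. (\<Sum>i<4. f i * m i j) = 0"
    using left_kernel by blast
  have k: "f 0 * m 0 j + f 1 * m 1 j + f 2 * m 2 j + f 3 * m 3 j = 0" if "j < 4" for j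
    using f(2)[rule_format, OF that] by (simp add: sum4)
  define D where "D = f 0 * f 3 - f 1 * f 2"
  have D: "D \<noteq> 0"
  \<comment> \<open>A rank one matrix of coefficients \<open>f\<close> would factor into a row
    combination and a point at which the pencil degenerates.\<close>
  proof
    assume "D = 0"
    then have r1: "f 0 * f 3 = f 1 * f 2" by (simp add: D_def)
    have r2: "f 0 \<noteq> 0 \<or> f 1 \<noteq> 0 \<or> f 2 \<noteq> 0 \<or> f 3 \<noteq> 0"
      using f(1) by (auto simp: eval_nat_numeral less_Suc_eq One_nat_def)
    obtain e g x y where e: "e \<noteq> 0 \<or> g \<noteq> 0" "x \<noteq> 0 \<or> y \<noteq> 0"
      "f 0 = e * x" "f 1 = e * y" "f 2 = g * x" "f 3 = g * y" by (rule rank_one[OF r1 r2])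
    obtain j where "j < 4" "e * (m 0 j * x + m 1 j * y) + g * (m 2 j * x + m 3 j * y) \<noteq> 0"
      using nondeg e(1,2) by blast
    moreover have "e * (m 0 j * x + m 1 j * y) + g * (m 2 j * x + m 3 j * y)
      = f 0 * m 0 j + f 1 * m 1 j + f 2 * m 2 j + f 3 * m 3 j"
      by (simp add: e algebra_simps)
    ultimately show False using k[of j] by simp
  qed
  define i where "i = inverse D"
  have i: "i * D = 1" using D by (simp add: i_def)
  \<comment> \<open>In these coordinates the relation \<open>f\<close> says that the coefficients of
    \<open>t\<close> in the first row agree with the coefficients of \<open>s\<close> in the second;
    the common values are \<open>G 1\<close>.\<close>
  define s :: "'k bipoly" where "s = cst (i * f 1) * var_s + cst (- i * f 0) * var_t"
  define t :: "'k bipoly" where "t = cst (i * f 3) * var_s + cst (- i * f 2) * var_t"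
  have det: "(i * f 1) * (- i * f 2) - (- i * f 0) * (i * f 3) = i"
  proof -
    have "(i * f 1) * (- i * f 2) - (- i * f 0) * (i * f 3) = i * (i * D)" by (simp add: D_def algebra_simps)
    then show ?thesis by (simp add: i)
  qed
  have "(i * f 1) * (- i * f 2) - (- i * f 0) * (i * f 3) \<noteq> 0"
    unfolding det using i by auto
  then have basis: "is_basis2 var_s var_t s t"
    unfolding is_basis2_def s_def t_def by (intro exI conjI) (assumption, rule refl, rule refl)
  have ci: "cst i * (cst (f 0) * cst (f 3) - cst (f 1) * cst (f 2)) = (1 :: 'k bipoly)"
    using i unfolding D_def by (metis cst_1 cst_diff cst_mult)
  have st: "var_s = cst (- f 2) * s + cst (f 0) * t" "var_t = cst (- f 3) * s + cst (f 1) * t"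
  proof -
    have "cst (- f 2) * s + cst (f 0) * t = cst i * (cst (f 0) * cst (f 3) - cst (f 1) * cst (f 2)) * var_s"
      "cst (- f 3) * s + cst (f 1) * t = cst i * (cst (f 0) * cst (f 3) - cst (f 1) * cst (f 2)) * var_t"
      unfolding s_def t_def by (simp_all add: cst_hom algebra_simps)
    then show "var_s = cst (- f 2) * s + cst (f 0) * t" "var_t = cst (- f 3) * s + cst (f 1) * t"
      by (simp_all add: ci)
  qed
  define G where "G a j = (if a = 0 then - f 2 * m 0 j - f 3 * m 1 j else if a = 1 then f 0 * m 0 j + f 1 * m
    1 j
     else f 0 * m 2 j + f 1 * m 3 j)" for a j :: nat
  have G1: "G 1 j = - f 2 * m 2 j - f 3 * m 3 j" if "j < 4" for j
  proof -
    have "G 1 j - (- f 2 * m 2 j - f 3 * m 3 j) = f 0 * m 0 j + f 1 * m 1 j + f 2 * m 2 j + f 3 * m 3 j"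
      by (simp add: G_def)
    then show ?thesis using k[OF that] by simp
  qed
  have coords: "cst (m 0 j) * var_s + cst (m 1 j) * var_t = cst (G 0 j) * s + cst (G 1 j) * t"
    "cst (m 2 j) * var_s + cst (m 3 j) * var_t = cst (G 1 j) * s + cst (G 2 j) * t" if "j < 4" for j
  proof -
    have "cst (G 0 j) * s + cst (G 1 j) * t
       = cst (m 0 j) * (cst (- f 2) * s + cst (f 0) * t) + cst (m 1 j) * (cst (- f 3) * s + cst (f 1) * t)"
      by (simp add: G_def cst_hom algebra_simps)
    then show "cst (m 0 j) * var_s + cst (m 1 j) * var_t = cst (G 0 j) * s + cst (G 1 j) * t"
      unfolding st[symmetric] by (rule sym)
    have "cst (G 1 j) * s + cst (G 2 j) * t
       = cst (m 2 j) * (cst (- f 2) * s + cst (f 0) * t) + cst (m 3 j) * (cst (- f 3) * s + cst (f 1) * t)"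
      unfolding G1[OF that] by (simp add: G_def cst_hom algebra_simps)
    then show "cst (m 2 j) * var_s + cst (m 3 j) * var_t = cst (G 1 j) * s + cst (G 2 j) * t"
      unfolding st[symmetric] by (rule sym)
  qed
  have "f0 = 0 \<and> f1 = 0 \<and> f2 = 0" if ker: "\<forall>j<4. f0 * G 0 j + f1 * G 1 j + f2 * G 2 j = 0" for f0 f1 f2
  proof (rule ccontr)
    assume ne: "\<not> (f0 = 0 \<and> f1 = 0 \<and> f2 = 0)"
    \<comment> \<open>Splitting \<open>f1\<close> into \<open>f1 - l\<close> and \<open>l\<close>
      makes the matrix with rows \<open>(f0, f1 - l)\<close> and \<open>(l, f2)\<close> singular.
      Its factors give a degenerate point in the coordinates \<open>s, t\<close>, which
      \<open>X, Y\<close> translate back to the variables.\<close>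
    obtain l where l: "l * l - f1 * l + f0 * f2 = 0" using quadratic_root by blast
    have r1: "f0 * f2 = (f1 - l) * l" using l by (simp add: algebra_simps)
    have r2: "f0 \<noteq> 0 \<or> f1 - l \<noteq> 0 \<or> l \<noteq> 0 \<or> f2 \<noteq> 0" using ne by auto
    obtain e g x y where e: "e \<noteq> 0 \<or> g \<noteq> 0" "x \<noteq> 0 \<or> y \<noteq> 0"
      "f0 = e * x" "f1 - l = e * y" "l = g * x" "f2 = g * y" by (rule rank_one[OF r1 r2])
    define X where "X = - f 2 * x + f 0 * y"
    define Y where "Y = - f 3 * x + f 1 * y"
    have "X \<noteq> 0 \<or> Y \<noteq> 0"
    proof (rule ccontr)
      assume "\<not> ?thesis"
      then have "X = 0" "Y = 0" by auto
      moreover have "D * x = f 1 * X - f 0 * Y" "D * y = f 3 * X - f 2 * Y"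
        unfolding X_def Y_def D_def by (simp_all add: algebra_simps)
      ultimately show False using D e(2) by simp
    qed
    then obtain j where j: "j < 4" "e * (m 0 j * X + m 1 j * Y) + g * (m 2 j * X + m 3 j * Y) \<noteq> 0"
      using nondeg e(1) by blast
    have "e * (m 0 j * X + m 1 j * Y) + g * (m 2 j * X + m 3 j * Y)
      = e * x * G 0 j + e * y * (f 0 * m 0 j + f 1 * m 1 j) + g * x * (- f 2 * m 2 j - f 3 * m 3 j) + g * y *
        G 2 j"
      unfolding X_def Y_def G_def by (simp add: algebra_simps)
    also have "\<dots> = e * x * G 0 j + e * y * G 1 j + g * x * G 1 j + g * y * G 2 j"
      using G1[OF j(1)] by (simp add: G_def)
    also have "\<dots> = f0 * G 0 j + f1 * G 1 j + f2 * G 2 j"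
    proof -
      have "f1 = e * y + g * x" using e(4,5) by (simp add: algebra_simps)
      then show ?thesis by (simp add: e(3,6) algebra_simps)
    qed
    finally show False using j ker by simp
  qed
  then obtain r H where "inverse4 (\<lambda>i j. if i = 3 then r j else G i j) H"
    using extend_to_invertible[of G] by blast
  then show ?thesis using basis coords
    by (intro disjI2 exI[of _ s] exI[of _ t] exI[of _ "\<lambda>i j. if i = 3 then r j else G i j"] exI[of _ H]) simp
qed simp

section \<open>Quadrics and their linear syzygies\<close>

definition quad :: "'k::field \<Rightarrow> 'k \<Rightarrow> 'k \<Rightarrow> 'k bipoly" where
  "quad a b c = cst a * (var_s * var_s) + cst b * (var_s * var_t) + cst c * (var_t * var_t)"

definition is_basis3 :: "'k::field bipoly \<Rightarrow> 'k bipoly \<Rightarrow> 'k bipoly \<Rightarrow> bool" where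
  "is_basis3 p q r \<longleftrightarrow> (\<exists>a0 a1 a2 b0 b1 b2 c0 c1 c2.
     a0 * (b1 * c2 - b2 * c1) + a1 * (b2 * c0 - b0 * c2) + a2 * (b0 * c1 - b1 * c0) \<noteq> 0 \<and>
     p = quad a0 a1 a2 \<and> q = quad b0 b1 b2 \<and> r = quad c0 c1 c2)"

text \<open>The Hilbert-Burch matrix of three quadrics: its columns \<open>x\<close> and
  \<open>y\<close> generate the syzygies and its signed minors are the quadrics. With
  \<open>q0 \<noteq> 0\<close> the columns are independent.\<close>

definition hilbert_burch :: "'k::field bipoly \<Rightarrow> 'k bipoly \<Rightarrow> 'k bipoly \<Rightarrow> 'k bipoly \<Rightarrow> 'k bipoly \<Rightarrow> 'k bipoly \<Rightarrow>
    'k bipoly \<Rightarrow> 'k bipoly \<Rightarrow> 'k bipoly \<Rightarrow> bool" where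
  "hilbert_burch q0 q1 q2 x0 x1 x2 y0 y1 y2 \<longleftrightarrow>
     {x0, x1, x2, y0, y1, y2} \<subseteq> graded_piece (1, 0) \<and>
     q0 = x1 * y2 - x2 * y1 \<and> q1 = x2 * y0 - x0 * y2 \<and> q2 = x0 * y1 - x1 * y0 \<and> q0 \<noteq> 0 \<and>
     (\<forall>a0 a1 a2. a0 * q0 + a1 * q1 + a2 * q2 = 0 \<longrightarrow>
       (\<exists>b c. a0 = b * x0 + c * y0 \<and> a1 = b * x1 + c * y1 \<and> a2 = b * x2 + c * y2))"

lemma coords_std: "coords (var_s :: 'k::field bipoly) var_t var_u var_v"
  by (simp add: coords_def is_basis2_refl)

text \<open>Two Koszul steps, one for \<open>s\<close> against the terms divisible by
  \<open>t\<close>, and one among these.\<close>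

lemma syzygies_of_monomials:
  fixes x y z :: "'k::field bipoly"
  assumes "x * (var_s * var_s) + y * (var_s * var_t) + z * (var_t * var_t) = 0"
  shows "\<exists>b c. x = b * var_t \<and> y = c * var_t - b * var_s \<and> z = - (c * var_s)"
proof -
  interpret coords "var_s :: 'k bipoly" var_t var_u var_v by (rule coords_std)
  have "var_s * (x * var_s) + var_t * (y * var_s + z * var_t) = 0"
    using assms by (simp add: algebra_simps)
  then obtain b where b: "x * var_s = var_t * b" "y * var_s + z * var_t = - (var_s * b)"
    using koszul_st0 by blast
  have "var_s * x = var_t * b" using b(1) by (simp add: mult.commute)
  then obtain b' where b': "x = var_t * b'" "b = var_s * b'" using koszul_st by blast
  have "var_s * (y + var_s * b') + var_t * z = 0"
    using b(2) unfolding b' by (simp add: algebra_simps eq_neg_iff_add_eq_0)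
  then obtain c where "y + var_s * b' = var_t * c" "z = - (var_s * c)" using koszul_st0 by blast
  then have "x = b' * var_t \<and> y = c * var_t - b' * var_s \<and> z = - (c * var_s)"
    using b' by (simp add: algebra_simps)
  then show ?thesis by blast
qed

lemma quad_eq_0_iff: "quad a b c = 0 \<longleftrightarrow> a = 0 \<and> b = 0 \<and> (c :: 'k::field) = 0"
proof
  assume 0: "quad a b c = 0"
  have "quad a b c = Poly_Mapping.single (2, 0, 0, 0) a + Poly_Mapping.single (1, 1, 0, 0) b
      + Poly_Mapping.single (0, 2, 0, 0) c"
    unfolding single_monomial quad_def by (simp add: power2_eq_square mult.assoc)
  then have *: "Poly_Mapping.lookup (Poly_Mapping.single (2, 0, 0, 0) a + Poly_Mapping.single (1, 1, 0, 0) b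
      + Poly_Mapping.single (0, 2, 0, 0) c) e = 0" for e :: expo
    unfolding 0 by (metis lookup_zero)
  from *[of "(2,0,0,0)"] *[of "(1,1,0,0)"] *[of "(0,2,0,0)"] show "a = 0 \<and> b = 0 \<and> c = 0"
    by (simp add: lookup_add lookup_single when_def)
qed (simp add: quad_def)

lemma quad_gp: "quad a b c \<in> graded_piece (2, 0)"
proof -
  have "x * y \<in> graded_piece (2, 0)" if "x \<in> graded_piece (1,0)" "y \<in> graded_piece (1,0)" for x y :: "'a bipoly"
    using that by (rule gp_mult) simp
  then show ?thesis unfolding quad_def by (intro gp_add gp_cst_mult) simp_all
qed

text \<open>
  The linear syzygies of the three monomials form the matrix with columns \<open>(t, -s, 0)\<close> and
  \<open>(0, t, -s)\<close>, whose minors are the monomials; the general case is a change of basis by the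
  matrix of cofactors.
\<close>

lemma hilbert_burch_exists:
  fixes q0 q1 q2 :: "'k::field bipoly"
  assumes "is_basis3 q0 q1 q2"
  shows "\<exists>x0 x1 x2 y0 y1 y2. hilbert_burch q0 q1 q2 x0 x1 x2 y0 y1 y2"
proof -
  obtain a0 a1 a2 b0 b1 b2 c0 c1 c2 where
    det0: "a0 * (b1 * c2 - b2 * c1) + a1 * (b2 * c0 - b0 * c2) + a2 * (b0 * c1 - b1 * c0) \<noteq> 0"
    and q0: "q0 = quad a0 a1 a2" and q1: "q1 = quad b0 b1 b2" and q2: "q2 = quad c0 c1 c2"
    using assms unfolding is_basis3_def by blast
  define e where "e = inverse (a0 * (b1 * c2 - b2 * c1) + a1 * (b2 * c0 - b0 * c2) + a2 * (b0 * c1 - b1 * c0))"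
  define S T :: "'k bipoly" where "S = var_s" and "T = var_t"
  define A0 A1 A2 B0 B1 B2 C0 C1 C2 E :: "'k bipoly" where
    "A0 = cst a0" and "A1 = cst a1" and "A2 = cst a2" and "B0 = cst b0" and "B1 = cst b1" and "B2 = cst b2"
    and "C0 = cst c0" and "C1 = cst c1" and "C2 = cst c2" and "E = cst e"
  define D where "D = A0 * (B1 * C2 - B2 * C1) + A1 * (B2 * C0 - B0 * C2) + A2 * (B0 * C1 - B1 * C0)"
  have "e * (a0 * (b1 * c2 - b2 * c1) + a1 * (b2 * c0 - b0 * c2) + a2 * (b0 * c1 - b1 * c0)) = 1"
    using det0 by (simp add: e_def)
  then have "cst (e * (a0 * (b1 * c2 - b2 * c1) + a1 * (b2 * c0 - b0 * c2) + a2 * (b0 * c1 - b1 * c0))) =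
    (1 :: 'k bipoly)"
    by simp
  then have ED: "E * D = 1"
    by (simp add: cst_hom D_def E_def A0_def A1_def A2_def B0_def B1_def B2_def C0_def C1_def C2_def)
  have q: "q0 = A0 * (S * S) + A1 * (S * T) + A2 * (T * T)" "q1 = B0 * (S * S) + B1 * (S * T) + B2 * (T * T)"
    "q2 = C0 * (S * S) + C1 * (S * T) + C2 * (T * T)"
    by (simp_all add: q0 q1 q2 quad_def S_def T_def A0_def A1_def A2_def B0_def B1_def B2_def C0_def C1_def
      C2_def)
  \<comment> \<open>The two monomial columns applied to the cofactors. The inverse determinant
    \<open>E\<close> goes into one column only, so that the minors come out as
    \<open>E * D * q\<close>, which is \<open>q\<close>.\<close>
  define X where "X k0 k1 k2 = k0 * T - k1 * S" for k0 k1 k2 :: "'k bipoly"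
  define Y where "Y k0 k1 k2 = E * (k1 * T - k2 * S)" for k0 k1 k2 :: "'k bipoly"
  define x0 x1 x2 y0 y1 y2 where
    "x0 = X (B1 * C2 - B2 * C1) (B2 * C0 - B0 * C2) (B0 * C1 - B1 * C0)" and
    "x1 = X (C1 * A2 - C2 * A1) (C2 * A0 - C0 * A2) (C0 * A1 - C1 * A0)" and
    "x2 = X (A1 * B2 - A2 * B1) (A2 * B0 - A0 * B2) (A0 * B1 - A1 * B0)" and
    "y0 = Y (B1 * C2 - B2 * C1) (B2 * C0 - B0 * C2) (B0 * C1 - B1 * C0)" and
    "y1 = Y (C1 * A2 - C2 * A1) (C2 * A0 - C0 * A2) (C0 * A1 - C1 * A0)" and
    "y2 = Y (A1 * B2 - A2 * B1) (A2 * B0 - A0 * B2) (A0 * B1 - A1 * B0)"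
  note xy = x0_def x1_def x2_def y0_def y1_def y2_def X_def Y_def
  have m: "x1 * y2 - x2 * y1 = E * D * q0" "x2 * y0 - x0 * y2 = E * D * q1" "x0 * y1 - x1 * y0 = E * D * q2"
    unfolding xy q D_def by (simp_all add: algebra_simps)
  have g: "{x0, x1, x2, y0, y1, y2} \<subseteq> graded_piece (1, 0)"
  proof -
    have c: "cst a * cst b - cst c * cst d = cst (a * b - c * d)" for a b c d :: 'k by (simp add: cst_hom)
    show ?thesis
      unfolding xy A0_def A1_def A2_def B0_def B1_def B2_def C0_def C1_def C2_def E_def S_def T_def c
      by (auto intro!: gp_cst_mult gp_diff)
  qed
  have syz: "\<exists>b c. a0 = b * x0 + c * y0 \<and> a1 = b * x1 + c * y1 \<and> a2 = b * x2 + c * y2"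
    if "a0 * q0 + a1 * q1 + a2 * q2 = 0" for a0 a1 a2
  proof -
    have "(a0 * A0 + a1 * B0 + a2 * C0) * (S * S) + (a0 * A1 + a1 * B1 + a2 * C1) * (S * T)
        + (a0 * A2 + a1 * B2 + a2 * C2) * (T * T) = 0"
      using that unfolding q by (simp add: algebra_simps)
    then obtain b c where bc: "a0 * A0 + a1 * B0 + a2 * C0 = b * T"
      "a0 * A1 + a1 * B1 + a2 * C1 = c * T - b * S"
      "a0 * A2 + a1 * B2 + a2 * C2 = - (c * S)"
      unfolding S_def T_def using syzygies_of_monomials by blast
    \<comment> \<open>Cramer's rule recovers the coefficients from their images under the matrix of
      the quadrics.\<close>
    have "D * a0 = (a0 * A0 + a1 * B0 + a2 * C0) * (B1 * C2 - B2 * C1) + (a0 * A1 + a1 * B1 + a2 * C1) * (B2 *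
      C0 - B0 * C2)
        + (a0 * A2 + a1 * B2 + a2 * C2) * (B0 * C1 - B1 * C0)"
      "D * a1 = (a0 * A0 + a1 * B0 + a2 * C0) * (C1 * A2 - C2 * A1) + (a0 * A1 + a1 * B1 + a2 * C1) * (C2 * A0
        - C0 * A2)
        + (a0 * A2 + a1 * B2 + a2 * C2) * (C0 * A1 - C1 * A0)"
      "D * a2 = (a0 * A0 + a1 * B0 + a2 * C0) * (A1 * B2 - A2 * B1) + (a0 * A1 + a1 * B1 + a2 * C1) * (A2 * B0
        - A0 * B2)
        + (a0 * A2 + a1 * B2 + a2 * C2) * (A0 * B1 - A1 * B0)"
      unfolding D_def by (simp_all add: algebra_simps)
    then have Da: "E * D * a0 = E * (b * T * (B1 * C2 - B2 * C1) + (c * T - b * S) * (B2 * C0 - B0 * C2) + -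
      (c * S) * (B0 * C1 - B1 * C0))"
      "E * D * a1 = E * (b * T * (C1 * A2 - C2 * A1) + (c * T - b * S) * (C2 * A0 - C0 * A2) + - (c * S) * (C0
        * A1 - C1 * A0))"
      "E * D * a2 = E * (b * T * (A1 * B2 - A2 * B1) + (c * T - b * S) * (A2 * B0 - A0 * B2) + - (c * S) * (A0
        * B1 - A1 * B0))"
      unfolding bc by (simp_all add: mult.assoc)
    have "a0 = (E * b) * x0 + c * y0" "a1 = (E * b) * x1 + c * y1" "a2 = (E * b) * x2 + c * y2"
      using Da unfolding ED xy by (simp_all add: algebra_simps)
    then show ?thesis by blast
  qed
  have "q0 \<noteq> 0" using det0 unfolding q0 quad_eq_0_iff by auto
  then have "hilbert_burch q0 q1 q2 x0 x1 x2 y0 y1 y2"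
    unfolding hilbert_burch_def using g m syz ED by simp
  then show ?thesis by blast
qed

section \<open>Types 1 to 4\<close>

text \<open>
  The syzygies of \<open>p\<close> are the images under \<open>eta\<close> of the solutions of \<open>rho x = 0\<close>, and the solutions that
  \<open>eta\<close> kills are freely generated by \<open>h1\<close> and \<open>h2\<close>.
\<close>

definition syz_system :: "(nat \<Rightarrow> 'r::comm_ring_1) \<Rightarrow> (nat \<Rightarrow> nat \<Rightarrow> 'r) \<Rightarrow> (nat \<Rightarrow> nat \<Rightarrow> 'r) \<Rightarrow> (nat \<Rightarrow> 'r) \<Rightarrow> (nat \<Rightarrow>
  'r) \<Rightarrow> bool" where
  "syz_system p rho eta h1 h2 \<longleftrightarrow>
     (\<forall>A. (\<Sum>i<4. p i * A i) = 0 \<longleftrightarrow>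
       (\<exists>x. (\<forall>i<2. (\<Sum>k<7. rho i k * x k) = 0) \<and> (\<forall>i<4. A i = (\<Sum>k<7. eta i k * x k)))) \<and>
     (\<forall>i<2. (\<Sum>k<7. rho i k * h1 k) = 0) \<and> (\<forall>i<2. (\<Sum>k<7. rho i k * h2 k) = 0) \<and>
     (\<forall>i<4. (\<Sum>k<7. eta i k * h1 k) = 0) \<and> (\<forall>i<4. (\<Sum>k<7. eta i k * h2 k) = 0) \<and>
     (\<forall>x. (\<forall>i<2. (\<Sum>k<7. rho i k * x k) = 0) \<longrightarrow> (\<forall>i<4. (\<Sum>k<7. eta i k * x k) = 0) \<longrightarrow>
       (\<exists>z1 z2. \<forall>k<7. x k = z1 * h1 k + z2 * h2 k)) \<and>
     (\<forall>z1 z2. (\<forall>k. 4 \<le> k \<and> k < 7 \<longrightarrow> z1 * h1 k + z2 * h2 k = 0) \<longrightarrow> z1 = 0 \<and> z2 = 0)"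

lemma syz_systemD:
  fixes p :: "nat \<Rightarrow> 'r::comm_ring_1"
  assumes "syz_system p rho eta h1 h2"
  shows "(\<Sum>i<4. p i * A i) = 0 \<longleftrightarrow>
      (\<exists>x. (\<forall>i<2. (\<Sum>k<7. rho i k * x k) = 0) \<and> (\<forall>i<4. A i = (\<Sum>k<7. eta i k * x k)))"
    and "\<forall>i<2. (\<Sum>k<7. rho i k * h1 k) = 0" "\<forall>i<2. (\<Sum>k<7. rho i k * h2 k) = 0"
    and "\<forall>i<4. (\<Sum>k<7. eta i k * h1 k) = 0" "\<forall>i<4. (\<Sum>k<7. eta i k * h2 k) = 0"
    and "\<forall>i<2. (\<Sum>k<7. rho i k * x k) = 0 \<Longrightarrow> \<forall>i<4. (\<Sum>k<7. eta i k * x k) = 0 \<Longrightarrow>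
      \<exists>z1 z2. \<forall>k<7. x k = z1 * h1 k + z2 * h2 k"
    and "\<forall>k. 4 \<le> k \<and> k < 7 \<longrightarrow> z1 * h1 k + z2 * h2 k = 0 \<Longrightarrow> z1 = 0 \<and> z2 = 0"
proof -
  note S = assms[unfolded syz_system_def]
  show "(\<Sum>i<4. p i * A i) = 0 \<longleftrightarrow>
      (\<exists>x. (\<forall>i<2. (\<Sum>k<7. rho i k * x k) = 0) \<and> (\<forall>i<4. A i = (\<Sum>k<7. eta i k * x k)))"
    using conjunct1[OF S] by (rule spec)
  show "\<forall>i<2. (\<Sum>k<7. rho i k * h1 k) = 0" "\<forall>i<2. (\<Sum>k<7. rho i k * h2 k) = 0"
    using S by - (elim conjE, assumption)+
  show "\<forall>i<4. (\<Sum>k<7. eta i k * h1 k) = 0" "\<forall>i<4. (\<Sum>k<7. eta i k * h2 k) = 0"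
    using S by - (elim conjE, assumption)+
  have "\<forall>x. (\<forall>i<2. (\<Sum>k<7. rho i k * x k) = 0) \<longrightarrow> (\<forall>i<4. (\<Sum>k<7. eta i k * x k) = 0) \<longrightarrow>
       (\<exists>z1 z2. \<forall>k<7. x k = z1 * h1 k + z2 * h2 k)"
    using S by (elim conjE)
  from this[rule_format, of x] show "\<forall>i<2. (\<Sum>k<7. rho i k * x k) = 0 \<Longrightarrow> \<forall>i<4. (\<Sum>k<7. eta i k * x k) = 0 \<Longrightarrow>
      \<exists>z1 z2. \<forall>k<7. x k = z1 * h1 k + z2 * h2 k" by blast
  have "\<forall>z1 z2. (\<forall>k. 4 \<le> k \<and> k < 7 \<longrightarrow> z1 * h1 k + z2 * h2 k = 0) \<longrightarrow> z1 = 0 \<and> z2 = 0"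
    using S by (elim conjE)
  from spec[OF spec[OF this, of z1], of z2]
  show "\<forall>k. 4 \<le> k \<and> k < 7 \<longrightarrow> z1 * h1 k + z2 * h2 k = 0 \<Longrightarrow> z1 = 0 \<and> z2 = 0" by (rule mp)
qed

lemma sum_compose:
  fixes f :: "nat \<Rightarrow> 'a::comm_ring_1"
  shows "(\<Sum>k<n. f k * (\<Sum>j<m. g k j * x j)) = (\<Sum>j<m. (\<Sum>k<n. f k * g k j) * x j)"
  unfolding sum_distrib_left sum_distrib_right by (subst sum.swap) (simp add: mult.assoc)

lemma sum_delta7: "i < 7 \<Longrightarrow> (\<Sum>j<(7::nat). (if i = j then 1 else 0) * x j) = (x i :: 'a::comm_ring_1)"
  by (simp add: if_distrib[of "\<lambda>c. c * _"] cong: if_cong)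

text \<open>Substitution \<open>x = G y\<close> in the unknowns. As \<open>G\<close> is the identity
  in the last three rows, \<open>h1\<close> and \<open>h2\<close> keep their last three entries and
  stay independent there.\<close>

lemma syz_system_base_change:
  fixes p :: "nat \<Rightarrow> 'r::comm_ring_1"
  assumes sys: "syz_system p E eta h1 h2"
    and E: "\<And>i j. i < 2 \<Longrightarrow> j < 7 \<Longrightarrow> E i j = (\<Sum>k<7. rho i k * G k j)"
    and GH: "\<And>i j. i < 7 \<Longrightarrow> j < 7 \<Longrightarrow> (\<Sum>l<7. G i l * H l j) = (if i = j then 1 else 0)"
    and HG: "\<And>i j. i < 7 \<Longrightarrow> j < 7 \<Longrightarrow> (\<Sum>l<7. H i l * G l j) = (if i = j then 1 else 0)"
    and id: "\<And>k j. 4 \<le> k \<Longrightarrow> k < 7 \<Longrightarrow> j < 7 \<Longrightarrow> G k j = (if k = j then 1 else 0)"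
  shows "syz_system p rho (\<lambda>i k. \<Sum>j<7. eta i j * H j k) (\<lambda>k. \<Sum>j<7. G k j * h1 j) (\<lambda>k. \<Sum>j<7. G k j * h2 j)"
proof -
  let ?G = "\<lambda>x k. \<Sum>j<7. G k j * x j"
  let ?H = "\<lambda>x k. \<Sum>j<7. H k j * x j"
  have HGx: "?H (?G x) k = x k" and GHx: "?G (?H x) k = x k" if "k < 7" for x k
    using that by (simp_all add: sum_compose HG GH sum_delta7)
  have rhoG: "(\<Sum>k<7. rho i k * ?G x k) = (\<Sum>k<7. E i k * x k)" if "i < 2" for i x
    unfolding sum_compose by (intro sum.cong) (simp_all add: E that)
  have rhoH: "(\<Sum>k<7. rho i k * x k) = (\<Sum>k<7. E i k * ?H x k)" if "i < 2" for i x
    unfolding rhoG[OF that, symmetric] by (intro sum.cong) (simp_all add: GHx)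
  have etaG: "(\<Sum>k<7. (\<Sum>j<7. eta i j * H j k) * ?G x k) = (\<Sum>k<7. eta i k * x k)" for i x
    unfolding sum_compose[symmetric] by (intro sum.cong) (simp_all add: HGx)
  have etaH: "(\<Sum>k<7. (\<Sum>j<7. eta i j * H j k) * x k) = (\<Sum>k<7. eta i k * ?H x k)" for i x
    unfolding sum_compose[symmetric] ..
  have hG: "?G x k = x k" if "4 \<le> k" "k < 7" for x k
    using that by (simp add: id sum_delta7)
  note S = syz_systemD[OF sys]
  define Eta where "Eta i k = (\<Sum>j<7. eta i j * H j k)" for i k
  note etaG = etaG[folded Eta_def] and etaH = etaH[folded Eta_def]
  define g1 g2 where "g1 = ?G h1" and "g2 = ?G h2"
  have syz: "(\<Sum>i<4. p i * A i) = 0 \<longleftrightarrow>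
      (\<exists>x. (\<forall>i<2. (\<Sum>k<7. rho i k * x k) = 0) \<and> (\<forall>i<4. A i = (\<Sum>k<7. Eta i k * x k)))" for A
    unfolding S(1)
  proof
    assume "\<exists>x. (\<forall>i<2. (\<Sum>k<7. E i k * x k) = 0) \<and> (\<forall>i<4. A i = (\<Sum>k<7. eta i k * x k))"
    then obtain x where x: "\<forall>i<2. (\<Sum>k<7. E i k * x k) = 0" "\<forall>i<4. A i = (\<Sum>k<7. eta i k * x k)" by blast
    define y where "y = ?G x"
    have "\<forall>i<2. (\<Sum>k<7. rho i k * y k) = 0" "\<forall>i<4. A i = (\<Sum>k<7. Eta i k * y k)"
      using x rhoG unfolding y_def etaG by simp_all
    then show "\<exists>x. (\<forall>i<2. (\<Sum>k<7. rho i k * x k) = 0) \<and> (\<forall>i<4. A i = (\<Sum>k<7. Eta i k * x k))" by blast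
  next
    assume "\<exists>x. (\<forall>i<2. (\<Sum>k<7. rho i k * x k) = 0) \<and> (\<forall>i<4. A i = (\<Sum>k<7. Eta i k * x k))"
    then obtain x where x: "\<forall>i<2. (\<Sum>k<7. rho i k * x k) = 0" "\<forall>i<4. A i = (\<Sum>k<7. Eta i k * x k)" by blast
    define y where "y = ?H x"
    have "\<forall>i<2. (\<Sum>k<7. E i k * y k) = 0" "\<forall>i<4. A i = (\<Sum>k<7. eta i k * y k)"
      using x rhoH unfolding y_def etaH[symmetric] by simp_all
    then show "\<exists>x. (\<forall>i<2. (\<Sum>k<7. E i k * x k) = 0) \<and> (\<forall>i<4. A i = (\<Sum>k<7. eta i k * x k))" by blast
  qed
  have h: "\<forall>i<2. (\<Sum>k<7. rho i k * g1 k) = 0" "\<forall>i<2. (\<Sum>k<7. rho i k * g2 k) = 0"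
    "\<forall>i<4. (\<Sum>k<7. Eta i k * g1 k) = 0" "\<forall>i<4. (\<Sum>k<7. Eta i k * g2 k) = 0"
    unfolding g1_def g2_def etaG using S(2-5) rhoG by simp_all
  have ker: "\<exists>z1 z2. \<forall>k<7. x k = z1 * g1 k + z2 * g2 k"
    if x: "\<forall>i<2. (\<Sum>k<7. rho i k * x k) = 0" "\<forall>i<4. (\<Sum>k<7. Eta i k * x k) = 0" for x
  proof -
    define y where "y = ?H x"
    have "\<forall>i<2. (\<Sum>k<7. E i k * y k) = 0" "\<forall>i<4. (\<Sum>k<7. eta i k * y k) = 0"
      using x rhoH unfolding y_def etaH[symmetric] by simp_all
    then obtain z1 z2 where z: "\<forall>k<7. y k = z1 * h1 k + z2 * h2 k" using S(6) by blast
    have "x k = z1 * g1 k + z2 * g2 k" if "k < 7" for k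
    proof -
      have "x k = ?G y k" using GHx[OF that] by (simp add: y_def)
      also have "\<dots> = (\<Sum>j<7. G k j * (z1 * h1 j + z2 * h2 j))" using z by (intro sum.cong) auto
      finally show ?thesis by (simp only: sum_linear g1_def g2_def)
    qed
    then show ?thesis by blast
  qed
  have indep: "z1 = 0 \<and> z2 = 0" if "\<forall>k. 4 \<le> k \<and> k < 7 \<longrightarrow> z1 * g1 k + z2 * g2 k = 0" for z1 z2
  proof (rule S(7), intro allI impI)
    fix k assume k: "4 \<le> k \<and> k < (7::nat)"
    then have "g1 k = h1 k" "g2 k = h2 k" using hG unfolding g1_def g2_def by blast+
    then show "z1 * h1 k + z2 * h2 k = 0" using that k by metis
  qed
  have "syz_system p rho Eta g1 g2"
    unfolding syz_system_def
    by (intro conjI, rule allI, rule syz, rule h(1), rule h(2), rule h(3), rule h(4),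
        intro allI impI, erule (1) ker, intro allI impI, erule indep)
  then show ?thesis unfolding Eta_def g1_def g2_def .
qed

text \<open>Pruning does not tell which two generators of degree (3,2) disappear; the premise
  \<open>list\<close> says that the remaining degrees are the same in every case.\<close>

lemma assemble_system:
  fixes p :: "nat \<Rightarrow> 'k::field bipoly"
  assumes sys: "syz_system p rho eta h1 h2"
    and p: "\<And>i. i < 4 \<Longrightarrow> p i \<in> graded_piece (2, 1)"
    and eta: "\<And>i k. i < 4 \<Longrightarrow> k < 7 \<Longrightarrow> eta i k \<in> graded_piece (hdeg k - (2, 1))"
    and h1: "\<And>k. k < 7 \<Longrightarrow> h1 k \<in> graded_piece ((3, 2) - hdeg k)"
    and h2: "\<And>k. k < 7 \<Longrightarrow> h2 k \<in> graded_piece ((3, 2) - hdeg k)"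
    and gam: "\<And>k j. k < 7 \<Longrightarrow> j < length L2 \<Longrightarrow> gam k j \<in> graded_piece (L2 ! j - hdeg k)"
    and D3: "\<And>i j. i < length L2 \<Longrightarrow> j < length L3 \<Longrightarrow> D3 i j \<in> graded_piece (L3 ! j - L2 ! i)"
    and D4: "\<And>i j. i < length L3 \<Longrightarrow> j < length L4 \<Longrightarrow> D4 i j \<in> graded_piece (L4 ! j - L3 ! i)"
    and ex: "exf 2 7 (length L2) rho gam" "exf 7 (length L2) (length L3) gam D3"
      "exf (length L2) (length L3) (length L4) D3 D4" "exf (length L3) (length L4) 0 D4 D4"
    and col: "\<And>j. j < length L2 \<Longrightarrow> L2 ! j \<noteq> (3, 2) \<Longrightarrow> (\<forall>k. 4 \<le> k \<and> k < 7 \<longrightarrow> gam k j = 0) \<or>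
        fst ((3, 2) - L2 ! j) < 0 \<or> snd ((3, 2) - L2 ! j) < 0"
    and disj: "(2, 1) \<notin> set L2" "set L2 \<inter> set L3 = {}" "set L3 \<inter> set L4 = {}"
    and list: "\<And>r1 r2. r1 < length L2 \<Longrightarrow> r2 < length L2 \<Longrightarrow> r1 \<noteq> r2 \<Longrightarrow> L2 ! r1 = (3, 2) \<Longrightarrow> L2 ! r2 = (3, 2) \<Longrightarrow>
        map ((!) L2) (filter (\<lambda>j. j \<noteq> r1 \<and> j \<noteq> r2) [0..<length L2]) = L2'"
    and type: "n \<in> {1..6}" "type_modules n = [replicate 4 (2, 1), L2', L3, L4]"
  shows "of_numerical_type n (ideal_gen (p ` {..<4}))"
proof -
  obtain r1 r2 d where r: "r1 < length L2" "r2 < length L2" "r1 \<noteq> r2" "L2 ! r1 = (3, 2)" "L2 ! r2 = (3, 2)"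
    and d: "minimal_free_resolution (ideal_gen (p ` {..<4}))
      (free_seq [replicate 4 (2, 1), map ((!) L2) (filter (\<lambda>j. j \<noteq> r1 \<and> j \<noteq> r2) [0..<length L2]), L3, L4]) d"
    using assemble[where p = p and eta = eta and rho = rho and gam = gam and ?D3.0 = D3 and ?D4.0 = D4 and
      ?h1.0 = h1 and ?h2.0 = h2,
        OF p eta gam D3 D4 syz_systemD(1)[OF sys] ex h1 h2 syz_systemD(2-7)[OF sys] col disj] by blast
  show ?thesis unfolding of_numerical_type_def type(2) using d[unfolded list[OF r]] type(1) by blast
qed

text \<open>All copies of \<open>e\<close> stand in one block, so deleting any two of them leaves
  the same list.\<close>

lemma remove_two:
  assumes "e \<notin> set A" "e \<notin> set B" "r1 \<noteq> r2" "r1 < length L" "r2 < length L" "L ! r1 = e" "L ! r2 = e"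
    and L: "L = A @ replicate k e @ B"
  shows "map ((!) L) (filter (\<lambda>j. j \<noteq> r1 \<and> j \<noteq> r2) [0..<length L]) = A @ replicate (k - 2) e @ B"
proof -
  let ?P = "\<lambda>j. j \<noteq> r1 \<and> j \<noteq> r2"
  let ?a = "length A" and ?b = "length A + k"
  have r: "?a \<le> r \<and> r < ?b" if "L ! r = e" "r < length L" for r
  proof (intro conjI; rule ccontr)
    assume "\<not> ?a \<le> r"
    then have "L ! r \<in> set A" unfolding L by (simp add: nth_append)
    then show False using that(1) assms(1) by simp
  next
    assume r: "\<not> r < ?b"
    then obtain d where d: "r = length A + k + d" by (metis le_iff_add not_less)
    then have "L ! r = B ! d" "d < length B" using that(2) unfolding L by (simp_all add: nth_append)
    then have "L ! r \<in> set B" by simp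
    then show False using that(1) assms(2) by simp
  qed
  have r1: "?a \<le> r1" "r1 < ?b" and r2: "?a \<le> r2" "r2 < ?b" using r assms by blast+
  have split: "[0..<length L] = [0..<?a] @ [?a..<?b] @ [?b..<length L]"
  proof -
    have "length L = ?b + length B" by (simp add: L)
    then have "[0..<length L] = [0..<?b] @ [?b..<length L]" by (simp only: upt_add_eq_append[OF le0])
    moreover have "[0..<?b] = [0..<?a] @ [?a..<?b]" by (rule upt_add_eq_append[OF le0])
    ultimately show ?thesis by (simp only: append_assoc)
  qed
  have f1: "filter ?P [0..<?a] = [0..<?a]" and f3: "filter ?P [?b..<length L] = [?b..<length L]"
    using r1 r2 by (auto intro!: filter_True)
  have m1: "map ((!) L) [0..<?a] = A" by (rule nth_equalityI) (auto simp: L nth_append)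
  have m3: "map ((!) L) [?b..<length L] = B"
    by (rule nth_equalityI) (auto simp: L nth_append add.commute)
  have m2: "map ((!) L) (filter ?P [?a..<?b]) = replicate (k - 2) e"
  proof (rule replicate_eqI)
    have "length (filter ?P [?a..<?b]) = card (set (filter ?P [?a..<?b]))"
      by (rule distinct_card[symmetric]) simp
    also have "set (filter ?P [?a..<?b]) = {?a..<?b} - {r1, r2}" by auto
    also have "card \<dots> = k - 2" using r1 r2 assms(3) by (subst card_Diff_subset) auto
    finally show "length (map ((!) L) (filter ?P [?a..<?b])) = k - 2" by simp
    show "y = e" if "y \<in> set (map ((!) L) (filter ?P [?a..<?b]))" for y
      using that by (auto simp: L nth_append)
  qed
  show ?thesis unfolding split filter_append map_append f1 f3 m1 m2 m3 ..
qed

lemma gp_one: "1 \<in> graded_piece 0"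
  using gp_cst[of 1] by (simp add: zero_prod_def)

lemma gp_uminus_iff [simp]: "- p \<in> graded_piece m \<longleftrightarrow> p \<in> graded_piece m"
  using gp_uminus[of p m] gp_uminus[of "- p" m] by auto

definition graded_system :: "(nat \<Rightarrow> 'k::field bipoly) \<Rightarrow> (nat \<Rightarrow> nat \<Rightarrow> 'k bipoly) \<Rightarrow> (nat \<Rightarrow> nat \<Rightarrow> 'k bipoly) \<Rightarrow>
    (nat \<Rightarrow> 'k bipoly) \<Rightarrow> (nat \<Rightarrow> 'k bipoly) \<Rightarrow> bool" where
  "graded_system p rho eta h1 h2 \<longleftrightarrow> syz_system p rho eta h1 h2 \<and> (\<forall>i<4. p i \<in> graded_piece (2, 1)) \<and>
     (\<forall>i<4. \<forall>k<7. eta i k \<in> graded_piece (hdeg k - (2, 1))) \<and>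
     (\<forall>k<7. h1 k \<in> graded_piece ((3, 2) - hdeg k) \<and> h2 k \<in> graded_piece ((3, 2) - hdeg k))"

lemma type_of_graded_system:
  fixes A B L3 L4 :: "(int \<times> int) list" and k :: nat
  defines "L2 \<equiv> A @ replicate k (3, 2) @ B"
  assumes sys: "graded_system p rho eta h1 h2"
    and g: "\<forall>k<7. \<forall>j<length L2. gam k j \<in> graded_piece (L2 ! j - hdeg k)"
    and d: "\<forall>i<length L2. \<forall>j<length L3. D3 i j \<in> graded_piece (L3 ! j - L2 ! i)"
    and e: "\<forall>i<length L3. \<forall>j<length L4. D4 i j \<in> graded_piece (L4 ! j - L3 ! i)"
    and ex: "exf 2 7 (length L2) rho gam" "exf 7 (length L2) (length L3) gam D3"
      "exf (length L2) (length L3) (length L4) D3 D4" "exf (length L3) (length L4) 0 D4 D4"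
    and c: "\<forall>j<length L2. L2 ! j \<noteq> (3, 2) \<longrightarrow> (\<forall>k<7. 4 \<le> k \<longrightarrow> gam k j = 0) \<or>
        fst ((3, 2) - L2 ! j) < 0 \<or> snd ((3, 2) - L2 ! j) < 0"
    and disj: "(2, 1) \<notin> set L2" "set L2 \<inter> set L3 = {}" "set L3 \<inter> set L4 = {}" "(3, 2) \<notin> set A \<union> set B"
    and type: "n \<in> {1..6}" "type_modules n = [replicate 4 (2, 1), A @ replicate (k - 2) (3, 2) @ B, L3, L4]"
  shows "of_numerical_type n (ideal_gen (p ` {..<4}))"
proof -
  have rem: "map ((!) L2) (filter (\<lambda>j. j \<noteq> r1 \<and> j \<noteq> r2) [0..<length L2]) = A @ replicate (k - 2) (3, 2) @ B"
    if "r1 < length L2" "r2 < length L2" "r1 \<noteq> r2" "L2 ! r1 = (3, 2)" "L2 ! r2 = (3, 2)" for r1 r2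
    by (rule remove_two[OF _ _ that(3,1,2,4,5)]) (use disj(4) in \<open>simp_all add: L2_def\<close>)
  have S: "syz_system p rho eta h1 h2" "\<forall>i<4. p i \<in> graded_piece (2, 1)"
    "\<forall>i<4. \<forall>k<7. eta i k \<in> graded_piece (hdeg k - (2, 1))"
    "\<forall>k<7. h1 k \<in> graded_piece ((3, 2) - hdeg k) \<and> h2 k \<in> graded_piece ((3, 2) - hdeg k)"
    using sys unfolding graded_system_def by - (elim conjE, assumption)+
  show ?thesis
    by (rule assemble_system[OF S(1) _ _ _ _ _ _ _ ex _ disj(1-3) rem type])
      (use S(2-4) g d e c in blast)+
qed

section \<open>Types 1 to 4 from systems in normal form\<close>

context coords
begin

lemma gp_products:
  "x \<in> {s, t} \<Longrightarrow> x \<in> graded_piece (1, 0)" "y \<in> {u, v} \<Longrightarrow> y \<in> graded_piece (0, 1)"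
  "x \<in> {s, t} \<Longrightarrow> x' \<in> {s, t} \<Longrightarrow> x * x' \<in> graded_piece (2, 0)"
  "y \<in> {u, v} \<Longrightarrow> y' \<in> {u, v} \<Longrightarrow> y * y' \<in> graded_piece (0, 2)"
  "x \<in> {s, t} \<Longrightarrow> y \<in> {u, v} \<Longrightarrow> x * y \<in> graded_piece (1, 1)"
proof -
  show 1: "x \<in> graded_piece (1, 0)" if "x \<in> {s, t}" for x using that gp_coords by auto
  show 2: "y \<in> graded_piece (0, 1)" if "y \<in> {u, v}" for y using that gp_coords by auto
  show "x \<in> {s, t} \<Longrightarrow> x' \<in> {s, t} \<Longrightarrow> x * x' \<in> graded_piece (2, 0)"
    by (rule gp_mult[OF 1 1]) simp_all
  show "y \<in> {u, v} \<Longrightarrow> y' \<in> {u, v} \<Longrightarrow> y * y' \<in> graded_piece (0, 2)"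
    by (rule gp_mult[OF 2 2]) simp_all
  show "x \<in> {s, t} \<Longrightarrow> y \<in> {u, v} \<Longrightarrow> x * y \<in> graded_piece (1, 1)"
    by (rule gp_mult[OF 1 2]) simp_all
qed

lemmas degree_simps = mt_def hdeg_def eval_nat_numeral All_less_Suc gp_products gp_one

text \<open>The degrees are those of the columns of \<open>gamma1\<close>, \<open>delta1\<close> and
  \<open>epsilon1\<close>; \<open>k\<close> counts the columns of \<open>gamma1\<close> of degree
  (3,2), of which two are pruned.\<close>

lemma type1_of_system:
  assumes "graded_system p (mt rho1) eta h1 h2"
  shows "of_numerical_type 1 (ideal_gen (p ` {..<4}))"
  by (rule type_of_graded_system[OF assms, where A = "[(2, 4)]" and k = 6 and B = "[(4, 1), (4,
    1)]" and ?L3.0 = "[(3, 4), (3, 4), (4, 2), (4, 2), (4, 2)]"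
        and gam = "mt gamma1" and ?D3.0 = "mt delta1" and ?L4.0 = "[(4, 4)]" and ?D4.0 = "mt epsilon1"])
    (use exact1_gamma exact1_delta exact1_epsilon exact1_inj in
      \<open>simp_all add: degree_simps gamma1_def delta1_def epsilon1_def type_modules_def\<close>)

lemma type2_of_system:
  assumes "graded_system p (mt rho2) eta h1 h2"
  shows "of_numerical_type 2 (ideal_gen (p ` {..<4}))"
  by (rule type_of_graded_system[OF assms, where A = "[(2, 3)]" and k = 6 and B = "[(4, 1), (4,
    1)]" and ?L3.0 = "[(3, 3), (3, 3), (4, 2), (4, 2), (4, 2)]"
        and gam = "mt gamma2" and ?D3.0 = "mt delta2" and ?L4.0 = "[(4, 3)]" and ?D4.0 = "mt epsilon2"])
    (use exact2_gamma exact2_delta exact2_epsilon exact2_inj in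
      \<open>simp_all add: degree_simps gamma2_def delta2_def epsilon2_def type_modules_def\<close>)

lemma type3_of_system:
  assumes "graded_system p (mt rho3) eta h1 h2"
  shows "of_numerical_type 3 (ideal_gen (p ` {..<4}))"
  by (rule type_of_graded_system[OF assms, where A = "[(2, 4), (3, 1)]" and k = 4 and B = "[(3, 3), (4, 2),
    (5, 1)]" and ?L3.0 = "[(3, 4), (3, 4), (4, 3), (4, 3), (5, 2), (5, 2)]"
        and gam = "mt gamma3" and ?D3.0 = "mt delta3" and ?L4.0 = "[(4, 4), (5, 3)]" and ?D4.0 = "mt epsilon3"])
    (use exact3_gamma exact3_delta exact3_epsilon exact3_inj in
      \<open>simp_all add: degree_simps gamma3_def delta3_def epsilon3_def type_modules_def\<close>)

lemma type4_of_system: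
  assumes "graded_system p (mt rho4) eta h1 h2"
  shows "of_numerical_type 4 (ideal_gen (p ` {..<4}))"
  by (rule type_of_graded_system[OF assms, where A = "[(2, 3), (3, 1)]" and k = 4 and B = "[(4, 2), (5,
    1)]" and ?L3.0 = "[(3, 3), (4, 3), (5, 2), (5, 2)]"
        and gam = "mt gamma4" and ?D3.0 = "mt delta4" and ?L4.0 = "[(5, 3)]" and ?D4.0 = "mt epsilon4"])
    (use exact4_gamma exact4_delta exact4_epsilon exact4_inj in
      \<open>simp_all add: degree_simps gamma4_def delta4_def epsilon4_def type_modules_def\<close>)

end

section \<open>Hilbert-Burch columns modulo u and v\<close>

lemma (in coords) retraction_uv:
  obtains r where "is_hom r" "\<And>c. r (cst c) = cst c" "r s = s" "r t = t" "r u = 0" "r v = 0"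
    "\<And>p. \<exists>a b. p = r p + u * a + v * b"
proof -
  obtain r f :: "'k bipoly \<Rightarrow> 'k bipoly" where R: "is_hom r" "\<And>c. r (cst c) = cst c" "is_hom f"
    "f var_s = s" "f var_t = t" "f var_u = u" "f var_v = v"
    "r s = f var_s" "r t = f var_t" "r u = f 0" "r v = f 0"
    "\<And>p. \<exists>a b. p = r p + (f var_u * a + f var_v * b)"
    using retraction_aux[OF triv_dec(3)[of var_s var_u var_v] triv_dec(3)[of var_t var_u var_v]
        triv_dec(1)[of var_u var_v] triv_dec(2)[of var_v var_u]] by blast
  show thesis
    by (rule that[of r]) (use R in \<open>simp_all add: is_homD add.assoc\<close>)
qed

lemma hom_fixes_linear:
  assumes "is_hom r" "\<And>c. r (cst c) = cst c" "r var_s = var_s" "r var_t = var_t" "p \<in> graded_piece (1, 0)"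
  shows "r p = p"
  using gp10[OF assms(5)] assms(1-4) by (auto simp: is_homD)

lemma hilbert_burchD:
  assumes "hilbert_burch q0 q1 q2 x0 x1 x2 y0 y1 y2"
  shows "x0 \<in> graded_piece (1, 0)" "x1 \<in> graded_piece (1, 0)" "x2 \<in> graded_piece (1, 0)"
    "y0 \<in> graded_piece (1, 0)" "y1 \<in> graded_piece (1, 0)" "y2 \<in> graded_piece (1, 0)"
    "q0 = x1 * y2 - x2 * y1" "q1 = x2 * y0 - x0 * y2" "q2 = x0 * y1 - x1 * y0" "q0 \<noteq> 0"
    "a0 * q0 + a1 * q1 + a2 * q2 = 0 \<Longrightarrow>
       \<exists>b c. a0 = b * x0 + c * y0 \<and> a1 = b * x1 + c * y1 \<and> a2 = b * x2 + c * y2"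
proof -
  note H = assms[unfolded hilbert_burch_def]
  show "x0 \<in> graded_piece (1, 0)" "x1 \<in> graded_piece (1, 0)" "x2 \<in> graded_piece (1, 0)"
    "y0 \<in> graded_piece (1, 0)" "y1 \<in> graded_piece (1, 0)" "y2 \<in> graded_piece (1, 0)"
    using H by blast+
  show "q0 = x1 * y2 - x2 * y1" "q1 = x2 * y0 - x0 * y2" "q2 = x0 * y1 - x1 * y0" "q0 \<noteq> 0"
    using H by - (elim conjE, assumption)+
  show "a0 * q0 + a1 * q1 + a2 * q2 = 0 \<Longrightarrow>
       \<exists>b c. a0 = b * x0 + c * y0 \<and> a1 = b * x1 + c * y1 \<and> a2 = b * x2 + c * y2"
    using H by blast
qed

text \<open>The last two entries suffice, because their minor is \<open>q0\<close>, which is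
  nonzero.\<close>

lemma hilbert_burch_indep:
  assumes hb: "hilbert_burch q0 q1 q2 x0 x1 x2 y0 y1 y2"
    and eq: "a * x1 + b * y1 = 0" "a * x2 + b * y2 = 0"
  shows "a = 0 \<and> b = 0"
proof -
  have "a * q0 = (a * x1 + b * y1) * y2 - (a * x2 + b * y2) * y1"
    "b * q0 = x1 * (a * x2 + b * y2) - x2 * (a * x1 + b * y1)"
    unfolding hilbert_burchD(7)[OF hb] by (simp_all add: algebra_simps)
  then have "a * q0 = 0" "b * q0 = 0" by (simp_all only: eq mult_zero_left mult_zero_right diff_self)
  then show ?thesis using hilbert_burchD(10)[OF hb] by simp
qed

text \<open>The entries of the columns are forms in \<open>s, t\<close>, hence fixed by the
  retraction that kills \<open>u\<close>; so the columns stay independent modulo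
  \<open>u\<close>.\<close>

lemma hilbert_burch_mod_u:
  assumes c: "coords var_s var_t u v" and hb: "hilbert_burch q0 q1 q2 x0 x1 x2 y0 y1 y2"
    and eq: "a * x0 + b * y0 = u * c0" "a * x1 + b * y1 = u * c1" "a * x2 + b * y2 = u * c2"
  shows "\<exists>a' b'. a = u * a' \<and> b = u * b' \<and> c0 = a' * x0 + b' * y0 \<and> c1 = a' * x1 + b' * y1 \<and>
    c2 = a' * x2 + b' * y2"
proof -
  interpret coords var_s var_t u v by (rule c)
  obtain r where r: "is_hom r" "\<And>c. r (cst c) = cst c" "r var_s = var_s" "r var_t = var_t" "r u = 0"
    "\<And>p. \<exists>a. p = r p + u * a"
    using retraction_u by metis
  note fx = hom_fixes_linear[OF r(1-4)]
  have "r (a * x1 + b * y1) = 0" "r (a * x2 + b * y2) = 0" unfolding eq by (simp_all add: is_homD[OF r(1)] r)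
  then have "r a * x1 + r b * y1 = 0" "r a * x2 + r b * y2 = 0"
    by (simp_all add: is_homD[OF r(1)] fx hilbert_burchD[OF hb])
  then have "r a = 0 \<and> r b = 0" by (rule hilbert_burch_indep[OF hb])
  then obtain a' b' where ab: "a = u * a'" "b = u * b'" using r(6)[of a] r(6)[of b] by auto
  have "u * (a' * x0 + b' * y0) = u * c0" "u * (a' * x1 + b' * y1) = u * c1" "u * (a' * x2 + b' * y2) = u * c2"
    using eq unfolding ab by (simp_all add: algebra_simps)
  then have "c0 = a' * x0 + b' * y0" "c1 = a' * x1 + b' * y1" "c2 = a' * x2 + b' * y2"
    using coords_neq_0 by simp_all
  then show ?thesis using ab by blast
qed

text \<open>Same reason as modulo \<open>u\<close>; this splits the coefficients of an induced
  syzygy into parts at \<open>u\<close> and at \<open>v\<close>.\<close>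

lemma hilbert_burch_mod_uv:
  assumes c: "coords var_s var_t u v" and hb: "hilbert_burch q0 q1 q2 x0 x1 x2 y0 y1 y2"
    and eq: "a * x1 + b * y1 = u * c1 + v * d1" "a * x2 + b * y2 = u * c2 + v * d2"
  shows "\<exists>a0 a1 b0 b1. a = u * a0 + v * a1 \<and> b = u * b0 + v * b1"
proof -
  interpret coords var_s var_t u v by (rule c)
  obtain r where r: "is_hom r" "\<And>c. r (cst c) = cst c" "r var_s = var_s" "r var_t = var_t" "r u = 0" "r v = 0"
    "\<And>p. \<exists>a b. p = r p + u * a + v * b"
    using retraction_uv by metis
  note fx = hom_fixes_linear[OF r(1-4)]
  have "r (a * x1 + b * y1) = 0" "r (a * x2 + b * y2) = 0" unfolding eq by (simp_all add: is_homD[OF r(1)] r)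
  then have "r a * x1 + r b * y1 = 0" "r a * x2 + r b * y2 = 0"
    by (simp_all add: is_homD[OF r(1)] fx hilbert_burchD[OF hb])
  then have "r a = 0 \<and> r b = 0" by (rule hilbert_burch_indep[OF hb])
  then show ?thesis using r(7)[of a] r(7)[of b] by auto
qed

section \<open>Syzygies of the two main normal forms\<close>

text \<open>
  \<open>w0, w1, w2, w3\<close> are the coefficients of \<open>v, v, u, u\<close> in the two coordinates of the syzygy of
  \<open>q0, q1, q2\<close> that a syzygy \<open>A\<close> induces; \<open>k0, k1, k2\<close> measure how far they determine \<open>A\<close>.
\<close>

lemma split_uv:
  assumes c: "coords var_s var_t u v" and "u * A + v * B = (u * a0 + v * a1) * x + (u * b0 + v * b1) * y"
  shows "\<exists>k. A = a0 * x + b0 * y + v * k \<and> B = a1 * x + b1 * y - u * k"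
proof -
  interpret coords var_s var_t u v by (rule c)
  have "u * (A - (a0 * x + b0 * y)) = v * (a1 * x + b1 * y - B)"
    using assms(2) by (simp add: algebra_simps)
  then obtain k where "A - (a0 * x + b0 * y) = v * k" "a1 * x + b1 * y - B = u * k"
    using koszul_uv by blast
  then have "A = a0 * x + b0 * y + v * k \<and> B = a1 * x + b1 * y - u * k" by (simp add: algebra_simps)
  then show ?thesis by blast
qed

text \<open>Sorted by \<open>q0, q1, q2\<close>, a syzygy \<open>A\<close> becomes one of the
  quadrics, with Hilbert-Burch coefficients \<open>a, b\<close>. Its entries vanish modulo
  \<open>u, v\<close>, so \<open>a\<close> and \<open>b\<close> split. \<open>A1\<close> and
  \<open>A2\<close> occur in two entries each; equating their two expressions gives the two
  equations.\<close>

lemma syzygies_L3: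
  assumes c: "coords var_s var_t u v" and hb: "hilbert_burch q0 q1 q2 x0 x1 x2 y0 y1 y2"
  shows "u * q0 * A0 + (v * q0 + u * q1) * A1 + (v * q1 + u * q2) * A2 + v * q2 * A3 = 0 \<longleftrightarrow>
    (\<exists>w0 w1 w2 w3 k0 k1 k2. w0 * x0 + w1 * y0 - w2 * x1 - w3 * y1 - u * k0 - v * k1 = 0 \<and>
       w0 * x1 + w1 * y1 - w2 * x2 - w3 * y2 - u * k1 - v * k2 = 0 \<and>
       A0 = w2 * x0 + w3 * y0 + v * k0 \<and> A1 = w2 * x1 + w3 * y1 + v * k1 \<and>
       A2 = w2 * x2 + w3 * y2 + v * k2 \<and> A3 = w0 * x2 + w1 * y2 - u * k2)" (is "?L \<longleftrightarrow> ?R")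
proof
  assume ?L
  then have "(u * A0 + v * A1) * q0 + (u * A1 + v * A2) * q1 + (u * A2 + v * A3) * q2 = 0"
    by (simp add: algebra_simps)
  then obtain a b where ab: "u * A0 + v * A1 = a * x0 + b * y0" "u * A1 + v * A2 = a * x1 + b * y1"
    "u * A2 + v * A3 = a * x2 + b * y2" using hilbert_burchD(11)[OF hb] by blast
  obtain a0 a1 b0 b1 where e: "a = u * a0 + v * a1" "b = u * b0 + v * b1"
    using hilbert_burch_mod_uv[OF c hb ab(2)[symmetric] ab(3)[symmetric]] by blast
  obtain k0 where k0: "A0 = a0 * x0 + b0 * y0 + v * k0" "A1 = a1 * x0 + b1 * y0 - u * k0"
    using split_uv[OF c ab(1)[unfolded e]] by blast
  obtain k1 where k1: "A1 = a0 * x1 + b0 * y1 + v * k1" "A2 = a1 * x1 + b1 * y1 - u * k1"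
    using split_uv[OF c ab(2)[unfolded e]] by blast
  obtain k2 where k2: "A2 = a0 * x2 + b0 * y2 + v * k2" "A3 = a1 * x2 + b1 * y2 - u * k2"
    using split_uv[OF c ab(3)[unfolded e]] by blast
  have "a1 * x0 + b1 * y0 - a0 * x1 - b0 * y1 - u * k0 - v * k1 = 0"
    "a1 * x1 + b1 * y1 - a0 * x2 - b0 * y2 - u * k1 - v * k2 = 0"
    using k0(2) k1 k2(1) by (simp_all add: algebra_simps)
  then show ?R using k0(1) k1(1) k2 by blast
next
  assume ?R
  then obtain w0 w1 w2 w3 k0 k1 k2 where E: "w0 * x0 + w1 * y0 - w2 * x1 - w3 * y1 - u * k0 - v * k1 = 0"
    "w0 * x1 + w1 * y1 - w2 * x2 - w3 * y2 - u * k1 - v * k2 = 0" and A: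
    "A0 = w2 * x0 + w3 * y0 + v * k0" "A1 = w2 * x1 + w3 * y1 + v * k1"
    "A2 = w2 * x2 + w3 * y2 + v * k2" "A3 = w0 * x2 + w1 * y2 - u * k2" by blast
  \<comment> \<open>With the quadrics written as minors the whole sum is a combination of the two
    equations.\<close>
  have "u * q0 * A0 + (v * q0 + u * q1) * A1 + (v * q1 + u * q2) * A2 + v * q2 * A3
    = - (v * q0 * (w0 * x0 + w1 * y0 - w2 * x1 - w3 * y1 - u * k0 - v * k1))
      - v * q1 * (w0 * x1 + w1 * y1 - w2 * x2 - w3 * y2 - u * k1 - v * k2)"
    unfolding A hilbert_burchD(7-9)[OF hb] by (simp add: algebra_simps)
  then show ?L unfolding E by simp
qed

text \<open>\<open>A3\<close> occurs with \<open>u\<close> only. The summand \<open>v * 0\<close>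
  gives its entry the shape of the others, and the expression found for this zero is the second
  equation.\<close>

lemma syzygies_L2:
  assumes c: "coords var_s var_t u v" and hb: "hilbert_burch q0 q1 q2 x0 x1 x2 y0 y1 y2"
  shows "u * q0 * A0 + (v * q0 + u * q1) * A1 + v * q1 * A2 + u * q2 * A3 = 0 \<longleftrightarrow>
    (\<exists>w0 w1 w2 w3 k0 k1 k2. w0 * x0 + w1 * y0 - w2 * x1 - w3 * y1 - u * k0 - v * k1 = 0 \<and>
       w0 * x2 + w1 * y2 - u * k2 = 0 \<and>
       A0 = w2 * x0 + w3 * y0 + v * k0 \<and> A1 = w2 * x1 + w3 * y1 + v * k1 \<and>
       A2 = w0 * x1 + w1 * y1 - u * k1 \<and> A3 = w2 * x2 + w3 * y2 + v * k2)" (is "?L \<longleftrightarrow> ?R")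
proof
  assume ?L
  then have "(u * A0 + v * A1) * q0 + (u * A1 + v * A2) * q1 + (u * A3 + v * 0) * q2 = 0"
    by (simp add: algebra_simps)
  then obtain a b where ab: "u * A0 + v * A1 = a * x0 + b * y0" "u * A1 + v * A2 = a * x1 + b * y1"
    "u * A3 + v * 0 = a * x2 + b * y2" using hilbert_burchD(11)[OF hb] by blast
  obtain a0 a1 b0 b1 where e: "a = u * a0 + v * a1" "b = u * b0 + v * b1"
    using hilbert_burch_mod_uv[OF c hb ab(2)[symmetric] ab(3)[symmetric]] by blast
  obtain k0 where k0: "A0 = a0 * x0 + b0 * y0 + v * k0" "A1 = a1 * x0 + b1 * y0 - u * k0"
    using split_uv[OF c ab(1)[unfolded e]] by blast
  obtain k1 where k1: "A1 = a0 * x1 + b0 * y1 + v * k1" "A2 = a1 * x1 + b1 * y1 - u * k1"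
    using split_uv[OF c ab(2)[unfolded e]] by blast
  obtain k2 where k2: "A3 = a0 * x2 + b0 * y2 + v * k2" "0 = a1 * x2 + b1 * y2 - u * k2"
    using split_uv[OF c ab(3)[unfolded e]] by blast
  have "a1 * x0 + b1 * y0 - a0 * x1 - b0 * y1 - u * k0 - v * k1 = 0" "a1 * x2 + b1 * y2 - u * k2 = 0"
    using k0(2) k1(1) k2(2) by (simp_all add: algebra_simps)
  then show ?R using k0(1) k1 k2(1) by blast
next
  assume ?R
  then obtain w0 w1 w2 w3 k0 k1 k2 where E: "w0 * x0 + w1 * y0 - w2 * x1 - w3 * y1 - u * k0 - v * k1 = 0"
    "w0 * x2 + w1 * y2 - u * k2 = 0" and A:
    "A0 = w2 * x0 + w3 * y0 + v * k0" "A1 = w2 * x1 + w3 * y1 + v * k1"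
    "A2 = w0 * x1 + w1 * y1 - u * k1" "A3 = w2 * x2 + w3 * y2 + v * k2" by blast
  have "u * q0 * A0 + (v * q0 + u * q1) * A1 + v * q1 * A2 + u * q2 * A3
    = - (v * q0 * (w0 * x0 + w1 * y0 - w2 * x1 - w3 * y1 - u * k0 - v * k1))
      - v * q2 * (w0 * x2 + w1 * y2 - u * k2)"
    unfolding A hilbert_burchD(7-9)[OF hb] by (simp add: algebra_simps)
  then show ?L unfolding E by simp
qed

text \<open>A decomposition \<open>a = u * a0 + v * a1\<close> is unique up to
  \<open>z * (v, -u)\<close>, and for the zero syzygy there is no other freedom: one
  \<open>z\<close> for each Hilbert-Burch column.\<close>

lemma ambiguity:
  assumes c: "coords var_s var_t u v" and hb: "hilbert_burch q0 q1 q2 x0 x1 x2 y0 y1 y2"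
    and 0: "w2 * x0 + w3 * y0 + v * k0 = 0" "w2 * x1 + w3 * y1 + v * k1 = 0" "w2 * x2 + w3 * y2 + v * k2 = 0"
    and 1: "w0 * x0 + w1 * y0 - u * k0 = 0" "w0 * x1 + w1 * y1 - u * k1 = 0" "w0 * x2 + w1 * y2 - u * k2 = 0"
  shows "\<exists>z1 z2. w0 = - (z1 * u) \<and> w1 = - (z2 * u) \<and> w2 = z1 * v \<and> w3 = z2 * v \<and>
    k0 = - (z1 * x0 + z2 * y0) \<and> k1 = - (z1 * x1 + z2 * y1) \<and> k2 = - (z1 * x2 + z2 * y2)"
proof -
  interpret coords var_s var_t u v by (rule c)
  have "w2 * x0 + w3 * y0 = v * (- k0)" "w2 * x1 + w3 * y1 = v * (- k1)" "w2 * x2 + w3 * y2 = v * (- k2)"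
    using 0 by (simp_all add: eq_neg_iff_add_eq_0)
  then obtain z1 z2 where z: "w2 = v * z1" "w3 = v * z2" "- k0 = z1 * x0 + z2 * y0" "- k1 = z1 * x1 + z2 * y1"
    "- k2 = z1 * x2 + z2 * y2"
    using hilbert_burch_mod_u[OF coords_swap_uv hb] by metis
  have k: "k0 = - (z1 * x0 + z2 * y0)" "k1 = - (z1 * x1 + z2 * y1)" "k2 = - (z1 * x2 + z2 * y2)"
    using z(3-5) by (metis minus_minus)+
  have "(w0 + u * z1) * x1 + (w1 + u * z2) * y1 = 0" "(w0 + u * z1) * x2 + (w1 + u * z2) * y2 = 0"
    using 1(2,3) unfolding k by (simp_all add: algebra_simps)
  then have "w0 + u * z1 = 0 \<and> w1 + u * z2 = 0" by (rule hilbert_burch_indep[OF hb])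
  then have "w0 = - (z1 * u)" "w1 = - (z2 * u)" by (simp_all add: eq_neg_iff_add_eq_0 mult.commute)
  then show ?thesis using z(1,2) k by (metis mult.commute)
qed

text \<open>The block matrix that transforms the unknowns \<open>a0, ..., a3\<close> by constants
  and leaves \<open>y0, y1, y2\<close> alone.\<close>

definition block :: "(nat \<Rightarrow> nat \<Rightarrow> 'k::field) \<Rightarrow> nat \<Rightarrow> nat \<Rightarrow> 'k bipoly" where
  "block G i j = (if i < 4 \<and> j < 4 then cst (G i j) else if i = j then 1 else 0)"

lemma block_gp: "block G i j \<in> graded_piece (hdeg j - hdeg i)"
  using gp_cst[of "G i j"] gp_one by (auto simp: block_def hdeg_def zero_prod_def)

lemma sum7: "(\<Sum>l<7. f l) = f 0 + f 1 + f 2 + f 3 + f 4 + f 5 + f (6::nat)"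
  by (simp add: eval_nat_numeral)

lemma block_inverse:
  fixes G H :: "nat \<Rightarrow> nat \<Rightarrow> 'k::field"
  assumes "\<forall>i<4. \<forall>j<4. (\<Sum>l<4. G i l * H l j) = (if i = j then 1 else 0)" "i < 7" "j < 7"
  shows "(\<Sum>l<7. block G i l * block H l j) = (if i = j then 1 else 0)"
proof (cases "i < 4")
  case True
  have z: "block G i 4 = 0" "block G i 5 = 0" "block G i 6 = 0" using True by (simp_all add: block_def)
  show ?thesis
  proof (cases "j < 4")
    case j: True
    have "(\<Sum>l<7. block G i l * block H l j) = cst (\<Sum>l<4. G i l * H l j)"
      using True j by (simp add: sum7 sum4 z cst_hom) (simp add: block_def)
    then show ?thesis using assms(1) True j by simp
  next
    case j: False
    have "block H 0 j = 0" "block H 1 j = 0" "block H 2 j = 0" "block H 3 j = 0" using j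
      by (auto simp: block_def)
    then show ?thesis using True j by (auto simp: sum7 z)
  qed
next
  case False
  have "block G i l = (if i = l then 1 else 0)" for l using False by (simp add: block_def)
  then have "(\<Sum>l<7. block G i l * block H l j) = block H i j" using sum_delta7[OF assms(2)] by simp
  then show ?thesis using False by (simp add: block_def)
qed

lemma graded_system_base_change:
  fixes G H :: "nat \<Rightarrow> nat \<Rightarrow> 'k::field"
  assumes sys: "graded_system p E eta h1 h2" and inv: "inverse4 G H"
    and E4: "\<And>i k. i < 2 \<Longrightarrow> 4 \<le> k \<Longrightarrow> k < 7 \<Longrightarrow> E i k = rho i k"
    and E: "\<And>i j. i < 2 \<Longrightarrow> j < 4 \<Longrightarrow>
      E i j = rho i 0 * cst (G 0 j) + rho i 1 * cst (G 1 j) + rho i 2 * cst (G 2 j) + rho i 3 * cst (G 3 j)"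
  shows "graded_system p rho (\<lambda>i k. \<Sum>j<7. eta i j * block H j k) (\<lambda>k. \<Sum>j<7. block G k j * h1 j)
      (\<lambda>k. \<Sum>j<7. block G k j * h2 j)"
proof -
  have S: "syz_system p E eta h1 h2" "\<forall>i<4. p i \<in> graded_piece (2, 1)"
    "\<forall>i<4. \<forall>k<7. eta i k \<in> graded_piece (hdeg k - (2, 1))"
    "\<forall>k<7. h1 k \<in> graded_piece ((3, 2) - hdeg k) \<and> h2 k \<in> graded_piece ((3, 2) - hdeg k)"
    using sys unfolding graded_system_def by - (elim conjE, assumption)+
  have "syz_system p rho (\<lambda>i k. \<Sum>j<7. eta i j * block H j k) (\<lambda>k. \<Sum>j<7. block G k j * h1 j) (\<lambda>k. \<Sum>j<7. block G
    k j * h2 j)"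
  proof (rule syz_system_base_change[OF S(1)])
    show "E i j = (\<Sum>k<7. rho i k * block G k j)" if "i < 2" "j < 7" for i j
    proof (cases "j < 4")
      case True
      then show ?thesis by (simp add: E[OF that(1)] sum7 block_def)
    next
      case False
      then have "j = 4 \<or> j = 5 \<or> j = 6" using that by auto
      then show ?thesis using E4[OF that(1) _ that(2)] by (auto simp: sum7 block_def)
    qed
    show "(\<Sum>l<7. block G i l * block H l j) = (if i = j then 1 else 0)"
      "(\<Sum>l<7. block H i l * block G l j) = (if i = j then 1 else 0)" if "i < 7" "j < 7" for i j
      using block_inverse[OF _ that] inv unfolding inverse4_def by blast+
    show "block G k j = (if k = j then 1 else 0)" if "4 \<le> k" "k < 7" "j < 7" for k j
      using that by (simp add: block_def)
  qed
  moreover have "(\<Sum>j<7. eta i j * block H j k) \<in> graded_piece (hdeg k - (2, 1))" if "i < 4" for i k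
    by (intro gp_sum gp_mult[OF S(3)[rule_format, OF that] block_gp]) auto
  moreover have "(\<Sum>j<7. block G k j * h1 j) \<in> graded_piece ((3, 2) - hdeg k)"
    "(\<Sum>j<7. block G k j * h2 j) \<in> graded_piece ((3, 2) - hdeg k)" for k
    by (intro gp_sum gp_mult[OF block_gp conjunct1[OF S(4)[rule_format]]] gp_mult[OF block_gp conjunct2[OF
      S(4)[rule_format]]]; auto)+
  ultimately show ?thesis unfolding graded_system_def using S(2) by blast
qed

text \<open>The last three columns separate types 1, 3 from types 2, 4; the two shapes of the pencil
  separate 1 from 3 and 2 from 4. Hence \<open>n\<close> and \<open>n + 2\<close>.\<close>

lemma type_of_pencil:
  fixes p :: "nat \<Rightarrow> 'k::alg_closed_field bipoly" and m :: "nat \<Rightarrow> nat \<Rightarrow> 'k"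
  assumes c: "coords var_s var_t u v"
    and sys: "graded_system p E eta h1 h2"
    and E: "\<And>k. k < 4 \<Longrightarrow> E 0 k = cst (m 0 k) * var_s + cst (m 1 k) * var_t"
      "\<And>k. k < 4 \<Longrightarrow> E 1 k = cst (m 2 k) * var_s + cst (m 3 k) * var_t"
    and E0: "E 0 4 = - u" "E 0 5 = - v" "E 0 6 = 0" "E 1 4 = 0"
    and E1: "E 1 5 = - u \<and> E 1 6 = - v \<and> n = 1 \<or> E 1 5 = 0 \<and> E 1 6 = - u \<and> n = 2"
    and nondeg: "\<forall>e f x y. (e \<noteq> 0 \<or> f \<noteq> 0) \<and> (x \<noteq> 0 \<or> y \<noteq> 0) \<longrightarrow>
     (\<exists>j<4. e * (m 0 j * x + m 1 j * y) + f * (m 2 j * x + m 3 j * y) \<noteq> 0)"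
  shows "of_numerical_type n (ideal_gen (p ` {..<4})) \<or> of_numerical_type (n + 2) (ideal_gen (p ` {..<4}))"
proof -
  have uv: "is_basis2 var_u var_v u v" using c by (simp add: coords_def)
  have k4: "k = 4 \<or> k = 5 \<or> k = 6" if "4 \<le> k" "k < 7" for k :: nat using that by auto
  have i2: "i = 0 \<or> i = 1" if "i < 2" for i :: nat using that by auto
  note transfer = graded_system_base_change[OF sys]
  from pencil_cases[OF nondeg] show ?thesis
  proof (elim disjE exE conjE)
    \<comment> \<open>An invertible coefficient matrix is itself the base change: the rows
      \<open>(s, t, 0, 0)\<close> and \<open>(0, 0, s, t)\<close> times \<open>m\<close> are the
      pencil.\<close>
    fix H assume inv: "inverse4 m H"
    interpret coords var_s var_t u v by (rule c)
    show ?thesis using E1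
    proof (elim disjE conjE)
      assume n: "E 1 5 = - u" "E 1 6 = - v" "n = 1"
      have "of_numerical_type 1 (ideal_gen (p ` {..<4}))"
        by (rule type1_of_system[OF transfer[OF inv]]; drule i2; (drule (1) k4)?)
          (use E E0 n in \<open>auto simp: rho1_def mt_def mult.commute\<close>)
      then show ?thesis using n by simp
    next
      assume n: "E 1 5 = 0" "E 1 6 = - u" "n = 2"
      have "of_numerical_type 2 (ideal_gen (p ` {..<4}))"
        by (rule type2_of_system[OF transfer[OF inv]]; drule i2; (drule (1) k4)?)
          (use E E0 n in \<open>auto simp: rho2_def mt_def mult.commute\<close>)
      then show ?thesis using n by simp
    qed
  next
    \<comment> \<open>Here the rows are \<open>(s, t, 0, 0)\<close> and \<open>(0, s, t, 0)\<close>
      in new coordinates; the fourth row of \<open>G\<close> meets only zeros.\<close>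
    fix s t :: "'k bipoly" and G H
    assume st: "is_basis2 var_s var_t s t" and inv: "inverse4 G H" and
      eq: "\<forall>j<4. cst (m 0 j) * var_s + cst (m 1 j) * var_t = cst (G 0 j) * s + cst (G 1 j) * t \<and>
             cst (m 2 j) * var_s + cst (m 3 j) * var_t = cst (G 1 j) * s + cst (G 2 j) * t"
    interpret coords s t u v using st uv by (simp add: coords_def)
    show ?thesis using E1
    proof (elim disjE conjE)
      assume n: "E 1 5 = - u" "E 1 6 = - v" "n = 1"
      have "of_numerical_type 3 (ideal_gen (p ` {..<4}))"
        by (rule type3_of_system[OF transfer[OF inv]]; drule i2; (drule (1) k4)?)
          (use E E0 n eq in \<open>auto simp: rho3_def mt_def mult.commute\<close>)
      then show ?thesis using n by (simp add: numeral_3_eq_3)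
    next
      assume n: "E 1 5 = 0" "E 1 6 = - u" "n = 2"
      have "of_numerical_type 4 (ideal_gen (p ` {..<4}))"
        by (rule type4_of_system[OF transfer[OF inv]]; drule i2; (drule (1) k4)?)
          (use E E0 n eq in \<open>auto simp: rho4_def mt_def mult.commute\<close>)
      then show ?thesis using n by simp
    qed
  qed
qed

section \<open>Types of the two main normal forms\<close>

lemma syz_systemI:
  fixes p h1 h2 :: "nat \<Rightarrow> 'r::comm_ring_1"
  assumes syz: "\<And>A. (\<Sum>i<4. p i * A i) = 0 \<longleftrightarrow> (\<exists>w0 w1 w2 w3 w4 w5 w6.
      (\<forall>i<2. rho i 0 * w0 + rho i 1 * w1 + rho i 2 * w2 + rho i 3 * w3 + rho i 4 * w4 + rho i 5 * w5 + rho i 6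
        * w6 = 0) \<and>
      (\<forall>i<4. A i = eta i 0 * w0 + eta i 1 * w1 + eta i 2 * w2 + eta i 3 * w3 + eta i 4 * w4 + eta i 5 * w5 +
        eta i 6 * w6))"
    and amb: "\<And>w0 w1 w2 w3 w4 w5 w6.
      (\<forall>i<2. rho i 0 * w0 + rho i 1 * w1 + rho i 2 * w2 + rho i 3 * w3 + rho i 4 * w4 + rho i 5 * w5 + rho i 6
        * w6 = 0) \<Longrightarrow>
      (\<forall>i<4. eta i 0 * w0 + eta i 1 * w1 + eta i 2 * w2 + eta i 3 * w3 + eta i 4 * w4 + eta i 5 * w5 + eta i 6
        * w6 = 0) \<Longrightarrow>
      (\<exists>z1 z2. w0 = z1 * h1 0 + z2 * h2 0 \<and> w1 = z1 * h1 1 + z2 * h2 1 \<and> w2 = z1 * h1 2 + z2 * h2 2 \<and>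
         w3 = z1 * h1 3 + z2 * h2 3 \<and> w4 = z1 * h1 4 + z2 * h2 4 \<and> w5 = z1 * h1 5 + z2 * h2 5 \<and>
           w6 = z1 * h1 6 + z2 * h2 6)"
    and h: "\<forall>i<2. (\<Sum>k<7. rho i k * h1 k) = 0" "\<forall>i<2. (\<Sum>k<7. rho i k * h2 k) = 0"
      "\<forall>i<4. (\<Sum>k<7. eta i k * h1 k) = 0" "\<forall>i<4. (\<Sum>k<7. eta i k * h2 k) = 0"
    and indep: "\<And>z1 z2. z1 * h1 4 + z2 * h2 4 = 0 \<Longrightarrow> z1 * h1 5 + z2 * h2 5 = 0 \<Longrightarrow> z1 * h1 6 + z2 * h2 6 = 0 \<Longrightarrow>
      z1 = 0 \<and> z2 = 0"
  shows "syz_system p rho eta h1 h2"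
proof -
  have 1: "(\<Sum>i<4. p i * A i) = 0 \<longleftrightarrow>
       (\<exists>x. (\<forall>i<2. (\<Sum>k<7. rho i k * x k) = 0) \<and> (\<forall>i<4. A i = (\<Sum>k<7. eta i k * x k)))" for A
    unfolding syz sum7
  proof (intro iffI; elim exE)
    fix w0 w1 w2 w3 w4 w5 w6 :: 'r
    let ?x = "\<lambda>k. [w0, w1, w2, w3, w4, w5, w6] ! k"
    assume "(\<forall>i<2. rho i 0 * w0 + rho i 1 * w1 + rho i 2 * w2 + rho i 3 * w3 + rho i 4 * w4 + rho i 5 * w5 +
      rho i 6 * w6 = 0) \<and>
      (\<forall>i<4. A i = eta i 0 * w0 + eta i 1 * w1 + eta i 2 * w2 + eta i 3 * w3 + eta i 4 * w4 + eta i 5 * w5 +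
        eta i 6 * w6)"
    then show "\<exists>x :: nat \<Rightarrow> 'r. (\<forall>i<2. rho i 0 * x 0 + rho i 1 * x 1 + rho i 2 * x 2 + rho i 3 * x 3 + rho i 4
      * x 4 + rho i 5 * x 5 + rho i 6 * x 6 = 0) \<and>
      (\<forall>i<4. A i = eta i 0 * x 0 + eta i 1 * x 1 + eta i 2 * x 2 + eta i 3 * x 3 + eta i 4 * x 4 + eta i 5 * x
        5 + eta i 6 * x 6)"
      by (intro exI[of _ ?x]) simp
  next
    fix x :: "nat \<Rightarrow> 'r"
    assume "(\<forall>i<2. rho i 0 * x 0 + rho i 1 * x 1 + rho i 2 * x 2 + rho i 3 * x 3 + rho i 4 * x 4 + rho i 5 * x
      5 + rho i 6 * x 6 = 0) \<and>
      (\<forall>i<4. A i = eta i 0 * x 0 + eta i 1 * x 1 + eta i 2 * x 2 + eta i 3 * x 3 + eta i 4 * x 4 + eta i 5 * x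
        5 + eta i 6 * x 6)"
    then show "\<exists>w0 w1 w2 w3 w4 w5 w6.
      (\<forall>i<2. rho i 0 * w0 + rho i 1 * w1 + rho i 2 * w2 + rho i 3 * w3 + rho i 4 * w4 + rho i 5 * w5 + rho i 6
        * w6 = 0) \<and>
      (\<forall>i<4. A i = eta i 0 * w0 + eta i 1 * w1 + eta i 2 * w2 + eta i 3 * w3 + eta i 4 * w4 + eta i 5 * w5 +
        eta i 6 * w6)"
      by (rule_tac exI, rule_tac exI, rule_tac exI, rule_tac exI, rule_tac exI, rule_tac exI, rule_tac exI)
  qed
  have 2: "\<exists>z1 z2. \<forall>k<7. x k = z1 * h1 k + z2 * h2 k"
    if x: "\<forall>i<2. (\<Sum>k<7. rho i k * x k) = 0" "\<forall>i<4. (\<Sum>k<7. eta i k * x k) = 0" for x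
  proof -
    obtain z1 z2 where z: "x 0 = z1 * h1 0 + z2 * h2 0 \<and> x 1 = z1 * h1 1 + z2 * h2 1 \<and>
      x 2 = z1 * h1 2 + z2 * h2 2 \<and>
         x 3 = z1 * h1 3 + z2 * h2 3 \<and> x 4 = z1 * h1 4 + z2 * h2 4 \<and> x 5 = z1 * h1 5 + z2 * h2 5 \<and>
           x 6 = z1 * h1 6 + z2 * h2 6"
      using amb[OF x[unfolded sum7]] by (elim exE)
    have "\<forall>k<7. x k = z1 * h1 k + z2 * h2 k"
      using z by (simp add: eval_nat_numeral All_less_Suc)
    then show ?thesis by (intro exI)
  qed
  have 3: "z1 = 0 \<and> z2 = 0" if "\<forall>k. 4 \<le> k \<and> k < 7 \<longrightarrow> z1 * h1 k + z2 * h2 k = 0" for z1 z2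
    by (rule indep) (use that in simp_all)
  show ?thesis unfolding syz_system_def
    by (intro conjI, rule allI, rule 1, rule h(1), rule h(2), rule h(3), rule h(4),
        intro allI impI, erule (1) 2, intro allI impI, erule 3)
qed

text \<open>Cramer's rule expresses \<open>x * x\<close> and \<open>y * y\<close> by the values of
  the three quadrics.\<close>

lemma is_basis3_no_zero:
  assumes "is_basis3 q0 q1 q2" "ev (\<lambda>x. x) x y z w q0 = 0" "ev (\<lambda>x. x) x y z w q1 = 0"
    "ev (\<lambda>x. x) x y z w q2 = 0"
  shows "x = 0 \<and> y = 0"
proof -
  obtain a0 a1 a2 b0 b1 b2 c0 c1 c2 where
    D: "a0 * (b1 * c2 - b2 * c1) + a1 * (b2 * c0 - b0 * c2) + a2 * (b0 * c1 - b1 * c0) \<noteq> 0" (is "?D \<noteq> 0")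
    and q: "q0 = quad a0 a1 a2" "q1 = quad b0 b1 b2" "q2 = quad c0 c1 c2"
    using assms(1) unfolding is_basis3_def by blast
  have e: "ev (\<lambda>x. x) x y z w (quad a b c) = a * (x * x) + b * (x * y) + c * (y * y)" for a b c
    unfolding quad_def using ev_vars[OF is_hom_id, of x y z w]
    by (simp add: ev_add is_hom_id ev_mult ev_cst)
  define P Q T where "P = a0 * (x * x) + a1 * (x * y) + a2 * (y * y)" and "Q = b0 * (x * x) + b1 * (x * y) +
    b2 * (y * y)"
    and "T = c0 * (x * x) + c1 * (x * y) + c2 * (y * y)"
  have 0: "P = 0" "Q = 0" "T = 0" using assms(2-4) unfolding q e P_def Q_def T_def .
  have "?D * (x * x) = P * (b1 * c2 - b2 * c1) + Q * (c1 * a2 - c2 * a1) + T * (a1 * b2 - a2 * b1)"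
    "?D * (y * y) = P * (b0 * c1 - b1 * c0) + Q * (c0 * a1 - c1 * a0) + T * (a0 * b1 - a1 * b0)"
    unfolding P_def Q_def T_def by (simp_all add: algebra_simps)
  then have "?D * (x * x) = 0" "?D * (y * y) = 0" unfolding 0 by simp_all
  then show ?thesis using D by simp
qed

lemma is_basis3_gp:
  assumes "is_basis3 p q r"
  shows "p \<in> graded_piece (2, 0)" "q \<in> graded_piece (2, 0)" "r \<in> graded_piece (2, 0)"
  using assms quad_gp unfolding is_basis3_def by blast+

lemma hilbert_burch_coefficients:
  assumes "hilbert_burch q0 q1 q2 x0 x1 x2 y0 y1 y2"
  obtains a0 a1 a2 b0 b1 b2 c0 c1 c2 d0 d1 d2 where
    "x0 = cst a0 * var_s + cst b0 * var_t" "x1 = cst a1 * var_s + cst b1 * var_t"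
      "x2 = cst a2 * var_s + cst b2 * var_t"
    "y0 = cst c0 * var_s + cst d0 * var_t" "y1 = cst c1 * var_s + cst d1 * var_t"
      "y2 = cst c2 * var_s + cst d2 * var_t"
  using gp10[OF hilbert_burchD(1)[OF assms]] gp10[OF hilbert_burchD(2)[OF assms]] gp10[OF hilbert_burchD(3)[OF
    assms]]
    gp10[OF hilbert_burchD(4)[OF assms]] gp10[OF hilbert_burchD(5)[OF assms]] gp10[OF hilbert_burchD(6)[OF
      assms]]
  by (elim exE)

text \<open>Successive vectors \<open>(X, Y)\<close> satisfy the same linear relation, so all three
  lie on one line and every minor vanishes.\<close>

lemma common_zero_of_minors:
  fixes e f :: "'a::idom"
  assumes "e \<noteq> 0 \<or> f \<noteq> 0" "e * X0 + f * X1 = 0" "e * Y0 + f * Y1 = 0" "e * X1 + f * X2 = 0"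
    "e * Y1 + f * Y2 = 0"
  shows "X1 * Y2 - X2 * Y1 = 0" "X2 * Y0 - X0 * Y2 = 0" "X0 * Y1 - X1 * Y0 = 0"
proof -
  have 1: "e * (X1 * Y2 - X2 * Y1) = (e * X1 + f * X2) * Y2 - X2 * (e * Y1 + f * Y2)"
    "f * (X1 * Y2 - X2 * Y1) = X1 * (e * Y1 + f * Y2) - (e * X1 + f * X2) * Y1"
    "e * (X0 * Y1 - X1 * Y0) = (e * X0 + f * X1) * Y1 - X1 * (e * Y0 + f * Y1)"
    "f * (X0 * Y1 - X1 * Y0) = X0 * (e * Y0 + f * Y1) - (e * X0 + f * X1) * Y0"
    by (simp_all add: algebra_simps)
  show 2: "X1 * Y2 - X2 * Y1 = 0" and 3: "X0 * Y1 - X1 * Y0 = 0" using 1 assms by auto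
  \<comment> \<open>The outer two vectors are related only through the middle one; their minor is
    reduced to the other two.\<close>
  have "e * (X2 * Y0 - X0 * Y2) = X2 * (e * Y0 + f * Y1) - (e * X0 + f * X1) * Y2 + f * (X1 * Y2 - X2 * Y1)"
    "f * (X2 * Y0 - X0 * Y2) = (e * X1 + f * X2) * Y0 - X0 * (e * Y1 + f * Y2) + e * (X0 * Y1 - X1 * Y0)"
    by (simp_all add: algebra_simps)
  then show "X2 * Y0 - X0 * Y2 = 0" using 2 3 assms by auto
qed

text \<open>At a degenerate point of the pencil all minors of the Hilbert-Burch matrix vanish, but
  these are \<open>q0, q1, q2\<close>, which form a basis of the quadrics.\<close>

lemma type_L3:
  fixes q0 q1 q2 u v :: "'k::alg_closed_field bipoly"
  assumes c: "coords var_s var_t u v" and q: "is_basis3 q0 q1 q2"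
  shows "of_numerical_type 1 (ideal_gen {u * q0, v * q0 + u * q1, v * q1 + u * q2, v * q2}) \<or>
    of_numerical_type 3 (ideal_gen {u * q0, v * q0 + u * q1, v * q1 + u * q2, v * q2})"
proof -
  interpret coords var_s var_t u v by (rule c)
  obtain x0 x1 x2 y0 y1 y2 where hb: "hilbert_burch q0 q1 q2 x0 x1 x2 y0 y1 y2"
    using hilbert_burch_exists[OF q] by blast
  obtain a0 a1 a2 b0 b1 b2 c0 c1 c2 d0 d1 d2 where
    lin: "x0 = cst a0 * var_s + cst b0 * var_t" "x1 = cst a1 * var_s + cst b1 * var_t"
      "x2 = cst a2 * var_s + cst b2 * var_t"
    "y0 = cst c0 * var_s + cst d0 * var_t" "y1 = cst c1 * var_s + cst d1 * var_t"
      "y2 = cst c2 * var_s + cst d2 * var_t"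
    by (rule hilbert_burch_coefficients[OF hb])
  \<comment> \<open>Coefficients of \<open>s\<close> and of \<open>t\<close> in the first equation,
    then in the second, at the first four unknowns.\<close>
  define M where "M = [[a0, c0, - a1, - c1], [b0, d0, - b1, - d1], [a1, c1, - a2, - c2], [b1, d1, - b2, - d2]]"
  define p where "p = [u * q0, v * q0 + u * q1, v * q1 + u * q2, v * q2]"
  define E where "E = [[x0, y0, - x1, - y1, - u, - v, 0], [x1, y1, - x2, - y2, 0, - u, - v]]"
  define eta where "eta = [[0, 0, x0, y0, v, 0, 0], [0, 0, x1, y1, 0, v, 0], [0, 0, x2, y2, 0, 0, v], [x2, y2,
    0, 0, 0, 0, - u]]"
  \<comment> \<open>The two solutions that represent the zero syzygy, one for each Hilbert-Burch
    column.\<close>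
  define h1 h2 where "h1 = [- u, 0, v, 0, - x0, - x1, - x2]" and "h2 = [0, - u, 0, v, - y0, - y1, - y2]"
  note hbD = hilbert_burchD[OF hb]
  have sys: "syz_system (\<lambda>i. p ! i) (mt E) (mt eta) (\<lambda>i. h1 ! i) (\<lambda>i. h2 ! i)"
  proof (rule syz_systemI)
    fix A :: "nat \<Rightarrow> 'k bipoly"
    have *: "(\<Sum>i<4. p ! i * A i) = u * q0 * A 0 + (v * q0 + u * q1) * A 1 + (v * q1 + u * q2) * A 2 + v * q2 *
      A 3"
      by (simp add: sum4 p_def)
    show "(\<Sum>i<4. p ! i * A i) = 0 \<longleftrightarrow> (\<exists>w0 w1 w2 w3 w4 w5 w6.
      (\<forall>i<2. mt E i 0 * w0 + mt E i 1 * w1 + mt E i 2 * w2 + mt E i 3 * w3 + mt E i 4 * w4 + mt E i 5 * w5 +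
        mt E i 6 * w6 = 0) \<and>
      (\<forall>i<4. A i = mt eta i 0 * w0 + mt eta i 1 * w1 + mt eta i 2 * w2 + mt eta i 3 * w3 + mt eta i 4 * w4 +
        mt eta i 5 * w5 + mt eta i 6 * w6))"
      unfolding * syzygies_L3[OF c hb]
      by (simp add: mt_def E_def eta_def eval_nat_numeral All_less_Suc mult.commute conj_ac)
  next
    fix w0 w1 w2 w3 w4 w5 w6
    assume "(\<forall>i<2. mt E i 0 * w0 + mt E i 1 * w1 + mt E i 2 * w2 + mt E i 3 * w3 + mt E i 4 * w4 + mt E i 5 *
      w5 + mt E i 6 * w6 = 0)"
      "(\<forall>i<4. mt eta i 0 * w0 + mt eta i 1 * w1 + mt eta i 2 * w2 + mt eta i 3 * w3 + mt eta i 4 * w4 + mt eta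
        i 5 * w5 + mt eta i 6 * w6 = 0)"
    then have 1: "w0 * x0 + w1 * y0 - w2 * x1 - w3 * y1 - u * w4 - v * w5 = 0"
      "w0 * x1 + w1 * y1 - w2 * x2 - w3 * y2 - u * w5 - v * w6 = 0"
      "w2 * x0 + w3 * y0 + v * w4 = 0" "w2 * x1 + w3 * y1 + v * w5 = 0" "w2 * x2 + w3 * y2 + v * w6 = 0"
      "w0 * x2 + w1 * y2 - u * w6 = 0"
      by (simp_all add: mt_def E_def eta_def eval_nat_numeral All_less_Suc mult.commute)
    \<comment> \<open>Adding the vanishing expressions for \<open>A1\<close> and \<open>A2\<close>
      to the equations yields the conditions with \<open>u\<close> that \<open>ambiguity\<close>
      asks for.\<close>
    have "w0 * x0 + w1 * y0 - u * w4 = (w0 * x0 + w1 * y0 - w2 * x1 - w3 * y1 - u * w4 - v * w5) + (w2 * x1 +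
      w3 * y1 + v * w5)"
      "w0 * x1 + w1 * y1 - u * w5 = (w0 * x1 + w1 * y1 - w2 * x2 - w3 * y2 - u * w5 - v * w6) + (w2 * x2 + w3
        * y2 + v * w6)"
      by (simp_all add: algebra_simps)
    then have 2: "w0 * x0 + w1 * y0 - u * w4 = 0" "w0 * x1 + w1 * y1 - u * w5 = 0" unfolding 1 by simp_all
    obtain z1 z2 where "w0 = - (z1 * u) \<and> w1 = - (z2 * u) \<and> w2 = z1 * v \<and> w3 = z2 * v \<and>
      w4 = - (z1 * x0 + z2 * y0) \<and> w5 = - (z1 * x1 + z2 * y1) \<and> w6 = - (z1 * x2 + z2 * y2)"
      using ambiguity[OF c hb 1(3-5) 2 1(6)] by (elim exE)
    then show "\<exists>z1 z2. w0 = z1 * h1 ! 0 + z2 * h2 ! 0 \<and> w1 = z1 * h1 ! 1 + z2 * h2 ! 1 \<and>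
      w2 = z1 * h1 ! 2 + z2 * h2 ! 2 \<and>
         w3 = z1 * h1 ! 3 + z2 * h2 ! 3 \<and> w4 = z1 * h1 ! 4 + z2 * h2 ! 4 \<and> w5 = z1 * h1 ! 5 + z2 * h2 ! 5 \<and>
           w6 = z1 * h1 ! 6 + z2 * h2 ! 6"
      by (intro exI[of _ z1] exI[of _ z2]) (simp add: h1_def h2_def)
  next
    show "\<forall>i<2. (\<Sum>k<7. mt E i k * h1 ! k) = 0" "\<forall>i<2. (\<Sum>k<7. mt E i k * h2 ! k) = 0"
      "\<forall>i<4. (\<Sum>k<7. mt eta i k * h1 ! k) = 0" "\<forall>i<4. (\<Sum>k<7. mt eta i k * h2 ! k) = 0"
      by (simp_all add: sum7 All_less_Suc eval_nat_numeral mt_def E_def eta_def h1_def h2_def algebra_simps)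
  next
    fix z1 z2 assume "z1 * h1 ! 5 + z2 * h2 ! 5 = 0" "z1 * h1 ! 6 + z2 * h2 ! 6 = 0"
    then have "- (z1 * x1 + z2 * y1) = 0" "- (z1 * x2 + z2 * y2) = 0" by (simp_all add: h1_def h2_def)
    then have "z1 * x1 + z2 * y1 = 0" "z1 * x2 + z2 * y2 = 0" by (simp_all only: neg_equal_0_iff_equal)
    then show "z1 = 0 \<and> z2 = 0" by (rule hilbert_burch_indep[OF hb])
  qed
  have nondeg: "\<forall>e f x y. (e \<noteq> 0 \<or> f \<noteq> 0) \<and> (x \<noteq> 0 \<or> y \<noteq> 0) \<longrightarrow>
     (\<exists>j<4. e * (mt M 0 j * x + mt M 1 j * y) + f * (mt M 2 j * x + mt M 3 j * y) \<noteq> 0)"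
  proof (intro allI impI, rule ccontr)
    fix e f x y
    assume ef: "(e \<noteq> 0 \<or> f \<noteq> 0) \<and> (x \<noteq> 0 \<or> y \<noteq> 0)"
      and "\<not> (\<exists>j<4. e * (mt M 0 j * x + mt M 1 j * y) + f * (mt M 2 j * x + mt M 3 j * y) \<noteq> 0)"
    then have z: "\<forall>j<4. e * (mt M 0 j * x + mt M 1 j * y) + f * (mt M 2 j * x + mt M 3 j * y) = 0" by blast
    define X0 X1 X2 Y0 Y1 Y2 where "X0 = a0 * x + b0 * y" "X1 = a1 * x + b1 * y" "X2 = a2 * x + b2 * y"
      "Y0 = c0 * x + d0 * y" "Y1 = c1 * x + d1 * y" "Y2 = c2 * x + d2 * y"
    note XY = this
    have "e * X0 + f * X1 = 0" "e * Y0 + f * Y1 = 0" "e * X1 + f * X2 = 0" "e * Y1 + f * Y2 = 0"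
      using z unfolding XY by (simp_all add: mt_def M_def eval_nat_numeral All_less_Suc algebra_simps
        eq_neg_iff_add_eq_0 neg_eq_iff_add_eq_0)
    note 0 = common_zero_of_minors[OF conjunct1[OF ef] this]
    have e: "ev (\<lambda>x. x) x y 0 0 (cst a * var_s + cst b * var_t) = a * x + b * y" for a b
      using ev_vars[OF is_hom_id, of x y 0 0] by (simp add: ev_add is_hom_id ev_mult ev_cst)
    note ho = is_homD[OF is_hom_ev[OF is_hom_id, of x y 0 0]]
    have "x = 0 \<and> y = 0"
      by (rule is_basis3_no_zero[OF q, of x y 0 0]; unfold hbD(7-9) ho(4,6) lin e) (rule 0[unfolded XY])+
    then show False using ef by simp
  qed
  have gsys: "graded_system (\<lambda>i. p ! i) (mt E) (mt eta) (\<lambda>i. h1 ! i) (\<lambda>i. h2 ! i)"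
    unfolding graded_system_def
  proof (intro conjI sys)
    show "\<forall>i<4. p ! i \<in> graded_piece (2, 1)"
      by (simp add: p_def eval_nat_numeral All_less_Suc gp_add gp_mult[OF gp_coords(3) is_basis3_gp(1)[OF q]]
        gp_mult[OF gp_coords(3) is_basis3_gp(2)[OF q]] gp_mult[OF gp_coords(3) is_basis3_gp(3)[OF q]]
        gp_mult[OF gp_coords(4) is_basis3_gp(1)[OF q]] gp_mult[OF gp_coords(4) is_basis3_gp(2)[OF q]]
          gp_mult[OF gp_coords(4) is_basis3_gp(3)[OF q]])
    show "\<forall>i<4. \<forall>k<7. mt eta i k \<in> graded_piece (hdeg k - (2, 1))"
      by (simp add: mt_def eta_def hdeg_def eval_nat_numeral All_less_Suc gp_coords hbD(1-6))
    show "\<forall>k<7. h1 ! k \<in> graded_piece ((3, 2) - hdeg k) \<and> h2 ! k \<in> graded_piece ((3, 2) - hdeg k)"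
      by (simp add: h1_def h2_def hdeg_def eval_nat_numeral All_less_Suc gp_coords hbD(1-6))
  qed
  have "of_numerical_type 1 (ideal_gen ((!) p ` {..<4})) \<or> of_numerical_type (1 + 2) (ideal_gen ((!) p `
    {..<4}))"
  proof (rule type_of_pencil[OF c gsys _ _ _ _ _ _ _ nondeg])
    show "mt E 0 k = cst (mt M 0 k) * var_s + cst (mt M 1 k) * var_t"
      "mt E 1 k = cst (mt M 2 k) * var_s + cst (mt M 3 k) * var_t" if "k < 4" for k
      using that by (auto simp: less_Suc_eq eval_nat_numeral mt_def E_def M_def lin cst_hom)
  qed (simp_all add: mt_def E_def)
  moreover have "(!) p ` {..<4} = {u * q0, v * q0 + u * q1, v * q1 + u * q2, v * q2}"
    by (simp add: p_def eval_nat_numeral lessThan_Suc insert_commute)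
  ultimately show ?thesis by (simp add: numeral_3_eq_3)
qed

text \<open>Degenerate points are of two kinds. For \<open>e = 0\<close> the third row of the
  Hilbert-Burch matrix vanishes, hence also \<open>q0\<close> and \<open>q1\<close>, which
  \<open>cop\<close> excludes. Otherwise all three minors vanish.\<close>

lemma type_L2:
  fixes q0 q1 q2 u v :: "'k::alg_closed_field bipoly"
  assumes c: "coords var_s var_t u v" and q: "is_basis3 q0 q1 q2"
    and cop: "\<And>x y. ev (\<lambda>x. x) x y 0 0 q0 = 0 \<Longrightarrow> ev (\<lambda>x. x) x y 0 0 q1 = 0 \<Longrightarrow> x = 0 \<and> y = 0"
  shows "of_numerical_type 2 (ideal_gen {u * q0, v * q0 + u * q1, v * q1, u * q2}) \<or>
    of_numerical_type 4 (ideal_gen {u * q0, v * q0 + u * q1, v * q1, u * q2})"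
proof -
  interpret coords var_s var_t u v by (rule c)
  obtain x0 x1 x2 y0 y1 y2 where hb: "hilbert_burch q0 q1 q2 x0 x1 x2 y0 y1 y2"
    using hilbert_burch_exists[OF q] by blast
  obtain a0 a1 a2 b0 b1 b2 c0 c1 c2 d0 d1 d2 where
    lin: "x0 = cst a0 * var_s + cst b0 * var_t" "x1 = cst a1 * var_s + cst b1 * var_t"
      "x2 = cst a2 * var_s + cst b2 * var_t"
    "y0 = cst c0 * var_s + cst d0 * var_t" "y1 = cst c1 * var_s + cst d1 * var_t"
      "y2 = cst c2 * var_s + cst d2 * var_t"
    by (rule hilbert_burch_coefficients[OF hb])
  define M where "M = [[a0, c0, - a1, - c1], [b0, d0, - b1, - d1], [a2, c2, 0, 0], [b2, d2, 0, 0]]"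
  define p where "p = [u * q0, v * q0 + u * q1, v * q1, u * q2]"
  define E where "E = [[x0, y0, - x1, - y1, - u, - v, 0], [x2, y2, 0, 0, 0, 0, - u]]"
  define eta where "eta = [[0, 0, x0, y0, v, 0, 0], [0, 0, x1, y1, 0, v, 0], [x1, y1, 0, 0, 0, - u, 0], [0, 0,
    x2, y2, 0, 0, v]]"
  define h1 h2 where "h1 = [- u, 0, v, 0, - x0, - x1, - x2]" and "h2 = [0, - u, 0, v, - y0, - y1, - y2]"
  note hbD = hilbert_burchD[OF hb]
  have sys: "syz_system (\<lambda>i. p ! i) (mt E) (mt eta) (\<lambda>i. h1 ! i) (\<lambda>i. h2 ! i)"
  proof (rule syz_systemI)
    fix A :: "nat \<Rightarrow> 'k bipoly"
    have *: "(\<Sum>i<4. p ! i * A i) = u * q0 * A 0 + (v * q0 + u * q1) * A 1 + v * q1 * A 2 + u * q2 * A 3"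
      by (simp add: sum4 p_def)
    show "(\<Sum>i<4. p ! i * A i) = 0 \<longleftrightarrow> (\<exists>w0 w1 w2 w3 w4 w5 w6.
      (\<forall>i<2. mt E i 0 * w0 + mt E i 1 * w1 + mt E i 2 * w2 + mt E i 3 * w3 + mt E i 4 * w4 + mt E i 5 * w5 +
        mt E i 6 * w6 = 0) \<and>
      (\<forall>i<4. A i = mt eta i 0 * w0 + mt eta i 1 * w1 + mt eta i 2 * w2 + mt eta i 3 * w3 + mt eta i 4 * w4 +
        mt eta i 5 * w5 + mt eta i 6 * w6))"
      unfolding * syzygies_L2[OF c hb]
      by (simp add: mt_def E_def eta_def eval_nat_numeral All_less_Suc mult.commute conj_ac)
  next
    fix w0 w1 w2 w3 w4 w5 w6
    assume "(\<forall>i<2. mt E i 0 * w0 + mt E i 1 * w1 + mt E i 2 * w2 + mt E i 3 * w3 + mt E i 4 * w4 + mt E i 5 *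
      w5 + mt E i 6 * w6 = 0)"
      "(\<forall>i<4. mt eta i 0 * w0 + mt eta i 1 * w1 + mt eta i 2 * w2 + mt eta i 3 * w3 + mt eta i 4 * w4 + mt eta
        i 5 * w5 + mt eta i 6 * w6 = 0)"
    then have 1: "w0 * x0 + w1 * y0 - w2 * x1 - w3 * y1 - u * w4 - v * w5 = 0"
      "w2 * x0 + w3 * y0 + v * w4 = 0" "w2 * x1 + w3 * y1 + v * w5 = 0" "w2 * x2 + w3 * y2 + v * w6 = 0"
      "w0 * x1 + w1 * y1 - u * w5 = 0" "w0 * x2 + w1 * y2 - u * w6 = 0"
      by (simp_all add: mt_def E_def eta_def eval_nat_numeral All_less_Suc mult.commute)
    have "w0 * x0 + w1 * y0 - u * w4 = (w0 * x0 + w1 * y0 - w2 * x1 - w3 * y1 - u * w4 - v * w5) + (w2 * x1 +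
      w3 * y1 + v * w5)"
      by (simp add: algebra_simps)
    then have 2: "w0 * x0 + w1 * y0 - u * w4 = 0" unfolding 1 by simp
    obtain z1 z2 where "w0 = - (z1 * u) \<and> w1 = - (z2 * u) \<and> w2 = z1 * v \<and> w3 = z2 * v \<and>
      w4 = - (z1 * x0 + z2 * y0) \<and> w5 = - (z1 * x1 + z2 * y1) \<and> w6 = - (z1 * x2 + z2 * y2)"
      using ambiguity[OF c hb 1(2-4) 2 1(5,6)] by (elim exE)
    then show "\<exists>z1 z2. w0 = z1 * h1 ! 0 + z2 * h2 ! 0 \<and> w1 = z1 * h1 ! 1 + z2 * h2 ! 1 \<and>
      w2 = z1 * h1 ! 2 + z2 * h2 ! 2 \<and>
         w3 = z1 * h1 ! 3 + z2 * h2 ! 3 \<and> w4 = z1 * h1 ! 4 + z2 * h2 ! 4 \<and> w5 = z1 * h1 ! 5 + z2 * h2 ! 5 \<and>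
           w6 = z1 * h1 ! 6 + z2 * h2 ! 6"
      by (intro exI[of _ z1] exI[of _ z2]) (simp add: h1_def h2_def)
  next
    show "\<forall>i<2. (\<Sum>k<7. mt E i k * h1 ! k) = 0" "\<forall>i<2. (\<Sum>k<7. mt E i k * h2 ! k) = 0"
      "\<forall>i<4. (\<Sum>k<7. mt eta i k * h1 ! k) = 0" "\<forall>i<4. (\<Sum>k<7. mt eta i k * h2 ! k) = 0"
      by (simp_all add: sum7 All_less_Suc eval_nat_numeral mt_def E_def eta_def h1_def h2_def algebra_simps)
  next
    fix z1 z2 assume "z1 * h1 ! 5 + z2 * h2 ! 5 = 0" "z1 * h1 ! 6 + z2 * h2 ! 6 = 0"
    then have "- (z1 * x1 + z2 * y1) = 0" "- (z1 * x2 + z2 * y2) = 0" by (simp_all add: h1_def h2_def)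
    then have "z1 * x1 + z2 * y1 = 0" "z1 * x2 + z2 * y2 = 0" by (simp_all only: neg_equal_0_iff_equal)
    then show "z1 = 0 \<and> z2 = 0" by (rule hilbert_burch_indep[OF hb])
  qed
  have nondeg: "\<forall>e f x y. (e \<noteq> 0 \<or> f \<noteq> 0) \<and> (x \<noteq> 0 \<or> y \<noteq> 0) \<longrightarrow>
     (\<exists>j<4. e * (mt M 0 j * x + mt M 1 j * y) + f * (mt M 2 j * x + mt M 3 j * y) \<noteq> 0)"
  proof (intro allI impI, rule ccontr)
    fix e f x y
    assume ef: "(e \<noteq> 0 \<or> f \<noteq> 0) \<and> (x \<noteq> 0 \<or> y \<noteq> 0)"
      and "\<not> (\<exists>j<4. e * (mt M 0 j * x + mt M 1 j * y) + f * (mt M 2 j * x + mt M 3 j * y) \<noteq> 0)"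
    then have z: "\<forall>j<4. e * (mt M 0 j * x + mt M 1 j * y) + f * (mt M 2 j * x + mt M 3 j * y) = 0" by blast
    define X0 X1 X2 Y0 Y1 Y2 where "X0 = a0 * x + b0 * y" "X1 = a1 * x + b1 * y" "X2 = a2 * x + b2 * y"
      "Y0 = c0 * x + d0 * y" "Y1 = c1 * x + d1 * y" "Y2 = c2 * x + d2 * y"
    note XY = this
    have 0: "e * X0 + f * X2 = 0" "e * Y0 + f * Y2 = 0" "e * X1 = 0" "e * Y1 = 0"
      using z unfolding XY by (simp_all add: mt_def M_def eval_nat_numeral All_less_Suc algebra_simps
        eq_neg_iff_add_eq_0 neg_eq_iff_add_eq_0)
    have e: "ev (\<lambda>x. x) x y 0 0 (cst a * var_s + cst b * var_t) = a * x + b * y" for a b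
      using ev_vars[OF is_hom_id, of x y 0 0] by (simp add: ev_add is_hom_id ev_mult ev_cst)
    note ho = is_homD[OF is_hom_ev[OF is_hom_id, of x y 0 0]]
    have "x = 0 \<and> y = 0"
    proof (cases "e = 0")
      case True
      then have "X2 = 0" "Y2 = 0" using 0 ef by simp_all
      then have "X1 * Y2 - X2 * Y1 = 0" "X2 * Y0 - X0 * Y2 = 0" by simp_all
      then show ?thesis by (intro cop; unfold hbD(7,8) ho(4,6) lin e XY)
    next
      case False
      then have "X1 = 0" "Y1 = 0" using 0 by simp_all
      moreover have "e * (X2 * Y0 - X0 * Y2) = X2 * (e * Y0 + f * Y2) - (e * X0 + f * X2) * Y2"
        by (simp add: algebra_simps)
      ultimately have "X1 * Y2 - X2 * Y1 = 0" "X2 * Y0 - X0 * Y2 = 0" "X0 * Y1 - X1 * Y0 = 0" using 0 False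
        by simp_all
      then show ?thesis by (intro is_basis3_no_zero[OF q, of x y 0 0]; unfold hbD(7-9) ho(4,6) lin e XY)
    qed
    then show False using ef by simp
  qed
  have gsys: "graded_system (\<lambda>i. p ! i) (mt E) (mt eta) (\<lambda>i. h1 ! i) (\<lambda>i. h2 ! i)"
    unfolding graded_system_def
  proof (intro conjI sys)
    show "\<forall>i<4. p ! i \<in> graded_piece (2, 1)"
      by (simp add: p_def eval_nat_numeral All_less_Suc gp_add gp_mult[OF gp_coords(3) is_basis3_gp(1)[OF q]]
        gp_mult[OF gp_coords(3) is_basis3_gp(2)[OF q]] gp_mult[OF gp_coords(3) is_basis3_gp(3)[OF q]]
        gp_mult[OF gp_coords(4) is_basis3_gp(1)[OF q]] gp_mult[OF gp_coords(4) is_basis3_gp(2)[OF q]]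
          gp_mult[OF gp_coords(4) is_basis3_gp(3)[OF q]])
    show "\<forall>i<4. \<forall>k<7. mt eta i k \<in> graded_piece (hdeg k - (2, 1))"
      by (simp add: mt_def eta_def hdeg_def eval_nat_numeral All_less_Suc gp_coords hbD(1-6))
    show "\<forall>k<7. h1 ! k \<in> graded_piece ((3, 2) - hdeg k) \<and> h2 ! k \<in> graded_piece ((3, 2) - hdeg k)"
      by (simp add: h1_def h2_def hdeg_def eval_nat_numeral All_less_Suc gp_coords hbD(1-6))
  qed
  have "of_numerical_type 2 (ideal_gen ((!) p ` {..<4})) \<or> of_numerical_type (2 + 2) (ideal_gen ((!) p `
    {..<4}))"
  proof (rule type_of_pencil[OF c gsys _ _ _ _ _ _ _ nondeg])
    show "mt E 0 k = cst (mt M 0 k) * var_s + cst (mt M 1 k) * var_t"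
      "mt E 1 k = cst (mt M 2 k) * var_s + cst (mt M 3 k) * var_t" if "k < 4" for k
      using that by (auto simp: less_Suc_eq eval_nat_numeral mt_def E_def M_def lin cst_hom)
  qed (simp_all add: mt_def E_def)
  moreover have "(!) p ` {..<4} = {u * q0, v * q0 + u * q1, v * q1, u * q2}"
    by (simp add: p_def eval_nat_numeral lessThan_Suc insert_commute)
  ultimately show ?thesis by (simp add: )
qed

section \<open>Types 5 and 6\<close>

lemma hom_fixes_quadric:
  assumes "is_hom r" "\<And>c. r (cst c) = cst c" "r var_s = var_s" "r var_t = var_t" "q \<in> graded_piece (2, 0)"
  shows "r q = q"
  using gp20[OF assms(5)] assms(1-4) by (auto simp: is_homD power2_eq_square)

text \<open>The Koszul relation of \<open>s, t\<close> after killing \<open>u\<close>, lifted back;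
  the remaining factor \<open>u\<close> cancels.\<close>

lemma (in coords) koszul_mod_u:
  assumes "b * s + c * t = u * A"
  shows "\<exists>z b' c'. b = t * z + u * b' \<and> c = u * c' - s * z \<and> A = b' * s + c' * t"
proof -
  obtain r where r: "is_hom r" "r s = s" "r t = t" "r u = 0" "\<And>p. \<exists>a. p = r p + u * a"
    using retraction_u by metis
  have "r (b * s + c * t) = 0" unfolding assms by (simp add: is_homD[OF r(1)] r)
  then have "s * r b + t * r c = 0" by (simp add: is_homD[OF r(1)] r mult.commute)
  then obtain z where z: "r b = t * z" "r c = - (s * z)" using koszul_st0 by blast
  obtain b' c' where bc: "b = t * z + u * b'" "c = u * c' - s * z"
    using r(5)[of b] r(5)[of c] unfolding z by (auto simp: algebra_simps)
  have "u * A = u * (b' * s + c' * t)" using assms unfolding bc by (simp add: algebra_simps)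
  then have "A = b' * s + c' * t" using coords_neq_0(3) by simp
  then show ?thesis using bc by blast
qed

text \<open>A quadric in \<open>s, t\<close> is fixed by the retraction that kills
  \<open>u, v\<close>, so it stays a nonzerodivisor there.\<close>

lemma quadric_mod_uv:
  assumes c: "coords var_s var_t u v" and q: "q \<in> graded_piece (2, 0)" "q \<noteq> 0" and eq: "b * q = u * x + v * y"
  shows "\<exists>b1 b2. b = u * b1 + v * b2"
proof -
  interpret coords var_s var_t u v by (rule c)
  obtain r where r: "is_hom r" "\<And>c. r (cst c) = cst c" "r var_s = var_s" "r var_t = var_t" "r u = 0" "r v = 0"
    "\<And>p. \<exists>a b. p = r p + u * a + v * b"
    using retraction_uv by metis
  have "r (b * q) = 0" unfolding eq by (simp add: is_homD[OF r(1)] r)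
  then have "r b = 0" using q(2) by (simp add: is_homD[OF r(1)] hom_fixes_quadric[OF r(1-4) q(1)])
  then show ?thesis using r(7)[of b] by auto
qed

lemma quadric_mod_u:
  assumes c: "coords var_s var_t u v" and q: "q \<in> graded_piece (2, 0)" "q \<noteq> 0" and eq: "b * q = u * x"
  shows "\<exists>c. b = u * c \<and> x = c * q"
proof -
  interpret coords var_s var_t u v by (rule c)
  obtain r where r: "is_hom r" "\<And>c. r (cst c) = cst c" "r var_s = var_s" "r var_t = var_t" "r u = 0"
    "\<And>p. \<exists>a. p = r p + u * a"
    using retraction_u by metis
  have "r (b * q) = 0" unfolding eq by (simp add: is_homD[OF r(1)] r)
  then have "r b = 0" using q(2) by (simp add: is_homD[OF r(1)] hom_fixes_quadric[OF r(1-4) q(1)])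
  then obtain c where b: "b = u * c" using r(6)[of b] by auto
  then have "u * (c * q) = u * x" using eq by (simp add: mult.assoc)
  then show ?thesis using b coords_neq_0(3) by auto
qed

text \<open>If the determinant were zero, \<open>(b, -a)\<close> and \<open>(d, -c)\<close> would be
  common zeros; so all coefficients would vanish, and \<open>(1, 0)\<close> would be one.\<close>

lemma is_basis2_of_no_common_zero:
  assumes "X = cst a * var_s + cst b * var_t" "Y = cst c * var_s + cst d * var_t"
    and "\<And>x y. a * x + b * y = 0 \<Longrightarrow> c * x + d * y = 0 \<Longrightarrow> x = 0 \<and> y = 0"
  shows "is_basis2 var_s var_t X Y"
proof -
  have "a * d - b * c \<noteq> 0"
  proof
    assume 0: "a * d - b * c = 0"
    then have "b = 0 \<and> - a = 0" "d = 0 \<and> - c = 0"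
      by (intro assms(3); simp add: algebra_simps)+
    then show False using assms(3)[of 1 0] by simp
  qed
  then show ?thesis using assms(1,2) unfolding is_basis2_def by blast
qed

text \<open>\<open>q0\<close> and \<open>q1\<close> are the minors that contain the row
  \<open>(x2, y2)\<close> and vanish wherever it does; likewise \<open>q0, q2\<close> and the row
  \<open>(x1, y1)\<close>. Coprime quadrics thus turn such a row into a pair of coordinates, with
  Koszul relations of its own.\<close>

lemma hilbert_burch_basis2:
  assumes hb: "hilbert_burch q0 q1 q2 x0 x1 x2 y0 y1 y2"
  shows "(\<And>x y. ev (\<lambda>x. x) x y 0 0 q0 = 0 \<Longrightarrow> ev (\<lambda>x. x) x y 0 0 q1 = 0 \<Longrightarrow> x = 0 \<and> y = 0) \<Longrightarrow>
    is_basis2 var_s var_t x2 y2"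
    and "(\<And>x y. ev (\<lambda>x. x) x y 0 0 q0 = 0 \<Longrightarrow> ev (\<lambda>x. x) x y 0 0 q2 = 0 \<Longrightarrow> x = 0 \<and> y = 0) \<Longrightarrow>
      is_basis2 var_s var_t x1 y1"
proof -
  obtain a0 a1 a2 b0 b1 b2 c0 c1 c2 d0 d1 d2 where
    lin: "x0 = cst a0 * var_s + cst b0 * var_t" "x1 = cst a1 * var_s + cst b1 * var_t"
      "x2 = cst a2 * var_s + cst b2 * var_t"
    "y0 = cst c0 * var_s + cst d0 * var_t" "y1 = cst c1 * var_s + cst d1 * var_t"
      "y2 = cst c2 * var_s + cst d2 * var_t"
    by (rule hilbert_burch_coefficients[OF hb])
  note hbD = hilbert_burchD[OF hb]
  have e: "ev (\<lambda>x. x) x y 0 0 (cst a * var_s + cst b * var_t) = a * x + b * y" for a b x y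
    using ev_vars[OF is_hom_id, of x y 0 0] by (simp add: ev_add is_hom_id ev_mult ev_cst)
  note ho = is_homD[OF is_hom_ev[OF is_hom_id]]
  show "is_basis2 var_s var_t x2 y2"
    if cop: "\<And>x y. ev (\<lambda>x. x) x y 0 0 q0 = 0 \<Longrightarrow> ev (\<lambda>x. x) x y 0 0 q1 = 0 \<Longrightarrow> x = 0 \<and> y = 0"
  proof (rule is_basis2_of_no_common_zero[OF lin(3,6)])
    show "x = 0 \<and> y = 0" if "a2 * x + b2 * y = 0" "c2 * x + d2 * y = 0" for x y
      by (rule cop; simp only: hbD(7,8) ho(4,6) lin e that; simp)
  qed
  show "is_basis2 var_s var_t x1 y1"
    if cop: "\<And>x y. ev (\<lambda>x. x) x y 0 0 q0 = 0 \<Longrightarrow> ev (\<lambda>x. x) x y 0 0 q2 = 0 \<Longrightarrow> x = 0 \<and> y = 0"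
  proof (rule is_basis2_of_no_common_zero[OF lin(2,5)])
    show "x = 0 \<and> y = 0" if "a1 * x + b1 * y = 0" "c1 * x + d1 * y = 0" for x y
      by (rule cop; simp only: hbD(7,9) ho(4,6) lin e that; simp)
  qed
qed

text \<open>The second entry of the induced syzygy is divisible by \<open>u\<close>, the third by
  \<open>v\<close>, and each is solved by a Koszul step in its own coordinates \<open>x1, y1\<close>
  or \<open>x2, y2\<close>. The first multiplier \<open>z\<close> lies in the ideal of
  \<open>u, v\<close> because \<open>z * q0\<close> does.\<close>

lemma syzygies_5a:
  assumes c: "coords var_s var_t u v" and hb: "hilbert_burch q0 q1 q2 x0 x1 x2 y0 y1 y2"
    and b1: "is_basis2 var_s var_t x1 y1" and b2: "is_basis2 var_s var_t x2 y2" and q: "q0 \<in> graded_piece (2,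
      0)"
    and eq: "u * q0 * A0 + v * q0 * A1 + u * q1 * A2 + v * q2 * A3 = 0"
  shows "\<exists>w0 w1 w2 w3 w4. A0 = v * w0 + v * x0 * w1 + v * y0 * w2 - q1 * w3 \<and> A1 = q2 * w4 - u * w0 \<and>
    A2 = v * x1 * w1 + v * y1 * w2 + q0 * w3 \<and> A3 = u * x2 * w1 + u * y2 * w2 - q0 * w4"
proof -
  interpret coords var_s var_t u v by (rule c)
  have uv: "is_basis2 var_u var_v u v" using c by (simp add: coords_def)
  interpret c1: coords x1 y1 u v using b1 uv by (simp add: coords_def)
  interpret c2: coords x2 y2 v u using b2 is_basis2_swap[OF uv] by (simp add: coords_def)
  note hbD = hilbert_burchD[OF hb]
  have "(u * A0 + v * A1) * q0 + (u * A2) * q1 + (v * A3) * q2 = 0" using eq by (simp add: algebra_simps)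
  then obtain b c where bc: "u * A0 + v * A1 = b * x0 + c * y0" "u * A2 = b * x1 + c * y1"
    "v * A3 = b * x2 + c * y2"
    using hbD(11) by blast
  obtain z b' c' where z: "b = y1 * z + u * b'" "c = u * c' - x1 * z" "A2 = b' * x1 + c' * y1"
    using c1.koszul_mod_u[OF bc(2)[symmetric]] by blast
  have "z * q0 = u * (b' * x2 + c' * y2) + v * (- A3)" using bc(3) unfolding z hbD(7)
    by (simp add: algebra_simps)
  then obtain z1 z2 where z': "z = u * z1 + v * z2" using quadric_mod_uv[OF c q hbD(10)] by blast
  \<comment> \<open>The part \<open>u * z1\<close> of \<open>z\<close> is absorbed here; only
    \<open>v * z2\<close> is left.\<close>
  define b1 c1 where "b1 = b' + y1 * z1" and "c1 = c' - x1 * z1"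
  have e: "b = y1 * (v * z2) + u * b1" "c = u * c1 - x1 * (v * z2)" "A2 = b1 * x1 + c1 * y1"
    unfolding b1_def c1_def z z' by (simp_all add: algebra_simps)
  have "u * (b1 * x2 + c1 * y2) = v * (A3 + z2 * q0)" using bc(3) unfolding e hbD(7)
    by (simp add: algebra_simps)
  then obtain g where g: "b1 * x2 + c1 * y2 = v * g" "A3 + z2 * q0 = u * g" using koszul_uv by blast
  obtain w b2 c2 where w: "b1 = y2 * w + v * b2" "c1 = v * c2 - x2 * w" "g = b2 * x2 + c2 * y2"
    using c2.koszul_mod_u[OF g(1)] by blast
  have A3: "A3 = u * (b2 * x2 + c2 * y2) - z2 * q0" using g(2) unfolding w by (simp add: algebra_simps)
  have A2: "A2 = w * q0 + v * (b2 * x1 + c2 * y1)" unfolding e w hbD(7) by (simp add: algebra_simps)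
  have "u * (A0 + w * q1 - v * (b2 * x0 + c2 * y0)) = v * (z2 * q2 - A1)"
    using bc(1) unfolding e w hbD(8,9) by (simp add: algebra_simps)
  then obtain d where d: "A0 + w * q1 - v * (b2 * x0 + c2 * y0) = v * d"
    "z2 * q2 - A1 = u * d" using koszul_uv by blast
  have "A0 = v * d + v * x0 * b2 + v * y0 * c2 - q1 * w" "A1 = q2 * z2 - u * d"
    "A2 = v * x1 * b2 + v * y1 * c2 + q0 * w" "A3 = u * x2 * b2 + u * y2 * c2 - q0 * z2"
    using d A2 A3 by (simp_all add: algebra_simps)
  then show ?thesis by (intro exI conjI)
qed

text \<open>The first equation makes \<open>w4\<close> divisible by \<open>u\<close>. After
  cancelling \<open>u\<close> in the last one, writing \<open>q0\<close> as a minor leaves a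
  homogeneous relation of \<open>x2, y2\<close>.\<close>

lemma relations_5a:
  assumes c: "coords var_s var_t u v" and hb: "hilbert_burch q0 q1 q2 x0 x1 x2 y0 y1 y2"
    and b2: "is_basis2 var_s var_t x2 y2" and q: "q0 \<in> graded_piece (2, 0)" "q2 \<in> graded_piece (2, 0)" "q2 \<noteq> 0"
    and eq: "q2 * w4 - u * w0 = 0"
    "v * x1 * w1 + v * y1 * w2 + q0 * w3 = 0" "u * x2 * w1 + u * y2 * w2 - q0 * w4 = 0"
  shows "\<exists>z1 z2. w0 = q2 * z1 \<and> w1 = - (y1 * z1) - y2 * z2 \<and> w2 = x1 * z1 + x2 * z2 \<and> w3 = v * z2 \<and> w4 = u * z1"
proof -
  interpret coords var_s var_t u v by (rule c)
  have uv: "is_basis2 var_u var_v u v" using c by (simp add: coords_def)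
  interpret c2: coords x2 y2 u v using b2 uv by (simp add: coords_def)
  note hbD = hilbert_burchD[OF hb]
  have "w4 * q2 = u * w0" using eq(1) by (simp add: mult.commute)
  then obtain z1 where z1: "w4 = u * z1" "w0 = z1 * q2" using quadric_mod_u[OF c q(2,3)] by blast
  have "u * (x2 * w1 + y2 * w2 - q0 * z1) = 0" using eq(3) unfolding z1 by (simp add: algebra_simps)
  then have 1: "x2 * w1 + y2 * w2 = q0 * z1" using coords_neq_0(3) by simp
  then have "x2 * (w1 + y1 * z1) + y2 * (w2 - x1 * z1) = 0" unfolding hbD(7) by (simp add: algebra_simps)
  then obtain z where z: "w1 + y1 * z1 = y2 * z" "w2 - x1 * z1 = - (x2 * z)" using c2.koszul_st0 by blast
  have w: "w1 = y2 * z - y1 * z1" "w2 = x1 * z1 - x2 * z" using z by (simp_all add: algebra_simps)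
  have "q0 * (v * z + w3) = v * x1 * w1 + v * y1 * w2 + q0 * w3" unfolding w hbD(7) by (simp add: algebra_simps)
  then have "v * z + w3 = 0" using eq(2) hbD(10) by simp
  then have "w3 = v * (- z)" by (simp add: eq_neg_iff_add_eq_0 add.commute)
  moreover have "w0 = q2 * z1" "w1 = - (y1 * z1) - y2 * (- z)" "w2 = x1 * z1 + x2 * (- z)"
    using z1 w by (simp_all add: algebra_simps)
  ultimately show ?thesis using z1(1) by blast
qed

text \<open>The fourth module is zero, so injectivity of \<open>D3\<close> closes the
  resolution.\<close>

lemma type_of_short_resolution:
  fixes p :: "'k::field bipoly list" and D2 D3 :: "'k bipoly list list" and L2 L3 :: free_module
  defines "m \<equiv> length L2" and "l \<equiv> length L3"
  assumes len: "length p = 4"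
    and gp: "\<forall>i<4. p ! i \<in> graded_piece (2, 1)" "\<forall>i<4. \<forall>j<m. mt D2 i j \<in> graded_piece (L2 ! j - (2, 1))"
      "\<forall>i<m. \<forall>j<l. mt D3 i j \<in> graded_piece (L3 ! j - L2 ! i)"
    and syz: "\<And>A. (\<Sum>i<4. p ! i * A i) = 0 \<Longrightarrow> \<exists>w. \<forall>i<4. A i = (\<Sum>j<m. mt D2 i j * w j)"
    and rel: "\<And>w. \<forall>i<4. (\<Sum>j<m. mt D2 i j * w j) = 0 \<Longrightarrow> \<exists>z. \<forall>j<m. w j = (\<Sum>k<l. mt D3 j k * z k)"
    and inj: "\<And>z. \<forall>j<m. (\<Sum>k<l. mt D3 j k * z k) = 0 \<Longrightarrow> \<forall>k<l. z k = 0"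
    and complex: "\<forall>j<m. (\<Sum>i<4. p ! i * mt D2 i j) = 0" "\<forall>i<4. \<forall>k<l. (\<Sum>j<m. mt D2 i j * mt D3 j k) = 0"
    and type: "n \<in> {1..6}" "type_modules n = [replicate 4 (2, 1), L2, L3, []]"
    and disj: "(2, 1) \<notin> set L2" "set L2 \<inter> set L3 = {}"
  shows "of_numerical_type n (ideal_gen (set p))"
proof -
  have "\<exists>d. minimal_free_resolution (ideal_gen ((!) p ` {..<4})) (free_seq [replicate 4 (2, 1), L2, L3, []]) d"
  proof (rule resolution_from_exact[of _ _ "mt D2" _ "mt D3" _ "\<lambda>_ _. 0"])
    show "exf 1 4 (length L2) (\<lambda>_. (!) p) (mt D2)"
      unfolding m_def[symmetric]
    proof (rule exfI)
      fix A assume A: "\<And>i. i < (1::nat) \<Longrightarrow> (\<Sum>j<4. p ! j * A j) = 0"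
      show "\<exists>w. \<forall>i<4. A i = (\<Sum>j<m. mt D2 i j * w j)" by (rule syz) (use A[of 0] in simp)
    qed (use complex(1) in simp)
    show "exf 4 (length L2) (length L3) (mt D2) (mt D3)"
      unfolding m_def[symmetric] l_def[symmetric]
    proof (rule exfI)
      fix w assume w: "\<And>i. i < 4 \<Longrightarrow> (\<Sum>j<m. mt D2 i j * w j) = 0"
      show "\<exists>z. \<forall>j<m. w j = (\<Sum>k<l. mt D3 j k * z k)" by (rule rel) (simp add: w)
    qed (use complex(2) in simp)
    show "exf (length L2) (length L3) (length []) (mt D3) (\<lambda>_ _. 0)"
      unfolding m_def[symmetric] l_def[symmetric]
    proof (rule exfI)
      fix z assume z: "\<And>j. j < m \<Longrightarrow> (\<Sum>k<l. mt D3 j k * z k) = 0"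
      have "\<forall>k<l. z k = 0" by (rule inj) (simp add: z)
      then show "\<exists>y. \<forall>k<l. z k = (\<Sum>j<length []. 0 * y j)" by simp
    qed simp
  qed (use gp disj in \<open>simp_all add: m_def l_def exf_def\<close>)
  moreover have "(!) p ` {..<4} = set p" using len by (auto simp: set_conv_nth)
  ultimately show ?thesis using type by (simp add: of_numerical_type_def)
qed

lemma type_5a:
  fixes q0 q1 q2 u v :: "'k::field bipoly"
  assumes c: "coords var_s var_t u v" and q: "is_basis3 q0 q1 q2"
    and cop1: "\<And>x y. ev (\<lambda>x. x) x y 0 0 q0 = 0 \<Longrightarrow> ev (\<lambda>x. x) x y 0 0 q1 = 0 \<Longrightarrow> x = 0 \<and> y = 0"
    and cop2: "\<And>x y. ev (\<lambda>x. x) x y 0 0 q0 = 0 \<Longrightarrow> ev (\<lambda>x. x) x y 0 0 q2 = 0 \<Longrightarrow> x = 0 \<and> y = 0"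
  shows "of_numerical_type 5 (ideal_gen {u * q0, v * q0, u * q1, v * q2})"
proof -
  interpret coords var_s var_t u v by (rule c)
  obtain x0 x1 x2 y0 y1 y2 where hb: "hilbert_burch q0 q1 q2 x0 x1 x2 y0 y1 y2"
    using hilbert_burch_exists[OF q] by blast
  note hbD = hilbert_burchD[OF hb] and gp_simps = gp_add gp_diff gp_products gp_coords hilbert_burchD(1-6)[OF
    hb] is_basis3_gp[OF q]
    gp_mult[OF gp_coords(3) is_basis3_gp(1)[OF q]] gp_mult[OF gp_coords(3) is_basis3_gp(2)[OF q]] gp_mult[OF
      gp_coords(3) is_basis3_gp(3)[OF q]]
    gp_mult[OF gp_coords(4) is_basis3_gp(1)[OF q]] gp_mult[OF gp_coords(4) is_basis3_gp(2)[OF q]] gp_mult[OF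
      gp_coords(4) is_basis3_gp(3)[OF q]]
  have b2: "is_basis2 var_s var_t x2 y2" by (rule hilbert_burch_basis2(1)[OF hb]) (rule cop1)
  have b1: "is_basis2 var_s var_t x1 y1" by (rule hilbert_burch_basis2(2)[OF hb]) (rule cop2)
  have q2: "q2 \<noteq> 0" using q by (auto simp: is_basis3_def quad_eq_0_iff)
  have m: "x * y \<in> graded_piece (1, 1)" if "x \<in> graded_piece (0, 1)" "y \<in> graded_piece (1,
    0)" for x y :: "'k bipoly"
    using that by (rule gp_mult) simp
  \<comment> \<open>Columns: the Koszul relation of \<open>u * q0, v * q0\<close>; the two
    Hilbert-Burch columns times \<open>u * v\<close>; the exchange relation of \<open>q0, q1\<close>
    at \<open>u\<close> and that of \<open>q0, q2\<close> at \<open>v\<close>.\<close>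
  define D2 where "D2 = [[v, v * x0, v * y0, - q1, 0], [- u, 0, 0, 0, q2],
    [0, v * x1, v * y1, q0, 0], [0, u * x2, u * y2, 0, - q0]]"
  define D3 where "D3 = [[q2, 0], [- y1, - y2], [x1, x2], [0, v], [u, 0]]"
  note unf = mt_def D2_def D3_def eval_nat_numeral All_less_Suc
  have "of_numerical_type 5 (ideal_gen (set [u * q0, v * q0, u * q1, v * q2]))"
  proof (rule type_of_short_resolution[where ?D2.0 = D2 and ?D3.0 = D3 and ?L2.0 = "[(2, 2), (3, 2), (3, 2),
    (4, 1), (4, 1)]" and ?L3.0 = "[(4, 2), (4, 2)]"])
    fix A assume "(\<Sum>i<4. [u * q0, v * q0, u * q1, v * q2] ! i * A i) = 0"
    then have "u * q0 * A 0 + v * q0 * A 1 + u * q1 * A 2 + v * q2 * A 3 = 0" by (simp add: sum4)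
    then obtain w0 w1 w2 w3 w4 where "A 0 = v * w0 + v * x0 * w1 + v * y0 * w2 - q1 * w3 \<and>
      A 1 = q2 * w4 - u * w0 \<and>
        A 2 = v * x1 * w1 + v * y1 * w2 + q0 * w3 \<and> A 3 = u * x2 * w1 + u * y2 * w2 - q0 * w4"
      using syzygies_5a[OF c hb b1 b2 is_basis3_gp(1)[OF q]] by blast
    then show "\<exists>w. \<forall>i<4. A i = (\<Sum>j<length [(2, 2), (3, 2), (3, 2), (4, 1), (4, 1)]. mt D2 i j * w j)"
      by (intro exI[of _ "(!) [w0, w1, w2, w3, w4]"]) (simp add: unf)
  next
    fix w assume "\<forall>i<4. (\<Sum>j<length [(2, 2), (3, 2), (3, 2), (4, 1), (4, 1)]. mt D2 i j * w j) = 0"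
    then have "q2 * w 4 - u * w 0 = 0" "v * x1 * w 1 + v * y1 * w 2 + q0 * w 3 = 0"
      "u * x2 * w 1 + u * y2 * w 2 - q0 * w 4 = 0"
      by (simp_all add: unf algebra_simps)
    then obtain z1 z2 where "w 0 = q2 * z1 \<and> w 1 = - (y1 * z1) - y2 * z2 \<and> w 2 = x1 * z1 + x2 * z2 \<and>
      w 3 = v * z2 \<and> w 4 = u * z1"
      using relations_5a[OF c hb b2 is_basis3_gp(1,3)[OF q] q2] by blast
    then show "\<exists>z. \<forall>j<length [(2, 2), (3, 2), (3, 2), (4, 1), (4, 1)]. w j = (\<Sum>k<length [(4, 2), (4,
      2)]. mt D3 j k * z k)"
      by (intro exI[of _ "(!) [z1, z2]"]) (simp add: unf)
  next
    show "\<forall>i<4. [u * q0, v * q0, u * q1, v * q2] ! i \<in> graded_piece (2, 1)"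
      "\<forall>i<4. \<forall>j<length [(2, 2), (3, 2), (3, 2), (4, 1), (4, 1)]. mt D2 i j \<in> graded_piece ([(2, 2), (3, 2),
        (3, 2), (4, 1), (4, 1)] ! j - (2, 1))"
      "\<forall>i<length [(2, 2), (3, 2), (3, 2), (4, 1), (4, 1)]. \<forall>j<length [(4, 2), (4,
        2)]. mt D3 i j \<in> graded_piece ([(4, 2), (4, 2)] ! j - [(2, 2), (3, 2), (3, 2), (4, 1), (4, 1)] ! i)"
      by (simp_all add: unf gp_simps m)
  qed (use coords_neq_0 in \<open>simp_all add: unf type_modules_def hbD(7-9) algebra_simps\<close>)
  then show ?thesis by simp
qed

text \<open>The third entry is a multiple of \<open>u\<close>, so \<open>(b, c)\<close> is a
  multiple of \<open>(y2, - x2)\<close> modulo \<open>u\<close>, and the second entry puts the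
  multiplier into the ideal of \<open>u, v\<close>. What remains is again a relation of
  \<open>x2, y2\<close> modulo \<open>u\<close>.\<close>

lemma syzygies_5b:
  assumes c: "coords var_s var_t u v" and hb: "hilbert_burch q0 q1 q2 x0 x1 x2 y0 y1 y2"
    and b2: "is_basis2 var_s var_t x2 y2" and q: "q0 \<in> graded_piece (2, 0)"
    and eq: "u * q0 * A0 + v * q0 * A1 + u * q1 * A2 + (v * q1 + u * q2) * A3 = 0"
  shows "\<exists>w0 w1 w2 w3 w4. A0 = v * w0 - u * x0 * w1 - u * y0 * w2 + q1 * w3 - q2 * w4 \<and>
    A1 = - (u * w0) - q1 * w4 \<and>
    A2 = (v * x2 - u * x1) * w1 + (v * y2 - u * y1) * w2 - q0 * w3 \<and> A3 = q0 * w4 - u * x2 * w1 - u * y2 * w2"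
proof -
  interpret coords var_s var_t u v by (rule c)
  have uv: "is_basis2 var_u var_v u v" using c by (simp add: coords_def)
  interpret c2: coords x2 y2 u v using b2 uv by (simp add: coords_def)
  note hbD = hilbert_burchD[OF hb]
  have "(u * A0 + v * A1) * q0 + (u * A2 + v * A3) * q1 + (u * A3) * q2 = 0" using eq
    by (simp add: algebra_simps)
  then obtain b c where bc: "u * A0 + v * A1 = b * x0 + c * y0" "u * A2 + v * A3 = b * x1 + c * y1"
    "u * A3 = b * x2 + c * y2"
    using hbD(11) by blast
  obtain z b' c' where z: "b = y2 * z + u * b'" "c = u * c' - x2 * z" "A3 = b' * x2 + c' * y2"
    using c2.koszul_mod_u[OF bc(3)[symmetric]] by blast
  have "z * q0 = u * (A2 - b' * x1 - c' * y1) + v * (b' * x2 + c' * y2)" using bc(2) unfolding z hbD(7)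
    by (simp add: algebra_simps)
  then obtain z1 w4 where z': "z = u * z1 + v * w4" using quadric_mod_uv[OF c q hbD(10)] by blast
  define b1 c1 where "b1 = b' + y2 * z1" and "c1 = c' - x2 * z1"
  have e: "b = y2 * (v * w4) + u * b1" "c = u * c1 - x2 * (v * w4)" "A3 = b1 * x2 + c1 * y2"
    unfolding b1_def c1_def z z' by (simp_all add: algebra_simps)
  have "u * (A2 - b1 * x1 - c1 * y1) = v * (w4 * q0 - b1 * x2 - c1 * y2)"
    using bc(2) unfolding e hbD(7) by (simp add: algebra_simps)
  then obtain g where g: "A2 - b1 * x1 - c1 * y1 = v * g" "w4 * q0 - b1 * x2 - c1 * y2 = u * g" using
    koszul_uv by blast
  \<comment> \<open>Writing \<open>w4 * q0\<close> as a minor collects everything at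
    \<open>x2\<close> and \<open>y2\<close>.\<close>
  have "(- (w4 * y1) - b1) * x2 + (w4 * x1 - c1) * y2 = u * g" using g(2) unfolding hbD(7)
    by (simp add: algebra_simps)
  then obtain w3 w1 w2 where w: "- (w4 * y1) - b1 = y2 * w3 + u * w1" "w4 * x1 - c1 = u * w2 - x2 * w3"
    "g = w1 * x2 + w2 * y2"
    using c2.koszul_mod_u by blast
  have b1: "b1 = - (w4 * y1) - y2 * w3 - u * w1" and c1: "c1 = w4 * x1 + x2 * w3 - u * w2"
    using w(1,2) by (simp_all add: algebra_simps)
  have A2: "A2 = v * g + b1 * x1 + c1 * y1" using g(1) by (simp add: algebra_simps)
  have "u * (A0 - b1 * x0 - c1 * y0) = v * (- (w4 * q1) - A1)"
    using bc(1) unfolding e hbD(8,9) by (simp add: algebra_simps)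
  then obtain d where d: "A0 - b1 * x0 - c1 * y0 = v * d" "- (w4 * q1) - A1 = u * d" using koszul_uv by blast
  have "A1 = - (w4 * q1) - (- (w4 * q1) - A1)" by simp
  then have A1: "A1 = - (u * d) - q1 * w4" unfolding d(2) by (simp add: mult.commute)
  have A0: "A0 = v * d + b1 * x0 + c1 * y0" using d(1) by (simp add: algebra_simps)
  have "A0 = v * d - u * x0 * w1 - u * y0 * w2 + q1 * w3 - q2 * w4"
    "A2 = (v * x2 - u * x1) * w1 + (v * y2 - u * y1) * w2 - q0 * w3" "A3 = q0 * w4 - u * x2 * w1 - u * y2 * w2"
    unfolding A0 A2 e(3) w(3) b1 c1 hbD(7-9) by (simp_all add: algebra_simps)
  then show ?thesis using A1 by (intro exI conjI)
qed

lemma relations_5b: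
  assumes c: "coords var_s var_t u v" and hb: "hilbert_burch q0 q1 q2 x0 x1 x2 y0 y1 y2"
    and b2: "is_basis2 var_s var_t x2 y2" and q: "q1 \<in> graded_piece (2, 0)" "q1 \<noteq> 0"
    and eq: "- (u * w0) - q1 * w4 = 0"
    "(v * x2 - u * x1) * w1 + (v * y2 - u * y1) * w2 - q0 * w3 = 0" "q0 * w4 - u * x2 * w1 - u * y2 * w2 = 0"
  shows "\<exists>z1 z2. w0 = - (q1 * z1) \<and> w1 = y2 * z2 - y1 * z1 \<and> w2 = x1 * z1 - x2 * z2 \<and> w3 = v * z1 - u * z2 \<and>
    w4 = u * z1"
proof -
  interpret coords var_s var_t u v by (rule c)
  have uv: "is_basis2 var_u var_v u v" using c by (simp add: coords_def)
  interpret c2: coords x2 y2 u v using b2 uv by (simp add: coords_def)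
  note hbD = hilbert_burchD[OF hb]
  have "w4 * q1 = u * (- w0)" using eq(1) by (simp add: algebra_simps eq_neg_iff_add_eq_0 neg_eq_iff_add_eq_0)
  then obtain z1 where z1: "w4 = u * z1" "- w0 = z1 * q1" using quadric_mod_u[OF c q] by blast
  have "u * (q0 * z1 - x2 * w1 - y2 * w2) = 0" using eq(3) unfolding z1 by (simp add: algebra_simps)
  then have "q0 * z1 - x2 * w1 - y2 * w2 = 0" using coords_neq_0(3) by simp
  then have 1: "x2 * w1 + y2 * w2 = q0 * z1" by (simp add: algebra_simps)
  then have "x2 * (w1 + y1 * z1) + y2 * (w2 - x1 * z1) = 0" unfolding hbD(7) by (simp add: algebra_simps)
  then obtain z where z: "w1 + y1 * z1 = y2 * z" "w2 - x1 * z1 = - (x2 * z)" using c2.koszul_st0 by blast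
  have w: "w1 = y2 * z - y1 * z1" "w2 = x1 * z1 - x2 * z" using z by (simp_all add: algebra_simps)
  have "q0 * (v * z1 - u * z - w3) = (v * x2 - u * x1) * w1 + (v * y2 - u * y1) * w2 - q0 * w3"
    unfolding w hbD(7) by (simp add: algebra_simps)
  then have "v * z1 - u * z - w3 = 0" using eq(2) hbD(10) by simp
  then have "w3 = v * z1 - u * z" by simp
  moreover have "w0 = - (q1 * z1)" using z1(2) by (metis minus_minus mult.commute)
  ultimately show ?thesis using z1(1) w by blast
qed

lemma type_5b:
  fixes q0 q1 q2 u v :: "'k::field bipoly"
  assumes c: "coords var_s var_t u v" and q: "is_basis3 q0 q1 q2"
    and cop1: "\<And>x y. ev (\<lambda>x. x) x y 0 0 q0 = 0 \<Longrightarrow> ev (\<lambda>x. x) x y 0 0 q1 = 0 \<Longrightarrow> x = 0 \<and> y = 0"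
  shows "of_numerical_type 5 (ideal_gen {u * q0, v * q0, u * q1, v * q1 + u * q2})"
proof -
  interpret coords var_s var_t u v by (rule c)
  obtain x0 x1 x2 y0 y1 y2 where hb: "hilbert_burch q0 q1 q2 x0 x1 x2 y0 y1 y2"
    using hilbert_burch_exists[OF q] by blast
  note hbD = hilbert_burchD[OF hb] and gp_simps = gp_add gp_diff gp_products gp_coords hilbert_burchD(1-6)[OF
    hb] is_basis3_gp[OF q]
    gp_mult[OF gp_coords(3) is_basis3_gp(1)[OF q]] gp_mult[OF gp_coords(3) is_basis3_gp(2)[OF q]] gp_mult[OF
      gp_coords(3) is_basis3_gp(3)[OF q]]
    gp_mult[OF gp_coords(4) is_basis3_gp(1)[OF q]] gp_mult[OF gp_coords(4) is_basis3_gp(2)[OF q]] gp_mult[OF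
      gp_coords(4) is_basis3_gp(3)[OF q]]
  have b2: "is_basis2 var_s var_t x2 y2" by (rule hilbert_burch_basis2(1)[OF hb]) (rule cop1)
  have q1: "q1 \<noteq> 0" using q by (auto simp: is_basis3_def quad_eq_0_iff)
  have m: "x * y \<in> graded_piece (1, 1)" if "x \<in> graded_piece (0, 1)" "y \<in> graded_piece (1,
    0)" for x y :: "'k bipoly"
    using that by (rule gp_mult) simp
  define D2 where "D2 = [[v, - (u * x0), - (u * y0), q1, - q2], [- u, 0, 0, 0, - q1],
    [0, v * x2 - u * x1, v * y2 - u * y1, - q0, 0], [0, - (u * x2), - (u * y2), 0, q0]]"
  define D3 where "D3 = [[- q1, 0], [- y1, y2], [x1, - x2], [v, - u], [u, 0]]"
  note unf = mt_def D2_def D3_def eval_nat_numeral All_less_Suc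
  have "of_numerical_type 5 (ideal_gen (set [u * q0, v * q0, u * q1, v * q1 + u * q2]))"
  proof (rule type_of_short_resolution[where ?D2.0 = D2 and ?D3.0 = D3 and ?L2.0 = "[(2, 2), (3, 2), (3, 2),
    (4, 1), (4, 1)]" and ?L3.0 = "[(4, 2), (4, 2)]"])
    fix A assume "(\<Sum>i<4. [u * q0, v * q0, u * q1, v * q1 + u * q2] ! i * A i) = 0"
    then have "u * q0 * A 0 + v * q0 * A 1 + u * q1 * A 2 + (v * q1 + u * q2) * A 3 = 0" by (simp add: sum4)
    then obtain w0 w1 w2 w3 w4 where "A 0 = v * w0 - u * x0 * w1 - u * y0 * w2 + q1 * w3 - q2 * w4 \<and>
      A 1 = - (u * w0) - q1 * w4 \<and>
        A 2 = (v * x2 - u * x1) * w1 + (v * y2 - u * y1) * w2 - q0 * w3 \<and>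
          A 3 = q0 * w4 - u * x2 * w1 - u * y2 * w2"
      using syzygies_5b[OF c hb b2 is_basis3_gp(1)[OF q]] by blast
    then show "\<exists>w. \<forall>i<4. A i = (\<Sum>j<length [(2, 2), (3, 2), (3, 2), (4, 1), (4, 1)]. mt D2 i j * w j)"
      by (intro exI[of _ "(!) [w0, w1, w2, w3, w4]"]) (simp add: unf)
  next
    fix w assume "\<forall>i<4. (\<Sum>j<length [(2, 2), (3, 2), (3, 2), (4, 1), (4, 1)]. mt D2 i j * w j) = 0"
    then have "- (u * w 0) - q1 * w 4 = 0" "(v * x2 - u * x1) * w 1 + (v * y2 - u * y1) * w 2 - q0 * w 3 = 0"
      "q0 * w 4 - u * x2 * w 1 - u * y2 * w 2 = 0"
      by (simp_all add: unf algebra_simps)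
    then obtain z1 z2 where "w 0 = - (q1 * z1) \<and> w 1 = y2 * z2 - y1 * z1 \<and> w 2 = x1 * z1 - x2 * z2 \<and>
      w 3 = v * z1 - u * z2 \<and> w 4 = u * z1"
      using relations_5b[OF c hb b2 is_basis3_gp(2)[OF q] q1] by blast
    then show "\<exists>z. \<forall>j<length [(2, 2), (3, 2), (3, 2), (4, 1), (4, 1)]. w j = (\<Sum>k<length [(4, 2), (4,
      2)]. mt D3 j k * z k)"
      by (intro exI[of _ "(!) [z1, z2]"]) (simp add: unf)
  next
    show "\<forall>i<4. [u * q0, v * q0, u * q1, v * q1 + u * q2] ! i \<in> graded_piece (2, 1)"
      "\<forall>i<4. \<forall>j<length [(2, 2), (3, 2), (3, 2), (4, 1), (4, 1)]. mt D2 i j \<in> graded_piece ([(2, 2), (3, 2),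
        (3, 2), (4, 1), (4, 1)] ! j - (2, 1))"
      "\<forall>i<length [(2, 2), (3, 2), (3, 2), (4, 1), (4, 1)]. \<forall>j<length [(4, 2), (4,
        2)]. mt D3 i j \<in> graded_piece ([(4, 2), (4, 2)] ! j - [(2, 2), (3, 2), (3, 2), (4, 1), (4, 1)] ! i)"
      by (simp_all add: unf gp_simps m)
    show "\<forall>k<length [(4, 2), (4, 2)]. z k = 0"
      if "\<forall>j<length [(2, 2), (3, 2), (3, 2), (4, 1), (4, 1)]. (\<Sum>k<length [(4, 2), (4,
        2)]. mt D3 j k * z k) = 0" for z
      using that coords_neq_0 by (auto simp: unf)
  qed (use coords_neq_0 in \<open>simp_all add: unf type_modules_def hbD(7-9) algebra_simps\<close>)
  then show ?thesis by simp
qed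

text \<open>The third entry is zero, so \<open>(b, c) = z * (y2, - x2)\<close> and the induced
  syzygy is \<open>z * (- q1, q0, 0)\<close>, with \<open>z\<close> in the ideal of
  \<open>u, v\<close>.\<close>

lemma syzygies_6:
  assumes c: "coords var_s var_t u v" and hb: "hilbert_burch q0 q1 q2 x0 x1 x2 y0 y1 y2"
    and b2: "is_basis2 var_s var_t x2 y2" and q: "q0 \<in> graded_piece (2, 0)"
    and eq: "u * q0 * A0 + v * q0 * A1 + u * q1 * A2 + v * q1 * A3 = 0"
  shows "\<exists>w0 w1 w2 w3. A0 = v * w0 + q1 * w2 \<and> A1 = q1 * w3 - u * w0 \<and>
    A2 = v * w1 - q0 * w2 \<and> A3 = - (u * w1) - q0 * w3"
proof -
  interpret coords var_s var_t u v by (rule c)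
  have uv: "is_basis2 var_u var_v u v" using c by (simp add: coords_def)
  interpret c2: coords x2 y2 u v using b2 uv by (simp add: coords_def)
  note hbD = hilbert_burchD[OF hb]
  have "(u * A0 + v * A1) * q0 + (u * A2 + v * A3) * q1 + 0 * q2 = 0" using eq by (simp add: algebra_simps)
  then obtain b c where bc: "u * A0 + v * A1 = b * x0 + c * y0" "u * A2 + v * A3 = b * x1 + c * y1"
    "0 = b * x2 + c * y2"
    using hbD(11) by blast
  have "x2 * b + y2 * c = 0" using bc(3) by (simp add: mult.commute)
  then obtain z where z: "b = y2 * z" "c = - (x2 * z)" using c2.koszul_st0 by blast
  have e: "u * A0 + v * A1 = - (z * q1)" "u * A2 + v * A3 = z * q0"
    unfolding bc(1,2) z hbD(7,8) by (simp_all add: algebra_simps)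
  obtain z0 z1 where z': "z = u * z0 + v * z1" using quadric_mod_uv[OF c q hbD(10) e(2)[symmetric]] by blast
  have "u * (A0 + z0 * q1) = v * (- A1 - z1 * q1)" "u * (A2 - z0 * q0) = v * (z1 * q0 - A3)"
    using e unfolding z' by (simp_all add: algebra_simps eq_neg_iff_add_eq_0 neg_eq_iff_add_eq_0)
  then obtain g h where gh: "A0 + z0 * q1 = v * g" "- A1 - z1 * q1 = u * g" "A2 - z0 * q0 = v * h"
    "z1 * q0 - A3 = u * h"
    using koszul_uv by metis
  have "A0 = (A0 + z0 * q1) - z0 * q1" "A1 = - (z1 * q1) - (- A1 - z1 * q1)"
    "A2 = (A2 - z0 * q0) + z0 * q0" "A3 = z1 * q0 - (z1 * q0 - A3)" by simp_all
  then have "A0 = v * g + q1 * (- z0)" "A1 = q1 * (- z1) - u * g" "A2 = v * h - q0 * (- z0)"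
    "A3 = - (u * h) - q0 * (- z1)"
    unfolding gh by (simp_all add: algebra_simps)
  then show ?thesis by (intro exI conjI)
qed

lemma relations_6:
  assumes c: "coords var_s var_t u v" and q: "q1 \<in> graded_piece (2, 0)" "q1 \<noteq> 0" "q0 \<noteq> 0"
    and eq: "v * w0 + q1 * w2 = 0" "q1 * w3 - u * w0 = 0" "- (u * w1) - q0 * w3 = 0"
  shows "\<exists>z. w0 = q1 * z \<and> w1 = - (q0 * z) \<and> w2 = - (v * z) \<and> w3 = u * z"
proof -
  interpret coords var_s var_t u v by (rule c)
  have "w3 * q1 = u * w0" using eq(2) by (simp add: algebra_simps)
  then obtain z where z: "w3 = u * z" "w0 = z * q1" using quadric_mod_u[OF c q(1,2)] by blast
  have "q1 * (v * z + w2) = 0" "- (u * (w1 + q0 * z)) = 0" using eq(1,3) unfolding z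
    by (simp_all add: algebra_simps)
  then have "v * z + w2 = 0" "w1 + q0 * z = 0" using q coords_neq_0 by simp_all
  then have "w2 = - (v * z)" "w1 = - (q0 * z)" by (simp_all add: eq_neg_iff_add_eq_0 add.commute)
  then show ?thesis using z by (metis mult.commute)
qed

lemma type_6:
  fixes q0 q1 q2 u v :: "'k::field bipoly"
  assumes c: "coords var_s var_t u v" and q: "is_basis3 q0 q1 q2"
    and cop1: "\<And>x y. ev (\<lambda>x. x) x y 0 0 q0 = 0 \<Longrightarrow> ev (\<lambda>x. x) x y 0 0 q1 = 0 \<Longrightarrow> x = 0 \<and> y = 0"
  shows "of_numerical_type 6 (ideal_gen {u * q0, v * q0, u * q1, v * q1})"
proof -
  interpret coords var_s var_t u v by (rule c)
  obtain x0 x1 x2 y0 y1 y2 where hb: "hilbert_burch q0 q1 q2 x0 x1 x2 y0 y1 y2"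
    using hilbert_burch_exists[OF q] by blast
  note hbD = hilbert_burchD[OF hb] and gp_simps = gp_add gp_diff gp_products gp_coords hilbert_burchD(1-6)[OF
    hb] is_basis3_gp[OF q]
    gp_mult[OF gp_coords(3) is_basis3_gp(1)[OF q]] gp_mult[OF gp_coords(3) is_basis3_gp(2)[OF q]] gp_mult[OF
      gp_coords(3) is_basis3_gp(3)[OF q]]
    gp_mult[OF gp_coords(4) is_basis3_gp(1)[OF q]] gp_mult[OF gp_coords(4) is_basis3_gp(2)[OF q]] gp_mult[OF
      gp_coords(4) is_basis3_gp(3)[OF q]]
  have b2: "is_basis2 var_s var_t x2 y2" by (rule hilbert_burch_basis2(1)[OF hb]) (rule cop1)
  have q1: "q1 \<noteq> 0" using q by (auto simp: is_basis3_def quad_eq_0_iff)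
  have m: "x * y \<in> graded_piece (1, 1)" if "x \<in> graded_piece (0, 1)" "y \<in> graded_piece (1,
    0)" for x y :: "'k bipoly"
    using that by (rule gp_mult) simp
  \<comment> \<open>The generators are the products of \<open>u, v\<close> with
    \<open>q0, q1\<close>: two Koszul relations of \<open>u, v\<close> and two of
    \<open>q0, q1\<close>, tied by a single second syzygy.\<close>
  define D2 where "D2 = [[v, 0, q1, 0], [- u, 0, 0, q1], [0, v, - q0, 0], [0, - u, 0, - q0]]"
  define D3 where "D3 = [[q1], [- q0], [- v], [u]]"
  note unf = mt_def D2_def D3_def eval_nat_numeral All_less_Suc
  have "of_numerical_type 6 (ideal_gen (set [u * q0, v * q0, u * q1, v * q1]))"
  proof (rule type_of_short_resolution[where ?D2.0 = D2 and ?D3.0 = D3 and ?L2.0 = "[(2, 2), (2, 2), (4, 1),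
    (4, 1)]" and ?L3.0 = "[(4, 2)]"])
    fix A assume "(\<Sum>i<4. [u * q0, v * q0, u * q1, v * q1] ! i * A i) = 0"
    then have "u * q0 * A 0 + v * q0 * A 1 + u * q1 * A 2 + v * q1 * A 3 = 0" by (simp add: sum4)
    then obtain w0 w1 w2 w3 where "A 0 = v * w0 + q1 * w2 \<and> A 1 = q1 * w3 - u * w0 \<and>
        A 2 = v * w1 - q0 * w2 \<and> A 3 = - (u * w1) - q0 * w3"
      using syzygies_6[OF c hb b2 is_basis3_gp(1)[OF q]] by blast
    then show "\<exists>w. \<forall>i<4. A i = (\<Sum>j<length [(2, 2), (2, 2), (4, 1), (4, 1)]. mt D2 i j * w j)"
      by (intro exI[of _ "(!) [w0, w1, w2, w3]"]) (simp add: unf)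
  next
    fix w assume "\<forall>i<4. (\<Sum>j<length [(2, 2), (2, 2), (4, 1), (4, 1)]. mt D2 i j * w j) = 0"
    then have "v * w 0 + q1 * w 2 = 0" "q1 * w 3 - u * w 0 = 0" "- (u * w 1) - q0 * w 3 = 0"
      by (simp_all add: unf algebra_simps)
    then obtain z where "w 0 = q1 * z \<and> w 1 = - (q0 * z) \<and> w 2 = - (v * z) \<and> w 3 = u * z"
      using relations_6[OF c is_basis3_gp(2)[OF q] q1 hbD(10)] by blast
    then show "\<exists>z. \<forall>j<length [(2, 2), (2, 2), (4, 1), (4, 1)]. w j = (\<Sum>k<length [(4, 2)]. mt D3 j k * z k)"
      by (intro exI[of _ "(!) [z]"]) (simp add: unf)
  next
    show "\<forall>i<4. [u * q0, v * q0, u * q1, v * q1] ! i \<in> graded_piece (2, 1)"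
      "\<forall>i<4. \<forall>j<length [(2, 2), (2, 2), (4, 1), (4, 1)]. mt D2 i j \<in> graded_piece ([(2, 2), (2, 2), (4, 1),
        (4, 1)] ! j - (2, 1))"
      "\<forall>i<length [(2, 2), (2, 2), (4, 1), (4, 1)]. \<forall>j<length [(4, 2)]. mt D3 i j \<in> graded_piece ([(4,
        2)] ! j - [(2, 2), (2, 2), (4, 1), (4, 1)] ! i)"
      by (simp_all add: unf gp_simps m)
  qed (use coords_neq_0 in \<open>simp_all add: unf type_modules_def hbD(7-9) algebra_simps\<close>)
  then show ?thesis by simp
qed

section \<open>Normal forms of U\<close>

text \<open>Linearity is asked for on all of R, so that \<open>\<lambda>q. f (u * q)\<close> is
  again a functional.\<close>

definition functional :: "('k::field bipoly \<Rightarrow> 'k) \<Rightarrow> bool" where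
  "functional f \<longleftrightarrow> (\<forall>p q. f (p + q) = f p + f q) \<and> (\<forall>c p. f (cst c * p) = c * f p)"

lemma functionalD:
  assumes "functional f"
  shows "f (p + q) = f p + f q" "f (cst c * p) = c * f p" "f 0 = 0" "f (- p) = - f p" "f (p - q) = f p - f q"
proof -
  show 1: "f (p + q) = f p + f q" "f (cst c * p) = c * f p" for p q c using assms
    by (simp_all add: functional_def)
  show "f 0 = 0" using 1(2)[of 0 0] by simp
  show 2: "f (- p) = - f p" for p using 1(2)[of "-1" p] by (simp add: cst_minus)
  show "f (p - q) = f p - f q" using 1(1)[of p "- q"] 2 by simp
qed

lemma functional_linear: "functional f \<Longrightarrow> functional g \<Longrightarrow> functional (\<lambda>p. a * f p + b * g p)"
  by (simp add: functional_def algebra_simps)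

definition monomials21 :: "'k::field bipoly set" where
  "monomials21 = {var_u * (var_s * var_s), var_u * (var_s * var_t), var_u * (var_t * var_t),
     var_v * (var_s * var_s), var_v * (var_s * var_t), var_v * (var_t * var_t)}"

lemma gp20_quad: "p \<in> graded_piece (2, 0) \<Longrightarrow> \<exists>a b c. p = quad a b c"
  using gp20[of p] by (simp add: quad_def power2_eq_square)

lemma gp21_span: "(graded_piece (2, 1) :: 'k::field bipoly set) \<subseteq> bipoly.span monomials21"
proof
  fix p :: "'k bipoly" assume "p \<in> graded_piece (2, 1)"
  then obtain a b where "a \<in> graded_piece (2, 0)" "b \<in> graded_piece (2, 0)" and p: "p = var_u * a + var_v * b"
    using gp21 by blast
  then obtain a0 a1 a2 b0 b1 b2 where ab: "a = quad a0 a1 a2" "b = quad b0 b1 b2" using gp20_quad by meson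
  have "p = const_mult a0 (var_u * (var_s * var_s)) + const_mult a1 (var_u * (var_s * var_t)) + const_mult a2
    (var_u * (var_t * var_t))
      + const_mult b0 (var_v * (var_s * var_s)) + const_mult b1 (var_v * (var_s * var_t)) + const_mult b2
        (var_v * (var_t * var_t))"
    unfolding p ab quad_def const_mult_eq by (simp add: algebra_simps)
  then show "p \<in> bipoly.span monomials21"
    by (simp only:) (intro bipoly.span_add bipoly.span_scale bipoly.span_base; simp add: monomials21_def)
qed

text \<open>The piece of bidegree (2,1) is spanned by six monomials, so a basis of \<open>U\<close>
  needs at most two more members there; \<open>f\<close> and \<open>g\<close> are their coordinate
  functions.\<close>

lemma functionals_exist:
  fixes U :: "'k::field bipoly set"
  assumes "four_dim_subspace U"
  shows "\<exists>f g. functional f \<and> functional g \<and> (\<forall>p \<in> graded_piece (2, 1). f p = 0 \<longrightarrow> g p = 0 \<longrightarrow> p \<in> U)"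
proof -
  have U: "bipoly.subspace U" "U \<subseteq> graded_piece (2, 1)" "bipoly.dim U = 4"
    using assms by (simp_all add: four_dim_subspace_def)
  obtain B where B: "B \<subseteq> U" "bipoly.independent B" "U \<subseteq> bipoly.span B" "card B = bipoly.dim U"
    by (rule bipoly.basis_exists)
  have "B \<subseteq> graded_piece (2, 1)" using B U by blast
  then obtain C where C: "B \<subseteq> C" "C \<subseteq> graded_piece (2, 1)" "bipoly.independent C" "graded_piece (2,
    1) \<subseteq> bipoly.span C"
    using B(2) by (rule bipoly.maximal_independent_subset_extend)
  have "finite (monomials21 :: 'k bipoly set)" "card (monomials21 :: 'k bipoly set) \<le> 6"
    unfolding monomials21_def by (simp_all add: card_insert_le_m1)
  then have "finite C" "card C \<le> 6"
    using bipoly.independent_span_bound[OF _ C(3) order_trans[OF C(2) gp21_span]] by (blast, linarith)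
  moreover have "card (C - B) = card C - 4"
    using B U C \<open>finite C\<close> by (simp add: card_Diff_subset finite_subset)
  ultimately have "card (C - B) \<le> 2" "finite (C - B)" by simp_all
  then obtain e1 e2 where e: "C - B \<subseteq> {e1, e2}"
  proof (cases "card (C - B) \<le> 1")
    case True
    then obtain x where "C - B \<subseteq> {x}" using \<open>finite (C - B)\<close>
      by (metis card_1_singletonE card_gt_0_iff empty_subsetI le_SucE le_zero_eq One_nat_def order_refl
        card_0_eq)
    then show thesis using that by blast
  next
    case False
    then have "card (C - B) = 2" using \<open>card (C - B) \<le> 2\<close> by simp
    then show thesis using that by (auto simp: card_2_iff)
  qed
  \<comment> \<open>A further extension to a basis of R makes the coordinate functions linear on all
    of R.\<close>
  define E where "E = bipoly.extend_basis C"
  have E: "C \<subseteq> E" "bipoly.independent E" "bipoly.span E = UNIV"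
    unfolding E_def using bipoly.extend_basis_superset bipoly.independent_extend_basis bipoly.span_extend_basis C(3) by blast+
  define f where "f c p = bipoly.representation E p c" for p c
  have f: "functional (f c)" for c
    unfolding functional_def f_def
  proof (intro conjI allI)
    fix p q :: "'k bipoly" and d
    have s: "p \<in> bipoly.span E" "q \<in> bipoly.span E" using E(3) by simp_all
    show "bipoly.representation E (p + q) c = bipoly.representation E p c + bipoly.representation E q c"
      using bipoly.representation_add[OF E(2) s(2,1)] by (simp add: add.commute)
    show "bipoly.representation E (cst d * p) c = d * bipoly.representation E p c"
      using bipoly.representation_scale[OF E(2) s(1), of d] by (simp add: const_mult_eq)
  qed
  have "p \<in> U" if p: "p \<in> graded_piece (2, 1)" "f e1 p = 0" "f e2 p = 0" for p
  proof -
    have pC: "p \<in> bipoly.span C" using p(1) C(4) by blast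
    have r: "bipoly.representation C p = bipoly.representation E p"
      using bipoly.representation_extend[OF E(2) pC E(1)] by simp
    have "p = (\<Sum>c\<in>C. const_mult (bipoly.representation C p c) c)"
      using bipoly.sum_representation_eq[OF C(3) pC \<open>finite C\<close> order_refl] by simp
    also have "\<dots> \<in> U"
    proof (rule bipoly.subspace_sum[OF U(1)])
      fix c assume c: "c \<in> C"
      show "const_mult (bipoly.representation C p c) c \<in> U"
      proof (cases "c \<in> B")
        case True
        then show ?thesis using B(1) bipoly.subspace_scale[OF U(1)] by blast
      next
        case False
        then have "c = e1 \<or> c = e2" using c e by blast
        then have "bipoly.representation C p c = 0" using p(2,3) unfolding r f_def by blast
        then show ?thesis using bipoly.subspace_0[OF U(1)] by simp
      qed
    qed
    finally show ?thesis .
  qed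
  then show ?thesis using f by blast
qed

lemma independent4:
  fixes p0 p1 p2 p3 :: "'k::field bipoly"
  assumes ind: "\<And>a b c d. cst a * p0 + cst b * p1 + cst c * p2 + cst d * p3 = 0 \<Longrightarrow> a = 0 \<and> b = 0 \<and> c = 0 \<and> d = 0"
  shows "bipoly.independent {p0, p1, p2, p3}" "card {p0, p1, p2, p3} = 4"
proof -
  have ne: "p0 \<noteq> p1" "p0 \<noteq> p2" "p0 \<noteq> p3" "p1 \<noteq> p2" "p1 \<noteq> p3" "p2 \<noteq> p3"
    using ind[of 1 "-1" 0 0] ind[of 1 0 "-1" 0] ind[of 1 0 0 "-1"] ind[of 0 1 "-1" 0] ind[of 0 1 0 "-1"]
      ind[of 0 0 1 "-1"]
    by (auto simp: cst_minus)
  let ?P = "{p0, p1, p2, p3}"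
  show "card ?P = 4" using ne by simp
  show "bipoly.independent ?P"
  proof
    assume "bipoly.dependent ?P"
    then obtain c where c: "\<exists>p\<in>?P. c p \<noteq> 0" "(\<Sum>p\<in>?P. const_mult (c p) p) = 0"
      using bipoly.dependent_finite[of ?P] by auto
    have "cst (c p0) * p0 + cst (c p1) * p1 + cst (c p2) * p2 + cst (c p3) * p3 = 0"
      using c(2) ne by (simp add: const_mult_eq add.assoc)
    from ind[OF this] c(1) show False by auto
  qed
qed

lemma span_of_independent:
  fixes U :: "'k::field bipoly set"
  assumes U: "four_dim_subspace U" and p: "{p0, p1, p2, p3} \<subseteq> U"
    and ind: "\<And>a b c d. cst a * p0 + cst b * p1 + cst c * p2 + cst d * p3 = 0 \<Longrightarrow> a = 0 \<and> b = 0 \<and> c = 0 \<and> d = 0"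
  shows "U = bipoly.span {p0, p1, p2, p3}" "ideal_gen U = ideal_gen {p0, p1, p2, p3}"
proof -
  have sub: "bipoly.subspace U" and dim: "bipoly.dim U = 4" using U by (simp_all add: four_dim_subspace_def)
  let ?P = "{p0, p1, p2, p3}"
  have indep: "bipoly.independent ?P" and card: "card ?P = 4"
    by (rule independent4, erule ind)+
  obtain B where B: "B \<subseteq> U" "bipoly.independent B" "U \<subseteq> bipoly.span B" "card B = bipoly.dim U"
    by (rule bipoly.basis_exists)
  have U_sp: "U \<subseteq> bipoly.span ?P"
  proof
    fix x assume x: "x \<in> U"
    show "x \<in> bipoly.span ?P"
    proof (rule ccontr)
      assume nx: "x \<notin> bipoly.span ?P"
      then have i: "bipoly.independent (insert x ?P)" using indep bipoly.independent_insert[of x ?P]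
        by (simp only: if_False simp_thms split: if_split)
      have "insert x ?P \<subseteq> U" using x p by simp
      then have s: "insert x ?P \<subseteq> bipoly.span B" using B(3) by (rule order_trans)
      have f: "finite B" using B(4) dim by (metis card.infinite zero_neq_numeral)
      have "card (insert x ?P) \<le> card B" using bipoly.independent_span_bound[OF f i s] by (rule conjunct2)
      moreover have "x \<notin> ?P" using nx bipoly.span_base[of x ?P] by (rule contrapos_nn)
      ultimately show False using card B(4) dim card_insert_disjoint[of ?P x] by simp
    qed
  qed
  moreover have sp_U: "bipoly.span ?P \<subseteq> U" using p sub by (rule bipoly.span_minimal)
  ultimately show eq: "U = bipoly.span ?P" by (rule equalityI)
  have "bipoly.span ?P \<subseteq> ideal_gen ?P"
    by (rule bipoly.span_minimal[OF bideal.span_superset])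
      (simp add: bipoly.subspace_def const_mult_eq bideal.span_zero bideal.span_add bideal.span_scale)
  then have "U \<subseteq> ideal_gen ?P" using eq by simp
  then show "ideal_gen U = ideal_gen ?P"
    by (intro equalityI bideal.span_minimal[OF _ bideal.subspace_span] bideal.span_mono p)
qed

text \<open>The products of the forms \<open>u, v\<close> with a basis of the quadrics are
  independent: killing \<open>u\<close> isolates the part at \<open>v\<close>, and then
  \<open>u\<close> cancels.\<close>

lemma products_independent:
  fixes q0 q1 q2 u v :: "'k::field bipoly"
  assumes c: "coords var_s var_t u v" and q: "is_basis3 q0 q1 q2"
    and eq: "u * (cst a0 * q0 + cst a1 * q1 + cst a2 * q2) + v * (cst b0 * q0 + cst b1 * q1 + cst b2 * q2) = 0"
  shows "a0 = 0 \<and> a1 = 0 \<and> a2 = 0 \<and> b0 = 0 \<and> b1 = 0 \<and> b2 = 0"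
proof -
  interpret coords var_s var_t u v by (rule c)
  have ind: "a = 0 \<and> b = 0 \<and> c = 0" if 0: "cst a * q0 + cst b * q1 + cst c * q2 = 0" for a b c
  proof -
    obtain a0 a1 a2 b0 b1 b2 c0 c1 c2 where
      D: "a0 * (b1 * c2 - b2 * c1) + a1 * (b2 * c0 - b0 * c2) + a2 * (b0 * c1 - b1 * c0) \<noteq> 0" (is "?D \<noteq> 0")
      and q: "q0 = quad a0 a1 a2" "q1 = quad b0 b1 b2" "q2 = quad c0 c1 c2"
      using q unfolding is_basis3_def by blast
    have "quad (a * a0 + b * b0 + c * c0) (a * a1 + b * b1 + c * c1) (a * a2 + b * b2 + c * c2) = 0"
      using 0 unfolding q quad_def by (simp add: cst_hom algebra_simps)
    then have z: "a * a0 + b * b0 + c * c0 = 0" "a * a1 + b * b1 + c * c1 = 0" "a * a2 + b * b2 + c * c2 = 0"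
      by (simp_all add: quad_eq_0_iff)
    have "a * ?D = (a * a0 + b * b0 + c * c0) * (b1 * c2 - b2 * c1) + (a * a1 + b * b1 + c * c1) * (b2 * c0 -
      b0 * c2) + (a * a2 + b * b2 + c * c2) * (b0 * c1 - b1 * c0)"
      "b * ?D = (a * a0 + b * b0 + c * c0) * (c1 * a2 - c2 * a1) + (a * a1 + b * b1 + c * c1) * (c2 * a0 - c0
        * a2) + (a * a2 + b * b2 + c * c2) * (c0 * a1 - c1 * a0)"
      "c * ?D = (a * a0 + b * b0 + c * c0) * (a1 * b2 - a2 * b1) + (a * a1 + b * b1 + c * c1) * (a2 * b0 - a0
        * b2) + (a * a2 + b * b2 + c * c2) * (a0 * b1 - a1 * b0)"
      by (simp_all add: algebra_simps)
    then have "a * ?D = 0" "b * ?D = 0" "c * ?D = 0" unfolding z by simp_all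
    then show ?thesis using D by simp
  qed
  let ?a = "cst a0 * q0 + cst a1 * q1 + cst a2 * q2" and ?b = "cst b0 * q0 + cst b1 * q1 + cst b2 * q2"
  have g: "?a \<in> graded_piece (2, 0)" "?b \<in> graded_piece (2, 0)" using is_basis3_gp[OF q]
    by (auto intro!: gp_add gp_cst_mult)
  obtain r where r: "is_hom r" "\<And>c. r (cst c) = cst c" "r var_s = var_s" "r var_t = var_t" "r u = 0" "r v = v"
    using retraction_u by metis
  have "r (u * ?a + v * ?b) = v * ?b" using hom_fixes_quadric[OF r(1-4) g(2)]
    by (simp only: is_homD[OF r(1)] r) simp
  then have b: "?b = 0" unfolding eq using coords_neq_0 by (simp add: is_homD[OF r(1)])
  then have a: "?a = 0" using eq coords_neq_0 by simp
  show ?thesis using ind[OF a] ind[OF b] by simp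
qed

section \<open>Functionals on the quadrics and the rank of their relation\<close>

lemma functional_times: "functional f \<Longrightarrow> functional (\<lambda>q. f (l * q))"
  unfolding functional_def by (simp add: distrib_left mult.left_commute[of l])

lemma functional_quad:
  "functional f \<Longrightarrow> f (quad a b c) = a * f (var_s * var_s) + b * f (var_s * var_t) + c * f (var_t * var_t)"
  by (simp add: quad_def functionalD)

lemma kernel2:
  fixes p q r w :: "'k::field"
  assumes "p * w = q * r"
  shows "\<exists>c d. (c \<noteq> 0 \<or> d \<noteq> 0) \<and> p * c + q * d = 0 \<and> r * c + w * d = 0"
proof (cases "p = 0 \<and> q = 0")
  case True
  show ?thesis
  proof (cases "r = 0 \<and> w = 0")
    case t: True
    show ?thesis using True t by (rule_tac exI[of _ 1], rule_tac exI[of _ 0]) simp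
  next
    case f: False
    show ?thesis using True f by (rule_tac exI[of _ w], rule_tac exI[of _ "- r"]) (auto simp: mult.commute)
  qed
next
  case False
  then show ?thesis using assms by (rule_tac exI[of _ q], rule_tac exI[of _ "- p"]) (auto simp: algebra_simps)
qed

lemma orthogonal3:
  fixes x0 x1 x2 :: "'k::field"
  shows "\<exists>a b c. (a \<noteq> 0 \<or> b \<noteq> 0 \<or> c \<noteq> 0) \<and> x0 * a + x1 * b + x2 * c = 0"
proof (cases "x0 = 0 \<and> x1 = 0")
  case True
  then show ?thesis by (rule_tac exI[of _ 1], rule_tac exI[of _ 0]) simp
next
  case False
  then show ?thesis by (rule_tac exI[of _ x1], rule_tac exI[of _ "- x0"],
    rule_tac exI[of _ 0]) (auto simp: mult.commute)
qed

lemma orthogonal_parallel: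
  fixes x0 x1 x2 y0 y1 y2 :: "'k::field"
  assumes "\<not> (x0 = 0 \<and> x1 = 0 \<and> x2 = 0)" "x0 * a + x1 * b + x2 * c = 0"
    and "x1 * y2 - x2 * y1 = 0 \<and> x2 * y0 - x0 * y2 = 0 \<and> x0 * y1 - x1 * y0 = 0"
  shows "y0 * a + y1 * b + y2 * c = 0"
proof -
  have "x0 * (y0 * a + y1 * b + y2 * c) = y0 * (x0 * a + x1 * b + x2 * c) + (x0 * y1 - x1 * y0) * b - (x2 * y0
    - x0 * y2) * c"
    "x1 * (y0 * a + y1 * b + y2 * c) = y1 * (x0 * a + x1 * b + x2 * c) - (x0 * y1 - x1 * y0) * a + (x1 * y2 -
      x2 * y1) * c"
    "x2 * (y0 * a + y1 * b + y2 * c) = y2 * (x0 * a + x1 * b + x2 * c) + (x2 * y0 - x0 * y2) * a - (x1 * y2 -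
      x2 * y1) * b"
    by (simp_all add: algebra_simps)
  then show ?thesis using assms by auto
qed

text \<open>The cross product of the two rows; if it is zero the rows are parallel and one condition
  is enough.\<close>

lemma kernel23:
  fixes x0 x1 x2 y0 y1 y2 :: "'k::field"
  shows "\<exists>a b c. (a \<noteq> 0 \<or> b \<noteq> 0 \<or> c \<noteq> 0) \<and> x0 * a + x1 * b + x2 * c = 0 \<and> y0 * a + y1 * b + y2 * c = 0"
proof (cases "x1 * y2 - x2 * y1 = 0 \<and> x2 * y0 - x0 * y2 = 0 \<and> x0 * y1 - x1 * y0 = 0")
  case False
  then show ?thesis
    by (rule_tac exI[of _ "x1 * y2 - x2 * y1"], rule_tac exI[of _ "x2 * y0 - x0 * y2"],
      rule_tac exI[of _ "x0 * y1 - x1 * y0"])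
      (auto simp: algebra_simps)
next
  case True
  show ?thesis
  proof (cases "x0 = 0 \<and> x1 = 0 \<and> x2 = 0")
    case True
    then show ?thesis using orthogonal3[of y0 y1 y2] by simp
  next
    case False
    obtain a b c where w: "a \<noteq> 0 \<or> b \<noteq> 0 \<or> c \<noteq> 0" "x0 * a + x1 * b + x2 * c = 0" using orthogonal3 by blast
    with orthogonal_parallel[OF False w(2) True] show ?thesis by blast
  qed
qed

lemma kernel3:
  fixes x0 x1 x2 y0 y1 y2 z0 z1 z2 :: "'k::field"
  assumes "z0 * (x1 * y2 - x2 * y1) + z1 * (x2 * y0 - x0 * y2) + z2 * (x0 * y1 - x1 * y0) = 0"
  shows "\<exists>a b c. (a \<noteq> 0 \<or> b \<noteq> 0 \<or> c \<noteq> 0) \<and> x0 * a + x1 * b + x2 * c = 0 \<and> y0 * a + y1 * b + y2 * c = 0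
    \<and> z0 * a + z1 * b + z2 * c = 0"
proof (cases "x1 * y2 - x2 * y1 = 0 \<and> x2 * y0 - x0 * y2 = 0 \<and> x0 * y1 - x1 * y0 = 0")
  case False
  then show ?thesis using assms
    by (rule_tac exI[of _ "x1 * y2 - x2 * y1"], rule_tac exI[of _ "x2 * y0 - x0 * y2"],
      rule_tac exI[of _ "x0 * y1 - x1 * y0"])
      (auto simp: algebra_simps)
next
  case True
  show ?thesis
  proof (cases "x0 = 0 \<and> x1 = 0 \<and> x2 = 0")
    case True
    then show ?thesis using kernel23[of y0 y1 y2 z0 z1 z2] by simp
  next
    case False
    obtain a b c where w: "a \<noteq> 0 \<or> b \<noteq> 0 \<or> c \<noteq> 0" "x0 * a + x1 * b + x2 * c = 0" "z0 * a + z1 * b + z2 * c = 0"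
      using kernel23 by blast
    with orthogonal_parallel[OF False w(2) True] show ?thesis by blast
  qed
qed

lemma is_basis3I:
  assumes "p = quad a0 a1 a2" "q = quad b0 b1 b2" "r = quad c0 c1 c2"
    "a0 * (b1 * c2 - b2 * c1) + a1 * (b2 * c0 - b0 * c2) + a2 * (b0 * c1 - b1 * c0) \<noteq> 0"
  shows "is_basis3 p q r"
  unfolding is_basis3_def by (intro exI conjI, rule assms(4), rule assms(1), rule assms(2), rule assms(3))

lemma is_basis3_rotate: "is_basis3 p q r \<Longrightarrow> is_basis3 q r p"
proof -
  assume "is_basis3 p q r"
  then obtain a0 a1 a2 b0 b1 b2 c0 c1 c2 where
    "a0 * (b1 * c2 - b2 * c1) + a1 * (b2 * c0 - b0 * c2) + a2 * (b0 * c1 - b1 * c0) \<noteq> 0"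
    "p = quad a0 a1 a2" "q = quad b0 b1 b2" "r = quad c0 c1 c2" unfolding is_basis3_def by blast
  then show ?thesis by (intro is_basis3I[of q b0 b1 b2 r c0 c1 c2 p a0 a1 a2]) (simp_all add: algebra_simps)
qed

lemma quad_linear: "cst c * quad a0 a1 a2 + cst d * quad b0 b1 b2 = quad (c * a0 + d * b0) (c * a1 + d * b1)
  (c * a2 + d * b2)"
  by (simp add: quad_def cst_hom algebra_simps)

lemma is_basis3_change:
  assumes "is_basis3 p q r" "a * d - b * c \<noteq> 0"
  shows "is_basis3 p (cst a * q + cst b * r) (cst c * q + cst d * r)"
proof -
  obtain a0 a1 a2 b0 b1 b2 c0 c1 c2 where
    D: "a0 * (b1 * c2 - b2 * c1) + a1 * (b2 * c0 - b0 * c2) + a2 * (b0 * c1 - b1 * c0) \<noteq> 0" (is "?D \<noteq> 0")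
    and q: "p = quad a0 a1 a2" "q = quad b0 b1 b2" "r = quad c0 c1 c2" using assms(1) unfolding is_basis3_def
      by blast
  have "(a * d - b * c) * ?D \<noteq> 0" using D assms(2) by simp
  moreover have "(a * d - b * c) * ?D = a0 * ((a * b1 + b * c1) * (c * b2 + d * c2) - (a * b2 + b * c2) * (c *
    b1 + d * c1))
    + a1 * ((a * b2 + b * c2) * (c * b0 + d * c0) - (a * b0 + b * c0) * (c * b2 + d * c2))
    + a2 * ((a * b0 + b * c0) * (c * b1 + d * c1) - (a * b1 + b * c1) * (c * b0 + d * c0))"
    by (simp add: algebra_simps)
  ultimately show ?thesis unfolding q quad_linear by (intro is_basis3I[OF refl refl refl]) simp
qed

lemma is_basis3_swap:
  assumes "is_basis3 p q r"
  shows "is_basis3 q (- p) r"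
proof -
  have "is_basis3 r (cst 0 * p + cst 1 * q) (cst (-1) * p + cst 0 * q)"
    by (rule is_basis3_change[OF is_basis3_rotate[OF is_basis3_rotate[OF assms]]]) simp
  then have "is_basis3 r q (- p)" by (simp add: cst_minus)
  then show ?thesis by (rule is_basis3_rotate)
qed

text \<open>The quadrics have dimension three. Cross products of the coefficient vectors form a dual
  basis up to the determinant \<open>D\<close>, and for \<open>D = 0\<close> there is a common
  kernel. The scalar is harmless, since only equality of values matters later.\<close>

lemma dual_basis_or_kernel:
  fixes X Y Z :: "'k::field bipoly \<Rightarrow> 'k"
  assumes f: "functional X" "functional Y" "functional Z"
  shows "(\<exists>D qx qy qz. is_basis3 qx qy qz \<and> X qx = D \<and> Y qx = 0 \<and> Z qx = 0 \<and> X qy = 0 \<and> Y qy = D \<and> Z qy = 0 \<and>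
      X qz = 0 \<and> Y qz = 0 \<and> Z qz = D) \<or> (\<exists>q \<in> graded_piece (2, 0). q \<noteq> 0 \<and> X q = 0 \<and> Y q = 0 \<and> Z q = 0)"
proof -
  define x0 x1 x2 where "x0 = X (var_s * var_s)" "x1 = X (var_s * var_t)" "x2 = X (var_t * var_t)"
  define y0 y1 y2 where "y0 = Y (var_s * var_s)" "y1 = Y (var_s * var_t)" "y2 = Y (var_t * var_t)"
  define z0 z1 z2 where "z0 = Z (var_s * var_s)" "z1 = Z (var_s * var_t)" "z2 = Z (var_t * var_t)"
  note defs = x0_x1_x2_def y0_y1_y2_def z0_z1_z2_def
  have v: "X (quad a b c) = x0 * a + x1 * b + x2 * c" "Y (quad a b c) = y0 * a + y1 * b + y2 * c"
    "Z (quad a b c) = z0 * a + z1 * b + z2 * c" for a b c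
    using f by (simp_all add: functional_quad defs mult.commute)
  define D where "D = z0 * (x1 * y2 - x2 * y1) + z1 * (x2 * y0 - x0 * y2) + z2 * (x0 * y1 - x1 * y0)"
  show ?thesis
  proof (cases "D = 0")
    case True
    then obtain a b c where "a \<noteq> 0 \<or> b \<noteq> 0 \<or> c \<noteq> 0" "x0 * a + x1 * b + x2 * c = 0"
      "y0 * a + y1 * b + y2 * c = 0"
      "z0 * a + z1 * b + z2 * c = 0"
      using kernel3[OF True[unfolded D_def]] by (elim exE conjE)
    then have "quad a b c \<noteq> 0" "X (quad a b c) = 0" "Y (quad a b c) = 0" "Z (quad a b c) = 0"
      by (simp_all add: v quad_eq_0_iff)
    then show ?thesis using quad_gp[of a b c] by (intro disjI2 bexI[of _ "quad a b c"] conjI)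
  next
    case False
    define qx where "qx = quad (y1 * z2 - y2 * z1) (y2 * z0 - y0 * z2) (y0 * z1 - y1 * z0)"
    define qy where "qy = quad (z1 * x2 - z2 * x1) (z2 * x0 - z0 * x2) (z0 * x1 - z1 * x0)"
    define qz where "qz = quad (x1 * y2 - x2 * y1) (x2 * y0 - x0 * y2) (x0 * y1 - x1 * y0)"
    define C where "C i j = [[y1 * z2 - y2 * z1, y2 * z0 - y0 * z2, y0 * z1 - y1 * z0],
      [z1 * x2 - z2 * x1, z2 * x0 - z0 * x2, z0 * x1 - z1 * x0], [x1 * y2 - x2 * y1, x2 * y0 - x0 * y2,
        x0 * y1 - x1 * y0]] ! i ! j" for i j
    \<comment> \<open>The cofactor matrix has determinant \<open>D * D\<close>.\<close>
    have "D * D = C 0 0 * (C 1 1 * C 2 2 - C 1 2 * C 2 1) + C 0 1 * (C 1 2 * C 2 0 - C 1 0 * C 2 2) + C 0 2 *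
      (C 1 0 * C 2 1 - C 1 1 * C 2 0)"
      unfolding C_def D_def by (simp add: algebra_simps)
    moreover have "D * D \<noteq> 0" using False by simp
    moreover have q: "qx = quad (C 0 0) (C 0 1) (C 0 2)" "qy = quad (C 1 0) (C 1 1) (C 1 2)"
      "qz = quad (C 2 0) (C 2 1) (C 2 2)"
      unfolding qx_def qy_def qz_def C_def by simp_all
    ultimately have "is_basis3 qx qy qz" by (intro is_basis3I[OF q]) simp
    moreover have "X qx = D \<and> Y qx = 0 \<and> Z qx = 0 \<and> X qy = 0 \<and> Y qy = D \<and> Z qy = 0 \<and> X qz = 0 \<and> Y qz = 0 \<and>
      Z qz = D"
      unfolding qx_def qy_def qz_def v D_def by (simp add: algebra_simps)
    ultimately show ?thesis
      by (intro disjI1, rule_tac exI[of _ D], rule_tac exI[of _ qx], rule_tac exI[of _ qy],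
        rule_tac exI[of _ qz]) (rule conjI)
  qed
qed

text \<open>The values on the three monomials, padded by a zero column, form a singular matrix of
  size 4.\<close>

lemma four_functionals_dependent:
  fixes X1 X2 Y1 Y2 :: "'k::field bipoly \<Rightarrow> 'k"
  assumes f: "functional X1" "functional X2" "functional Y1" "functional Y2"
  shows "\<exists>a b c d. (a \<noteq> 0 \<or> b \<noteq> 0 \<or> c \<noteq> 0 \<or> d \<noteq> 0) \<and> (\<forall>q \<in> graded_piece (2,
    0). a * X1 q + b * X2 q + c * Y1 q + d * Y2 q = 0)"
proof -
  define val where "val F j = [F (var_s * var_s), F (var_s * var_t), F (var_t * var_t),
    0] ! j" for F :: "'k bipoly \<Rightarrow> 'k" and j
  define G where "G i = [val X1, val X2, val Y1, val Y2] ! i" for i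
  have "\<nexists>H. inverse4 G H"
  proof
    assume "\<exists>H. inverse4 G H"
    then obtain H where "inverse4 G H" ..
    then have "\<forall>i<4. \<forall>j<4. (\<Sum>l<4. H i l * G l j) = (if i = j then 1 else 0)"
      unfolding inverse4_def by (rule conjunct2)
    from this[rule_format, of 3 3] show False by (simp add: sum4 G_def val_def numeral_3_eq_3)
  qed
  then obtain c where c: "\<exists>i<4. c i \<noteq> 0" "\<forall>j<4. (\<Sum>i<4. c i * G i j) = 0" using left_kernel by blast
  have "c 0 * X1 q + c 1 * X2 q + c 2 * Y1 q + c 3 * Y2 q = 0" if q: "q \<in> graded_piece (2, 0)" for q
  proof -
    obtain x y z where q: "q = quad x y z" using gp20_quad[OF q] by blast
    have e: "c 0 * val X1 j + c 1 * val X2 j + c 2 * val Y1 j + c 3 * val Y2 j = 0" if "j < 4" for j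
      using c(2) that by (simp add: sum4 G_def numeral_3_eq_3 numeral_2_eq_2)
    have "c 0 * X1 q + c 1 * X2 q + c 2 * Y1 q + c 3 * Y2 q = x * (c 0 * val X1 0 + c 1 * val X2 0 + c 2 * val
      Y1 0 + c 3 * val Y2 0)
      + y * (c 0 * val X1 1 + c 1 * val X2 1 + c 2 * val Y1 1 + c 3 * val Y2 1)
      + z * (c 0 * val X1 2 + c 1 * val X2 2 + c 2 * val Y1 2 + c 3 * val Y2 2)"
      unfolding q functional_quad[OF f(1)] functional_quad[OF f(2)] functional_quad[OF f(3)]
        functional_quad[OF f(4)]
      by (simp add: val_def algebra_simps)
    then show ?thesis using e[of 0] e[of 1] e[of 2] by simp
  qed
  moreover have "c 0 \<noteq> 0 \<or> c 1 \<noteq> 0 \<or> c 2 \<noteq> 0 \<or> c 3 \<noteq> 0" using c(1) by (auto simp: eval_nat_numeral less_Suc_eq)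
  ultimately show ?thesis
    by (rule_tac exI[of _ "c 0"], rule_tac exI[of _ "c 1"], rule_tac exI[of _ "c 2"],
      rule_tac exI[of _ "c 3"]) (intro conjI ballI)
qed

text \<open>By \<open>eq\<close> three functionals of \<open>q\<close> are left:
  \<open>g (u * q)\<close>, \<open>g (v * q)\<close> and \<open>f (v * q)\<close>. On their dual
  basis \<open>x, y, z\<close> the values cancel for \<open>q0 = z\<close>, \<open>q1 = - y\<close>,
  \<open>q2 = x\<close>. A common kernel vector is the exceptional quadric.\<close>

lemma normal_form_L3:
  fixes U :: "'k::field bipoly set"
  assumes c: "coords var_s var_t u v" and f: "functional f" "functional g"
    and U: "\<And>p. p \<in> graded_piece (2, 1) \<Longrightarrow> f p = 0 \<Longrightarrow> g p = 0 \<Longrightarrow> p \<in> U"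
    and eq: "\<And>q. q \<in> graded_piece (2, 0) \<Longrightarrow> f (u * q) = g (v * q)"
  shows "(\<exists>q0 q1 q2. is_basis3 q0 q1 q2 \<and> {u * q0, v * q0 + u * q1, v * q1 + u * q2, v * q2} \<subseteq> U) \<or>
    (\<exists>q \<in> graded_piece (2, 0). q \<noteq> 0 \<and> u * q \<in> U \<and> v * q \<in> U)"
proof -
  interpret coords var_s var_t u v by (rule c)
  have m: "u * q \<in> graded_piece (2, 1)" "v * q \<in> graded_piece (2, 1)" if "q \<in> graded_piece (2, 0)" for q
    using gp_mult[OF gp_coords(3) that] gp_mult[OF gp_coords(4) that] by simp_all
  note fl = functionalD[OF f(1)] functionalD[OF f(2)]
  show ?thesis
    using dual_basis_or_kernel[OF functional_times[OF f(2), of u] functional_times[OF f(2),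
      of v] functional_times[OF f(1), of v]]
  proof (elim disjE exE bexE conjE)
    fix D x y z assume b: "is_basis3 x y z" and e: "g (u * x) = D" "g (v * x) = 0" "f (v * x) = 0"
      "g (u * y) = 0" "g (v * y) = D" "f (v * y) = 0" "g (u * z) = 0" "g (v * z) = 0" "f (v * z) = D"
    note gp = is_basis3_gp[OF b]
    have e': "f (u * x) = 0" "f (u * y) = D" "f (u * z) = 0" using eq[OF gp(1)] eq[OF gp(2)] eq[OF gp(3)] e
      by simp_all
    have b': "is_basis3 z (- y) x" by (rule is_basis3_swap[OF is_basis3_rotate[OF b]])
    have "{u * z, v * z + u * (- y), v * (- y) + u * x, v * x} \<subseteq> U"
      unfolding insert_subset
      by (intro conjI U empty_subsetI) (simp_all add: m gp gp_add gp_diff fl e e')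
    then show ?thesis using b' by blast
  next
    fix q assume "q \<in> graded_piece (2, 0)" "q \<noteq> 0" "g (u * q) = 0" "g (v * q) = 0" "f (v * q) = 0"
    moreover from this have "u * q \<in> U" "v * q \<in> U" by (intro U; simp add: m eq)+
    ultimately show ?thesis by blast
  qed
qed

text \<open>Now \<open>f (u * q)\<close> is zero, and the dual basis \<open>x, y, z\<close> of the
  same three functionals gives \<open>q0 = y\<close>, \<open>q1 = - x\<close>,
  \<open>q2 = z\<close>.\<close>

lemma normal_form_L2:
  fixes U :: "'k::field bipoly set"
  assumes c: "coords var_s var_t u v" and f: "functional f" "functional g"
    and U: "\<And>p. p \<in> graded_piece (2, 1) \<Longrightarrow> f p = 0 \<Longrightarrow> g p = 0 \<Longrightarrow> p \<in> U"
    and eq: "\<And>q. q \<in> graded_piece (2, 0) \<Longrightarrow> f (u * q) = 0"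
  shows "(\<exists>q0 q1 q2. is_basis3 q0 q1 q2 \<and> {u * q0, v * q0 + u * q1, v * q1, u * q2} \<subseteq> U) \<or>
    (\<exists>q \<in> graded_piece (2, 0). q \<noteq> 0 \<and> u * q \<in> U \<and> v * q \<in> U)"
proof -
  interpret coords var_s var_t u v by (rule c)
  have m: "u * q \<in> graded_piece (2, 1)" "v * q \<in> graded_piece (2, 1)" if "q \<in> graded_piece (2, 0)" for q
    using gp_mult[OF gp_coords(3) that] gp_mult[OF gp_coords(4) that] by simp_all
  note fl = functionalD[OF f(1)] functionalD[OF f(2)]
  show ?thesis
    using dual_basis_or_kernel[OF functional_times[OF f(2), of u] functional_times[OF f(2),
      of v] functional_times[OF f(1), of v]]
  proof (elim disjE exE bexE conjE)
    fix D x y z assume b: "is_basis3 x y z" and e: "g (u * x) = D" "g (v * x) = 0" "f (v * x) = 0"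
      "g (u * y) = 0" "g (v * y) = D" "f (v * y) = 0" "g (u * z) = 0" "g (v * z) = 0" "f (v * z) = D"
    note gp = is_basis3_gp[OF b]
    have b': "is_basis3 y (- x) z" by (rule is_basis3_swap[OF b])
    have "{u * y, v * y + u * (- x), v * (- x), u * z} \<subseteq> U"
      unfolding insert_subset
      by (intro conjI U empty_subsetI) (simp_all add: m gp gp_add gp_diff fl e eq)
    then show ?thesis using b' by blast
  next
    fix q assume "q \<in> graded_piece (2, 0)" "q \<noteq> 0" "g (u * q) = 0" "g (v * q) = 0" "f (v * q) = 0"
    moreover from this have "u * q \<in> U" "v * q \<in> U" by (intro U; simp add: m eq)+
    ultimately show ?thesis by blast
  qed
qed

lemma normal_form:
  fixes U :: "'k::field bipoly set"
  assumes sub: "bipoly.subspace U" and f: "functional f" "functional g"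
    and U: "\<And>p. p \<in> graded_piece (2, 1) \<Longrightarrow> f p = 0 \<Longrightarrow> g p = 0 \<Longrightarrow> p \<in> U"
  shows "(\<exists>u v q0 q1 q2. coords var_s var_t u v \<and> is_basis3 q0 q1 q2 \<and> {u * q0, v * q0 + u * q1,
    v * q1 + u * q2, v * q2} \<subseteq> U) \<or>
    (\<exists>u v q0 q1 q2. coords var_s var_t u v \<and> is_basis3 q0 q1 q2 \<and> {u * q0, v * q0 + u * q1, v * q1,
      u * q2} \<subseteq> U) \<or>
    (\<exists>q \<in> graded_piece (2, 0). q \<noteq> 0 \<and> var_u * q \<in> U \<and> var_v * q \<in> U)" (is "?A \<or> ?B \<or> ?C")
proof -
  obtain a b c d where n: "a \<noteq> 0 \<or> b \<noteq> 0 \<or> c \<noteq> 0 \<or> d \<noteq> 0" and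
    rel: "\<And>q. q \<in> graded_piece (2, 0) \<Longrightarrow> a * f (var_u * q) + b * g (var_u * q) + c * f (var_v * q) + d * g
      (var_v * q) = 0"
    using four_functionals_dependent[OF functional_times[OF f(1), of var_u] functional_times[OF f(2), of var_u]
        functional_times[OF f(1), of var_v] functional_times[OF f(2), of var_v]] by blast
  show ?thesis
  proof (cases "a * d = b * c")
    case False
    \<comment> \<open>Rank two: \<open>F\<close> and \<open>G\<close> are a new basis of the
      functionals in which the relation reads \<open>F (u * q) = G (v * q)\<close>.\<close>
    define F G where "F p = a * f p + b * g p" and "G p = (- c) * f p + (- d) * g p" for p
    have "functional F" "functional G" unfolding F_def G_def by (rule functional_linear[OF f])+
    moreover have "p \<in> U" if p: "p \<in> graded_piece (2, 1)" "F p = 0" "G p = 0" for p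
    proof (rule U[OF p(1)])
      have "(a * d - b * c) * f p = d * F p + b * G p" "(a * d - b * c) * g p = - c * F p - a * G p"
        unfolding F_def G_def by (simp_all add: algebra_simps)
      then show "f p = 0" "g p = 0" using p False by simp_all
    qed
    moreover have "F (var_u * q) = G (var_v * q)" if "q \<in> graded_piece (2, 0)" for q
      using rel[OF that] unfolding F_def G_def by (simp add: algebra_simps eq_neg_iff_add_eq_0)
    ultimately have "(\<exists>q0 q1 q2. is_basis3 q0 q1 q2 \<and> {var_u * q0, var_v * q0 + var_u * q1,
      var_v * q1 + var_u * q2, var_v * q2} \<subseteq> U) \<or>
      (\<exists>q \<in> graded_piece (2, 0). q \<noteq> 0 \<and> var_u * q \<in> U \<and> var_v * q \<in> U)"
      by (rule normal_form_L3[OF coords_std])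
    then show ?thesis using coords_std by (elim disjE) (rule disjI1, blast, blast)
  next
    case True
    obtain e e' x y where ee: "e \<noteq> 0 \<or> e' \<noteq> 0" "x \<noteq> 0 \<or> y \<noteq> 0" and r: "a = e * x" "b = e * y" "c = e' * x"
      "d = e' * y"
      using rank_one[OF True n] .
    \<comment> \<open>Rank one: the relation factors into \<open>F (u * q) = 0\<close> with one
      functional and one linear form; \<open>G\<close> and \<open>v\<close> complete them to
      bases.\<close>
    define F where "F p = x * f p + y * g p" for p
    define G where "G = (if x = 0 then f else g)"
    define u where "u = cst e * var_u + cst e' * var_v"
    define v :: "'k bipoly" where "v = (if e = 0 then var_u else var_v)"
    have uv: "is_basis2 var_u var_v u v"
    proof (cases "e = 0")
      case True
      then show ?thesis using ee unfolding is_basis2_def u_def v_def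
        by (rule_tac exI[of _ e], rule_tac exI[of _ e'], rule_tac exI[of _ 1], rule_tac exI[of _ 0]) simp
    next
      case False
      then show ?thesis unfolding is_basis2_def u_def v_def
        by (rule_tac exI[of _ e], rule_tac exI[of _ e'], rule_tac exI[of _ 0], rule_tac exI[of _ 1]) simp
    qed
    then have c: "coords var_s var_t u v" by (simp add: coords_def is_basis2_refl)
    have "functional F" unfolding F_def by (rule functional_linear[OF f])
    moreover have "functional G" using f by (simp add: G_def)
    moreover have "p \<in> U" if p: "p \<in> graded_piece (2, 1)" "F p = 0" "G p = 0" for p
      using p ee(2) by (intro U[OF p(1)]) (auto simp: F_def G_def split: if_splits)
    moreover have "F (u * q) = 0" if "q \<in> graded_piece (2, 0)" for q
      using rel[OF that] unfolding F_def u_def r distrib_right mult.assoc functionalD[OF f(1)] functionalD[OF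
        f(2)]
      by (simp add: algebra_simps)
    ultimately have "(\<exists>q0 q1 q2. is_basis3 q0 q1 q2 \<and> {u * q0, v * q0 + u * q1, v * q1, u * q2} \<subseteq> U) \<or>
      (\<exists>q \<in> graded_piece (2, 0). q \<noteq> 0 \<and> u * q \<in> U \<and> v * q \<in> U)"
      by (rule normal_form_L2[OF c])
    then show ?thesis
    proof (elim disjE)
      assume "\<exists>q0 q1 q2. is_basis3 q0 q1 q2 \<and> {u * q0, v * q0 + u * q1, v * q1, u * q2} \<subseteq> U"
      then have ?B using c by blast
      then show ?thesis by blast
    next
      assume "\<exists>q \<in> graded_piece (2, 0). q \<noteq> 0 \<and> u * q \<in> U \<and> v * q \<in> U"
      then obtain q where q: "q \<in> graded_piece (2, 0)" "q \<noteq> 0" "u * q \<in> U" "v * q \<in> U" by blast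
      obtain a b c d where i: "var_u = cst a * u + cst b * v" "var_v = cst c * u + cst d * v"
        using is_basis2_inv[OF uv] unfolding is_basis2_def by blast
      have "cst x * (u * q) + cst y * (v * q) \<in> U" for x y
        using q bipoly.subspace_add[OF sub] bipoly.subspace_scale[OF sub]
          by (simp add: const_mult_eq[symmetric])
      from this[of a b] this[of c d] have "var_u * q \<in> U" "var_v * q \<in> U"
        unfolding i by (simp_all only: distrib_right mult.assoc)
      then have ?C using q by blast
      then show ?thesis by blast
    qed
  qed
qed

section \<open>The exceptional case of a quadric whose products with u and v lie in U\<close>

lemma binary_quadratic_zero:
  fixes a b c :: "'k::alg_closed_field"
  shows "\<exists>x y. (x \<noteq> 0 \<or> y \<noteq> 0) \<and> a * (x * x) + b * (x * y) + c * (y * y) = 0"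
proof (cases "a = 0")
  case True
  then show ?thesis by (rule_tac exI[of _ 1], rule_tac exI[of _ 0]) simp
next
  case False
  obtain x where x: "x * x - (- b / a) * x + c / a = 0" using quadratic_root by blast
  have "a * (x * x) + b * (x * 1) + c * (1 * 1) = a * (x * x - (- b / a) * x + c / a)"
    using False by (simp add: field_simps)
  then have "a * (x * x) + b * (x * 1) + c * (1 * 1) = 0" unfolding x by simp
  then show ?thesis by (rule_tac exI[of _ x], rule_tac exI[of _ 1]) simp
qed

text \<open>For given \<open>x, y\<close> a second point \<open>c, d\<close> exists when a 2 x 2
  determinant vanishes, and this determinant is a quadratic form in \<open>x, y\<close>.
  Geometrically, two forms of bidegree (1,1) on a product of two projective lines have a common
  zero.\<close>

lemma bilinear_common_zero:
  fixes f11 f12 f21 f22 g11 g12 g21 g22 :: "'k::alg_closed_field"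
  shows "\<exists>x y c d. (x \<noteq> 0 \<or> y \<noteq> 0) \<and> (c \<noteq> 0 \<or> d \<noteq> 0) \<and>
    (x * f11 + y * f21) * c + (x * f12 + y * f22) * d = 0 \<and> (x * g11 + y * g21) * c + (x * g12 + y * g22) * d
      = 0"
proof -
  obtain x y where xy: "x \<noteq> 0 \<or> y \<noteq> 0" "(f11 * g12 - f12 * g11) * (x * x)
      + (f11 * g22 + f21 * g12 - f12 * g21 - f22 * g11) * (x * y) + (f21 * g22 - f22 * g21) * (y * y) = 0"
    using binary_quadratic_zero by blast
  then have "(x * f11 + y * f21) * (x * g12 + y * g22) = (x * f12 + y * f22) * (x * g11 + y * g21)"
    by (simp add: algebra_simps)
  from kernel2[OF this] show ?thesis using xy(1) by (elim exE) (rule_tac exI[of _ x], rule_tac exI[of _ y],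
    blast)
qed

lemma extend_to_basis3:
  assumes "q \<in> graded_piece (2, 0)" "q \<noteq> 0"
  shows "\<exists>r1 r2. is_basis3 q r1 r2"
proof -
  obtain a b c where q: "q = quad a b c" using gp20_quad[OF assms(1)] by blast
  have "a \<noteq> 0 \<or> b \<noteq> 0 \<or> c \<noteq> 0" using assms(2) by (simp add: q quad_eq_0_iff)
  then show ?thesis
  proof (elim disjE)
    assume "a \<noteq> 0"
    then have "is_basis3 q (quad 0 1 0) (quad 0 0 1)" by (intro is_basis3I[OF q refl refl]) simp
    then show ?thesis by blast
  next
    assume "b \<noteq> 0"
    then have "is_basis3 q (quad 1 0 0) (quad 0 0 1)" by (intro is_basis3I[OF q refl refl]) simp
    then show ?thesis by blast
  next
    assume "c \<noteq> 0"
    then have "is_basis3 q (quad 1 0 0) (quad 0 1 0)" by (intro is_basis3I[OF q refl refl]) simp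
    then show ?thesis by blast
  qed
qed

lemma is_basis2_extend:
  assumes "a \<noteq> 0 \<or> b \<noteq> 0"
  shows "\<exists>y. is_basis2 p q (cst a * p + cst b * q) y"
proof (cases "a = 0")
  case True
  then have "is_basis2 p q (cst a * p + cst b * q) p" using assms unfolding is_basis2_def
    by (rule_tac exI[of _ a], rule_tac exI[of _ b], rule_tac exI[of _ 1], rule_tac exI[of _ 0]) simp
  then show ?thesis by blast
next
  case False
  then have "is_basis2 p q (cst a * p + cst b * q) q" unfolding is_basis2_def
    by (rule_tac exI[of _ a], rule_tac exI[of _ b], rule_tac exI[of _ 0], rule_tac exI[of _ 1]) simp
  then show ?thesis by blast
qed

lemma is_basis3_extend:
  assumes "is_basis3 q r1 r2" "a \<noteq> 0 \<or> b \<noteq> 0"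
  shows "\<exists>q2. is_basis3 q (cst a * r1 + cst b * r2) q2"
proof (cases "a = 0")
  case True
  then show ?thesis using is_basis3_change[OF assms(1), where a=a and b=b and c=1 and d=0] assms(2) by auto
next
  case False
  then show ?thesis using is_basis3_change[OF assms(1), where a=a and b=b and c=0 and d=1] by auto
qed

lemma ev_quadric:
  assumes "q \<in> graded_piece (2, 0)"
  shows "ev (\<lambda>x. x) x y z w q = ev (\<lambda>x. x) x y 0 0 q"
proof -
  obtain a b c where "q = quad a b c" using gp20_quad[OF assms] by blast
  then show ?thesis by (simp add: quad_def ev_add is_hom_id ev_mult ev_cst ev_vars)
qed

lemma quadric_zero:
  fixes q :: "'k::alg_closed_field bipoly"
  assumes "q \<in> graded_piece (2, 0)"
  shows "\<exists>x y. (x \<noteq> 0 \<or> y \<noteq> 0) \<and> ev (\<lambda>x. x) x y 0 0 q = 0"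
proof -
  obtain a b c where q: "q = quad a b c" using gp20_quad[OF assms] by blast
  have "ev (\<lambda>x. x) x y 0 0 q = a * (x * x) + b * (x * y) + c * (y * y)" for x y
    unfolding q by (simp add: quad_def ev_add is_hom_id ev_mult ev_cst ev_vars)
  then show ?thesis using binary_quadratic_zero[of a b c] by simp
qed

lemma coords_zero:
  fixes u v :: "'k::field bipoly"
  assumes "coords var_s var_t u v"
  shows "\<exists>z w. (z \<noteq> 0 \<or> w \<noteq> 0) \<and> (\<forall>x y. ev (\<lambda>x. x) x y z w u = 0)"
proof -
  obtain a b c d where u: "a * d - b * c \<noteq> 0" "u = cst a * var_u + cst b * var_v"
    using assms unfolding coords_def is_basis2_def by blast
  have "ev (\<lambda>x. x) x y b (- a) u = 0" for x y
    unfolding u(2) by (simp add: ev_add is_hom_id ev_mult ev_cst ev_vars)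
  moreover have "b \<noteq> 0 \<or> - a \<noteq> 0" using u(1) by auto
  ultimately show ?thesis by blast
qed

lemma basepoint_freeD:
  fixes U :: "'k::field bipoly set"
  assumes bpf: "basepoint_free U" and U: "U = bipoly.span P"
    and z: "z \<noteq> 0 \<or> w \<noteq> 0" and P: "\<And>p. p \<in> P \<Longrightarrow> ev (\<lambda>x. x) x y z w p = 0"
  shows "x = 0 \<and> y = 0"
proof (rule ccontr)
  assume xy: "\<not> (x = 0 \<and> y = 0)"
  have "bipoly.subspace {p. ev (\<lambda>x. x) x y z w p = 0}"
    by (simp add: bipoly.subspace_def const_mult_eq ev_add is_hom_id ev_mult)
  then have "U \<subseteq> {p. ev (\<lambda>x. x) x y z w p = 0}" unfolding U using P by (intro bipoly.span_minimal) auto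
  then have "\<forall>p\<in>U. bipoly_eval p (x, y) (z, w) = 0" by (auto simp: bipoly_eval_eq)
  then show False using bpf xy z unfolding basepoint_free_def by (metis prod.inject zero_prod_def)
qed

text \<open>At the zero of \<open>u\<close> only the terms with the factor \<open>v\<close> survive.\<close>

lemma coprime_of_basepoint_free:
  fixes U :: "'k::field bipoly set"
  assumes bpf: "basepoint_free U" "U = bipoly.span {p0, p1, p2, p3}" and c: "coords var_s var_t u v"
    and q: "q0 \<in> graded_piece (2, 0)" "q1 \<in> graded_piece (2, 0)"
    and z: "ev (\<lambda>x. x) x y 0 0 q0 = 0" "ev (\<lambda>x. x) x y 0 0 q1 = 0"
    and p: "\<And>h. is_hom h \<Longrightarrow> h u = (0 :: 'k) \<Longrightarrow> h q0 = 0 \<Longrightarrow> h q1 = 0 \<Longrightarrow> h p0 = 0 \<and> h p1 = 0 \<and> h p2 = 0 \<and> h p3 = 0"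
  shows "x = 0 \<and> y = 0"
proof -
  obtain z w where zw: "z \<noteq> 0 \<or> w \<noteq> 0" "\<And>x y. ev (\<lambda>x. x) x y z w u = 0" using coords_zero[OF c] by blast
  have "ev (\<lambda>x. x) x y z w q0 = 0" "ev (\<lambda>x. x) x y z w q1 = 0"
    using z ev_quadric[OF q(1), of x y z w] ev_quadric[OF q(2), of x y z w] by simp_all
  note h = p[OF is_hom_ev[OF is_hom_id] zw(2) this]
  have "ev (\<lambda>x. x) x y z w p = 0" if "p \<in> {p0, p1, p2, p3}" for p
    using that h by auto
  with bpf zw(1) show ?thesis by (rule basepoint_freeD)
qed

text \<open>On the products of \<open>var_u, var_v\<close> with a complement of \<open>q0\<close>
  the functionals are two bilinear forms. A common zero of them is a product \<open>u * q1\<close>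
  in \<open>U\<close>. Three coefficients against two conditions give a fourth generator, to be
  simplified by completing products.\<close>

lemma corank_two_type:
  fixes U :: "'k::alg_closed_field bipoly set"
  assumes U4: "four_dim_subspace U" and bpf: "basepoint_free U"
    and f: "functional f" "functional g"
    and U: "\<And>p. p \<in> graded_piece (2, 1) \<Longrightarrow> f p = 0 \<Longrightarrow> g p = 0 \<Longrightarrow> p \<in> U"
    and q0: "q0 \<in> graded_piece (2, 0)" "q0 \<noteq> 0" "var_u * q0 \<in> U" "var_v * q0 \<in> U"
  shows "of_numerical_type 5 (ideal_gen U) \<or> of_numerical_type 6 (ideal_gen U)"
proof -
  have sub: "bipoly.subspace U" using U4 by (simp add: four_dim_subspace_def)
  have lin: "cst a * p + cst b * q \<in> U" if "p \<in> U" "q \<in> U" for a b p q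
    using that bipoly.subspace_add[OF sub] bipoly.subspace_scale[OF sub] by (simp add: const_mult_eq[symmetric])
  note fl = functionalD[OF f(1)] functionalD[OF f(2)]
  obtain r1 r2 where b3: "is_basis3 q0 r1 r2" using extend_to_basis3[OF q0(1,2)] by blast
  obtain x y c d where xy: "x \<noteq> 0 \<or> y \<noteq> 0" "c \<noteq> 0 \<or> d \<noteq> 0" and
    0: "(x * f (var_u * r1) + y * f (var_v * r1)) * c + (x * f (var_u * r2) + y * f (var_v * r2)) * d = 0"
    "(x * g (var_u * r1) + y * g (var_v * r1)) * c + (x * g (var_u * r2) + y * g (var_v * r2)) * d = 0"
    using bilinear_common_zero by blast
  define u q1 where "u = cst x * var_u + cst y * var_v" and "q1 = cst c * r1 + cst d * r2"
  obtain v where uv: "is_basis2 var_u var_v u v" using is_basis2_extend[OF xy(1)] unfolding u_def by blast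
  have cd: "coords var_s var_t u v" using uv by (simp add: coords_def is_basis2_refl)
  interpret coords var_s var_t u v by (rule cd)
  obtain q2 where q: "is_basis3 q0 q1 q2" using is_basis3_extend[OF b3 xy(2)] unfolding q1_def by blast
  note gp = is_basis3_gp[OF q]
  have m: "u * q \<in> graded_piece (2, 1)" "v * q \<in> graded_piece (2, 1)" if "q \<in> graded_piece (2, 0)" for q
    using gp_mult[OF gp_coords(3) that] gp_mult[OF gp_coords(4) that] by simp_all
  have "u * q1 = cst c * (cst x * (var_u * r1) + cst y * (var_v * r1)) + cst d * (cst x * (var_u * r2) + cst y
    * (var_v * r2))"
    unfolding u_def q1_def by (simp add: algebra_simps)
  then have "f (u * q1) = c * (x * f (var_u * r1) + y * f (var_v * r1)) + d * (x * f (var_u * r2) + y * f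
    (var_v * r2))"
    "g (u * q1) = c * (x * g (var_u * r1) + y * g (var_v * r1)) + d * (x * g (var_u * r2) + y * g (var_v * r2))"
    by (simp_all only: fl)
  then have "f (u * q1) = 0" "g (u * q1) = 0" using 0 by (simp_all add: mult.commute)
  then have U2: "u * q1 \<in> U" by (rule U[OF m(1)[OF gp(2)]])
  obtain a1 b1 c1 d1 where uv': "u = cst a1 * var_u + cst b1 * var_v" "v = cst c1 * var_u + cst d1 * var_v"
    using uv unfolding is_basis2_def by blast
  have U01: "u * q0 \<in> U" "v * q0 \<in> U"
    using lin[OF q0(3,4), of a1 b1] lin[OF q0(3,4), of c1 d1] unfolding uv'
      by (simp_all add: distrib_right mult.assoc)
  obtain \<gamma> \<beta> \<delta> where n: "\<gamma> \<noteq> 0 \<or> \<beta> \<noteq> 0 \<or> \<delta> \<noteq> 0" and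
    k: "f (u * q2) * \<gamma> + f (v * q1) * \<beta> + f (v * q2) * \<delta> = 0"
      "g (u * q2) * \<gamma> + g (v * q1) * \<beta> + g (v * q2) * \<delta> = 0"
    using kernel23 by blast
  define G where "G = cst \<gamma> * (u * q2) + cst \<beta> * (v * q1) + cst \<delta> * (v * q2)"
  have G: "G \<in> U"
  proof (rule U)
    show "G \<in> graded_piece (2, 1)" unfolding G_def by (intro gp_add gp_cst_mult m gp)
    show "f G = 0" "g G = 0" using k unfolding G_def by (simp_all add: fl mult.commute)
  qed
  show ?thesis
  proof (cases "\<delta> = 0")
    case \<delta>: False
    define e where "e = inverse \<delta>"
    have e: "e * \<delta> = 1" using \<delta> by (simp add: e_def)
    have ce: "cst e * cst \<delta> = 1" using e by (metis cst_1 cst_mult)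
    \<comment> \<open>A suitable multiple of \<open>u * q1\<close> completes the scaled
      \<open>G\<close> to a product \<open>w * z\<close>; this is the shape of
      \<open>type_5a\<close>.\<close>
    define z where "z = cst (e * \<beta>) * q1 + cst 1 * q2"
    define w where "w = v + cst (e * \<gamma>) * u"
    have qz: "is_basis3 q0 q1 z"
      using is_basis3_change[OF q, of 1 1 0 "e * \<beta>"] unfolding z_def by simp
    have "is_basis2 u v u w" unfolding is_basis2_def w_def
      by (rule exI[of _ 1], rule exI[of _ 0], rule exI[of _ "e * \<gamma>"], rule exI[of _ 1]) (simp add: add.commute)
    then have cw: "coords var_s var_t u w" using is_basis2_trans[OF uv] by (simp add: coords_def is_basis2_refl)
    have "w * z = cst e * G + cst (e * \<gamma> * (e * \<beta>)) * (u * q1)"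
    proof -
      have "cst e * G = cst (e * \<gamma>) * (u * q2) + cst (e * \<beta>) * (v * q1) + (cst e * cst \<delta>) * (v * q2)"
        unfolding G_def by (simp add: cst_hom algebra_simps)
      then show ?thesis unfolding w_def z_def ce by (simp add: cst_hom algebra_simps)
    qed
    then have wz: "w * z \<in> U" using lin[OF G U2] by simp
    have wq: "w * q0 \<in> U" using lin[OF U01(2,1), of 1 "e * \<gamma>"] unfolding w_def
      by (simp add: distrib_right mult.assoc)
    have P: "{u * q0, w * q0, u * q1, w * z} \<subseteq> U" using U01 wq U2 wz by simp
    have ind: "a = 0 \<and> b = 0 \<and> c = 0 \<and> d = 0"
      if "cst a * (u * q0) + cst b * (w * q0) + cst c * (u * q1) + cst d * (w * z) = 0" for a b c d
    proof -
      have "u * (cst a * q0 + cst c * q1 + cst 0 * z) + w * (cst b * q0 + cst 0 * q1 + cst d * z) = 0"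
        using that by (simp add: algebra_simps)
      from products_independent[OF cw qz this] show ?thesis by simp
    qed
    have S: "U = bipoly.span {u * q0, w * q0, u * q1, w * z}" "ideal_gen U = ideal_gen {u * q0, w * q0,
      u * q1, w * z}"
      by (rule span_of_independent[OF U4 P], erule ind)+
    have cw': "coords var_s var_t w u" using cw is_basis2_swap by (auto simp: coords_def)
    have "of_numerical_type 5 (ideal_gen {u * q0, w * q0, u * q1, w * z})"
    proof (rule type_5a[OF cw qz])
      show "x = 0 \<and> y = 0" if "ev (\<lambda>x. x) x y 0 0 q0 = 0" "ev (\<lambda>x. x) x y 0 0 q1 = 0" for x y
      by (rule coprime_of_basepoint_free[OF bpf S(1) cw' _ _ that]) (simp_all add: is_homD gp)
      show "x = 0 \<and> y = 0" if "ev (\<lambda>x. x) x y 0 0 q0 = 0" "ev (\<lambda>x. x) x y 0 0 z = 0" for x y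
      by (rule coprime_of_basepoint_free[OF bpf S(1) cw _ _ that]) (simp_all add: is_homD is_basis3_gp[OF qz])
    qed
    then show ?thesis unfolding S(2) by (rule disjI1)
  next
    case \<delta>: True
    \<comment> \<open>Otherwise all generators except \<open>v * q0\<close> are multiples of
      \<open>u\<close>, and a zero of \<open>u\<close> together with a zero of \<open>q0\<close> is
      a basepoint.\<close>
    have \<beta>: "\<beta> \<noteq> 0"
    proof
      assume \<beta>: "\<beta> = 0"
      define e where "e = inverse \<gamma>"
      have "e * \<gamma> = 1" using n \<delta> \<beta> by (simp add: e_def)
      then have "cst e * cst \<gamma> = 1" by (metis cst_1 cst_mult)
      then have "u * q2 = cst e * G + cst 0 * G" unfolding G_def \<delta> \<beta> by (simp add: mult.assoc[symmetric])
      then have "u * q2 \<in> U" using lin[OF G G, of e 0] by simp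
      then have P: "{u * q0, v * q0, u * q1, u * q2} \<subseteq> U" using U01 U2 by simp
      have ind: "a = 0 \<and> b = 0 \<and> c = 0 \<and> d = 0"
        if "cst a * (u * q0) + cst b * (v * q0) + cst c * (u * q1) + cst d * (u * q2) = 0" for a b c d
      proof -
        have "u * (cst a * q0 + cst c * q1 + cst d * q2) + v * (cst b * q0 + cst 0 * q1 + cst 0 * q2) = 0"
          using that by (simp add: algebra_simps)
        from products_independent[OF cd q this] show ?thesis by simp
      qed
      have S: "U = bipoly.span {u * q0, v * q0, u * q1, u * q2}" "ideal_gen U = ideal_gen {u * q0, v * q0,
        u * q1, u * q2}"
      by (rule span_of_independent[OF U4 P], erule ind)+
      obtain x y where xy: "x \<noteq> 0 \<or> y \<noteq> 0" "ev (\<lambda>x. x) x y 0 0 q0 = 0" using quadric_zero[OF q0(1)] by blast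
      have "x = 0 \<and> y = 0"
      by (rule coprime_of_basepoint_free[OF bpf S(1) cd _ _ xy(2,2)]) (simp_all add: is_homD gp)
      then show False using xy(1) by simp
    qed
    define e where "e = inverse \<beta>"
    have "e * \<beta> = 1" using \<beta> by (simp add: e_def)
    then have ce: "cst e * cst \<beta> = 1" by (metis cst_1 cst_mult)
    define z where "z = cst (e * \<gamma>) * q2"
    have "v * q1 + u * z = cst e * G + cst 0 * G" unfolding G_def \<delta> z_def
      using ce by (simp add: distrib_left mult.assoc[symmetric] cst_hom mult.commute[of u] add.commute)
    then have Gz: "v * q1 + u * z \<in> U" using lin[OF G G, of e 0] by simp
    then have P: "{u * q0, v * q0, u * q1, v * q1 + u * z} \<subseteq> U" using U01 U2 by simp
    have ind: "a = 0 \<and> b = 0 \<and> c = 0 \<and> d = 0"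
      if "cst a * (u * q0) + cst b * (v * q0) + cst c * (u * q1) + cst d * (v * q1 + u * z) = 0" for a b c d
    proof -
      have "u * (cst a * q0 + cst c * q1 + cst (d * (e * \<gamma>)) * q2) + v * (cst b * q0 + cst d * q1 + cst 0 *
        q2) = 0"
        using that unfolding z_def by (simp add: cst_hom algebra_simps)
      from products_independent[OF cd q this] show ?thesis by simp
    qed
    have S: "U = bipoly.span {u * q0, v * q0, u * q1, v * q1 + u * z}" "ideal_gen U = ideal_gen {u * q0,
      v * q0, u * q1, v * q1 + u * z}"
      by (rule span_of_independent[OF U4 P], erule ind)+
    have cop: "x = 0 \<and> y = 0" if "ev (\<lambda>x. x) x y 0 0 q0 = 0" "ev (\<lambda>x. x) x y 0 0 q1 = 0" for x y
    by (rule coprime_of_basepoint_free[OF bpf S(1) cd _ _ that]) (simp_all add: is_homD gp)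
    \<comment> \<open>\<open>z\<close> is a multiple of \<open>q2\<close>: if it is zero the type is
      6, otherwise \<open>q0, q1, z\<close> is still a basis and \<open>type_5b\<close>
      applies.\<close>
    show ?thesis
    proof (cases "\<gamma> = 0")
      case True
      then have "z = 0" by (simp add: z_def)
      moreover have "of_numerical_type 6 (ideal_gen {u * q0, v * q0, u * q1, v * q1})"
        by (rule type_6[OF cd q cop])
      ultimately show ?thesis unfolding S(2) by simp
    next
      case False
      then have "e * \<gamma> \<noteq> 0" using \<beta> by (simp add: e_def)
      then have "is_basis3 q0 (cst 1 * q1 + cst 0 * q2) (cst 0 * q1 + cst (e * \<gamma>) * q2)"
        by (intro is_basis3_change[OF q]) simp
      then have "is_basis3 q0 q1 z" by (simp add: z_def)
      then have "of_numerical_type 5 (ideal_gen {u * q0, v * q0, u * q1, v * q1 + u * z})"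
        by (rule type_5b[OF cd _ cop])
      then show ?thesis unfolding S(2) by (rule disjI1)
    qed
  qed
qed

theorem numerical_type_exists:
  fixes U :: "'k::alg_closed_field bipoly set"
  assumes U4: "four_dim_subspace U" and bpf: "basepoint_free U"
  shows "\<exists>n \<in> {1..6}. of_numerical_type n (ideal_gen U)"
proof -
  obtain f g where f: "functional f" "functional g" and
    U: "\<And>p. p \<in> graded_piece (2, 1) \<Longrightarrow> f p = 0 \<Longrightarrow> g p = 0 \<Longrightarrow> p \<in> U"
    using functionals_exist[OF U4] by blast
  have sub: "bipoly.subspace U" using U4 by (simp add: four_dim_subspace_def)
  have "(\<exists>u v q0 q1 q2. coords var_s var_t u v \<and> is_basis3 q0 q1 q2 \<and> {u * q0, v * q0 + u * q1,
    v * q1 + u * q2, v * q2} \<subseteq> U) \<or>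
    (\<exists>u v q0 q1 q2. coords var_s var_t u v \<and> is_basis3 q0 q1 q2 \<and> {u * q0, v * q0 + u * q1, v * q1,
      u * q2} \<subseteq> U) \<or>
    (\<exists>q \<in> graded_piece (2, 0). q \<noteq> 0 \<and> var_u * q \<in> U \<and> var_v * q \<in> U)"
    by (rule normal_form[OF sub f U])
  then show ?thesis
  proof (elim disjE exE bexE conjE)
    fix u v q0 q1 q2 assume cd: "coords var_s var_t u v" and q: "is_basis3 q0 q1 q2"
      and P: "{u * q0, v * q0 + u * q1, v * q1 + u * q2, v * q2} \<subseteq> U"
    have ind: "a = 0 \<and> b = 0 \<and> c = 0 \<and> d = 0"
      if "cst a * (u * q0) + cst b * (v * q0 + u * q1) + cst c * (v * q1 + u * q2) + cst d * (v * q2) = 0" for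
        a b c d
    proof -
      have "u * (cst a * q0 + cst b * q1 + cst c * q2) + v * (cst b * q0 + cst c * q1 + cst d * q2) = 0"
        using that by (simp add: algebra_simps)
      from products_independent[OF cd q this] show ?thesis by simp
    qed
    have "ideal_gen U = ideal_gen {u * q0, v * q0 + u * q1, v * q1 + u * q2, v * q2}"
      by (rule span_of_independent[OF U4 P], erule ind)
    then show ?thesis using type_L3[OF cd q] by auto
  next
    fix u v q0 q1 q2 assume cd: "coords var_s var_t u v" and q: "is_basis3 q0 q1 q2"
      and P: "{u * q0, v * q0 + u * q1, v * q1, u * q2} \<subseteq> U"
    have ind: "a = 0 \<and> b = 0 \<and> c = 0 \<and> d = 0"
      if "cst a * (u * q0) + cst b * (v * q0 + u * q1) + cst c * (v * q1) + cst d * (u * q2) = 0" for a b c d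
    proof -
      have "u * (cst a * q0 + cst b * q1 + cst d * q2) + v * (cst b * q0 + cst c * q1 + cst 0 * q2) = 0"
        using that by (simp add: algebra_simps)
      from products_independent[OF cd q this] show ?thesis by simp
    qed
    have S: "U = bipoly.span {u * q0, v * q0 + u * q1, v * q1, u * q2}" "ideal_gen U = ideal_gen {u * q0,
      v * q0 + u * q1, v * q1, u * q2}"
      by (rule span_of_independent[OF U4 P], erule ind)+
    have cop: "x = 0 \<and> y = 0" if "ev (\<lambda>x. x) x y 0 0 q0 = 0" "ev (\<lambda>x. x) x y 0 0 q1 = 0" for x y
    by (rule coprime_of_basepoint_free[OF bpf S(1) cd _ _ that]) (simp_all add: is_homD is_basis3_gp[OF q])
    have "of_numerical_type 2 (ideal_gen {u * q0, v * q0 + u * q1, v * q1, u * q2}) \<or>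
      of_numerical_type 4 (ideal_gen {u * q0, v * q0 + u * q1, v * q1, u * q2})" by (rule type_L2[OF cd q cop])
    then show ?thesis unfolding S(2) by auto
  next
    fix q assume h: "q \<in> graded_piece (2, 0)" "q \<noteq> 0" "var_u * q \<in> U" "var_v * q \<in> U"
    have "of_numerical_type 5 (ideal_gen U) \<or> of_numerical_type 6 (ideal_gen U)"
      by (rule corank_two_type[OF U4 bpf f _ h]) (rule U)
    then show ?thesis by auto
  qed
qed

section \<open>The types exclude each other\<close>

text \<open>The beginning of a minimal resolution in equations. Evaluation at the origin is the
  constant term: by \<open>D_min\<close> no syzygy has a unit entry, and \<open>rel_min\<close>
  makes the columns of \<open>D\<close> minimal generators of the syzygies.\<close>

locale presented =
  fixes I :: "'k::field bipoly set" and L :: free_module and p :: "nat \<Rightarrow> 'k bipoly" and D :: "nat \<Rightarrow> nat \<Rightarrow>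
    'k bipoly"
  assumes p_gp: "\<And>i. i < 4 \<Longrightarrow> p i \<in> graded_piece (2, 1)"
    and I_eq: "I = {q. \<exists>x. q = (\<Sum>i<4. p i * x i)}"
    and syz_iff: "\<And>a. (\<Sum>i<4. p i * a i) = 0 \<longleftrightarrow> (\<exists>b. \<forall>i<4. a i = (\<Sum>j<length L. D i j * b j))"
    and D_gp: "\<And>i j. i < 4 \<Longrightarrow> j < length L \<Longrightarrow> D i j \<in> graded_piece (L ! j - (2, 1))"
    and D_min: "\<And>i j. i < 4 \<Longrightarrow> j < length L \<Longrightarrow> ev (\<lambda>x. x) 0 0 0 0 (D i j) = 0"
    and rel_min: "\<And>b j. (\<And>i. i < 4 \<Longrightarrow> (\<Sum>j<length L. D i j * b j) = 0) \<Longrightarrow> j < length L \<Longrightarrow>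
      ev (\<lambda>x. x) 0 0 0 0 (b j) = 0"

lemma ev_irrelevant:
  assumes "q \<in> ideal_gen {var_s, var_t, var_u, var_v :: 'k::field bipoly}"
  shows "ev (\<lambda>x. x) 0 0 0 0 q = 0"
proof -
  have "ideal_gen {var_s, var_t, var_u, var_v :: 'k bipoly} \<subseteq> {q. ev (\<lambda>x. x) 0 0 0 0 q = 0}"
    by (rule bideal.span_minimal) (auto simp: bideal.subspace_def ev_add ev_mult is_hom_id)
  then show ?thesis using assms by blast
qed

lemma ev_sum: "is_hom h \<Longrightarrow> ev h x y z w (sum f A) = (\<Sum>i\<in>A. ev h x y z w (f i))"
  by (induction A rule: infinite_finite_induct) (simp_all add: ev_add)

lemma index_mult_mat_vec_sum:
  assumes "A \<in> carrier_mat m n" "x \<in> carrier_vec n" "i < m"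
  shows "(A *\<^sub>v x) $ i = (\<Sum>j<n. A $$ (i, j) * x $ j)"
  using assms by (simp add: scalar_prod_def lessThan_atLeast0)

text \<open>For \<open>rel_min\<close>: relations among the columns of the second matrix come from
  the third one, whose entries lie in the ideal of the variables.\<close>

lemma presented_of_resolution:
  fixes I :: "'k::field bipoly set"
  assumes res: "minimal_free_resolution I F d" and F1: "F 1 = replicate 4 (2, 1)"
  shows "\<exists>p D. presented I (F 2) p D"
  supply One_nat_def [simp del]
proof -
  define p where "p i = d 1 $$ (0, i)" for i
  define D where "D i j = d 2 $$ (i, j)" for i j
  define E where "E i j = d 3 $$ (i, j)" for i j
  note R = res[unfolded minimal_free_resolution_def]
  have hom1: "d 1 \<in> graded_hom (F 1) [(0, 0)]" using R by (elim conjE)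
  have homs: "d (i + 1) \<in> graded_hom (F (i + 1)) (F i)" if "i \<ge> 1" for i using R that by blast
  have im: "(\<lambda>x. x $ 0) ` mat_image (d 1) = I" using R by (elim conjE)
  have ex: "mat_kernel (d i) = mat_image (d (i + 1))" if "i \<ge> 1" for i using R that by blast
  have mn: "d (i + 1) $$ (r, c) \<in> ideal_gen {var_s, var_t, var_u, var_v}" if "i \<ge> 1" "r < length (F i)"
    "c < length (F (i + 1))" for i r c
    using R that by blast
  have 12: "(1::nat) + 1 = 2" "(2::nat) + 1 = 3" by simp_all
  note hom2 = homs[of 1, unfolded 12] and hom3 = homs[of 2, unfolded 12] and ex1 = ex[of 1,
    unfolded 12] and ex2 = ex[of 2, unfolded 12]
  have l4: "length (F 1) = 4" using F1 by simp
  have c1: "d 1 \<in> carrier_mat 1 4" using hom1 l4 by (simp add: graded_hom_def One_nat_def)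
  have c2: "d 2 \<in> carrier_mat 4 (length (F 2))" using hom2 l4 by (simp add: graded_hom_def)
  have c3: "d 3 \<in> carrier_mat (length (F 2)) (length (F 3))" using hom3 by (simp add: graded_hom_def)
  have m1: "(d 1 *\<^sub>v x) $ 0 = (\<Sum>i<4. p i * x $ i)" if "x \<in> carrier_vec 4" for x
    using index_mult_mat_vec_sum[OF c1 that] by (simp add: p_def)
  have m2: "(d 2 *\<^sub>v x) $ i = (\<Sum>j<length (F 2). D i j * x $ j)" if "x \<in> carrier_vec (length (F 2))"
    "i < 4" for x i
    using index_mult_mat_vec_sum[OF c2 that] by (simp add: D_def)
  have "presented I (F 2) p D"
  proof
    show "p i \<in> graded_piece (2, 1)" if "i < 4" for i
    proof -
      have "d 1 $$ (0, i) \<in> graded_piece (F 1 ! i - [(0, 0)] ! 0)" using hom1 that l4 unfolding graded_hom_def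
        by fastforce
      then show ?thesis using that by (simp add: p_def F1)
    qed
    show "I = {q. \<exists>x. q = (\<Sum>i<4. p i * x i)}"
    proof (intro equalityI subsetI)
      fix q assume "q \<in> I"
      then obtain x where x: "x \<in> carrier_vec 4" "q = (d 1 *\<^sub>v x) $ 0"
        using c1 unfolding im[symmetric] mat_image_def by auto
      then have "q = (\<Sum>i<4. p i * x $ i)" using m1 by simp
      then show "q \<in> {q. \<exists>x. q = (\<Sum>i<4. p i * x i)}" by blast
    next
      fix q assume "q \<in> {q. \<exists>x. q = (\<Sum>i<4. p i * x i)}"
      then obtain x where x: "q = (\<Sum>i<4. p i * x i)" by blast
      have "q = (d 1 *\<^sub>v vec 4 x) $ 0" unfolding x by (subst m1) simp_all
      moreover have "d 1 *\<^sub>v vec 4 x \<in> mat_image (d 1)" using c1 unfolding mat_image_def by (intro imageI) simp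
      ultimately show "q \<in> I" unfolding im[symmetric] by (rule image_eqI)
    qed
    show "(\<Sum>i<4. p i * a i) = 0 \<longleftrightarrow> (\<exists>b. \<forall>i<4. a i = (\<Sum>j<length (F 2). D i j * b j))" for a
    proof
      assume 0: "(\<Sum>i<4. p i * a i) = 0"
      have "d 1 *\<^sub>v vec 4 a = 0\<^sub>v 1"
      proof (rule eq_vecI)
        fix i assume "i < dim_vec (0\<^sub>v 1 :: 'k bipoly vec)"
        then have "i = 0" by simp
        then show "(d 1 *\<^sub>v vec 4 a) $ i = 0\<^sub>v 1 $ i" using 0 by (simp only: m1 vec_carrier) simp
      qed (use c1 in simp)
      then have "vec 4 a \<in> mat_kernel (d 1)" using c1 by (simp add: mat_kernel_def)
      then obtain b where b: "b \<in> carrier_vec (length (F 2))" "vec 4 a = d 2 *\<^sub>v b"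
        using ex1 c2 unfolding mat_image_def by auto
      have "a i = (\<Sum>j<length (F 2). D i j * b $ j)" if "i < 4" for i
        using arg_cong[OF b(2), of "\<lambda>v. v $ i"] m2[OF b(1) that] that by simp
      then show "\<exists>b. \<forall>i<4. a i = (\<Sum>j<length (F 2). D i j * b j)" by blast
    next
      assume "\<exists>b. \<forall>i<4. a i = (\<Sum>j<length (F 2). D i j * b j)"
      then obtain b where b: "\<forall>i<4. a i = (\<Sum>j<length (F 2). D i j * b j)" by blast
      let ?b = "vec (length (F 2)) b"
      have e: "d 2 *\<^sub>v ?b = vec 4 a"
        by (rule eq_vecI) (use b c2 m2[of ?b] in simp_all)
      have "d 2 *\<^sub>v ?b \<in> mat_kernel (d 1)" using ex1 c2 unfolding mat_image_def by auto
      then have "d 1 *\<^sub>v vec 4 a = 0\<^sub>v 1" using c1 unfolding e by (simp add: mat_kernel_def)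
      then have "(d 1 *\<^sub>v vec 4 a) $ 0 = 0" by simp
      then show "(\<Sum>i<4. p i * a i) = 0" by (simp only: m1 vec_carrier) simp
    qed
    show "D i j \<in> graded_piece (F 2 ! j - (2, 1))" if "i < 4" "j < length (F 2)" for i j
    proof -
      have "d 2 $$ (i, j) \<in> graded_piece (F 2 ! j - F 1 ! i)" using hom2 that l4 unfolding graded_hom_def
        by fastforce
      then show ?thesis using that by (simp add: D_def F1)
    qed
    show "ev (\<lambda>x. x) 0 0 0 0 (D i j) = 0" if "i < 4" "j < length (F 2)" for i j
      unfolding D_def by (rule ev_irrelevant) (use mn[of 1 i j] that l4 in \<open>simp add: numeral_2_eq_2\<close>)
    show "ev (\<lambda>x. x) 0 0 0 0 (b j) = 0"
      if b: "\<And>i. i < 4 \<Longrightarrow> (\<Sum>j<length (F 2). D i j * b j) = 0" and j: "j < length (F 2)" for b j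
    proof -
      let ?b = "vec (length (F 2)) b"
      have "d 2 *\<^sub>v ?b = 0\<^sub>v 4" by (rule eq_vecI) (use b c2 m2[of ?b] in simp_all)
      then have "?b \<in> mat_kernel (d 2)" using c2 by (simp add: mat_kernel_def)
      then obtain z where z: "z \<in> carrier_vec (length (F 3))" "?b = d 3 *\<^sub>v z"
        using ex2 c3 unfolding mat_image_def by auto
      have "b j = (\<Sum>l<length (F 3). d 3 $$ (j, l) * z $ l)"
        using arg_cong[OF z(2), of "\<lambda>v. v $ j"] index_mult_mat_vec_sum[OF c3 z(1) j] j by simp
      also have "\<dots> \<in> ideal_gen {var_s, var_t, var_u, var_v}"
      proof (rule bideal.span_sum)
        fix l assume "l \<in> {..<length (F 3)}"
        then have "d 3 $$ (j, l) \<in> ideal_gen {var_s, var_t, var_u, var_v}" using mn[of 2 j l] j by simp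
        then show "d 3 $$ (j, l) * z $ l \<in> ideal_gen {var_s, var_t, var_u, var_v}"
          using bideal.span_scale[of "d 3 $$ (j, l)" _ "z $ l"] by (simp add: mult.commute)
      qed
      finally show ?thesis by (rule ev_irrelevant)
    qed
  qed
  then show ?thesis by blast
qed

text \<open>For \<open>m\<close> a basis of the forms of some bidegree: expand the coefficients of a
  syzygy in \<open>m\<close> and collect the generators at each member of \<open>m\<close>. The
  result mentions the ideal but no choice of generators, so it can be compared between two
  resolutions.\<close>

definition linear_syzygy :: "'k::field bipoly list \<Rightarrow> 'k bipoly set \<Rightarrow> (nat \<Rightarrow> 'k bipoly) \<Rightarrow> bool" where
  "linear_syzygy m I A \<longleftrightarrow> (\<forall>j<length m. A j \<in> I \<inter> graded_piece (2, 1)) \<and> (\<Sum>j<length m. m ! j * A j) = 0"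

definition has_syzygy :: "'k::field bipoly list \<Rightarrow> 'k bipoly set \<Rightarrow> bool" where
  "has_syzygy m I \<longleftrightarrow> (\<exists>A. linear_syzygy m I A \<and> (\<exists>j<length m. A j \<noteq> 0))"

definition has_two_syzygies :: "'k::field bipoly list \<Rightarrow> 'k bipoly set \<Rightarrow> bool" where
  "has_two_syzygies m I \<longleftrightarrow> (\<exists>A B. linear_syzygy m I A \<and> linear_syzygy m I B \<and>
     (\<forall>x y. (\<forall>j<length m. cst x * A j + cst y * B j = 0) \<longrightarrow> x = 0 \<and> y = 0))"

definition gp_basis :: "'k::field bipoly list \<Rightarrow> int \<times> int \<Rightarrow> bool" where
  "gp_basis m e \<longleftrightarrow> (\<forall>j<length m. m ! j \<in> graded_piece e) \<and>
     (\<forall>a \<in> graded_piece e. \<exists>c. a = (\<Sum>j<length m. cst (c j) * m ! j)) \<and>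
     (\<forall>c. (\<Sum>j<length m. cst (c j) * m ! j) = 0 \<longrightarrow> (\<forall>j<length m. c j = 0))"

context presented
begin

text \<open>A constant relation would be a syzygy with a nonzero constant term, against
  \<open>D_min\<close>.\<close>

lemma p_indep:
  assumes "(\<Sum>i<4. cst (c i) * p i) = 0" "i < 4"
  shows "c i = 0"
proof -
  have 0: "(\<Sum>i<4. p i * cst (c i)) = 0" using assms(1) by (simp add: mult.commute)
  obtain b where "\<forall>i<4. cst (c i) = (\<Sum>j<length L. D i j * b j)" using iffD1[OF syz_iff 0] by (elim exE)
  then have "ev (\<lambda>x. x) 0 0 0 0 (cst (c i)) = ev (\<lambda>x. x) 0 0 0 0 (\<Sum>j<length L. D i j * b j)" using assms(2)
    by simp
  also have "\<dots> = (\<Sum>j<length L. ev (\<lambda>x. x) 0 0 0 0 (D i j * b j))"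
    by (simp add: ev_sum is_hom_id)
  also have "\<dots> = 0" using D_min assms(2) by (simp add: ev_mult is_hom_id)
  finally show ?thesis by (simp add: ev_cst is_hom_id)
qed

lemma linear_combinations:
  assumes "A \<in> I \<inter> graded_piece (2, 1)"
  shows "\<exists>c. A = (\<Sum>i<4. cst (c i) * p i)"
proof -
  obtain x where x: "A = (\<Sum>i<4. p i * x i)" using assms unfolding I_eq by blast
  have "A = hc (2, 1) A" using assms by (simp add: hc_gp)
  also have "\<dots> = (\<Sum>i<4. hc (2, 1) (p i * x i))" unfolding x hc_sum ..
  also have "\<dots> = (\<Sum>i<4. p i * hc (0, 0) (x i))" by (intro sum.cong) (simp_all add: hc_mult[OF p_gp]
    zero_prod_def)
  finally have A: "A = (\<Sum>i<4. p i * hc (0, 0) (x i))" .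
  have "\<forall>i. \<exists>c. hc (0, 0) (x i) = cst c" using gp00 hc_in by blast
  then obtain c where "\<forall>i. hc (0, 0) (x i) = cst (c i)" by metis
  then show ?thesis using A by (intro exI[of _ c]) (simp add: mult.commute)
qed

lemma combination_in: "(\<Sum>i<4. cst (c i) * p i) \<in> I \<inter> graded_piece (2, 1)"
proof
  have "(\<Sum>i<4. cst (c i) * p i) = (\<Sum>i<4. p i * cst (c i))" by (simp add: mult.commute)
  then show "(\<Sum>i<4. cst (c i) * p i) \<in> I" unfolding I_eq by (intro CollectI exI)
  show "(\<Sum>i<4. cst (c i) * p i) \<in> graded_piece (2, 1)" by (intro gp_sum gp_cst_mult p_gp) simp
qed

text \<open>A column contributes in total bidegree \<open>(2, 1) + e\<close> only if its own degree
  is not larger. By \<open>cols\<close> just the columns of exactly this degree remain, with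
  constant coefficients \<open>f\<close>.\<close>

lemma syzygy_coefficients:
  assumes "gp_basis m e" "linear_syzygy m I A"
    and cols: "\<And>j. j < length L \<Longrightarrow> L ! j \<noteq> (2, 1) + e \<Longrightarrow> fst ((2, 1) + e - L ! j) < 0 \<or> snd ((2,
      1) + e - L ! j) < 0"
  shows "\<exists>c f. (\<forall>j<length m. A j = (\<Sum>i<4. cst (c i j) * p i)) \<and>
    (\<forall>i<4. (\<Sum>j<length m. cst (c i j) * m ! j) = (\<Sum>l<length L. D i l * (if L ! l = (2,
      1) + e then cst (f l) else 0)))"
proof -
  have "\<forall>j. \<exists>c. j < length m \<longrightarrow> A j = (\<Sum>i<4. cst (c i) * p i)"
    using assms(2) linear_combinations unfolding linear_syzygy_def by meson
  from choice[OF this] obtain c' where "\<forall>j. j < length m \<longrightarrow> A j = (\<Sum>i<4. cst (c' j i) * p i)" by (elim exE)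
  then have c': "A j = (\<Sum>i<4. cst (c' j i) * p i)" if "j < length m" for j using that by simp
  define a where "a i = (\<Sum>j<length m. cst (c' j i) * m ! j)" for i
  have a_gp: "a i \<in> graded_piece e" for i unfolding a_def using assms(1)
    by (intro gp_sum gp_cst_mult) (simp add: gp_basis_def)
  have "(\<Sum>i<4. p i * a i) = (\<Sum>j<length m. m ! j * A j)"
    by (simp add: a_def c' sum_distrib_left mult_ac) (rule sum.swap)
  then have 0: "(\<Sum>i<4. p i * a i) = 0" using assms(2) by (simp add: linear_syzygy_def)
  obtain b where b: "\<forall>i<4. a i = (\<Sum>j<length L. D i j * b j)" using iffD1[OF syz_iff 0] by (elim exE)
  have "\<forall>l. \<exists>f. L ! l = (2, 1) + e \<longrightarrow> hc (e - (L ! l - (2, 1))) (b l) = cst f"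
  proof
  fix l show "\<exists>f. L ! l = (2, 1) + e \<longrightarrow> hc (e - (L ! l - (2, 1))) (b l) = cst f"
  proof (cases "L ! l = (2, 1) + e")
    case True
    then have "e - (L ! l - (2, 1)) = (0, 0)" by (simp add: zero_prod_def)
    then have "hc (e - (L ! l - (2, 1))) (b l) \<in> graded_piece (0, 0)" using hc_in by metis
    then show ?thesis using gp00 by blast
  qed simp
  qed
  from choice[OF this] obtain f where "\<forall>l. L ! l = (2, 1) + e \<longrightarrow> hc (e - (L ! l - (2, 1))) (b l) = cst (f l)"
    by (elim exE)
  then have f: "hc (e - (L ! l - (2, 1))) (b l) = cst (f l)" if "L ! l = (2, 1) + e" for l using that by simp
  have "a i = (\<Sum>l<length L. D i l * (if L ! l = (2, 1) + e then cst (f l) else 0))" if i: "i < 4" for i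
  proof -
    have "a i = hc e (a i)" by (simp add: hc_gp a_gp)
    also have "\<dots> = (\<Sum>l<length L. hc e (D i l * b l))" using b i by (simp add: hc_sum)
    also have "\<dots> = (\<Sum>l<length L. D i l * (if L ! l = (2, 1) + e then cst (f l) else 0))"
    proof (intro sum.cong refl)
      fix l assume "l \<in> {..<length L}"
      then have l: "l < length L" by simp
      have h: "hc e (D i l * b l) = D i l * hc (e - (L ! l - (2, 1))) (b l)" by (rule hc_mult[OF D_gp[OF i l]])
      show "hc e (D i l * b l) = D i l * (if L ! l = (2, 1) + e then cst (f l) else 0)"
      proof (cases "L ! l = (2, 1) + e")
        case True
        then show ?thesis using h f by simp
      next
        case False
        have "e - (L ! l - (2, 1)) = (2, 1) + e - L ! l" by simp
        then have "hc (e - (L ! l - (2, 1))) (b l) = 0" using cols[OF l False] gp_neg[OF _ hc_in] by metis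
        then show ?thesis using h False by simp
      qed
    qed
    finally show ?thesis .
  qed
  then show ?thesis using c' by (intro exI[of _ "\<lambda>i j. c' j i"] exI[of _ f]) (simp add: a_def)
qed

lemma coefficients_0:
  assumes "gp_basis m e" "\<And>i. i < 4 \<Longrightarrow> (\<Sum>j<length m. cst (c i j) * m ! j) = 0" "i < 4" "j < length m"
  shows "c i j = 0"
  using assms unfolding gp_basis_def by blast

lemma not_has_syzygy:
  assumes m: "gp_basis m e"
    and cols: "\<And>j. j < length L \<Longrightarrow> fst ((2, 1) + e - L ! j) < 0 \<or> snd ((2, 1) + e - L ! j) < 0"
  shows "\<not> has_syzygy m I"
proof
  assume "has_syzygy m I"
  then obtain A where A: "linear_syzygy m I A" "\<exists>j<length m. A j \<noteq> 0" unfolding has_syzygy_def by blast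
  obtain c f where c: "\<forall>j<length m. A j = (\<Sum>i<4. cst (c i j) * p i)"
    "\<forall>i<4. (\<Sum>j<length m. cst (c i j) * m ! j) = (\<Sum>l<length L. D i l * (if L ! l = (2,
      1) + e then cst (f l) else 0))"
    using syzygy_coefficients[OF m A(1) cols] by blast
  have "L ! l \<noteq> (2, 1) + e" if "l < length L" for l using cols[OF that] by auto
  then have "(\<Sum>j<length m. cst (c i j) * m ! j) = 0" if "i < 4" for i using c(2) that by simp
  then have "c i j = 0" if "i < 4" "j < length m" for i j using coefficients_0[OF m _ that] by blast
  then have "A j = 0" if "j < length m" for j using c(1) that by simp
  then show False using A(2) by blast
qed

text \<open>All syzygies of this bidegree are scalar multiples of the single column
  \<open>k\<close>.\<close>

lemma not_has_two_syzygies: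
  assumes m: "gp_basis m e" and k: "k < length L"
    and cols: "\<And>j. j < length L \<Longrightarrow> j \<noteq> k \<Longrightarrow> fst ((2, 1) + e - L ! j) < 0 \<or> snd ((2, 1) + e - L ! j) < 0"
    and Lk: "L ! k = (2, 1) + e"
  shows "\<not> has_two_syzygies m I"
proof
  assume "has_two_syzygies m I"
  then obtain A B where AB: "linear_syzygy m I A" "linear_syzygy m I B"
    and ind: "\<And>x y. (\<forall>j<length m. cst x * A j + cst y * B j = 0) \<Longrightarrow> x = 0 \<and> y = 0"
    unfolding has_two_syzygies_def by blast
  have cols': "fst ((2, 1) + e - L ! j) < 0 \<or> snd ((2, 1) + e - L ! j) < 0" if "j < length L" "L ! j \<noteq> (2,
    1) + e" for j
    using cols[OF that(1)] Lk that(2) by blast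
  have *: "(\<Sum>l<length L. D i l * (if L ! l = (2, 1) + e then cst (f l) else 0)) = D i k * cst (f k)" for i f
  proof -
    have "(\<Sum>l<length L. D i l * (if L ! l = (2, 1) + e then cst (f l) else 0)) = (\<Sum>l<length L. if l = k then D
      i l * cst (f l) else 0)"
    proof (intro sum.cong refl)
      fix l assume "l \<in> {..<length L}"
      then have "L ! l = (2, 1) + e \<longleftrightarrow> l = k" using cols[of l] Lk by (cases "l = k") auto
      then show "D i l * (if L ! l = (2, 1) + e then cst (f l) else 0) = (if l = k then D i l * cst (f l) else
        0)" by simp
    qed
    then show ?thesis using k by simp
  qed
  obtain c f where c: "\<forall>j<length m. A j = (\<Sum>i<4. cst (c i j) * p i)"
    "\<forall>i<4. (\<Sum>j<length m. cst (c i j) * m ! j) = D i k * cst (f k)"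
    using syzygy_coefficients[OF m AB(1) cols'] unfolding * by blast
  obtain d g where d: "\<forall>j<length m. B j = (\<Sum>i<4. cst (d i j) * p i)"
    "\<forall>i<4. (\<Sum>j<length m. cst (d i j) * m ! j) = D i k * cst (g k)"
    using syzygy_coefficients[OF m AB(2) cols'] unfolding * by blast
  have comb: "\<forall>j<length m. cst x * A j + cst y * B j = 0" if "x * f k + y * g k = 0" for x y
  proof -
    have "(\<Sum>j<length m. cst (x * c i j + y * d i j) * m ! j) = 0" if i: "i < 4" for i
    proof -
      have "(\<Sum>j<length m. cst (x * c i j + y * d i j) * m ! j)
          = cst x * (\<Sum>j<length m. cst (c i j) * m ! j) + cst y * (\<Sum>j<length m. cst (d i j) * m ! j)"
        by (simp add: cst_hom sum.distrib sum_distrib_left distrib_right mult.assoc)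
      also have "\<dots> = D i k * cst (x * f k + y * g k)" using c(2) d(2) i by (simp add: cst_hom algebra_simps)
      finally show ?thesis using \<open>x * f k + y * g k = 0\<close> by simp
    qed
    then have z: "x * c i j + y * d i j = 0" if "i < 4" "j < length m" for i j
      using coefficients_0[OF m, of "\<lambda>i j. x * c i j + y * d i j"] that by blast
    show ?thesis
    proof (intro allI impI)
      fix j assume j: "j < length m"
      have "cst x * A j + cst y * B j = (\<Sum>i<4. cst (x * c i j + y * d i j) * p i)"
        using c(1) d(1) j by (simp add: cst_hom sum.distrib sum_distrib_left distrib_right mult.assoc)
      then show "cst x * A j + cst y * B j = 0" using z j by simp
    qed
  qed
  \<comment> \<open>Crossing the two scalars produces a vanishing combination; once both are zero,
    \<open>A\<close> alone vanishes.\<close>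
  have "g k = 0 \<and> - f k = 0" by (rule ind, rule comb) (simp add: mult.commute)
  then have "(1::'k) = 0 \<and> (0::'k) = 0" by (intro ind comb) simp
  then show False by simp
qed

text \<open>The entries of a column of degree \<open>(2, 1) + e\<close> are forms of bidegree
  \<open>e\<close>; expanding them in \<open>m\<close> gives the intrinsic form of its
  syzygy.\<close>

lemma column_syzygy:
  assumes m: "gp_basis m e" and k: "k < length L" "L ! k = (2, 1) + e"
  shows "\<exists>A c. linear_syzygy m I A \<and> (\<forall>j. A j = (\<Sum>i<4. cst (c i j) * p i)) \<and>
    (\<forall>i<4. D i k = (\<Sum>j<length m. cst (c i j) * m ! j))"
proof -
  have "\<forall>i. \<exists>c. i < 4 \<longrightarrow> D i k = (\<Sum>j<length m. cst (c j) * m ! j)"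
  proof (intro allI)
    fix i show "\<exists>c. i < 4 \<longrightarrow> D i k = (\<Sum>j<length m. cst (c j) * m ! j)"
    proof (cases "i < 4")
      case True
      have "D i k \<in> graded_piece e" using D_gp[OF True k(1)] k(2) by simp
      then show ?thesis using m unfolding gp_basis_def by blast
    qed simp
  qed
  from choice[OF this] obtain c where c: "\<forall>i<4. D i k = (\<Sum>j<length m. cst (c i j) * m ! j)" by (elim exE)
  define A where "A j = (\<Sum>i<4. cst (c i j) * p i)" for j
  have "(\<Sum>j<length m. m ! j * A j) = (\<Sum>i<4. p i * D i k)"
    using c by (simp add: A_def sum_distrib_left mult_ac) (rule sum.swap)
  also have "\<dots> = 0"
    unfolding syz_iff using k(1) by (intro exI[of _ "\<lambda>j. if j = k then 1 else 0"]) (simp add: if_distrib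
      cong: if_cong)
  finally have 0: "(\<Sum>j<length m. m ! j * A j) = 0" .
  have "linear_syzygy m I A"
    unfolding linear_syzygy_def by (intro conjI allI impI 0) (simp only: A_def combination_in)
  moreover have "\<forall>j. A j = (\<Sum>i<4. cst (c i j) * p i)" by (simp add: A_def)
  ultimately show ?thesis using c by (rule_tac exI[of _ A], rule_tac exI[of _ c]) (intro conjI)
qed

text \<open>If the intrinsic form were zero, so would be the column, and a zero column is a relation
  with coefficient 1, against \<open>rel_min\<close>.\<close>

lemma has_syzygy:
  assumes m: "gp_basis m e" and k: "k < length L" "L ! k = (2, 1) + e"
  shows "has_syzygy m I"
proof -
  obtain A c where A: "linear_syzygy m I A" "\<forall>j. A j = (\<Sum>i<4. cst (c i j) * p i)"
    "\<forall>i<4. D i k = (\<Sum>j<length m. cst (c i j) * m ! j)" using column_syzygy[OF m k] by blast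
  have "\<exists>j<length m. A j \<noteq> 0"
  proof (rule ccontr)
    assume "\<not> (\<exists>j<length m. A j \<noteq> 0)"
    then have "(\<Sum>i<4. cst (c i j) * p i) = 0" if "j < length m" for j using A(2) that by simp
    then have "c i j = 0" if "i < 4" "j < length m" for i j using p_indep[of "\<lambda>i. c i j"] that by blast
    then have 0: "D i k = 0" if "i < 4" for i using A(3) that by simp
    have "ev (\<lambda>x. x) 0 0 0 0 ((if k = k then 1 else 0) :: 'k bipoly) = 0"
      by (rule rel_min[of "\<lambda>j. if j = k then 1 else 0"]) (use 0 k in simp_all)
    then show False by (simp add: is_homD(2)[OF is_hom_ev[OF is_hom_id]])
  qed
  then show ?thesis using A(1) unfolding has_syzygy_def by blast
qed

text \<open>A dependence of the two syzygies would be a constant relation between two columns,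
  against \<open>rel_min\<close>.\<close>

lemma has_two_syzygies:
  assumes m: "gp_basis m e" and k: "k < length L" "L ! k = (2, 1) + e" and l: "l < length L" "L ! l = (2,
    1) + e" "k \<noteq> l"
  shows "has_two_syzygies m I"
proof -
  obtain A c where A: "linear_syzygy m I A" "\<forall>j. A j = (\<Sum>i<4. cst (c i j) * p i)"
    "\<forall>i<4. D i k = (\<Sum>j<length m. cst (c i j) * m ! j)" using column_syzygy[OF m k] by blast
  obtain B d where B: "linear_syzygy m I B" "\<forall>j. B j = (\<Sum>i<4. cst (d i j) * p i)"
    "\<forall>i<4. D i l = (\<Sum>j<length m. cst (d i j) * m ! j)" using column_syzygy[OF m l(1,2)] by blast
  have "x = 0 \<and> y = 0" if xy: "\<forall>j<length m. cst x * A j + cst y * B j = 0" for x y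
  proof -
    have "(\<Sum>i<4. cst (x * c i j + y * d i j) * p i) = cst x * A j + cst y * B j" for j
      using A(2) B(2) by (simp add: cst_hom sum.distrib sum_distrib_left distrib_right mult.assoc)
    then have "(\<Sum>i<4. cst (x * c i j + y * d i j) * p i) = 0" if "j < length m" for j using xy that by simp
    then have z: "x * c i j + y * d i j = 0" if "i < 4" "j < length m" for i j
      using p_indep[of "\<lambda>i. x * c i j + y * d i j"] that by blast
    define b where "b j = (if j = k then cst x else if j = l then cst y else 0)" for j
    have "(\<Sum>j<length L. D i j * b j) = 0" if i: "i < 4" for i
    proof -
      have "(\<Sum>j<length L. D i j * b j) = (\<Sum>j<length L. (if j = k then D i j * cst x else 0) + (if j = l then D
        i j * cst y else 0))"
        by (intro sum.cong) (use l(3) in \<open>auto simp: b_def\<close>)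
      also have "\<dots> = D i k * cst x + D i l * cst y" using k l by (simp add: sum.distrib)
      also have "\<dots> = (\<Sum>j<length m. cst (x * c i j + y * d i j) * m ! j)"
        using A(3) B(3) i by (simp add: cst_hom sum.distrib sum_distrib_left sum_distrib_right distrib_left
          distrib_right mult_ac)
      also have "\<dots> = 0" using z i by simp
      finally show ?thesis .
    qed
    then have "ev (\<lambda>x. x) 0 0 0 0 (b k) = 0" "ev (\<lambda>x. x) 0 0 0 0 (b l) = 0" using rel_min k(1) l(1) by blast+
    then show ?thesis using l(3) by (simp add: b_def ev_cst is_hom_id)
  qed
  then show ?thesis using A(1) B(1) unfolding has_two_syzygies_def by blast
qed

end

section \<open>The test bidegrees (0,1), (1,0) and (0,2)\<close>

lemma gp02:
  assumes "p \<in> graded_piece (0, 2)"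
  shows "\<exists>a b c. p = cst a * (var_u * var_u) + cst b * (var_u * var_v) + cst c * (var_v * var_v)"
proof -
  define f where "f = Poly_Mapping.lookup p"
  have "e \<in> {(0,0,2,0), (0,0,1,1), (0,0,0,2)}" if "bidegree e = (0, 2)" for e
    using that by (cases e) (auto simp: nat_sum_eqs)
  then have "p = (\<Sum>e\<in>{(0,0,2,0), (0,0,1,1), (0,0,0,2)}. Poly_Mapping.single e (f e))"
    by (unfold f_def, intro gp_eq_sum[OF assms]) auto
  also have "\<dots> = cst (f (0,0,2,0)) * (var_u * var_u) + cst (f (0,0,1,1)) * (var_u * var_v) + cst (f (0,0,0,2))
    * (var_v * var_v)"
    by (simp add: single_monomial power2_eq_square add.assoc mult.assoc)
  finally show ?thesis by (intro exI)
qed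

lemma ev_simps:
  "ev (\<lambda>x. x) x y z w (p + q) = ev (\<lambda>x. x) x y z w p + ev (\<lambda>x. x) x y z w q"
  "ev (\<lambda>x. x) x y z w (p * q) = ev (\<lambda>x. x) x y z w p * ev (\<lambda>x. x) x y z w q"
  "ev (\<lambda>x. x) x y z w (cst c) = c" "ev (\<lambda>x. x) x y z w var_s = x" "ev (\<lambda>x. x) x y z w var_t = y"
  "ev (\<lambda>x. x) x y z w var_u = z" "ev (\<lambda>x. x) x y z w var_v = w"
  by (simp_all add: ev_add ev_mult ev_cst ev_vars is_hom_id)

lemma gp_basis_uv: "gp_basis [var_u, var_v] (0, 1)"
  unfolding gp_basis_def
proof (intro conjI ballI allI impI)
  fix a :: "'a bipoly" assume "a \<in> graded_piece (0, 1)"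
  then obtain x y where "a = cst x * var_u + cst y * var_v" using gp01 by blast
  then show "\<exists>c. a = (\<Sum>j<length [var_u, var_v]. cst (c j) * [var_u, var_v] ! j)"
    by (intro exI[of _ "(!) [x, y]"]) (simp add: eval_nat_numeral)
next
  fix c :: "nat \<Rightarrow> 'a" and j
  assume "(\<Sum>j<length [var_u, var_v]. cst (c j) * [var_u, var_v] ! j) = 0" and j: "j < length [var_u,
    var_v :: 'a bipoly]"
  then have "cst (c 0) * var_u + cst (c 1) * var_v = 0" by (simp add: eval_nat_numeral)
  then have *: "ev (\<lambda>x. x) 0 0 z w (cst (c 0) * var_u + cst (c 1) * var_v) = 0" for z w by simp
  have "c 0 = 0" "c 1 = 0" using *[of 1 0] *[of 0 1] by (simp_all add: ev_simps)
  then show "c j = 0" using j by (auto simp: less_Suc_eq)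
qed (auto simp: less_Suc_eq)

lemma gp_basis_st: "gp_basis [var_s, var_t] (1, 0)"
  unfolding gp_basis_def
proof (intro conjI ballI allI impI)
  fix a :: "'a bipoly" assume "a \<in> graded_piece (1, 0)"
  then obtain x y where "a = cst x * var_s + cst y * var_t" using gp10 by blast
  then show "\<exists>c. a = (\<Sum>j<length [var_s, var_t]. cst (c j) * [var_s, var_t] ! j)"
    by (intro exI[of _ "(!) [x, y]"]) (simp add: eval_nat_numeral)
next
  fix c :: "nat \<Rightarrow> 'a" and j
  assume "(\<Sum>j<length [var_s, var_t]. cst (c j) * [var_s, var_t] ! j) = 0" and j: "j < length [var_s,
    var_t :: 'a bipoly]"
  then have "cst (c 0) * var_s + cst (c 1) * var_t = 0" by (simp add: eval_nat_numeral)
  then have *: "ev (\<lambda>x. x) z w 0 0 (cst (c 0) * var_s + cst (c 1) * var_t) = 0" for z w by simp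
  have "c 0 = 0" "c 1 = 0" using *[of 1 0] *[of 0 1] by (simp_all add: ev_simps)
  then show "c j = 0" using j by (auto simp: less_Suc_eq)
qed (auto simp: less_Suc_eq)

lemma gp_basis_uv2: "gp_basis [var_u * var_u, var_u * var_v, var_v * var_v] (0, 2)" (is "gp_basis ?m _")
  unfolding gp_basis_def
proof (intro conjI ballI allI impI)
  fix a :: "'a bipoly" assume "a \<in> graded_piece (0, 2)"
  then obtain x y z where "a = cst x * (var_u * var_u) + cst y * (var_u * var_v) + cst z * (var_v * var_v)"
    using gp02 by blast
  then show "\<exists>c. a = (\<Sum>j<length ?m. cst (c j) * ?m ! j)"
    by (intro exI[of _ "(!) [x, y, z]"]) (simp add: eval_nat_numeral)
next
  fix c :: "nat \<Rightarrow> 'a" and j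
  assume "(\<Sum>j<length ?m. cst (c j) * ?m ! j) = 0" and j: "j < length ?m"
  then have "cst (c 0) * (var_u * var_u) + cst (c 1) * (var_u * var_v) + cst (c 2) * (var_v * var_v) = 0"
    by (simp add: eval_nat_numeral)
  then have *: "ev (\<lambda>x. x) 0 0 z w (cst (c 0) * (var_u * var_u) + cst (c 1) * (var_u * var_v) + cst (c 2) *
    (var_v * var_v)) = 0" for z w by simp
  have "c 0 = 0" "c 2 = 0" using *[of 1 0] *[of 0 1] by (simp_all add: ev_simps)
  moreover from this have "c 1 = 0" using *[of 1 1] by (simp add: ev_simps)
  ultimately show "c j = 0" using j by (auto simp: less_Suc_eq eval_nat_numeral)
next
  fix j assume "j < length ?m"
  then show "?m ! j \<in> graded_piece (0, 2)" by (auto simp: less_Suc_eq eval_nat_numeral gp_mult[OF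
    gp_vars(3,3)] gp_mult[OF gp_vars(3,4)] gp_mult[OF gp_vars(4,4)])
qed

lemma presented_of_type:
  assumes "of_numerical_type n I"
  shows "\<exists>p D. presented I (type_modules n ! 1) p D"
proof -
  obtain d where "minimal_free_resolution I (free_seq (type_modules n)) d" using assms
    by (auto simp: of_numerical_type_def)
  moreover have "free_seq (type_modules n) 1 = replicate 4 (2, 1)"
    "free_seq (type_modules n) 2 = type_modules n ! 1"
    by (simp_all add: free_seq_def type_modules_def)
  ultimately show ?thesis using presented_of_resolution by metis
qed

lemma type_cases:
  assumes "of_numerical_type n I"
  shows "n = 1 \<or> n = 2 \<or> n = 3 \<or> n = 4 \<or> n = 5 \<or> n = 6"
  using assms by (auto simp: of_numerical_type_def)

text \<open>Bidegree (0,1) detects the summands of degree (2,2): none in types 1 to 4, one in type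
  5, two in type 6. Among types 1 to 4, (0,2) detects degree (2,3), present in 2 and 4, and (1,0)
  detects degree (3,1), present in 3 and 4.\<close>

lemma syzygies_of_type:
  fixes I :: "'k::field bipoly set"
  assumes n: "of_numerical_type n I"
  shows "has_syzygy [var_u, var_v] I \<longleftrightarrow> n \<in> {5, 6}"
    and "n \<in> {5, 6} \<Longrightarrow> has_two_syzygies [var_u, var_v] I \<longleftrightarrow> n = 6"
    and "n \<notin> {5, 6} \<Longrightarrow> has_syzygy [var_u * var_u, var_u * var_v, var_v * var_v] I \<longleftrightarrow> n \<in> {2, 4}"
    and "n \<notin> {5, 6} \<Longrightarrow> has_syzygy [var_s, var_t] I \<longleftrightarrow> n \<in> {3, 4}"
proof -
  obtain p D where "presented I (type_modules n ! 1) p D" using presented_of_type[OF n] by blast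
  then interpret presented I "type_modules n ! 1" p D .
  \<comment> \<open>The numbers are the positions of the detected degrees in the lists of
    \<open>type_modules\<close>.\<close>
  note yes = has_syzygy[OF gp_basis_uv, of 0] has_syzygy[OF gp_basis_uv2, of 0] has_syzygy[OF gp_basis_st, of 1]
    has_two_syzygies[OF gp_basis_uv, of 0 1]
  have A: "\<not> has_syzygy m I" if "gp_basis m e" "\<forall>f \<in> set (type_modules n ! 1). fst ((2, 1) + e - f) < 0 \<or>
    snd ((2, 1) + e - f) < 0" for m e
    by (rule not_has_syzygy[OF that(1)]) (use that(2) nth_mem in blast)
  have B: "\<not> has_two_syzygies [var_u, var_v] I" if "n = 5"
    using that by (intro not_has_two_syzygies[OF gp_basis_uv,
      of 0]) (auto simp: type_modules_def less_Suc_eq eval_nat_numeral)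
  show "has_syzygy [var_u, var_v] I \<longleftrightarrow> n \<in> {5, 6}"
    using type_cases[OF n] yes(1) A[OF gp_basis_uv] by (elim disjE) (simp_all add: type_modules_def
      numeral_2_eq_2)
  show "has_two_syzygies [var_u, var_v] I \<longleftrightarrow> n = 6" if "n \<in> {5, 6}"
    using that B yes(4) by (elim insertE) (simp_all add: type_modules_def numeral_2_eq_2)
  show "has_syzygy [var_u * var_u, var_u * var_v, var_v * var_v] I \<longleftrightarrow> n \<in> {2, 4}" if "n \<notin> {5, 6}"
    using type_cases[OF n] that yes(2) A[OF gp_basis_uv2] by (elim disjE) (simp_all add: type_modules_def)
  show "has_syzygy [var_s, var_t] I \<longleftrightarrow> n \<in> {3, 4}" if "n \<notin> {5, 6}"
    using type_cases[OF n] that yes(3) A[OF gp_basis_st] by (elim disjE) (simp_all add: type_modules_def)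
qed

lemma numerical_type_unique:
  assumes "of_numerical_type n I" "of_numerical_type m I"
  shows "n = m"
  using syzygies_of_type[OF assms(1)] syzygies_of_type[OF assms(2)] type_cases[OF assms(1)] type_cases[OF
    assms(2)]
  by (elim disjE) simp_all

section \<open>Every type occurs\<close>

lemma four_dim_subspace_span:
  fixes p0 p1 p2 p3 :: "'k::field bipoly"
  assumes p: "{p0, p1, p2, p3} \<subseteq> graded_piece (2, 1)"
    and ind: "\<And>a b c d. cst a * p0 + cst b * p1 + cst c * p2 + cst d * p3 = 0 \<Longrightarrow> a = 0 \<and> b = 0 \<and> c = 0 \<and> d = 0"
  shows "four_dim_subspace (bipoly.span {p0, p1, p2, p3})"
proof -
  have "bipoly.subspace (graded_piece (2, 1) :: 'k bipoly set)"
    by (auto simp: bipoly.subspace_def const_mult_eq gp_cst_mult)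
  then have "bipoly.span {p0, p1, p2, p3} \<subseteq> graded_piece (2, 1)" using p by (intro bipoly.span_minimal)
  moreover have "bipoly.dim (bipoly.span {p0, p1, p2, p3}) = 4"
    using bipoly.dim_span_eq_card_independent[OF independent4(1)[OF ind]] independent4(2)[OF ind] by simp
  ultimately show ?thesis by (simp add: four_dim_subspace_def)
qed

lemma basepoint_free_span:
  fixes p0 p1 p2 p3 :: "'k::field bipoly"
  assumes "\<And>x y z w. ev (\<lambda>x. x) x y z w p0 = 0 \<Longrightarrow> ev (\<lambda>x. x) x y z w p1 = 0 \<Longrightarrow> ev (\<lambda>x. x) x y z w p2 = 0 \<Longrightarrow>
    ev (\<lambda>x. x) x y z w p3 = 0 \<Longrightarrow> x = 0 \<and> y = 0 \<or> z = 0 \<and> w = 0"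
  shows "basepoint_free (bipoly.span {p0, p1, p2, p3})"
  unfolding basepoint_free_def
proof
  assume "\<exists>P Q. P \<noteq> (0, 0) \<and> Q \<noteq> (0, 0) \<and> (\<forall>p\<in>bipoly.span {p0, p1, p2, p3}. bipoly_eval p P Q = 0)"
  then obtain x y z w where n: "(x, y) \<noteq> (0, 0)" "(z, w) \<noteq> (0, 0)" and
    0: "\<forall>p\<in>bipoly.span {p0, p1, p2, p3}. bipoly_eval p (x, y) (z, w) = 0" by auto
  have "ev (\<lambda>x. x) x y z w p = 0" if "p \<in> {p0, p1, p2, p3}" for p
    using 0 bipoly.span_base[OF that] by (simp add: bipoly_eval_eq)
  then have "x = 0 \<and> y = 0 \<or> z = 0 \<and> w = 0" by (intro assms) simp_all
  then show False using n by auto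
qed

text \<open>Taking components of bidegree (2,1) leaves only constant coefficients, so in this
  bidegree the ideal is as small as the span of its generators.\<close>

lemma ideal_gp21:
  fixes p0 p1 p2 p3 :: "'k::field bipoly"
  assumes A: "A \<in> ideal_gen {p0, p1, p2, p3} \<inter> graded_piece (2, 1)" and p: "{p0, p1, p2,
    p3} \<subseteq> graded_piece (2, 1)"
  shows "\<exists>a b c d. A = cst a * p0 + cst b * p1 + cst c * p2 + cst d * p3"
proof -
  let ?p = "(!) [p0, p1, p2, p3]"
  have s: "?p ` {..<4} = {p0, p1, p2, p3}" by (simp add: eval_nat_numeral lessThan_Suc insert_commute)
  obtain x where "A = (\<Sum>i<4. ?p i * x i)" using A ideal_gen_image[of ?p 4] unfolding s by auto
  then have x: "A = p0 * x 0 + p1 * x 1 + p2 * x 2 + p3 * x 3" by (simp add: eval_nat_numeral)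
  have h: "\<exists>c. hc (2, 1) (q * y) = cst c * q" if "q \<in> graded_piece (2, 1)" for q y :: "'k bipoly"
  proof -
    have "hc ((2, 1) - (2, 1)) y \<in> graded_piece (0, 0)" using hc_in[of "(2, 1) - (2, 1)" y]
      by (simp add: zero_prod_def)
    then obtain c where "hc ((2, 1) - (2, 1)) y = cst c" using gp00 by blast
    then show ?thesis using hc_mult[OF that, of "(2, 1)" y] by (auto simp: mult.commute)
  qed
  have "A = hc (2, 1) A" using A by (simp add: hc_gp)
  also have "\<dots> = hc (2, 1) (p0 * x 0) + hc (2, 1) (p1 * x 1) + hc (2, 1) (p2 * x 2) + hc (2, 1) (p3 * x 3)"
    unfolding x by (simp add: hc_add)
  finally have e: "A = hc (2, 1) (p0 * x 0) + hc (2, 1) (p1 * x 1) + hc (2, 1) (p2 * x 2) + hc (2,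
    1) (p3 * x 3)" .
  obtain a b c d where "hc (2, 1) (p0 * x 0) = cst a * p0" "hc (2, 1) (p1 * x 1) = cst b * p1"
    "hc (2, 1) (p2 * x 2) = cst c * p2" "hc (2, 1) (p3 * x 3) = cst d * p3"
    using h[of p0 "x 0"] h[of p1 "x 1"] h[of p2 "x 2"] h[of p3 "x 3"] p by auto
  then show ?thesis using e by (intro exI) simp
qed

lemma quad_add: "quad a0 a1 a2 + quad b0 b1 b2 = quad (a0 + b0) (a1 + b1) (a2 + b2)"
  and quad_cst_mult: "cst c * quad a0 a1 a2 = quad (c * a0) (c * a1) (c * a2)"
  by (simp_all add: quad_def cst_hom algebra_simps)

text \<open>The left side has bidegree (3,1); each equation is the coefficient of one of its eight
  monomials.\<close>

lemma st_syzygy_coefficients: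
  fixes a0 a1 a2 b0 b1 b2 c0 c1 c2 d0 d1 d2 :: "'k::field"
  assumes "var_s * (var_u * quad a0 a1 a2 + var_v * quad b0 b1 b2) + var_t * (var_u * quad c0 c1 c2 + var_v *
    quad d0 d1 d2) = 0"
  shows "a0 = 0" "a1 + c0 = 0" "a2 + c1 = 0" "c2 = 0" "b0 = 0" "b1 + d0 = 0" "b2 + d1 = 0" "d2 = 0"
proof -
  let ?S = "\<lambda>e c. Poly_Mapping.single (e :: expo) (c :: 'k)"
  have "?S (3,0,1,0) a0 + ?S (2,1,1,0) (a1 + c0) + ?S (1,2,1,0) (a2 + c1) + ?S (0,3,1,0) c2
      + ?S (3,0,0,1) b0 + ?S (2,1,0,1) (b1 + d0) + ?S (1,2,0,1) (b2 + d1) + ?S (0,3,0,1) d2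
    = var_s * (var_u * quad a0 a1 a2 + var_v * quad b0 b1 b2) + var_t * (var_u * quad c0 c1 c2 + var_v * quad
      d0 d1 d2)"
    unfolding single_monomial quad_def cst_add by (simp add: power2_eq_square power3_eq_cube algebra_simps)
  then have *: "Poly_Mapping.lookup (?S (3,0,1,0) a0 + ?S (2,1,1,0) (a1 + c0) + ?S (1,2,1,0) (a2 + c1) + ?S
    (0,3,1,0) c2
      + ?S (3,0,0,1) b0 + ?S (2,1,0,1) (b1 + d0) + ?S (1,2,0,1) (b2 + d1) + ?S (0,3,0,1) d2) e = 0" for e
    using assms by (metis lookup_zero)
  show "a0 = 0" using *[of "(3,0,1,0)"] by (simp add: lookup_add lookup_single when_def)
  show "a1 + c0 = 0" using *[of "(2,1,1,0)"] by (simp add: lookup_add lookup_single when_def)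
  show "a2 + c1 = 0" using *[of "(1,2,1,0)"] by (simp add: lookup_add lookup_single when_def)
  show "c2 = 0" using *[of "(0,3,1,0)"] by (simp add: lookup_add lookup_single when_def)
  show "b0 = 0" using *[of "(3,0,0,1)"] by (simp add: lookup_add lookup_single when_def)
  show "b1 + d0 = 0" using *[of "(2,1,0,1)"] by (simp add: lookup_add lookup_single when_def)
  show "b2 + d1 = 0" using *[of "(1,2,0,1)"] by (simp add: lookup_add lookup_single when_def)
  show "d2 = 0" using *[of "(0,3,0,1)"] by (simp add: lookup_add lookup_single when_def)
qed

lemma ev_quad: "ev (\<lambda>x. x) x y z w (quad a b c) = a * (x * x) + b * (x * y) + c * (y * y)"
  by (simp add: quad_def ev_simps)

lemma has_syzygy_stD:
  assumes "has_syzygy [var_s, var_t] I"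
  obtains A B where "A \<in> I \<inter> graded_piece (2, 1)" "B \<in> I \<inter> graded_piece (2, 1)" "var_s * A + var_t * B = 0"
    "A \<noteq> 0 \<or> B \<noteq> 0"
  using assms unfolding has_syzygy_def linear_syzygy_def by (auto simp: less_Suc_eq All_less_Suc Ex_less_Suc)

lemma has_syzygy_stI:
  assumes "A \<in> P" "B \<in> P" "P \<subseteq> graded_piece (2, 1)" "var_s * A = var_t * B" "A \<noteq> 0"
  shows "has_syzygy [var_s, var_t] (ideal_gen P)"
  unfolding has_syzygy_def linear_syzygy_def
  using assms bideal.span_base[of A P] bideal.span_neg[OF bideal.span_base[of B P]]
  by (intro exI[of _ "(!) [A, - B]"]) (auto simp: All_less_Suc Ex_less_Suc)

definition realises :: "nat \<Rightarrow> 'k::field bipoly set \<Rightarrow> bool" where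
  "realises n U \<longleftrightarrow> four_dim_subspace U \<and> basepoint_free U \<and> of_numerical_type n (ideal_gen U)"

lemma realisesI:
  fixes p0 p1 p2 p3 :: "'k::field bipoly"
  assumes p: "{p0, p1, p2, p3} \<subseteq> graded_piece (2, 1)"
    and ind: "\<And>a b c d. cst a * p0 + cst b * p1 + cst c * p2 + cst d * p3 = 0 \<Longrightarrow> a = 0 \<and> b = 0 \<and> c = 0 \<and> d = 0"
    and bpf: "\<And>x y z w. ev (\<lambda>x. x) x y z w p0 = 0 \<Longrightarrow> ev (\<lambda>x. x) x y z w p1 = 0 \<Longrightarrow> ev (\<lambda>x. x) x y z w p2 = 0 \<Longrightarrow>
      ev (\<lambda>x. x) x y z w p3 = 0 \<Longrightarrow> x = 0 \<and> y = 0 \<or> z = 0 \<and> w = 0"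
    and type: "of_numerical_type n (ideal_gen {p0, p1, p2, p3})"
  shows "realises n (bipoly.span {p0, p1, p2, p3})"
proof -
  have U: "four_dim_subspace (bipoly.span {p0, p1, p2, p3})" by (rule four_dim_subspace_span[OF p]) (erule ind)
  moreover have "basepoint_free (bipoly.span {p0, p1, p2, p3})" by (rule basepoint_free_span) (erule (3) bpf)
  moreover have "ideal_gen (bipoly.span {p0, p1, p2, p3}) = ideal_gen {p0, p1, p2, p3}"
    by (rule span_of_independent(2)[OF U bipoly.span_superset]) (erule ind)
  ultimately show ?thesis using type by (simp add: realises_def)
qed

lemma products_gp21:
  "q \<in> graded_piece (2, 0) \<Longrightarrow> var_u * q \<in> graded_piece (2, 1)" "q \<in> graded_piece (2, 0) \<Longrightarrow>
    var_v * q \<in> graded_piece (2, 1)"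
  using gp_mult[OF gp_vars(3), of q "(2, 0)" "(2, 1)"] gp_mult[OF gp_vars(4), of q "(2, 0)" "(2, 1)"]
    by simp_all

lemma type_L3_realised:
  fixes q0 q1 q2 :: "'k::alg_closed_field bipoly"
  assumes q: "is_basis3 q0 q1 q2"
    and bpf: "\<And>x y z w. z * ev (\<lambda>x. x) x y z w q0 = 0 \<Longrightarrow>
      w * ev (\<lambda>x. x) x y z w q0 + z * ev (\<lambda>x. x) x y z w q1 = 0 \<Longrightarrow>
      w * ev (\<lambda>x. x) x y z w q1 + z * ev (\<lambda>x. x) x y z w q2 = 0 \<Longrightarrow> w * ev (\<lambda>x. x) x y z w q2 = 0 \<Longrightarrow> x = 0 \<and>
        y = 0 \<or> z = 0 \<and> w = 0"
    and type: "of_numerical_type n (ideal_gen {var_u * q0, var_v * q0 + var_u * q1, var_v * q1 + var_u * q2,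
      var_v * q2})"
  shows "\<exists>U :: 'k bipoly set. realises n U"
proof (rule exI, rule realisesI[OF _ _ _ type])
  show "{var_u * q0, var_v * q0 + var_u * q1, var_v * q1 + var_u * q2, var_v * q2} \<subseteq> graded_piece (2, 1)"
    using is_basis3_gp[OF q] by (auto intro!: gp_add products_gp21)
  show "a = 0 \<and> b = 0 \<and> c = 0 \<and> d = 0"
    if "cst a * (var_u * q0) + cst b * (var_v * q0 + var_u * q1) + cst c * (var_v * q1 + var_u * q2) + cst d *
      (var_v * q2) = 0" for a b c d
  proof -
    have "var_u * (cst a * q0 + cst b * q1 + cst c * q2) + var_v * (cst b * q0 + cst c * q1 + cst d * q2) = 0"
      using that by (simp add: algebra_simps)
    from products_independent[OF coords_std q this] show ?thesis by simp
  qed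
qed (rule bpf; simp add: ev_simps)

lemma type_L2_realised:
  fixes q0 q1 q2 :: "'k::alg_closed_field bipoly"
  assumes q: "is_basis3 q0 q1 q2"
    and cop: "\<And>x y z w. ev (\<lambda>x. x) x y z w q0 = 0 \<Longrightarrow> ev (\<lambda>x. x) x y z w q1 = 0 \<Longrightarrow> x = 0 \<and> y = 0"
    and type: "of_numerical_type n (ideal_gen {var_u * q0, var_v * q0 + var_u * q1, var_v * q1, var_u * q2})"
  shows "\<exists>U :: 'k bipoly set. realises n U"
proof (rule exI, rule realisesI[OF _ _ _ type])
  show "{var_u * q0, var_v * q0 + var_u * q1, var_v * q1, var_u * q2} \<subseteq> graded_piece (2, 1)"
    using is_basis3_gp[OF q] by (auto intro!: gp_add products_gp21)
  show "a = 0 \<and> b = 0 \<and> c = 0 \<and> d = 0"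
    if "cst a * (var_u * q0) + cst b * (var_v * q0 + var_u * q1) + cst c * (var_v * q1) + cst d * (var_u * q2)
      = 0" for a b c d
  proof -
    have "var_u * (cst a * q0 + cst b * q1 + cst d * q2) + var_v * (cst b * q0 + cst c * q1 + cst 0 * q2) = 0"
      using that by (simp add: algebra_simps)
    from products_independent[OF coords_std q this] show ?thesis by simp
  qed
  show "x = 0 \<and> y = 0 \<or> z = 0 \<and> w = 0"
    if "ev (\<lambda>x. x) x y z w (var_u * q0) = 0" "ev (\<lambda>x. x) x y z w (var_v * q0 + var_u * q1) = 0"
      "ev (\<lambda>x. x) x y z w (var_v * q1) = 0" "ev (\<lambda>x. x) x y z w (var_u * q2) = 0" for x y z w
    using that cop[of x y z w] by (cases "z = 0"; cases "w = 0") (auto simp: ev_simps)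
qed

text \<open>
  The quadrics are the minors of \<open>(s, 0, t)\<close> and \<open>(t, t, s)\<close>, for which the pencil matrix is invertible;
  monomial quadrics would give type 3 in every order.
\<close>

lemma type1_realised: "\<exists>U :: 'k::alg_closed_field bipoly set. realises 1 U"
proof -
  define q0 q1 q2 :: "'k bipoly" where "q0 = quad 0 0 (-1)" "q1 = quad (-1) 0 1" "q2 = quad 0 1 0"
  note q_def = this
  have q: "is_basis3 q0 q1 q2" by (rule is_basis3I[OF q_def]) simp
  let ?P = "{var_u * q0, var_v * q0 + var_u * q1, var_v * q1 + var_u * q2, var_v * q2}"
  have gp: "?P \<subseteq> graded_piece (2, 1)" using is_basis3_gp[OF q] by (auto intro!: gp_add products_gp21)
  have form: "\<exists>a b c d. A = var_u * quad (- b) c (b - a) + var_v * quad (- c) d (c - b)" if A: "A \<in> ideal_gen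
    ?P \<inter> graded_piece (2, 1)" for A
  proof -
    obtain a b c d where "A = cst a * (var_u * q0) + cst b * (var_v * q0 + var_u * q1) + cst c * (var_v * q1 +
      var_u * q2) + cst d * (var_v * q2)"
      using ideal_gp21[OF A gp] by blast
    then have "A = var_u * (cst a * q0 + cst b * q1 + cst c * q2) + var_v * (cst b * q0 + cst c * q1 + cst d *
      q2)"
      by (simp add: algebra_simps)
    then have "A = var_u * quad (- b) c (b - a) + var_v * quad (- c) d (c - b)" unfolding q_def quad_cst_mult
      quad_add by simp
    then show ?thesis by blast
  qed
  \<comment> \<open>\<open>type_L3\<close> leaves types 1 and 3, and type 3 would require such a
    syzygy.\<close>
  have "\<not> has_syzygy [var_s, var_t] (ideal_gen ?P)"
  proof
    assume "has_syzygy [var_s, var_t] (ideal_gen ?P)"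
    then obtain A B where AB: "A \<in> ideal_gen ?P \<inter> graded_piece (2, 1)" "B \<in> ideal_gen ?P \<inter> graded_piece (2, 1)"
      "var_s * A + var_t * B = 0" "A \<noteq> 0 \<or> B \<noteq> 0" by (rule has_syzygy_stD)
    obtain a b c d where A: "A = var_u * quad (- b) c (b - a) + var_v * quad (- c) d (c - b)" using form[OF
      AB(1)] by blast
    obtain a' b' c' d' where B: "B = var_u * quad (- b') c' (b' - a') + var_v * quad (- c') d' (c' - b')"
      using form[OF AB(2)] by blast
    note z = st_syzygy_coefficients[OF AB(3)[unfolded A B]]
    have "b = 0" "c = 0" using z by simp_all
    moreover from this have "b' = 0" using z(2) by simp
    moreover from this have "a' = 0" "c' = 0" using z(4,8) by simp_all
    moreover from calculation have "a = 0" "d = 0" "d' = 0" using z by simp_all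
    ultimately have "A = 0" "B = 0" unfolding A B by (simp_all add: quad_def)
    then show False using AB(4) by simp
  qed
  then have "of_numerical_type 1 (ideal_gen ?P)"
    using type_L3[OF coords_std q] syzygies_of_type(4)[of 3 "ideal_gen ?P"] by auto
  then show ?thesis
  proof (rule type_L3_realised[OF q, rotated])
    fix x y z w :: 'k
    assume "z * ev (\<lambda>x. x) x y z w q0 = 0" "w * ev (\<lambda>x. x) x y z w q0 + z * ev (\<lambda>x. x) x y z w q1 = 0"
      "w * ev (\<lambda>x. x) x y z w q1 + z * ev (\<lambda>x. x) x y z w q2 = 0" "w * ev (\<lambda>x. x) x y z w q2 = 0"
    then show "x = 0 \<and> y = 0 \<or> z = 0 \<and> w = 0"
      unfolding q_def ev_quad by (cases "z = 0"; cases "w = 0"; cases "y = 0") auto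
  qed
qed

text \<open>The monomial quadrics satisfy \<open>s * q1 = t * q0\<close> and
  \<open>s * q2 = t * q1\<close>; together these give a syzygy of the two middle generators, which
  excludes type 1.\<close>

lemma type3_realised: "\<exists>U :: 'k::alg_closed_field bipoly set. realises 3 U"
proof -
  define q0 q1 q2 :: "'k bipoly" where "q0 = quad 1 0 0" "q1 = quad 0 1 0" "q2 = quad 0 0 1"
  note q_def = this
  have q: "is_basis3 q0 q1 q2" by (rule is_basis3I[OF q_def]) simp
  let ?P = "{var_u * q0, var_v * q0 + var_u * q1, var_v * q1 + var_u * q2, var_v * q2}"
  have gp: "?P \<subseteq> graded_piece (2, 1)" using is_basis3_gp[OF q] by (auto intro!: gp_add products_gp21)
  have "has_syzygy [var_s, var_t] (ideal_gen ?P)"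
  proof (rule has_syzygy_stI)
    show "var_v * q1 + var_u * q2 \<in> ?P" "var_v * q0 + var_u * q1 \<in> ?P" by simp_all
    show "var_s * (var_v * q1 + var_u * q2) = var_t * (var_v * q0 + var_u * q1)"
      by (simp add: q_def quad_def algebra_simps)
    have "ev (\<lambda>x. x) 0 1 1 0 (var_v * q1 + var_u * q2) = 1" by (simp add: ev_simps q_def ev_quad)
    then show "var_v * q1 + var_u * q2 \<noteq> 0" by auto
  qed (rule gp)
  then have "of_numerical_type 3 (ideal_gen ?P)"
    using type_L3[OF coords_std q] syzygies_of_type(4)[of 1 "ideal_gen ?P"] by auto
  then show ?thesis
  proof (rule type_L3_realised[OF q, rotated])
    fix x y z w :: 'k
    assume "z * ev (\<lambda>x. x) x y z w q0 = 0" "w * ev (\<lambda>x. x) x y z w q0 + z * ev (\<lambda>x. x) x y z w q1 = 0"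
      "w * ev (\<lambda>x. x) x y z w q1 + z * ev (\<lambda>x. x) x y z w q2 = 0" "w * ev (\<lambda>x. x) x y z w q2 = 0"
    then show "x = 0 \<and> y = 0 \<or> z = 0 \<and> w = 0"
      unfolding q_def ev_quad by (cases "z = 0"; cases "w = 0"; cases "y = 0") auto
  qed
qed

text \<open>\<open>q0 = s^2\<close> and \<open>q1 = t^2\<close> have no common zero. The third
  quadric is \<open>s t + t^2\<close>, since \<open>s t\<close> would produce the syzygy between
  \<open>u * q0\<close> and \<open>u * q2\<close> that belongs to type 4.\<close>

lemma type2_realised: "\<exists>U :: 'k::alg_closed_field bipoly set. realises 2 U"
proof -
  define q0 q1 q2 :: "'k bipoly" where "q0 = quad 1 0 0" "q1 = quad 0 0 1" "q2 = quad 0 1 1"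
  note q_def = this
  have q: "is_basis3 q0 q1 q2" by (rule is_basis3I[OF q_def]) simp
  let ?P = "{var_u * q0, var_v * q0 + var_u * q1, var_v * q1, var_u * q2}"
  have gp: "?P \<subseteq> graded_piece (2, 1)" using is_basis3_gp[OF q] by (auto intro!: gp_add products_gp21)
  have cop: "x = 0 \<and> y = 0" if "ev (\<lambda>x. x) x y z w q0 = 0" "ev (\<lambda>x. x) x y z w q1 = 0" for x y z w
    using that unfolding q_def ev_quad by simp
  have form: "\<exists>a b c d. A = var_u * quad a d (b + d) + var_v * quad b 0 c" if A: "A \<in> ideal_gen ?P \<inter>
    graded_piece (2, 1)" for A
  proof -
    obtain a b c d where "A = cst a * (var_u * q0) + cst b * (var_v * q0 + var_u * q1) + cst c * (var_v * q1)
      + cst d * (var_u * q2)"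
      using ideal_gp21[OF A gp] by blast
    then have "A = var_u * (cst a * q0 + cst b * q1 + cst d * q2) + var_v * (cst b * q0 + cst c * q1)"
      by (simp add: algebra_simps)
    then have "A = var_u * quad a d (b + d) + var_v * quad b 0 c" unfolding q_def quad_cst_mult quad_add by simp
    then show ?thesis by blast
  qed
  have "\<not> has_syzygy [var_s, var_t] (ideal_gen ?P)"
  proof
    assume "has_syzygy [var_s, var_t] (ideal_gen ?P)"
    then obtain A B where AB: "A \<in> ideal_gen ?P \<inter> graded_piece (2, 1)" "B \<in> ideal_gen ?P \<inter> graded_piece (2, 1)"
      "var_s * A + var_t * B = 0" "A \<noteq> 0 \<or> B \<noteq> 0" by (rule has_syzygy_stD)
    obtain a b c d where A: "A = var_u * quad a d (b + d) + var_v * quad b 0 c" using form[OF AB(1)] by blast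
    obtain a' b' c' d' where B: "B = var_u * quad a' d' (b' + d') + var_v * quad b' 0 c'" using form[OF AB(2)]
      by blast
    note z = st_syzygy_coefficients[OF AB(3)[unfolded A B]]
    have "a = 0" "b = 0" "b' = 0" "c = 0" "c' = 0" using z by simp_all
    moreover from this have "d' = 0" using z(4) by simp
    moreover from calculation have "d = 0" using z(3) by simp
    moreover from this have "a' = 0" using z(2) by simp
    ultimately have "A = 0" "B = 0" unfolding A B by (simp_all add: quad_def)
    then show False using AB(4) by simp
  qed
  moreover have "of_numerical_type 2 (ideal_gen ?P) \<or> of_numerical_type 4 (ideal_gen ?P)"
    by (rule type_L2[OF coords_std q cop])
  ultimately have n: "of_numerical_type 2 (ideal_gen ?P)" using syzygies_of_type(4)[of 4 "ideal_gen ?P"] by auto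
  show ?thesis by (rule type_L2_realised[OF q _ n]) (erule (1) cop)
qed

lemma type4_realised: "\<exists>U :: 'k::alg_closed_field bipoly set. realises 4 U"
proof -
  define q0 q1 q2 :: "'k bipoly" where "q0 = quad 1 0 0" "q1 = quad 0 0 1" "q2 = quad 0 1 0"
  note q_def = this
  have q: "is_basis3 q0 q1 q2" by (rule is_basis3I[OF q_def]) simp
  let ?P = "{var_u * q0, var_v * q0 + var_u * q1, var_v * q1, var_u * q2}"
  have gp: "?P \<subseteq> graded_piece (2, 1)" using is_basis3_gp[OF q] by (auto intro!: gp_add products_gp21)
  have cop: "x = 0 \<and> y = 0" if "ev (\<lambda>x. x) x y z w q0 = 0" "ev (\<lambda>x. x) x y z w q1 = 0" for x y z w
    using that unfolding q_def ev_quad by simp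
  have "has_syzygy [var_s, var_t] (ideal_gen ?P)"
  proof (rule has_syzygy_stI)
    show "var_u * q2 \<in> ?P" "var_u * q0 \<in> ?P" by simp_all
    show "var_s * (var_u * q2) = var_t * (var_u * q0)" by (simp add: q_def quad_def algebra_simps)
    show "var_u * q2 \<noteq> 0" by (simp add: q_def quad_eq_0_iff)
  qed (rule gp)
  moreover have "of_numerical_type 2 (ideal_gen ?P) \<or> of_numerical_type 4 (ideal_gen ?P)"
    by (rule type_L2[OF coords_std q cop])
  ultimately have n: "of_numerical_type 4 (ideal_gen ?P)" using syzygies_of_type(4)[of 2 "ideal_gen ?P"] by auto
  show ?thesis by (rule type_L2_realised[OF q _ n]) (erule (1) cop)
qed

text \<open>\<open>t^2\<close> and \<open>s t + t^2\<close> have no zero in common with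
  \<open>s^2\<close>, as \<open>type_5a\<close> requires of both pairs.\<close>

lemma type5_realised: "\<exists>U :: 'k::alg_closed_field bipoly set. realises 5 U"
proof -
  define q0 q1 q2 :: "'k bipoly" where "q0 = quad 1 0 0" "q1 = quad 0 0 1" "q2 = quad 0 1 1"
  note q_def = this
  have q: "is_basis3 q0 q1 q2" by (rule is_basis3I[OF q_def]) simp
  have z: "x = 0 \<and> y = 0" if "ev (\<lambda>x. x) x y z w q0 = 0" "ev (\<lambda>x. x) x y z w q1 = 0 \<or>
    ev (\<lambda>x. x) x y z w q2 = 0" for x y z w
    using that unfolding q_def ev_quad by auto
  show ?thesis
  proof (rule exI, rule realisesI)
    show "{var_u * q0, var_v * q0, var_u * q1, var_v * q2} \<subseteq> graded_piece (2, 1)"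
      using is_basis3_gp[OF q] by (auto intro!: products_gp21)
    show "a = 0 \<and> b = 0 \<and> c = 0 \<and> d = 0"
      if "cst a * (var_u * q0) + cst b * (var_v * q0) + cst c * (var_u * q1) + cst d * (var_v * q2) = 0" for a
        b c d
    proof -
      have "var_u * (cst a * q0 + cst c * q1 + cst 0 * q2) + var_v * (cst b * q0 + cst 0 * q1 + cst d * q2) = 0"
        using that by (simp add: algebra_simps)
      from products_independent[OF coords_std q this] show ?thesis by simp
    qed
    show "x = 0 \<and> y = 0 \<or> z = 0 \<and> w = 0"
      if "ev (\<lambda>x. x) x y z w (var_u * q0) = 0" "ev (\<lambda>x. x) x y z w (var_v * q0) = 0"
        "ev (\<lambda>x. x) x y z w (var_u * q1) = 0" "ev (\<lambda>x. x) x y z w (var_v * q2) = 0" for x y z w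
      using that z[of x y z w] by (auto simp: ev_simps)
    show "of_numerical_type 5 (ideal_gen {var_u * q0, var_v * q0, var_u * q1, var_v * q2})"
      by (rule type_5a[OF coords_std q]; rule z; blast)
  qed
qed

lemma type6_realised: "\<exists>U :: 'k::alg_closed_field bipoly set. realises 6 U"
proof -
  define q0 q1 q2 :: "'k bipoly" where "q0 = quad 1 0 0" "q1 = quad 0 0 1" "q2 = quad 0 1 0"
  note q_def = this
  have q: "is_basis3 q0 q1 q2" by (rule is_basis3I[OF q_def]) simp
  have z: "x = 0 \<and> y = 0" if "ev (\<lambda>x. x) x y z w q0 = 0" "ev (\<lambda>x. x) x y z w q1 = 0" for x y z w
    using that unfolding q_def ev_quad by auto
  show ?thesis
  proof (rule exI, rule realisesI)
    show "{var_u * q0, var_v * q0, var_u * q1, var_v * q1} \<subseteq> graded_piece (2, 1)"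
      using is_basis3_gp[OF q] by (auto intro!: products_gp21)
    show "a = 0 \<and> b = 0 \<and> c = 0 \<and> d = 0"
      if "cst a * (var_u * q0) + cst b * (var_v * q0) + cst c * (var_u * q1) + cst d * (var_v * q1) = 0" for a
        b c d
    proof -
      have "var_u * (cst a * q0 + cst c * q1 + cst 0 * q2) + var_v * (cst b * q0 + cst d * q1 + cst 0 * q2) = 0"
        using that by (simp add: algebra_simps)
      from products_independent[OF coords_std q this] show ?thesis by simp
    qed
    show "x = 0 \<and> y = 0 \<or> z = 0 \<and> w = 0"
      if "ev (\<lambda>x. x) x y z w (var_u * q0) = 0" "ev (\<lambda>x. x) x y z w (var_v * q0) = 0"
        "ev (\<lambda>x. x) x y z w (var_u * q1) = 0" "ev (\<lambda>x. x) x y z w (var_v * q1) = 0" for x y z w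
      using that z[of x y z w] by (auto simp: ev_simps)
    show "of_numerical_type 6 (ideal_gen {var_u * q0, var_v * q0, var_u * q1, var_v * q1})"
      by (rule type_6[OF coords_std q]; rule z) simp_all
  qed
qed

theorem mainTheorem1:
  shows "(\<forall>U :: 'k::alg_closed_field bipoly set.
            four_dim_subspace U \<and> basepoint_free U \<longrightarrow>
            (\<exists>!n. n \<in> {1..6} \<and> of_numerical_type n (ideal_gen U))) \<and>
         (\<forall>n \<in> {1..6}. \<exists>U :: 'k bipoly set.
            four_dim_subspace U \<and> basepoint_free U \<and> of_numerical_type n (ideal_gen U))"
proof (intro conjI allI impI ballI)
  fix U :: "'k bipoly set"
  assume "four_dim_subspace U \<and> basepoint_free U"
  then obtain n where "n \<in> {1..6}" "of_numerical_type n (ideal_gen U)" using numerical_type_exists by blast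
  then show "\<exists>!n. n \<in> {1..6} \<and> of_numerical_type n (ideal_gen U)" using numerical_type_unique by blast
next
  fix n :: nat assume "n \<in> {1..6}"
  then have "n = 1 \<or> n = 2 \<or> n = 3 \<or> n = 4 \<or> n = 5 \<or> n = 6" by auto
  then have "\<exists>U :: 'k bipoly set. realises n U"
    using type1_realised type2_realised type3_realised type4_realised type5_realised type6_realised by metis
  then show "\<exists>U :: 'k bipoly set. four_dim_subspace U \<and> basepoint_free U \<and> of_numerical_type n (ideal_gen U)"
    unfolding realises_def .
qed

end
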